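(* Let $\mathscr B$ be a translation invariant BF-space on $\mathbf R^{2d}$ and let $\omega\in\mathscr P(\mathbf R^{2d})$. Then $A_0(\omega,\mathscr B)=A(\omega,\mathscr B)$, and the map $f\mapsto \mathfrak V f$ from $M(\omega,\mathscr B)$ to $A(\omega,\mathscr B)$ is isometric and bijective.
   Context: Weights: a positive $\omega\in L^\infty_{loc}(\mathbf R^n)$ is $v$-moderate ($v\in L^\infty_{loc}(\mathbf R^n)$ positive) if there is $C>0$ with $\omega(x+y)\le C\omega(x)v(y)$ for all $x,y$. $\mathscr P(\mathbf R^n)$ is the set of all $\omega$ that are $v$-moderate for some polynomial $v$. $v$ is submultiplicative if it is $v$-moderate; submultiplicative weights are assumed even. BF-spaces: let $\mathscr B$ be a Banach space of complex-valued measurable functions on $\mathbf R^n$ and $v\in\mathscr P(\mathbf R^n)$ submultiplicative. $\mathscr B$ is a translation invariant BF-space on $\mathbf R^n$ (with respect to $v$) if there is a constant $C$ such that: (1) $\mathscr S(\mathbf R^n)\subseteq\mathscr B\subseteq\mathscr S'(\mathbf R^n)$ with continuous embeddings; (2) if $x\in\mathbf R^n$, $f\in\mathscr B$, then $f(\cdot-x)\in\mathscr B$ and $\|f(\cdot-x)\|_{\mathscr B}\le Cv(x)\|f\|_{\mathscr B}$; (3) if $f,g\in L^1_{loc}(\mathbf R^n)$, $g\in\mathscr B$ and $|f|\le|g|$ a.e., then $f\in\mathscr B$ and $\|f\|_{\mathscr B}\le C\|g\|_{\mathscr B}$; (4) $(f,\varphi)\mapsto f*\varphi$ is continuous from $\mathscr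 B\times C_0^\infty(\mathbf R^n)$ to $\mathscr B$. Modulation spaces: $(\mathscr Ff)(\xi)=(2\pi)^{-d/2}\int_{\mathbf R^d} f(x)e^{-i\langle x,\xi\rangle}dx$, extended to $\mathscr S'(\mathbf R^d)$. Let $\phi(x)=\pi^{-d/4}e^{-|x|^2/2}$ on $\mathbf R^d$ and, for $f\in\mathscr S'(\mathbf R^d)$, $V_\phi f(x,\xi)=\mathscr F(f\,\overline{\phi(\cdot-x)})(\xi)$. $M(\omega,\mathscr B)$ is the set of $f\in\mathscr S'(\mathbf R^d)$ with $\|f\|_{M(\omega,\mathscr B)}=\|V_\phi f\cdot\omega\|_{\mathscr B}<\infty$. Bargmann transform: for $z,w\in\mathbf C^d$ let $\langle z,w\rangle=\sum_j z_jw_j$. For $f\in\mathscr S'(\mathbf R^d)$, $(\mathfrak Vf)(z)=\langle f,\mathfrak A_d(z,\cdot)\rangle$, where $\mathfrak A_d(z,y)=\pi^{-d/4}\exp(-\tfrac12(\langle z,z\rangle+|y|^2)+2^{1/2}\langle z,y\rangle)$; it is an entire function on $\mathbf C^d$. Spaces of entire functions: identify $\mathbf C^d\ni x+i\xi$ with $(x,\xi)\in\mathbf R^{2d}$; $A(\mathbf C^d)$ is the set of entire functions on $\mathbf C^d$; $(SF)(x,\xi)=F(2^{-1/2}x,-2^{-1/2}\xi)$. $A(\omega,\mathscr B)$ is the set of $F\in A(\mathbf C^d)$ with $\|F\|_{A(\omega,\mathscr B)}=\|S(Fe^{-|\cdot|^2/2})\,\omega\|_{\mathscr B}<\infty$.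 $A_0(\omega,\mathscr B)=\{\mathfrak Vf: f\in M(\omega,\mathscr B)\}$, equipped with the norm $\|\mathfrak Vf\|_{A_0(\omega,\mathscr B)}=\|f\|_{M(\omega,\mathscr B)}$.
   Formalization: The A(ω,B) norm is multiplied by (2π)^{-d/2}, and the map is then isometric when (3) holds with C=1; for general C the two norms agree up to the factor C. As written, isometry fails (B=L², ω=1, f=φ gives 1 versus (2π)^{d/2}). *)

theory Defs
  imports "HOL-Analysis.Analysis"
begin

section \<open>Topologies given by seminorms\<close>

definition function_subspace :: "('x \<Rightarrow> complex) set \<Rightarrow> bool" where
  "function_subspace X \<longleftrightarrow>
     (\<lambda>x. 0) \<in> X \<and>
     (\<forall>f\<in>X. \<forall>g\<in>X. (\<lambda>x. f x + g x) \<in> X) \<and>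
     (\<forall>f\<in>X. \<forall>c. (\<lambda>x. c * f x) \<in> X)"

definition seminorm_on :: "('x \<Rightarrow> complex) set \<Rightarrow> (('x \<Rightarrow> complex) \<Rightarrow> real) \<Rightarrow> bool" where
  "seminorm_on X p \<longleftrightarrow>
     (\<forall>f\<in>X. \<forall>g\<in>X. p (\<lambda>x. f x + g x) \<le> p f + p g) \<and>
     (\<forall>f\<in>X. \<forall>c. p (\<lambda>x. c * f x) = cmod c * p f)"

definition seminorm_topology ::
  "('x \<Rightarrow> complex) set \<Rightarrow> (('x \<Rightarrow> complex) \<Rightarrow> real) set \<Rightarrow> ('x \<Rightarrow> complex) topology" where
  "seminorm_topology X P =
     topology_generated_by
       {{g\<in>X. p (\<lambda>x. g x - f x) < r} | p f r. p \<in> P \<and> f \<in> X \<and> 0 < r}"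


section \<open>Test functions, Schwartz functions, tempered distributions\<close>

definition partial :: "'a::euclidean_space \<Rightarrow> ('a \<Rightarrow> complex) \<Rightarrow> 'a \<Rightarrow> complex" where
  "partial b f = (\<lambda>x. frechet_derivative f (at x) b)"

definition partials :: "'a::euclidean_space list \<Rightarrow> ('a \<Rightarrow> complex) \<Rightarrow> 'a \<Rightarrow> complex" where
  "partials bs f = foldr partial bs f"

(* A list of basis vectors plays the role of a multi-index.  Total differentiability of
   all iterated partial derivatives makes them continuous, so this is C^infinity. *)
definition smooth :: "('a::euclidean_space \<Rightarrow> complex) \<Rightarrow> bool" where
  "smooth f \<longleftrightarrow> (\<forall>bs\<in>lists Basis. \<forall>x. partials bs f differentiable at x)"

definition schwartz_seminorm ::
  "nat \<Rightarrow> 'a::euclidean_space list \<Rightarrow> ('a \<Rightarrow> complex) \<Rightarrow> real" where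
  "schwartz_seminorm k bs f = (SUP x. norm x ^ k * cmod (partials bs f x))"

definition schwartz :: "('a::euclidean_space \<Rightarrow> complex) set" where
  "schwartz = {f. smooth f \<and>
     (\<forall>k. \<forall>bs\<in>lists Basis. bdd_above (range (\<lambda>x. norm x ^ k * cmod (partials bs f x))))}"

definition schwartz_topology :: "('a::euclidean_space \<Rightarrow> complex) topology" where
  "schwartz_topology =
     seminorm_topology schwartz {schwartz_seminorm k bs | k bs. bs \<in> lists Basis}"

definition test_functions :: "('a::euclidean_space \<Rightarrow> complex) set" where
  "test_functions = {f. smooth f \<and> compact (closure {x. f x \<noteq> 0})}"

definition test_functions_in :: "'a::euclidean_space set \<Rightarrow> ('a \<Rightarrow> complex) set" where
  "test_functions_in K = {f\<in>test_functions. closure {x. f x \<noteq> 0} \<subseteq> K}"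

definition test_topology_in :: "'a::euclidean_space set \<Rightarrow> ('a \<Rightarrow> complex) topology" where
  "test_topology_in K =
     seminorm_topology (test_functions_in K) {schwartz_seminorm 0 bs | bs. bs \<in> lists Basis}"

(* The usual (LF) inductive limit topology: it is generated by all seminorms that are
   continuous on the test functions supported in K, for every compact K. *)
definition test_topology :: "('a::euclidean_space \<Rightarrow> complex) topology" where
  "test_topology =
     seminorm_topology test_functions
       {p. seminorm_on test_functions p \<and>
           (\<forall>K. compact K \<longrightarrow> continuous_map (test_topology_in K) euclideanreal p)}"

(* Functionals on the Schwartz space are made extensional, so that two tempered
   distributions are equal as soon as they agree on Schwartz functions. *)
definition tempered :: "(('a::euclidean_space \<Rightarrow> complex) \<Rightarrow> complex) set" where
  "tempered = {u\<in>extensional schwartz.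
     (\<forall>\<phi>\<in>schwartz. \<forall>\<psi>\<in>schwartz. u (\<lambda>x. \<phi> x + \<psi> x) = u \<phi> + u \<psi>) \<and>
     (\<forall>\<phi>\<in>schwartz. \<forall>c. u (\<lambda>x. c * \<phi> x) = c * u \<phi>) \<and>
     continuous_map schwartz_topology euclidean u}"

definition tempered_topology ::
  "(('a::euclidean_space \<Rightarrow> complex) \<Rightarrow> complex) topology" where
  "tempered_topology = seminorm_topology tempered {\<lambda>u. cmod (u \<phi>) | \<phi>. \<phi> \<in> schwartz}"

definition L1_loc :: "('a::euclidean_space \<Rightarrow> complex) set" where
  "L1_loc = {f. \<forall>K. compact K \<longrightarrow> f absolutely_integrable_on K}"

(* The distribution u is the locally integrable function g. *)
definition represents ::
  "(('a::euclidean_space \<Rightarrow> complex) \<Rightarrow> complex) \<Rightarrow> ('a \<Rightarrow> complex) \<Rightarrow> bool" where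
  "represents u g \<longleftrightarrow>
     g \<in> L1_loc \<and> (\<forall>\<psi>\<in>test_functions. u \<psi> = integral\<^sup>L lebesgue (\<lambda>x. g x * \<psi> x))"

definition function_of_distr ::
  "(('a::euclidean_space \<Rightarrow> complex) \<Rightarrow> complex) \<Rightarrow> 'a \<Rightarrow> complex" where
  "function_of_distr u = (THE g. continuous_on UNIV g \<and> represents u g)"


section \<open>Weights\<close>

definition weight :: "('a::euclidean_space \<Rightarrow> real) \<Rightarrow> bool" where
  "weight \<omega> \<longleftrightarrow> (\<forall>x. 0 < \<omega> x) \<and> \<omega> \<in> borel_measurable lebesgue \<and>
     (\<forall>K. compact K \<longrightarrow> (\<exists>C. AE x in lebesgue. x \<in> K \<longrightarrow> \<omega> x \<le> C))"

definition moderate :: "('a::euclidean_space \<Rightarrow> real) \<Rightarrow> ('a \<Rightarrow> real) \<Rightarrow> bool" where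
  "moderate \<omega> v \<longleftrightarrow> weight \<omega> \<and> weight v \<and> (\<exists>C>0. \<forall>x y. \<omega> (x + y) \<le> C * \<omega> x * v y)"

definition poly_moderate :: "('a::euclidean_space \<Rightarrow> real) set" where
  "poly_moderate = {\<omega>. \<exists>v. real_polynomial_function v \<and> moderate \<omega> v}"

definition submultiplicative :: "('a::euclidean_space \<Rightarrow> real) \<Rightarrow> bool" where
  "submultiplicative v \<longleftrightarrow> moderate v v \<and> (\<forall>x. v (- x) = v x)"


section \<open>Translation invariant BF-spaces\<close>

(* A Banach space of functions is given by the set B of all its measurable
   representatives and by its norm N; functions vanishing a.e. are the elements of norm
   zero, so the actual Banach space is the quotient by equality almost everywhere. *)
definition banach_function_space ::
  "('a::euclidean_space \<Rightarrow> complex) set \<Rightarrow> (('a \<Rightarrow> complex) \<Rightarrow> real) \<Rightarrow> bool" where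
  "banach_function_space B N \<longleftrightarrow>
     B \<subseteq> borel_measurable lebesgue \<and> function_subspace B \<and> seminorm_on B N \<and>
     (\<forall>f\<in>borel_measurable lebesgue. (AE x in lebesgue. f x = 0) \<longrightarrow> f \<in> B) \<and>
     (\<forall>f\<in>B. N f = 0 \<longleftrightarrow> (AE x in lebesgue. f x = 0)) \<and>
     (\<forall>F::nat \<Rightarrow> 'a \<Rightarrow> complex. range F \<subseteq> B \<and>
        (\<forall>e>0. \<exists>M. \<forall>m\<ge>M. \<forall>n\<ge>M. N (\<lambda>x. F m x - F n x) < e) \<longrightarrow>
        (\<exists>f\<in>B. (\<lambda>n. N (\<lambda>x. F n x - f x)) \<longlonglongrightarrow> 0))"

definition convolution ::
  "('a::euclidean_space \<Rightarrow> complex) \<Rightarrow> ('a \<Rightarrow> complex) \<Rightarrow> 'a \<Rightarrow> complex" where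
  "convolution f \<phi> = (\<lambda>x. integral\<^sup>L lebesgue (\<lambda>y. f (x - y) * \<phi> y))"

definition solid_with ::
  "real \<Rightarrow> ('a::euclidean_space \<Rightarrow> complex) set \<Rightarrow> (('a \<Rightarrow> complex) \<Rightarrow> real) \<Rightarrow> bool" where
  "solid_with C B N \<longleftrightarrow>
     (\<forall>f\<in>L1_loc. \<forall>g\<in>L1_loc. g \<in> B \<and> (AE x in lebesgue. cmod (f x) \<le> cmod (g x)) \<longrightarrow>
        f \<in> B \<and> N f \<le> C * N g)"

definition translation_invariant_BF ::
  "('a::euclidean_space \<Rightarrow> real) \<Rightarrow> ('a \<Rightarrow> complex) set \<Rightarrow> (('a \<Rightarrow> complex) \<Rightarrow> real) \<Rightarrow> bool" where
  "translation_invariant_BF v B N \<longleftrightarrow>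
     banach_function_space B N \<and> v \<in> poly_moderate \<and> submultiplicative v \<and>
     continuous_map schwartz_topology (seminorm_topology B {N}) (\<lambda>f. f) \<and>
     (\<exists>\<iota>. continuous_map (seminorm_topology B {N}) tempered_topology \<iota> \<and>
          (\<forall>f\<in>B. represents (\<iota> f) f)) \<and>
     (\<exists>C. (\<forall>x. \<forall>f\<in>B. (\<lambda>y. f (y - x)) \<in> B \<and> N (\<lambda>y. f (y - x)) \<le> C * v x * N f) \<and>
          solid_with C B N) \<and>
     continuous_map (prod_topology (seminorm_topology B {N}) test_topology)
       (seminorm_topology B {N}) (\<lambda>(f, \<phi>). convolution f \<phi>)"


section \<open>Modulation spaces\<close>

definition fourier :: "('a::euclidean_space \<Rightarrow> complex) \<Rightarrow> 'a \<Rightarrow> complex" where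
  "fourier f \<xi> = of_real ((2 * pi) powr (- real DIM('a) / 2)) *
     integral\<^sup>L lebesgue (\<lambda>x. f x * exp (- \<i> * of_real (x \<bullet> \<xi>)))"

definition fourier_distr ::
  "(('a::euclidean_space \<Rightarrow> complex) \<Rightarrow> complex) \<Rightarrow> ('a \<Rightarrow> complex) \<Rightarrow> complex" where
  "fourier_distr u = restrict (\<lambda>\<psi>. u (fourier \<psi>)) schwartz"

definition mult_distr ::
  "(('a::euclidean_space \<Rightarrow> complex) \<Rightarrow> complex) \<Rightarrow> ('a \<Rightarrow> complex) \<Rightarrow>
     ('a \<Rightarrow> complex) \<Rightarrow> complex" where
  "mult_distr u a = restrict (\<lambda>\<psi>. u (\<lambda>x. a x * \<psi> x)) schwartz"

definition gauss :: "'a::euclidean_space \<Rightarrow> complex" where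
  "gauss x = of_real (pi powr (- real DIM('a) / 4) * exp (- (norm x)\<^sup>2 / 2))"

definition stft ::
  "('a::euclidean_space \<Rightarrow> complex) \<Rightarrow> (('a \<Rightarrow> complex) \<Rightarrow> complex) \<Rightarrow> 'a \<times> 'a \<Rightarrow> complex" where
  "stft \<phi> f = (\<lambda>(x, \<xi>).
     function_of_distr (fourier_distr (mult_distr f (\<lambda>y. cnj (\<phi> (y - x))))) \<xi>)"

definition modulation_space ::
  "('a::euclidean_space \<times> 'a \<Rightarrow> real) \<Rightarrow> ('a \<times> 'a \<Rightarrow> complex) set \<Rightarrow>
     (('a \<Rightarrow> complex) \<Rightarrow> complex) set" where
  "modulation_space \<omega> B = {f\<in>tempered. (\<lambda>p. stft gauss f p * of_real (\<omega> p)) \<in> B}"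

definition modulation_norm ::
  "('a::euclidean_space \<times> 'a \<Rightarrow> real) \<Rightarrow> (('a \<times> 'a \<Rightarrow> complex) \<Rightarrow> real) \<Rightarrow>
     (('a \<Rightarrow> complex) \<Rightarrow> complex) \<Rightarrow> real" where
  "modulation_norm \<omega> N f = N (\<lambda>p. stft gauss f p * of_real (\<omega> p))"


section \<open>The Bargmann transform and spaces of entire functions\<close>

(* bilinear: no complex conjugation *)
definition cdot :: "(complex ^ 'd) \<Rightarrow> (complex ^ 'd) \<Rightarrow> complex" where
  "cdot z w = (\<Sum>j\<in>UNIV. z $ j * w $ j)"

definition bargmann_kernel :: "(complex ^ 'd) \<Rightarrow> real ^ 'd \<Rightarrow> complex" where
  "bargmann_kernel z y = of_real (pi powr (- real CARD('d) / 4)) *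
     exp (- (1 / 2) * (cdot z z + of_real ((norm y)\<^sup>2)) +
          of_real (sqrt 2) * cdot z (\<chi> j. of_real (y $ j)))"

definition bargmann :: "(((real ^ 'd) \<Rightarrow> complex) \<Rightarrow> complex) \<Rightarrow> (complex ^ 'd) \<Rightarrow> complex" where
  "bargmann f z = f (bargmann_kernel z)"

definition entire :: "((complex ^ 'd) \<Rightarrow> complex) set" where
  "entire = {F. \<forall>z. \<exists>D. (F has_derivative D) (at z) \<and> (\<forall>c h. D (c *s h) = c * D h)}"

definition bargmann_S :: "((complex ^ 'd) \<Rightarrow> complex) \<Rightarrow> (real ^ 'd) \<times> (real ^ 'd) \<Rightarrow> complex" where
  "bargmann_S F = (\<lambda>(x, \<xi>). F (\<chi> j. Complex (x $ j / sqrt 2) (- \<xi> $ j / sqrt 2)))"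

definition weighted_entire ::
  "((real ^ 'd) \<times> (real ^ 'd) \<Rightarrow> real) \<Rightarrow> ((complex ^ 'd) \<Rightarrow> complex) \<Rightarrow>
     (real ^ 'd) \<times> (real ^ 'd) \<Rightarrow> complex" where
  "weighted_entire \<omega> F =
     (\<lambda>p. bargmann_S (\<lambda>z. F z * of_real (exp (- (norm z)\<^sup>2 / 2))) p * of_real (\<omega> p))"

definition A_space ::
  "((real ^ 'd) \<times> (real ^ 'd) \<Rightarrow> real) \<Rightarrow> ((real ^ 'd) \<times> (real ^ 'd) \<Rightarrow> complex) set \<Rightarrow>
     ((complex ^ 'd) \<Rightarrow> complex) set" where
  "A_space \<omega> B = {F\<in>entire. weighted_entire \<omega> F \<in> B}"

definition A_norm ::
  "((real ^ 'd) \<times> (real ^ 'd) \<Rightarrow> real) \<Rightarrow> (((real ^ 'd) \<times> (real ^ 'd) \<Rightarrow> complex) \<Rightarrow> real) \<Rightarrow>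
     ((complex ^ 'd) \<Rightarrow> complex) \<Rightarrow> real" where
  "A_norm \<omega> N F = N (weighted_entire \<omega> F)"

definition A0_space ::
  "((real ^ 'd) \<times> (real ^ 'd) \<Rightarrow> real) \<Rightarrow> ((real ^ 'd) \<times> (real ^ 'd) \<Rightarrow> complex) set \<Rightarrow>
     ((complex ^ 'd) \<Rightarrow> complex) set" where
  "A0_space \<omega> B = bargmann ` modulation_space \<omega> B"

definition A0_norm ::
  "((real ^ 'd) \<times> (real ^ 'd) \<Rightarrow> real) \<Rightarrow> ((real ^ 'd) \<times> (real ^ 'd) \<Rightarrow> complex) set \<Rightarrow>
     (((real ^ 'd) \<times> (real ^ 'd) \<Rightarrow> complex) \<Rightarrow> real) \<Rightarrow> ((complex ^ 'd) \<Rightarrow> complex) \<Rightarrow> real" where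
  "A0_norm \<omega> B N F =
     modulation_norm \<omega> N (THE f. f \<in> modulation_space \<omega> B \<and> bargmann f = F)"

(* With these normalizations
     stft gauss f (x, xi) =
       (2 pi)^(-d/2) exp(-i <x,xi> / 2) bargmann_S (bargmann f * exp(-|.|^2/2)) (x, xi),
   so the natural norm on A_space carries the constant (2 pi)^(-d/2).  The unimodular
   factor is only controlled by solidity; it leaves N unchanged if solid_with 1 B N, and
   changes N by at most a factor C if solid_with C B N. *)
definition A_norm_normalized ::
  "((real ^ 'd) \<times> (real ^ 'd) \<Rightarrow> real) \<Rightarrow> (((real ^ 'd) \<times> (real ^ 'd) \<Rightarrow> complex) \<Rightarrow> real) \<Rightarrow>
     ((complex ^ 'd) \<Rightarrow> complex) \<Rightarrow> real" where
  "A_norm_normalized \<omega> N F = (2 * pi) powr (- real CARD('d) / 2) * A_norm \<omega> N F"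

end

theory Submission
  imports Defs "HOL-Probability.Probability" "HOL-Complex_Analysis.Complex_Analysis"
begin

text \<open>Write p = (x, \<xi>) for a point of phase space, \<open>to_complex p\<close> = (x - i \<xi>) / sqrt 2 for the
corresponding point of complex space, and \<open>coherent p\<close> for the Gaussian window translated by x and
modulated by \<xi>. For a tempered distribution u everything is encoded in the function
p \<mapsto> u (coherent p):

\<^item> the short-time Fourier transform is (2 \<pi>)^(-d/2) u (coherent p) (\<open>stft_eq\<close>), and

\<^item> since the Bargmann kernel at \<open>to_complex p\<close> is \<open>twist p\<close> times \<open>coherent p\<close>, where \<open>twist p\<close> =
  exp (|p|^2 / 4 + i x\<sqdot>\<xi> / 2), the Bargmann transform at \<open>to_complex p\<close> is
  twist p u (coherent p) (\<open>bargmann_eq\<close>).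

So the two weighted functions whose norms are compared differ by a constant and by the unimodular
factor exp (i x\<sqdot>\<xi> / 2) only (\<open>stft_weighted_entire\<close>). Solidity controls this factor, which gives all
the statements about norms. What remains is that the Bargmann transform maps tempered
distributions injectively into the entire functions and that every entire function in
\<open>A_space \<omega> B\<close> is reached.

The engine is the reproducing formula (\<open>reproducing_formula\<close>): if F is entire and
F (to_complex p) = twist p G p with G of polynomial growth, then (2 \<pi>)^d G q is the integral of
G p against the inner product K (p, q) of \<open>coherent p\<close> and \<open>coherent q\<close>. After a translation to q this
is the mean value property of an entire function against a Gaussian, which is rotation invariant
(\<open>entire_mean_value\<close>). The second ingredient is that a tempered distribution may be
interchanged with a rapidly convergent integral of coherent states (\<open>tempered_superposition\<close>).

\<^item> Entire: coherent states themselves satisfy the reproducing formula, so u (coherent q) is an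
  integral of u (coherent p) against K (p, q). Multiplied by \<open>twist q\<close> the kernel becomes an exponential
  of a linear function of \<open>to_complex q\<close>, and one may differentiate under the integral
  (\<open>bargmann_entire\<close>).

\<^item> Injective: every Schwartz function is a superposition of coherent states
  (\<open>coherent_inversion\<close>), hence u is determined by the numbers u (coherent p).

\<^item> Surjective: if G has polynomial growth, integrating G against the transform of \<psi> in coherent
  states defines a tempered distribution, because that transform decays rapidly
  (\<open>coherent_transform_decay\<close>), and by the reproducing formula it takes the value G q at \<open>coherent q\<close>
  (\<open>bargmann_surjective\<close>). For F in \<open>A_space \<omega> B\<close> the polynomial growth follows from the mean value
  property on unit balls: continuity of the embedding of B into the tempered distributions bounds the
  integral of an element of B over the unit ball by its norm, and translating the ball to q costs only
  the polynomially bounded factor v q (\<open>weighted_entire_growth\<close>).\<close>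

section \<open>Iterated partial derivatives\<close>

lemma partial_eq:
  "(f has_derivative f') (at x) \<Longrightarrow> partial b f x = f' b"
  unfolding partial_def by (metis frechet_derivative_at)

lemma partials_Cons: "partials (b # bs) f = partial b (partials bs f)"
  and partials_Nil: "partials [] f = f"
  by (simp_all add: partials_def)

lemma partials_append: "partials (as @ bs) f = partials as (partials bs f)"
  by (simp add: partials_def)

lemma smooth_differentiable:
  "smooth f \<Longrightarrow> f differentiable at x"
  unfolding smooth_def by (metis lists.Nil partials_Nil)

lemma smooth_partials:
  assumes "smooth f" "set bs \<subseteq> Basis"
  shows "smooth (partials bs f)"
  unfolding smooth_def
proof (intro ballI allI)
  fix as :: "'a list" and x assume "as \<in> lists Basis"
  then have "as @ bs \<in> lists Basis" using assms(2) by auto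
  then show "partials as (partials bs f) differentiable at x"
    using assms(1) unfolding smooth_def partials_append[symmetric] by blast
qed

lemma smooth_partial: "smooth f \<Longrightarrow> b \<in> Basis \<Longrightarrow> smooth (partial b f)"
  using smooth_partials[of f "[b]"] by (simp add: partials_Cons partials_Nil)

lemma partials_in_invariant_set:
  assumes "f \<in> X" "set bs \<subseteq> Basis"
    and "\<And>g b. g \<in> X \<Longrightarrow> b \<in> Basis \<Longrightarrow> partial b g \<in> X"
  shows "partials bs f \<in> X"
  using assms(2) by (induction bs) (auto simp: partials_Nil partials_Cons assms)

text \<open>The smooth functions are the largest class of differentiable functions that is closed under partial
derivatives. Hence a function is smooth as soon as it lies in some invariant class, whatever its higher
derivatives are.\<close>
lemma smooth_coinduct:
  assumes "f \<in> X"
    and "\<And>g x. g \<in> X \<Longrightarrow> g differentiable at x"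
    and "\<And>g b. g \<in> X \<Longrightarrow> b \<in> Basis \<Longrightarrow> partial b g \<in> X"
  shows "smooth f"
  unfolding smooth_def
  using partials_in_invariant_set[of f X] assms by (auto simp: in_lists_conv_set subset_eq)

lemma partial_add:
  assumes "f differentiable at x" "g differentiable at x"
  shows "partial b (\<lambda>x. f x + g x) x = partial b f x + partial b g x"
  using has_derivative_add[of f _ "at x" g] assms
  unfolding differentiable_def by (metis (no_types, lifting) partial_eq)

lemma partial_cmult:
  fixes c :: complex
  assumes "f differentiable at x"
  shows "partial b (\<lambda>x. c * f x) x = c * partial b f x"
proof -
  obtain f' where f': "(f has_derivative f') (at x)" using assms by (auto simp: differentiable_def)
  have "((\<lambda>x. c * f x) has_derivative (\<lambda>h. c * f' h)) (at x)"
    by (rule has_derivative_mult_right[OF f'])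
  from partial_eq[OF this] partial_eq[OF f'] show ?thesis by simp
qed

lemma partial_mult:
  fixes f g :: "'a::euclidean_space \<Rightarrow> complex"
  assumes "f differentiable at x" "g differentiable at x"
  shows "partial b (\<lambda>x. f x * g x) x = partial b f x * g x + f x * partial b g x"
proof -
  obtain f' g' where f': "(f has_derivative f') (at x)" and g': "(g has_derivative g') (at x)"
    using assms by (auto simp: differentiable_def)
  from partial_eq[OF has_derivative_mult[OF f' g']] partial_eq[OF f'] partial_eq[OF g']
  show ?thesis by simp
qed

lemma partials_add:
  assumes "smooth f" "smooth g" "set bs \<subseteq> Basis"
  shows "partials bs (\<lambda>x. f x + g x) = (\<lambda>x. partials bs f x + partials bs g x)"
  using assms(3)
proof (induction bs)
  case (Cons b bs)
  have "partial b (\<lambda>x. partials bs f x + partials bs g x) x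
      = partial b (partials bs f) x + partial b (partials bs g) x" for x
    using Cons.prems assms by (intro partial_add smooth_differentiable smooth_partials) auto
  with Cons show ?case by (auto simp: partials_Cons)
qed (simp add: partials_Nil)

lemma partials_cmult:
  assumes "smooth f" "set bs \<subseteq> Basis"
  shows "partials bs (\<lambda>x. c * f x) = (\<lambda>x. c * partials bs f x)"
  using assms(2)
proof (induction bs)
  case (Cons b bs)
  have "partial b (\<lambda>x. c * partials bs f x) x = c * partial b (partials bs f) x" for x
    using Cons.prems assms by (intro partial_cmult smooth_differentiable smooth_partials) auto
  with Cons show ?case by (auto simp: partials_Cons)
qed (simp add: partials_Nil)

lemma smooth_add: assumes "smooth f" "smooth g" shows "smooth (\<lambda>x. f x + g x)"
  unfolding smooth_def
proof (intro ballI allI)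
  fix bs :: "'a list" and x assume "bs \<in> lists Basis"
  then have bs: "set bs \<subseteq> Basis" by auto
  show "partials bs (\<lambda>x. f x + g x) differentiable at x"
    unfolding partials_add[OF assms bs]
    using assms bs by (intro differentiable_add smooth_differentiable smooth_partials)
qed

lemma smooth_cmult: assumes "smooth f" shows "smooth (\<lambda>x. c * f x)"
  unfolding smooth_def
proof (intro ballI allI)
  fix bs :: "'a list" and x assume "bs \<in> lists Basis"
  then have bs: "set bs \<subseteq> Basis" by auto
  show "partials bs (\<lambda>x. c * f x) differentiable at x"
    unfolding partials_cmult[OF assms bs]
    using assms bs by (intro differentiable_mult differentiable_const smooth_differentiable smooth_partials)
qed

text \<open>The invariant class for \<open>smooth_mult\<close>: by the Leibniz rule a partial derivative of a product is a sum
of two products, so sums have to be included.\<close>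
inductive_set product_sums :: "('a::euclidean_space \<Rightarrow> complex) set" where
  product: "smooth f \<Longrightarrow> smooth g \<Longrightarrow> (\<lambda>x. f x * g x) \<in> product_sums"
| sum: "f \<in> product_sums \<Longrightarrow> g \<in> product_sums \<Longrightarrow> (\<lambda>x. f x + g x) \<in> product_sums"

lemma product_sums_step:
  assumes "f \<in> product_sums"
  shows "f differentiable at x" "b \<in> Basis \<Longrightarrow> partial b f \<in> product_sums"
proof -
  have "(\<forall>x. f differentiable at x) \<and> (\<forall>b\<in>Basis. partial b f \<in> product_sums)"
    using assms
  proof induction
    case (product f g)
    have "partial b (\<lambda>x. f x * g x) \<in> product_sums" if "b \<in> Basis" for b
    proof -
      have "partial b (\<lambda>x. f x * g x) = (\<lambda>x. partial b f x * g x + f x * partial b g x)"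
        using product by (auto intro!: partial_mult smooth_differentiable)
      then show ?thesis
        using product that by (auto intro!: product_sums.intros smooth_partial)
    qed
    moreover have "(\<lambda>x. f x * g x) differentiable at x" for x
      using product by (intro differentiable_mult smooth_differentiable)
    ultimately show ?case by blast
  next
    case (sum f g)
    have "partial b (\<lambda>x. f x + g x) = (\<lambda>x. partial b f x + partial b g x)" for b
      using sum by (auto intro!: partial_add)
    with sum show ?case by (auto intro!: product_sums.intros)
  qed
  then show "f differentiable at x" "b \<in> Basis \<Longrightarrow> partial b f \<in> product_sums" by auto
qed

lemma smooth_mult: assumes "smooth f" "smooth g" shows "smooth (\<lambda>x. f x * g x)"
  by (rule smooth_coinduct[of _ product_sums]) (auto intro: product_sums_step product_sums.intros assms)

lemma partial_const [simp]: "partial b (\<lambda>x. c) = (\<lambda>x. 0)"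
  by (rule ext) (rule partial_eq, simp)

lemma smooth_const [simp]: "smooth (\<lambda>x. c)"
  by (rule smooth_coinduct[of _ "range (\<lambda>c x. c)"]) auto

lemma partial_coordinate: "partial b (\<lambda>x. complex_of_real (x \<bullet> e)) = (\<lambda>x. of_real (b \<bullet> e))"
  by (rule ext) (rule partial_eq, auto intro!: derivative_eq_intros)

lemma smooth_coordinate: "smooth (\<lambda>x. complex_of_real (x \<bullet> e))"
proof (rule smooth_coinduct[of _ "insert (\<lambda>x. complex_of_real (x \<bullet> e)) (range (\<lambda>c x. c))"])
  show "g differentiable at x" if "g \<in> insert (\<lambda>x. complex_of_real (x \<bullet> e)) (range (\<lambda>c x. c))"
    for g and x :: 'a
  proof -
    have "((\<lambda>x. complex_of_real (x \<bullet> e)) has_derivative (\<lambda>h. of_real (h \<bullet> e))) (at x)"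
      by (auto intro!: derivative_eq_intros)
    then have "(\<lambda>x. complex_of_real (x \<bullet> e)) differentiable at x"
      unfolding differentiable_def by blast
    with that show ?thesis by auto
  qed
  show "partial b g \<in> insert (\<lambda>x. complex_of_real (x \<bullet> e)) (range (\<lambda>c x. c))"
    if g: "g \<in> insert (\<lambda>x. complex_of_real (x \<bullet> e)) (range (\<lambda>c x. c))" for g and b :: 'a
  proof (cases "g = (\<lambda>x. complex_of_real (x \<bullet> e))")
    case False
    then obtain c where "g = (\<lambda>x. c)" using g by auto
    then have "partial b g = (\<lambda>x. 0)" by simp
    then show ?thesis by blast
  qed (simp add: partial_coordinate)
qed simp

lemma smooth_prod:
  "finite I \<Longrightarrow> (\<And>i. i \<in> I \<Longrightarrow> smooth (f i)) \<Longrightarrow> smooth (\<lambda>x. \<Prod>i\<in>I. f i x)"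
  by (induction I rule: finite_induct) (auto intro: smooth_mult)

lemma smooth_continuous: "smooth f \<Longrightarrow> continuous_on UNIV f"
  using smooth_differentiable differentiable_imp_continuous_within
  by (metis continuous_at_imp_continuous_on)

lemma continuous_partials:
  "smooth f \<Longrightarrow> set bs \<subseteq> Basis \<Longrightarrow> continuous_on UNIV (partials bs f)"
  by (intro smooth_continuous smooth_partials)

section \<open>Schwartz functions and tempered distributions\<close>

lemma schwartzI:
  assumes "smooth f"
    and "\<And>k bs. set bs \<subseteq> Basis \<Longrightarrow> \<exists>C. \<forall>x. norm x ^ k * cmod (partials bs f x) \<le> C"
  shows "f \<in> schwartz"
  using assms unfolding schwartz_def bdd_above_def by (auto simp: in_lists_conv_set subset_eq)

lemma schwartz_smooth: "f \<in> schwartz \<Longrightarrow> smooth f"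
  by (simp add: schwartz_def)

lemma schwartz_seminorm_bound:
  assumes "f \<in> schwartz" "set bs \<subseteq> Basis"
  shows "norm x ^ k * cmod (partials bs f x) \<le> schwartz_seminorm k bs f"
  using assms unfolding schwartz_seminorm_def schwartz_def
  by (intro cSUP_upper) (auto simp: in_lists_conv_set subset_eq)

lemma schwartz_seminorm_le:
  assumes "\<And>x. norm x ^ k * cmod (partials bs f x) \<le> C"
  shows "schwartz_seminorm k bs f \<le> C"
  unfolding schwartz_seminorm_def by (rule cSUP_least) (use assms in auto)

lemma schwartz_seminorm_nonneg:
  assumes "f \<in> schwartz" "set bs \<subseteq> Basis"
  shows "0 \<le> schwartz_seminorm k bs f"
  using order_trans[OF _ schwartz_seminorm_bound[OF assms, of 0 k]] by simp

lemma schwartz_add: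
  assumes "f \<in> schwartz" "g \<in> schwartz"
  shows "(\<lambda>x. f x + g x) \<in> schwartz"
    and "set bs \<subseteq> Basis \<Longrightarrow>
      schwartz_seminorm k bs (\<lambda>x. f x + g x) \<le> schwartz_seminorm k bs f + schwartz_seminorm k bs g"
proof -
  have *: "norm x ^ k * cmod (partials bs (\<lambda>x. f x + g x) x)
     \<le> schwartz_seminorm k bs f + schwartz_seminorm k bs g" if bs: "set bs \<subseteq> Basis" for k bs x
  proof -
    have "norm x ^ k * cmod (partials bs (\<lambda>x. f x + g x) x)
      \<le> norm x ^ k * (cmod (partials bs f x) + cmod (partials bs g x))"
      using assms bs by (auto simp: partials_add schwartz_smooth intro!: mult_left_mono norm_triangle_ineq)
    also have "\<dots> \<le> schwartz_seminorm k bs f + schwartz_seminorm k bs g"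
      using assms bs by (simp add: distrib_left add_mono schwartz_seminorm_bound)
    finally show ?thesis .
  qed
  show "(\<lambda>x. f x + g x) \<in> schwartz"
  proof (rule schwartzI)
    show "smooth (\<lambda>x. f x + g x)"
      by (intro smooth_add schwartz_smooth assms)
  qed (use * in blast)
  show "schwartz_seminorm k bs (\<lambda>x. f x + g x) \<le> schwartz_seminorm k bs f + schwartz_seminorm k bs g"
    if "set bs \<subseteq> Basis"
    using * that by (intro schwartz_seminorm_le)
qed

lemma schwartz_cmult:
  assumes "f \<in> schwartz"
  shows "(\<lambda>x. c * f x) \<in> schwartz"
    and "set bs \<subseteq> Basis \<Longrightarrow> schwartz_seminorm k bs (\<lambda>x. c * f x) \<le> cmod c * schwartz_seminorm k bs f"
proof -
  have *: "norm x ^ k * cmod (partials bs (\<lambda>x. c * f x) x) \<le> cmod c * schwartz_seminorm k bs f"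
    if bs: "set bs \<subseteq> Basis" for k bs x
  proof -
    have "norm x ^ k * cmod (partials bs (\<lambda>x. c * f x) x) = cmod c * (norm x ^ k * cmod (partials bs f x))"
      using assms bs by (auto simp: partials_cmult schwartz_smooth norm_mult)
    also have "\<dots> \<le> cmod c * schwartz_seminorm k bs f"
      using assms bs by (intro mult_left_mono schwartz_seminorm_bound) auto
    finally show ?thesis .
  qed
  show "(\<lambda>x. c * f x) \<in> schwartz"
  proof (rule schwartzI)
    show "smooth (\<lambda>x. c * f x)"
      by (intro smooth_cmult schwartz_smooth assms)
  qed (use * in blast)
  show "schwartz_seminorm k bs (\<lambda>x. c * f x) \<le> cmod c * schwartz_seminorm k bs f"
    if "set bs \<subseteq> Basis"
    using * that by (intro schwartz_seminorm_le)
qed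

lemma schwartz_zero [simp]: "(\<lambda>x. 0) \<in> schwartz"
proof (rule schwartzI)
  have "partials bs (\<lambda>x. 0 :: complex) = (\<lambda>x::'a. 0)" for bs :: "'a list"
    by (induction bs) (auto simp: partials_Nil partials_Cons)
  then show "\<exists>C. \<forall>x. norm x ^ k * cmod (partials bs (\<lambda>x. 0) x) \<le> C" for k and bs :: "'a list"
    by (auto intro!: exI[of _ 0])
qed auto

lemma schwartz_diff:
  assumes "f \<in> schwartz" "g \<in> schwartz"
  shows "(\<lambda>x. f x - g x) \<in> schwartz"
  using schwartz_add(1)[OF assms(1) schwartz_cmult(1)[OF assms(2), of "-1"]] by simp

text \<open>An increasing sequence of norms that defines the Schwartz topology. The single index n bounds both the
power of the weight and the order of the derivative, so that a finite family of seminorms is always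
dominated by one of these norms and continuity becomes an estimate between two of them.\<close>
definition schwartz_norm :: "nat \<Rightarrow> ('a::euclidean_space \<Rightarrow> complex) \<Rightarrow> real" where
  "schwartz_norm n f =
     (\<Sum>k\<le>n. \<Sum>bs | set bs \<subseteq> Basis \<and> length bs \<le> n. schwartz_seminorm k bs f)"

lemma finite_multiindices [simp]:
  "finite {bs::'a::euclidean_space list. set bs \<subseteq> Basis \<and> length bs \<le> n}"
  by (rule finite_lists_length_le) simp

lemma schwartz_norm_nonneg: "f \<in> schwartz \<Longrightarrow> 0 \<le> schwartz_norm n f"
  unfolding schwartz_norm_def by (intro sum_nonneg schwartz_seminorm_nonneg) auto

lemma schwartz_norm_add:
  assumes "f \<in> schwartz" "g \<in> schwartz"
  shows "schwartz_norm n (\<lambda>x. f x + g x) \<le> schwartz_norm n f + schwartz_norm n g"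
  unfolding schwartz_norm_def sum.distrib[symmetric]
  using assms by (intro sum_mono schwartz_add) auto

lemma schwartz_norm_cmult:
  assumes "f \<in> schwartz"
  shows "schwartz_norm n (\<lambda>x. c * f x) \<le> cmod c * schwartz_norm n f"
  unfolding schwartz_norm_def sum_distrib_left
  using assms by (intro sum_mono schwartz_cmult) auto

lemma schwartz_norm_minus:
  assumes "f \<in> schwartz" "g \<in> schwartz"
  shows "schwartz_norm n (\<lambda>x. f x - g x) \<le> schwartz_norm n f + schwartz_norm n g"
proof -
  have "schwartz_norm n (\<lambda>x. f x + (-1) * g x) \<le> schwartz_norm n f + schwartz_norm n (\<lambda>x. (-1) * g x)"
    using assms by (intro schwartz_norm_add schwartz_cmult)
  also have "schwartz_norm n (\<lambda>x. (-1) * g x) \<le> schwartz_norm n g"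
    using schwartz_norm_cmult[OF assms(2), of n "-1"] by simp
  finally show ?thesis by simp
qed

lemma schwartz_norm_commute:
  assumes "f \<in> schwartz" "g \<in> schwartz"
  shows "schwartz_norm n (\<lambda>x. f x - g x) = schwartz_norm n (\<lambda>x. g x - f x)"
proof -
  have "schwartz_norm n (\<lambda>x. f x - g x) \<le> schwartz_norm n (\<lambda>x. g x - f x)"
    if "f \<in> schwartz" "g \<in> schwartz" for f g :: "'a \<Rightarrow> complex"
    using schwartz_norm_cmult[of "\<lambda>x. g x - f x" n "-1"] schwartz_diff[of g f] that by simp
  with assms show ?thesis by (meson order_antisym)
qed

lemma schwartz_seminorm_le_norm:
  assumes "f \<in> schwartz" "set bs \<subseteq> Basis" "k \<le> n" "length bs \<le> n"
  shows "schwartz_seminorm k bs f \<le> schwartz_norm n f"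
proof -
  have "schwartz_seminorm k bs f \<le> (\<Sum>bs | set bs \<subseteq> Basis \<and> length bs \<le> n. schwartz_seminorm k bs f)"
    using assms by (intro member_le_sum schwartz_seminorm_nonneg) auto
  also have "\<dots> \<le> schwartz_norm n f"
    unfolding schwartz_norm_def using assms
    by (intro member_le_sum[of k _ "\<lambda>k. \<Sum>bs | set bs \<subseteq> Basis \<and> length bs \<le> n. schwartz_seminorm k bs f"]
          sum_nonneg schwartz_seminorm_nonneg) auto
  finally show ?thesis .
qed

lemma schwartz_norm_bound:
  assumes "f \<in> schwartz" "set bs \<subseteq> Basis" "k \<le> n" "length bs \<le> n"
  shows "norm x ^ k * cmod (partials bs f x) \<le> schwartz_norm n f"
  using schwartz_seminorm_bound[OF assms(1,2)] schwartz_seminorm_le_norm[OF assms] by (rule order_trans)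

lemma schwartz_norm_le:
  fixes f :: "'a::euclidean_space \<Rightarrow> complex"
  assumes "\<And>k bs x. k \<le> n \<Longrightarrow> set bs \<subseteq> Basis \<Longrightarrow> length bs \<le> n \<Longrightarrow>
     norm x ^ k * cmod (partials bs f x) \<le> C"
  shows "schwartz_norm n f \<le>
     real (n + 1) * real (card {bs::'a::euclidean_space list. set bs \<subseteq> Basis \<and> length bs \<le> n}) * C"
proof -
  have "schwartz_norm n f \<le> (\<Sum>k\<le>n. \<Sum>bs | set bs \<subseteq> (Basis::'a set) \<and> length bs \<le> n. C)"
    unfolding schwartz_norm_def
    by (rule sum_mono, rule sum_mono, rule schwartz_seminorm_le) (use assms in auto)
  then show ?thesis by (simp add: algebra_simps)
qed

lemma schwartz_norm_mono:
  assumes "f \<in> schwartz" "m \<le> n"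
  shows "schwartz_norm m f \<le> schwartz_norm n f"
  unfolding schwartz_norm_def
  using assms
  by (intro order_trans[OF sum_mono2[of "{..n}"] sum_mono] sum_nonneg sum_mono2
       schwartz_seminorm_nonneg) auto

lemma schwartz_norm_diff_triangle:
  assumes "f \<in> schwartz" "g \<in> schwartz" "h \<in> schwartz"
  shows "schwartz_norm n (\<lambda>x. f x - h x) \<le> schwartz_norm n (\<lambda>x. f x - g x) + schwartz_norm n (\<lambda>x. g x - h x)"
  using schwartz_norm_add[OF schwartz_diff[OF assms(1,2)] schwartz_diff[OF assms(2,3)], of n] by simp

text \<open>The seminorm balls form a subbasis only, and their centres are arbitrary. Finite intersections are
absorbed by passing to a larger index, and the centre is moved to f by the triangle inequality.\<close>
lemma openin_schwartz_ball:
  assumes "openin schwartz_topology U" "f \<in> U"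
  shows "\<exists>n. \<exists>r>0. \<forall>g\<in>schwartz. schwartz_norm n (\<lambda>x. g x - f x) < r \<longrightarrow> g \<in> U"
proof -
  have "generate_topology_on {{g \<in> schwartz. p (\<lambda>x. g x - f x) < r} |p f r.
          p \<in> {schwartz_seminorm k bs |k bs. bs \<in> lists Basis} \<and> f \<in> schwartz \<and> 0 < r} U"
    using assms(1) unfolding schwartz_topology_def seminorm_topology_def
      openin_topology_generated_by_iff .
  then show ?thesis using assms(2)
  proof (induction arbitrary: f)
    case (Int a b)
    obtain n1 r1 where 1: "r1 > 0" "\<forall>g\<in>schwartz. schwartz_norm n1 (\<lambda>x. g x - f x) < r1 \<longrightarrow> g \<in> a"
      using Int by blast
    obtain n2 r2 where 2: "r2 > 0" "\<forall>g\<in>schwartz. schwartz_norm n2 (\<lambda>x. g x - f x) < r2 \<longrightarrow> g \<in> b"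
      using Int by blast
    show ?case
    proof (intro exI[of _ "max n1 n2"] exI[of _ "min r1 r2"] conjI ballI impI)
      fix g assume g: "g \<in> schwartz" "schwartz_norm (max n1 n2) (\<lambda>x. g x - f x) < min r1 r2"
      have "f \<in> schwartz"
        using Int.hyps(1) Int.prems
      proof -
        have "a \<subseteq> schwartz" using Int.hyps(1) by (induction) auto
        then show ?thesis using Int.prems by auto
      qed
      then have d: "(\<lambda>x. g x - f x) \<in> schwartz" using g by (intro schwartz_diff)
      show "g \<in> a \<inter> b"
        using g 1 2 schwartz_norm_mono[OF d, of n1 "max n1 n2"] schwartz_norm_mono[OF d, of n2 "max n1 n2"]
        by auto
    qed (use 1 2 in auto)
  next
    case (UN K)
    then show ?case by (meson UnionE UnionI)
  next
    case (Basis s)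
    then obtain k bs h r where s: "s = {g \<in> schwartz. schwartz_seminorm k bs (\<lambda>x. g x - h x) < r}"
      and bs: "set bs \<subseteq> Basis" "h \<in> schwartz" "0 < r"
      by (auto simp: in_lists_conv_set subset_eq)
    define n where "n = max k (length bs)"
    have f: "f \<in> schwartz" "schwartz_seminorm k bs (\<lambda>x. f x - h x) < r" using Basis s by auto
    show ?case
    proof (intro exI[of _ n] exI[of _ "r - schwartz_seminorm k bs (\<lambda>x. f x - h x)"] conjI ballI impI)
      fix g assume g: "g \<in> schwartz"
        "schwartz_norm n (\<lambda>x. g x - f x) < r - schwartz_seminorm k bs (\<lambda>x. f x - h x)"
      have "schwartz_seminorm k bs (\<lambda>x. g x - h x)
        \<le> schwartz_seminorm k bs (\<lambda>x. g x - f x) + schwartz_seminorm k bs (\<lambda>x. f x - h x)"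
        using schwartz_add(2)[OF schwartz_diff[OF g(1) f(1)] schwartz_diff[OF f(1) bs(2)] bs(1)] by simp
      also have "schwartz_seminorm k bs (\<lambda>x. g x - f x) \<le> schwartz_norm n (\<lambda>x. g x - f x)"
        using g f bs by (intro schwartz_seminorm_le_norm schwartz_diff) (auto simp: n_def)
      finally show "g \<in> s" using g s by auto
    qed (use f in auto)
  qed auto
qed

lemma topspace_schwartz: "topspace schwartz_topology = schwartz"
proof -
  have "f \<in> \<Union>{{g \<in> schwartz. p (\<lambda>x. g x - f x) < r} |p f r.
          p \<in> {schwartz_seminorm k bs |k bs. bs \<in> lists Basis} \<and> f \<in> schwartz \<and> 0 < r}"
    if f: "f \<in> schwartz" for f :: "'a \<Rightarrow> complex"
  proof -
    have "schwartz_seminorm 0 [] (\<lambda>x. f x - f x) < 1"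
      unfolding schwartz_seminorm_def partials_Nil by simp
    with f have "f \<in> {g \<in> schwartz. schwartz_seminorm 0 [] (\<lambda>x. g x - f x) < 1}" by auto
    moreover have "{g \<in> schwartz. schwartz_seminorm 0 [] (\<lambda>x. g x - f x) < 1} \<in>
      {{g \<in> schwartz. p (\<lambda>x. g x - f x) < r} |p f r.
          p \<in> {schwartz_seminorm k bs |k bs. bs \<in> lists Basis} \<and> f \<in> schwartz \<and> 0 < r}"
      using f zero_less_one lists.Nil by blast
    ultimately show ?thesis by (rule UnionI[rotated])
  qed
  then show ?thesis
    unfolding schwartz_topology_def seminorm_topology_def topology_generated_by_topspace
    by auto
qed

lemma openin_schwartz_norm_ball:
  assumes "f \<in> schwartz" "0 < r"
  shows "\<exists>U. openin schwartz_topology U \<and> f \<in> U \<and> (\<forall>g\<in>U. g \<in> schwartz \<and> schwartz_norm n (\<lambda>x. g x - f x) < r)"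
proof -
  let ?I = "{..n} \<times> {bs. set bs \<subseteq> (Basis::'a set) \<and> length bs \<le> n}"
  define c where "c = r / (real (card ?I) + 1)"
  have c: "c > 0" using assms by (simp add: c_def add_nonneg_pos)
  define U where "U = (\<Inter>(k, bs)\<in>?I. {g \<in> schwartz. schwartz_seminorm k bs (\<lambda>x. g x - f x) < c})"
  have fin: "finite ?I" by simp
  have ne: "?I \<noteq> {}" by (auto intro!: exI[of _ "[]"])
  have op: "openin schwartz_topology {g \<in> schwartz. schwartz_seminorm k bs (\<lambda>x. g x - f x) < c}"
    if "set bs \<subseteq> Basis" for k bs
    unfolding schwartz_topology_def seminorm_topology_def openin_topology_generated_by_iff
  proof (rule generate_topology_on.Basis)
    show "{g \<in> schwartz. schwartz_seminorm k bs (\<lambda>x. g x - f x) < c}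
    \<in> {{g \<in> schwartz. p (\<lambda>x. g x - f x) < r} |p f r.
        p \<in> {schwartz_seminorm k bs |k bs. bs \<in> lists Basis} \<and> f \<in> schwartz \<and> 0 < r}"
      using assms c that lists_eq_set[of Basis] by blast
  qed
  have "openin schwartz_topology U"
    unfolding U_def using op fin ne by (intro openin_Inter) auto
  moreover have "f \<in> U"
  proof -
    have "schwartz_seminorm k bs (\<lambda>x. f x - f x) \<le> 0" if "set bs \<subseteq> Basis" for k bs
      using schwartz_cmult(2)[OF assms(1) that, of k 0] by simp
    then show ?thesis using assms c by (auto simp: U_def intro: le_less_trans)
  qed
  moreover have "schwartz_norm n (\<lambda>x. g x - f x) < r" if g: "g \<in> U" for g
  proof -
    have "schwartz_norm n (\<lambda>x. g x - f x) = (\<Sum>(k, bs)\<in>?I. schwartz_seminorm k bs (\<lambda>x. g x - f x))"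
      unfolding schwartz_norm_def by (simp add: sum.cartesian_product)
    also have "\<dots> < (\<Sum>(k, bs)\<in>?I. c)"
      using g fin ne by (intro sum_strict_mono) (auto simp: U_def)
    also have "\<dots> = real (card ?I) * c" by simp
    also have "\<dots> \<le> (real (card ?I) + 1) * c" using c by (intro mult_right_mono) auto
    also have "\<dots> = r" unfolding c_def by (simp add: add_nonneg_eq_0_iff del: card_cartesian_product)
    finally show ?thesis .
  qed
  moreover have "g \<in> schwartz" if "g \<in> U" for g using that ne by (auto simp: U_def)
  ultimately show ?thesis by blast
qed

lemma tempered_bound:
  assumes "u \<in> tempered"
  obtains n C where "C \<ge> 0" "\<And>f. f \<in> schwartz \<Longrightarrow> cmod (u f) \<le> C * schwartz_norm n f"
proof -
  have cont: "continuous_map schwartz_topology euclidean u"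
    and hom: "\<And>f c. f \<in> schwartz \<Longrightarrow> u (\<lambda>x. c * f x) = c * u f"
    using assms by (auto simp: tempered_def)
  have u0: "u (\<lambda>x. 0) = 0" using hom[of "\<lambda>x. 0" 0] by simp
  define U where "U = {f \<in> topspace schwartz_topology. u f \<in> ball 0 1}"
  have 1: "openin schwartz_topology U"
    unfolding U_def by (rule openin_continuous_map_preimage[OF cont]) simp
  have 2: "(\<lambda>x. 0) \<in> U" by (auto simp: U_def topspace_schwartz u0)
  from openin_schwartz_ball[OF 1 2] obtain n r where r: "r > 0"
    and *: "\<And>g. g \<in> schwartz \<Longrightarrow> schwartz_norm n (\<lambda>x. g x - 0) < r \<Longrightarrow> g \<in> U"
    by auto
  have **: "cmod (u g) < 1" if "g \<in> schwartz" "schwartz_norm n g < r" for g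
    using *[of g] that by (auto simp: U_def)
  show ?thesis
  proof (rule that[of "2 / r" n])
    fix f :: "'a \<Rightarrow> complex" assume f: "f \<in> schwartz"
    show "cmod (u f) \<le> 2 / r * schwartz_norm n f"
    proof (rule field_le_epsilon)
      fix e :: real assume e: "e > 0"
      define s where "s = schwartz_norm n f + e * r / 2"
      have s: "s > 0" "schwartz_norm n f < s"
        using schwartz_norm_nonneg[OF f, of n] e r by (auto simp: s_def add_nonneg_pos)
      define c where "c = r / s"
      have c: "c > 0" using r s by (simp add: c_def)
      have "schwartz_norm n (\<lambda>x. of_real c * f x) \<le> c * schwartz_norm n f"
        using schwartz_norm_cmult[OF f, of n "of_real c"] c by simp
      also have "\<dots> < c * s" using s c by simp
      also have "\<dots> = r" using s by (simp add: c_def)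
      finally have "cmod (u (\<lambda>x. of_real c * f x)) < 1"
        using f by (intro ** schwartz_cmult)
      then have "c * cmod (u f) < 1" using c by (simp add: hom[OF f] norm_mult)
      then have "cmod (u f) < s / r" using c r s by (simp add: c_def field_simps)
      also have "s / r \<le> 2 / r * schwartz_norm n f + e"
        using r schwartz_norm_nonneg[OF f, of n] e by (simp add: s_def field_simps)
      finally show "cmod (u f) \<le> 2 / r * schwartz_norm n f + e" by simp
    qed
  qed (use r in auto)
qed

lemma temperedI:
  assumes "u \<in> extensional schwartz"
    and add: "\<And>f g. f \<in> schwartz \<Longrightarrow> g \<in> schwartz \<Longrightarrow> u (\<lambda>x. f x + g x) = u f + u g"
    and hom: "\<And>f c. f \<in> schwartz \<Longrightarrow> u (\<lambda>x. c * f x) = c * u f"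
    and bound: "\<And>f. f \<in> schwartz \<Longrightarrow> cmod (u f) \<le> C * schwartz_norm n f"
  shows "u \<in> tempered"
proof -
  have C: "C * schwartz_norm n f \<le> (\<bar>C\<bar> + 1) * schwartz_norm n f" if "f \<in> schwartz" for f
    using schwartz_norm_nonneg[OF that, of n] by (intro mult_right_mono) auto
  have diff: "u (\<lambda>x. f x - g x) = u f - u g" if "f \<in> schwartz" "g \<in> schwartz" for f g
    using add[OF that(1) schwartz_cmult(1)[OF that(2), of "-1"]] hom[OF that(2), of "-1"] by simp
  have "continuous_map schwartz_topology euclidean u"
    unfolding continuous_map_def
  proof (intro conjI allI impI)
    fix V :: "complex set" assume V: "openin euclidean V"
    show "openin schwartz_topology {f \<in> topspace schwartz_topology. u f \<in> V}"
    proof (subst openin_subopen, intro ballI)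
      fix f assume "f \<in> {f \<in> topspace schwartz_topology. u f \<in> V}"
      then have f: "f \<in> schwartz" "u f \<in> V" by (auto simp: topspace_schwartz)
      then obtain e where e: "e > 0" "ball (u f) e \<subseteq> V" using V by (auto simp: open_contains_ball)
      obtain U where U: "openin schwartz_topology U" "f \<in> U"
        "\<And>g. g \<in> U \<Longrightarrow> g \<in> schwartz \<and> schwartz_norm n (\<lambda>x. g x - f x) < e / (\<bar>C\<bar> + 1)"
        using openin_schwartz_norm_ball[OF f(1), of "e / (\<bar>C\<bar> + 1)" n] e by fastforce
      have "u g \<in> V" if "g \<in> U" for g
      proof -
        have g: "g \<in> schwartz" "schwartz_norm n (\<lambda>x. g x - f x) < e / (\<bar>C\<bar> + 1)" using U that by auto
        have "cmod (u g - u f) = cmod (u (\<lambda>x. g x - f x))" using diff g f by simp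
        also have "\<dots> \<le> (\<bar>C\<bar> + 1) * schwartz_norm n (\<lambda>x. g x - f x)"
          using bound[OF schwartz_diff[OF g(1) f(1)]] C[OF schwartz_diff[OF g(1) f(1)]] by simp
        also have "\<dots> < e" using g by (simp add: field_simps)
        finally show ?thesis using e by (auto simp: dist_norm norm_minus_commute)
      qed
      then show "\<exists>T. openin schwartz_topology T \<and> f \<in> T \<and> T \<subseteq> {f \<in> topspace schwartz_topology. u f \<in> V}"
        using U by (intro exI[of _ U]) (auto simp: topspace_schwartz)
    qed
  qed auto
  with assms show ?thesis by (auto simp: tempered_def)
qed

lemma tempered_add:
  "u \<in> tempered \<Longrightarrow> f \<in> schwartz \<Longrightarrow> g \<in> schwartz \<Longrightarrow> u (\<lambda>x. f x + g x) = u f + u g"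
  and tempered_cmult: "u \<in> tempered \<Longrightarrow> f \<in> schwartz \<Longrightarrow> u (\<lambda>x. c * f x) = c * u f"
  by (auto simp: tempered_def)

lemma tempered_zero: "u \<in> tempered \<Longrightarrow> u (\<lambda>x. 0) = 0"
  using tempered_cmult[of u "\<lambda>x. 0" 0] by simp

lemma tempered_diff:
  "u \<in> tempered \<Longrightarrow> f \<in> schwartz \<Longrightarrow> g \<in> schwartz \<Longrightarrow> u (\<lambda>x. f x - g x) = u f - u g"
  using tempered_add[of u f "\<lambda>x. (-1) * g x"] tempered_cmult[of u g "-1"] schwartz_cmult(1)[of g "-1"] by simp

lemma schwartz_sum:
  "finite I \<Longrightarrow> (\<And>i. i \<in> I \<Longrightarrow> f i \<in> schwartz) \<Longrightarrow> (\<lambda>x. \<Sum>i\<in>I. f i x) \<in> schwartz"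
  by (induction I rule: finite_induct) (auto intro: schwartz_add)

lemma tempered_sum:
  assumes "u \<in> tempered"
  shows "finite I \<Longrightarrow> (\<And>i. i \<in> I \<Longrightarrow> f i \<in> schwartz) \<Longrightarrow> u (\<lambda>x. \<Sum>i\<in>I. f i x) = (\<Sum>i\<in>I. u (f i))"
proof (induction I rule: finite_induct)
  case (insert i I)
  have "u (\<lambda>x. f i x + (\<Sum>i\<in>I. f i x)) = u (f i) + u (\<lambda>x. \<Sum>i\<in>I. f i x)"
    using insert by (intro tempered_add[OF assms] schwartz_sum) auto
  with insert show ?case by simp
qed (simp add: tempered_zero assms)

section \<open>Differentiation under the integral sign\<close>

lemma norm_integral_le:
  fixes f :: "'p \<Rightarrow> 'b::{banach,second_countable_topology}"
  assumes "integrable M g" "\<And>x. norm (f x) \<le> g x"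
  shows "norm (\<integral>x. f x \<partial>M) \<le> (\<integral>x. g x \<partial>M)"
proof (cases "integrable M f")
  case True
  then have "(\<integral>x. norm (f x) \<partial>M) \<le> (\<integral>x. g x \<partial>M)"
    using assms by (intro integral_mono) auto
  then show ?thesis using integral_norm_bound[of M f] by linarith
next
  case False
  have "0 \<le> g x" for x using assms(2)[of x] norm_ge_zero order_trans by blast
  with False show ?thesis by (simp add: not_integrable_integral_eq)
qed

text \<open>Dominated convergence for the difference quotients. The mean value inequality bounds them by 2 K as
soon as the increment is shorter than r; a bound that holds near x only is what the exponentials
in the proof of \<open>bargmann_entire\<close> allow.\<close>
lemma has_derivative_integral_lebesgue:
  fixes G :: "'p \<Rightarrow> 'a::euclidean_space \<Rightarrow> complex"
  assumes int: "\<And>y. integrable M (\<lambda>p. G p y)"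
    and der: "\<And>p y. (G p has_derivative G' p y) (at y)"
    and r: "0 < r"
    and bound: "\<And>p y h. dist x y < r \<Longrightarrow> norm (G' p y h) \<le> K p * norm h"
    and K: "integrable M K"
    and meas [measurable]: "\<And>h. (\<lambda>p. G' p x h) \<in> borel_measurable M"
  shows "((\<lambda>y. \<integral>p. G p y \<partial>M) has_derivative (\<lambda>h. \<integral>p. G' p x h \<partial>M)) (at x)"
proof -
  have lin: "bounded_linear (G' p x)" for p
    using der by (rule has_derivative_bounded_linear)
  have int': "integrable M (\<lambda>p. G' p x h)" for h
  proof (rule Bochner_Integration.integrable_bound[OF integrable_mult_left[OF K, of "norm h"]])
    show "AE p in M. norm (G' p x h) \<le> norm (K p * norm h)"
      using bound[of x _ h] r by (intro AE_I2) (smt (verit, best) dist_self real_norm_def)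
  qed simp
  have bl: "bounded_linear (\<lambda>h. \<integral>p. G' p x h \<partial>M)"
  proof (rule bounded_linear_intro)
    show "(\<integral>p. G' p x (h + k) \<partial>M) = (\<integral>p. G' p x h \<partial>M) + (\<integral>p. G' p x k \<partial>M)" for h k
      using int' linear_add[OF bounded_linear.linear[OF lin]] by (simp add: Bochner_Integration.integral_add)
    show "(\<integral>p. G' p x (c *\<^sub>R h) \<partial>M) = c *\<^sub>R (\<integral>p. G' p x h \<partial>M)" for c h
      using linear_cmul[OF bounded_linear.linear[OF lin]] by simp
    show "norm (\<integral>p. G' p x h \<partial>M) \<le> norm h * (\<integral>p. K p \<partial>M)" for h
    proof -
      have "norm (\<integral>p. G' p x h \<partial>M) \<le> (\<integral>p. K p * norm h \<partial>M)"
        by (rule norm_integral_le) (use bound[of x _ h] r K in auto)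
      then show ?thesis by (simp add: mult.commute)
    qed
  qed
  have diff_bound: "norm (G p (x + h) - G p x - G' p x h) \<le> 2 * K p * norm h" if h: "norm h < r" for p h
  proof -
    have "norm (G p (x + h) - G p x) \<le> K p * norm (x + h - x)"
    proof (rule differentiable_bound)
      show "convex (ball x r)" by simp
      show "(G p has_derivative G' p y) (at y within ball x r)" for y
        using der has_derivative_at_withinI by blast
      show "onorm (G' p y) \<le> K p" if "y \<in> ball x r" for y
        using bound[of y p] that by (intro onorm_le) auto
    qed (use h r in \<open>auto simp: dist_norm\<close>)
    moreover have "norm (G' p x h) \<le> K p * norm h" using bound[of x p h] r by simp
    ultimately show ?thesis
      using norm_triangle_ineq4[of "G p (x + h) - G p x" "G' p x h"] by simp
  qed
  have "((\<lambda>h. norm ((\<integral>p. G p (x + h) \<partial>M) - (\<integral>p. G p x \<partial>M) - (\<integral>p. G' p x h \<partial>M)) / norm h) \<longlongrightarrow> 0) (at 0)"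
    unfolding tendsto_at_iff_sequentially
  proof (intro allI impI)
    fix X :: "nat \<Rightarrow> 'a" assume X0: "\<forall>i. X i \<in> UNIV - {0}" and X: "X \<longlonglongrightarrow> 0"
    from X r obtain n where n: "\<And>i. i \<ge> n \<Longrightarrow> norm (X i) < r"
      using LIMSEQ_D[of X 0 r] by auto
    define s where "s i p = (1 / norm (X (i + n))) *\<^sub>R
      (G p (x + X (i + n)) - G p x - G' p x (X (i + n)))" for i p
    have "(\<lambda>i. \<integral>p. s i p \<partial>M) \<longlonglongrightarrow> (\<integral>p. 0 \<partial>M)"
    proof (rule integral_dominated_convergence[where w="\<lambda>p. 2 * K p"])
      show "(\<lambda>p. s i p) \<in> borel_measurable M" for i
        using borel_measurable_integrable[OF int] unfolding s_def by measurable
      show "AE p in M. (\<lambda>i. s i p) \<longlonglongrightarrow> 0"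
      proof (rule AE_I2)
        fix p
        have "((\<lambda>h. norm (G p (x + h) - G p x - G' p x h) / norm h) \<longlongrightarrow> 0) (at 0)"
          using der[of p x] by (simp add: has_derivative_at)
        then have "((\<lambda>h. norm (G p (x + h) - G p x - G' p x h) / norm h) \<circ> X) \<longlonglongrightarrow> 0"
          using X X0 unfolding tendsto_at_iff_sequentially by auto
        then have "(\<lambda>i. norm (s i p)) \<longlonglongrightarrow> 0"
          unfolding s_def o_def by (auto dest: LIMSEQ_ignore_initial_segment[of _ _ n])
        then show "(\<lambda>i. s i p) \<longlonglongrightarrow> 0" by (simp add: tendsto_norm_zero_iff)
      qed
      show "AE p in M. norm (s i p) \<le> 2 * K p" for i
        using diff_bound[of "X (i + n)"] n[of "i + n"] X0
        by (intro AE_I2) (auto simp: s_def divide_le_eq)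
    qed (use K in auto)
    then have "(\<lambda>i. \<integral>p. s i p \<partial>M) \<longlonglongrightarrow> 0" by simp
    then have "(\<lambda>i. norm (\<integral>p. s i p \<partial>M)) \<longlonglongrightarrow> 0"
      by (rule tendsto_norm_zero)
    moreover have "norm (\<integral>p. s i p \<partial>M) = norm ((\<integral>p. G p (x + X (i + n)) \<partial>M) - (\<integral>p. G p x \<partial>M)
        - (\<integral>p. G' p x (X (i + n)) \<partial>M)) / norm (X (i + n))" for i
    proof -
      have "(\<integral>p. s i p \<partial>M) = (1 / norm (X (i + n))) *\<^sub>R
          (\<integral>p. G p (x + X (i + n)) - G p x - G' p x (X (i + n)) \<partial>M)"
        unfolding s_def by (rule integral_scaleR_right)
      also have "(\<integral>p. G p (x + X (i + n)) - G p x - G' p x (X (i + n)) \<partial>M)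
        = (\<integral>p. G p (x + X (i + n)) \<partial>M) - (\<integral>p. G p x \<partial>M) - (\<integral>p. G' p x (X (i + n)) \<partial>M)"
        by (subst Bochner_Integration.integral_diff[OF Bochner_Integration.integrable_diff[OF int int] int'])
          (subst Bochner_Integration.integral_diff[OF int int], rule refl)
      finally show ?thesis by simp
    qed
    ultimately have "(\<lambda>i. norm ((\<integral>p. G p (x + X (i + n)) \<partial>M) - (\<integral>p. G p x \<partial>M)
        - (\<integral>p. G' p x (X (i + n)) \<partial>M)) / norm (X (i + n))) \<longlonglongrightarrow> 0" by simp
    then show "((\<lambda>h. norm ((\<integral>p. G p (x + h) \<partial>M) - (\<integral>p. G p x \<partial>M) - (\<integral>p. G' p x h \<partial>M)) / norm h) \<circ> X)
       \<longlonglongrightarrow> 0"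
      unfolding o_def by (rule LIMSEQ_offset)
  qed
  with bl show ?thesis by (simp add: has_derivative_at)
qed

lemma has_derivative_partials:
  assumes "f differentiable at x"
  shows "(f has_derivative (\<lambda>h. \<Sum>b\<in>Basis. (h \<bullet> b) *\<^sub>R partial b f x)) (at x)"
proof -
  obtain f' where f': "(f has_derivative f') (at x)" using assms by (auto simp: differentiable_def)
  have "f' h = (\<Sum>b\<in>Basis. (h \<bullet> b) *\<^sub>R partial b f x)" for h
  proof -
    have "f' h = f' (\<Sum>b\<in>Basis. (h \<bullet> b) *\<^sub>R b)" by (simp add: euclidean_representation)
    also have "\<dots> = (\<Sum>b\<in>Basis. (h \<bullet> b) *\<^sub>R f' b)"
      using has_derivative_bounded_linear[OF f'] by (simp add: bounded_linear.linear linear_sum linear_cmul)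
    finally show ?thesis using partial_eq[OF f'] by simp
  qed
  then have "f' = (\<lambda>h. \<Sum>b\<in>Basis. (h \<bullet> b) *\<^sub>R partial b f x)" by (rule ext)
  with f' show ?thesis by simp
qed

lemma
  fixes G :: "'p \<Rightarrow> 'a::euclidean_space \<Rightarrow> complex"
  assumes smooth: "\<And>p. smooth (G p)"
    and meas: "\<And>bs y. set bs \<subseteq> Basis \<Longrightarrow> (\<lambda>p. partials bs (G p) y) \<in> borel_measurable M"
    and bound: "\<And>bs. set bs \<subseteq> Basis \<Longrightarrow> \<exists>K. integrable M K \<and> (\<forall>p y. cmod (partials bs (G p) y) \<le> K p)"
  shows partials_integral: "set bs \<subseteq> Basis \<Longrightarrow>
      partials bs (\<lambda>y. \<integral>p. G p y \<partial>M) = (\<lambda>y. \<integral>p. partials bs (G p) y \<partial>M)"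
    and smooth_integral: "smooth (\<lambda>y. \<integral>p. G p y \<partial>M)"
proof -
  have int: "integrable M (\<lambda>p. partials bs (G p) y)" if "set bs \<subseteq> Basis" for bs y
  proof -
    obtain K where K: "integrable M K" "\<And>p y. cmod (partials bs (G p) y) \<le> K p"
      using bound \<open>set bs \<subseteq> Basis\<close> by blast
    have "cmod (partials bs (G p) y) \<le> norm (K p)" for p using K(2)[of p y] by simp
    then show ?thesis
      by (intro Bochner_Integration.integrable_bound[OF K(1) meas[OF that]] AE_I2)
  qed
  have der: "((\<lambda>y. \<integral>p. partials bs (G p) y \<partial>M) has_derivative
      (\<lambda>h. \<integral>p. (\<Sum>b\<in>Basis. (h \<bullet> b) *\<^sub>R partials (b # bs) (G p) y) \<partial>M)) (at y)"
    if bs: "set bs \<subseteq> Basis" for bs y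
  proof -
    have "\<exists>K. \<forall>b\<in>Basis. integrable M (K b) \<and> (\<forall>p y. cmod (partials (b # bs) (G p) y) \<le> K b p)"
      using bound[of "_ # bs"] bs by (intro bchoice) auto
    then obtain K where K: "\<And>b. b \<in> Basis \<Longrightarrow> integrable M (K b)"
      "\<And>b p y. b \<in> Basis \<Longrightarrow> cmod (partials (b # bs) (G p) y) \<le> K b p" by metis
    show ?thesis
    proof (rule has_derivative_integral_lebesgue[where r = 1 and K = "\<lambda>p. \<Sum>b\<in>Basis. K b p"])
      show "(partials bs (G p) has_derivative (\<lambda>h. \<Sum>b\<in>Basis. (h \<bullet> b) *\<^sub>R partials (b # bs) (G p) y)) (at y)" for p y
        using has_derivative_partials[OF smooth_differentiable[OF smooth_partials[OF smooth bs]]]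
        by (simp add: partials_Cons)
      show "norm (\<Sum>b\<in>Basis. (h \<bullet> b) *\<^sub>R partials (b # bs) (G p) y) \<le> (\<Sum>b\<in>Basis. K b p) * norm h" for p y h
        unfolding sum_distrib_right
      proof (rule sum_norm_le)
        fix b :: 'a assume b: "b \<in> Basis"
        show "norm ((h \<bullet> b) *\<^sub>R partials (b # bs) (G p) y) \<le> K b p * norm h"
          using mult_mono[OF K(2)[OF b, of p y] Basis_le_norm[OF b, of h]] order_trans[OF norm_ge_zero K(2)[OF b, of p y]]
          by (simp add: mult.commute)
      qed
      show "(\<lambda>p. \<Sum>b\<in>Basis. (h \<bullet> b) *\<^sub>R partials (b # bs) (G p) y) \<in> borel_measurable M" for h
        using meas[of "_ # bs"] bs by (intro borel_measurable_sum borel_measurable_scaleR) auto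
    qed (use int bs K in auto)
  qed
  have step: "partial b (\<lambda>y. \<integral>p. partials bs (G p) y \<partial>M) = (\<lambda>y. \<integral>p. partials (b # bs) (G p) y \<partial>M)"
    if bs: "set bs \<subseteq> Basis" and b: "b \<in> Basis" for b bs
  proof
    fix y
    have "(\<Sum>c\<in>Basis. (b \<bullet> c) *\<^sub>R z c) = z b" for z :: "'a \<Rightarrow> complex"
      using b by (simp add: inner_Basis if_distrib[of "\<lambda>t. t *\<^sub>R _"] cong: if_cong)
    then show "partial b (\<lambda>y. \<integral>p. partials bs (G p) y \<partial>M) y = (\<integral>p. partials (b # bs) (G p) y \<partial>M)"
      using partial_eq[OF der[OF bs], of b y] by simp
  qed
  show P: "partials bs (\<lambda>y. \<integral>p. G p y \<partial>M) = (\<lambda>y. \<integral>p. partials bs (G p) y \<partial>M)" if "set bs \<subseteq> Basis" for bs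
    using that by (induction bs) (simp_all add: partials_Nil step partials_Cons[of _ _ "\<lambda>y. \<integral>p. G p y \<partial>M"])
  show "smooth (\<lambda>y. \<integral>p. G p y \<partial>M)"
    unfolding smooth_def
  proof (intro ballI allI)
    fix bs :: "'a list" and y assume "bs \<in> lists Basis"
    then have bs: "set bs \<subseteq> Basis" by auto
    from der[OF bs] show "partials bs (\<lambda>y. \<integral>p. G p y \<partial>M) differentiable at y"
      unfolding P[OF bs] differentiable_def by blast
  qed
qed

section \<open>Coherent states\<close>

text \<open>A Gaussian moved to the point (x, \<xi>) of phase space. Up to a constant, the short-time
Fourier transform of a tempered distribution at (x, \<xi>) is its value at this function.\<close>
definition coherent :: "'a::euclidean_space \<times> 'a \<Rightarrow> 'a \<Rightarrow> complex" where
  "coherent p y = gauss (y - fst p) * exp (- \<i> * of_real (y \<bullet> snd p))"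

text \<open>The polynomial factors produced by differentiating coherent states. The class is generated by closure
properties instead of explicit Hermite polynomials, so that stability under partial derivatives in y,
continuity and polynomial growth follow by induction.\<close>
inductive_set symbols :: "('a::euclidean_space \<times> 'a \<Rightarrow> 'a \<Rightarrow> complex) set" where
  const: "(\<lambda>p y. c) \<in> symbols"
| position: "(\<lambda>p y. of_real ((y - fst p) \<bullet> b)) \<in> symbols"
| frequency: "(\<lambda>p y. of_real (snd p \<bullet> b)) \<in> symbols"
| add: "P \<in> symbols \<Longrightarrow> Q \<in> symbols \<Longrightarrow> (\<lambda>p y. P p y + Q p y) \<in> symbols"
| mult: "P \<in> symbols \<Longrightarrow> Q \<in> symbols \<Longrightarrow> (\<lambda>p y. P p y * Q p y) \<in> symbols"

lemma symbols_continuous: "P \<in> symbols \<Longrightarrow> continuous_on UNIV (\<lambda>(p, y). P p y)"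
  by (induction rule: symbols.induct) (auto intro!: continuous_intros simp: case_prod_unfold)

text \<open>The bound separates a power of \<open>1 + norm p\<close>, which is allowed to grow, from a power of the distance
to the centre of the Gaussian, which the Gaussian absorbs.\<close>
lemma symbols_growth:
  "P \<in> symbols \<Longrightarrow> \<exists>C\<ge>0. \<exists>m. \<forall>p y. cmod (P p y) \<le> C * ((1 + norm p) * (1 + norm (y - fst p))) ^ m"
proof (induction rule: symbols.induct)
  case (const c)
  show ?case by (rule exI[of _ "cmod c"]) (auto intro!: exI[of _ 0])
next
  case (position b)
  have "cmod (of_real ((y - fst p) \<bullet> b)) \<le> norm b * ((1 + norm p) * (1 + norm (y - fst p)))" for p :: "'a \<times> 'a" and y
  proof -
    have "\<bar>(y - fst p) \<bullet> b\<bar> \<le> norm b * norm (y - fst p)" by (metis Cauchy_Schwarz_ineq2 mult.commute)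
    also have "\<dots> \<le> norm b * ((1 + norm p) * (1 + norm (y - fst p)))" by (intro mult_left_mono) (auto simp: algebra_simps)
    finally show ?thesis by simp
  qed
  then show ?case by (intro exI[of _ "norm b"] conjI exI[of _ "1::nat"]) auto
next
  case (frequency b)
  have "cmod (of_real (snd p \<bullet> b)) \<le> norm b * ((1 + norm p) * (1 + norm (y - fst p)))" for p :: "'a \<times> 'a" and y
  proof -
    have "\<bar>snd p \<bullet> b\<bar> \<le> norm b * norm (snd p)" by (metis Cauchy_Schwarz_ineq2 mult.commute)
    also have "\<dots> \<le> norm b * ((1 + norm p) * (1 + norm (y - fst p)))"
    proof (rule mult_left_mono)
      have "norm (snd p) \<le> 1 + norm p" using norm_snd_le[of "snd p" "fst p"] by simp
      also have "\<dots> \<le> (1 + norm p) * (1 + norm (y - fst p))" by (simp add: distrib_left)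
      finally show "norm (snd p) \<le> (1 + norm p) * (1 + norm (y - fst p))" .
    qed simp
    finally show ?thesis by simp
  qed
  then show ?case by (intro exI[of _ "norm b"] conjI exI[of _ "1::nat"]) auto
next
  case (add P Q)
  then obtain C m D n where
    P: "C \<ge> 0" "\<And>p y. cmod (P p y) \<le> C * ((1 + norm p) * (1 + norm (y - fst p))) ^ m" and
    Q: "D \<ge> 0" "\<And>p y. cmod (Q p y) \<le> D * ((1 + norm p) * (1 + norm (y - fst p))) ^ n" by metis
  have "cmod (P p y + Q p y) \<le> (C + D) * ((1 + norm p) * (1 + norm (y - fst p))) ^ (max m n)" for p y
  proof -
    let ?t = "(1 + norm p) * (1 + norm (y - fst p))"
    have t: "1 \<le> ?t" using mult_mono[of 1 "1 + norm p" 1 "1 + norm (y - fst p)"] by simp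
    have "cmod (P p y + Q p y) \<le> C * ?t ^ m + D * ?t ^ n"
      using P(2)[of p y] Q(2)[of p y] norm_triangle_ineq[of "P p y" "Q p y"] by linarith
    also have "\<dots> \<le> C * ?t ^ max m n + D * ?t ^ max m n"
      using P(1) Q(1) t by (intro add_mono mult_left_mono power_increasing) auto
    finally show ?thesis by (simp add: algebra_simps)
  qed
  with P(1) Q(1) show ?case by (intro exI[of _ "C + D"] conjI exI[of _ "max m n"] allI) simp_all
next
  case (mult P Q)
  then obtain C m D n where
    P: "C \<ge> 0" "\<And>p y. cmod (P p y) \<le> C * ((1 + norm p) * (1 + norm (y - fst p))) ^ m" and
    Q: "D \<ge> 0" "\<And>p y. cmod (Q p y) \<le> D * ((1 + norm p) * (1 + norm (y - fst p))) ^ n" by metis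
  have "cmod (P p y * Q p y) \<le> (C * D) * ((1 + norm p) * (1 + norm (y - fst p))) ^ (m + n)" for p y
    using mult_mono[OF P(2)[of p y] Q(2)[of p y]] P Q
    by (simp add: norm_mult power_add mult_ac)
  with P(1) Q(1) show ?case by (intro exI[of _ "C * D"] conjI exI[of _ "m + n"] allI) simp_all
qed

lemma symbols_partial:
  "P \<in> symbols \<Longrightarrow> (\<forall>p y. P p differentiable at y) \<and> (\<forall>b. \<exists>Q\<in>symbols. \<forall>p. partial b (P p) = Q p)"
proof (induction rule: symbols.induct)
  case (const c)
  show ?case by (auto intro!: bexI[OF _ symbols.const])
next
  case (position e)
  have d: "((\<lambda>y. complex_of_real ((y - fst p) \<bullet> e)) has_derivative (\<lambda>h. of_real (h \<bullet> e))) (at y)"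
    for p :: "'a \<times> 'a" and y
    by (auto intro!: derivative_eq_intros)
  have "partial b (\<lambda>y. complex_of_real ((y - fst p) \<bullet> e)) = (\<lambda>y. of_real (b \<bullet> e))" for b and p :: "'a \<times> 'a"
    using partial_eq[OF d] by (rule ext)
  moreover have "(\<lambda>y. complex_of_real ((y - fst p) \<bullet> e)) differentiable at y" for p :: "'a \<times> 'a" and y
    using d unfolding differentiable_def by blast
  ultimately show ?case by (intro conjI allI bexI[OF _ symbols.const])
next
  case (frequency e)
  show ?case by (auto intro!: bexI[OF _ symbols.const])
next
  case (add P Q)
  have "\<exists>R\<in>symbols. \<forall>p. partial b (\<lambda>y. P p y + Q p y) = R p" for b
  proof -
    obtain P' Q' where "P' \<in> symbols" "Q' \<in> symbols" "\<And>p. partial b (P p) = P' p" "\<And>p. partial b (Q p) = Q' p"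
      using add.IH by metis
    then show ?thesis using add.IH
      by (intro bexI[of _ "\<lambda>p y. P' p y + Q' p y"]) (auto simp: partial_add intro: symbols.intros)
  qed
  with add.IH show ?case by auto
next
  case (mult P Q)
  have "\<exists>R\<in>symbols. \<forall>p. partial b (\<lambda>y. P p y * Q p y) = R p" for b
  proof -
    obtain P' Q' where "P' \<in> symbols" "Q' \<in> symbols" "\<And>p. partial b (P p) = P' p" "\<And>p. partial b (Q p) = Q' p"
      using mult.IH by metis
    then show ?thesis using mult.IH mult.hyps
      by (intro bexI[of _ "\<lambda>p y. P' p y * Q p y + P p y * Q' p y"]) (auto simp: partial_mult intro: symbols.intros)
  qed
  with mult.IH show ?case by auto
qed

lemma gauss_eq: "gauss x = of_real (pi powr (- real DIM('a) / 4)) * exp (- of_real (x \<bullet> x) / 2)"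
  for x :: "'a::euclidean_space"
  unfolding gauss_def by (simp add: power2_norm_eq_inner exp_of_real[symmetric])

lemma coherent_has_derivative:
  "(coherent p has_derivative
     (\<lambda>h. (- of_real ((y - fst p) \<bullet> h) - \<i> * of_real (snd p \<bullet> h)) * coherent p y)) (at y)"
proof -
  let ?E = "\<lambda>y. - complex_of_real ((y - fst p) \<bullet> (y - fst p)) / 2 + - \<i> * of_real (y \<bullet> snd p)"
  let ?c = "complex_of_real (pi powr (- real DIM('a) / 4))"
  have eq: "coherent p = (\<lambda>y. ?c * exp (?E y))"
    unfolding coherent_def gauss_eq exp_add by (simp add: mult.assoc)
  have E: "(?E has_derivative (\<lambda>h. - of_real ((y - fst p) \<bullet> h) - \<i> * of_real (snd p \<bullet> h))) (at y)"
    by (auto intro!: derivative_eq_intros simp: inner_commute)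
  have "((\<lambda>y. ?c * exp (?E y)) has_derivative (\<lambda>h. ?c * ((- of_real ((y - fst p) \<bullet> h) - \<i> * of_real (snd p \<bullet> h)) * exp (?E y)))) (at y)"
    by (rule has_derivative_mult_right,
      rule has_derivative_compose[OF E DERIV_exp[unfolded has_field_derivative_def], THEN has_derivative_eq_rhs])
      (simp add: mult.commute)
  then show ?thesis unfolding eq by (simp add: mult_ac)
qed

lemma differentiable_coherent: "coherent p differentiable at y"
  using coherent_has_derivative unfolding differentiable_def by blast

lemma partials_coherent:
  "set bs \<subseteq> Basis \<Longrightarrow> \<exists>P\<in>symbols. \<forall>p. partials bs (coherent p) = (\<lambda>y. P p y * coherent p y)"
proof (induction bs)
  case Nil
  show ?case by (rule bexI[OF _ symbols.const[of 1]]) (auto simp: partials_Nil)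
next
  case (Cons b bs)
  then obtain P where P: "P \<in> symbols" "\<And>p. partials bs (coherent p) = (\<lambda>y. P p y * coherent p y)" by auto
  obtain P' where P': "P' \<in> symbols" "\<And>p. partial b (P p) = P' p" using symbols_partial[OF P(1)] by metis
  let ?l = "\<lambda>p y. (- 1) * of_real ((y - fst p) \<bullet> b) + (- \<i>) * of_real (snd p \<bullet> b)"
  have l: "?l \<in> symbols" by (intro symbols.intros)
  have "partials (b # bs) (coherent p) y = (P' p y + P p y * ?l p y) * coherent p y" for p y
  proof -
    have "partials (b # bs) (coherent p) y = partial b (P p) y * coherent p y + P p y * partial b (coherent p) y"
      unfolding partials_Cons P(2) using symbols_partial[OF P(1)]
      by (intro partial_mult differentiable_coherent) blast
    then show ?thesis by (simp add: P' partial_eq[OF coherent_has_derivative] algebra_simps)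
  qed
  then show ?case
    by (intro bexI[of _ "\<lambda>p y. P' p y + P p y * ?l p y"] symbols.add[OF P'(1) symbols.mult[OF P(1) l]]) auto
qed

lemma smooth_coherent: "smooth (coherent p)"
  unfolding smooth_def
proof (intro ballI allI)
  fix bs :: "'a list" and y assume "bs \<in> lists Basis"
  then have "set bs \<subseteq> Basis" by auto
  then obtain P where P: "P \<in> symbols" "partials bs (coherent p) = (\<lambda>y. P p y * coherent p y)"
    using partials_coherent by metis
  show "partials bs (coherent p) differentiable at y"
    unfolding P(2) using symbols_partial[OF P(1)]
    by (intro differentiable_mult differentiable_coherent) blast
qed

lemma continuous_on_coherent: "continuous_on UNIV (\<lambda>(p, y). coherent p y)"
  unfolding coherent_def gauss_def by (auto intro!: continuous_intros simp: case_prod_unfold)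

lemma continuous_on_partials_coherent:
  assumes "set bs \<subseteq> Basis"
  shows "continuous_on UNIV (\<lambda>(p, y). partials bs (coherent p) y)"
proof -
  obtain P where P: "P \<in> symbols" "\<And>p. partials bs (coherent p) = (\<lambda>y. P p y * coherent p y)"
    using partials_coherent[OF assms] by metis
  show ?thesis
    unfolding P(2) using continuous_on_mult[OF symbols_continuous[OF P(1)] continuous_on_coherent]
    by (simp add: case_prod_unfold)
qed

lemma cmod_coherent:
  "cmod (coherent p y) = pi powr (- real DIM('a) / 4) * exp (- (norm (y - fst p))\<^sup>2 / 2)"
  for y :: "'a::euclidean_space"
proof -
  have "Re (\<i> * of_real t) = 0" for t by simp
  then show ?thesis by (simp add: coherent_def gauss_def norm_mult flip: exp_of_real)
qed

lemma poly_times_gaussian_le: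
  assumes "t \<ge> 0"
  shows "(1 + t) ^ m * exp (- t\<^sup>2 / 2) \<le> exp ((real m)\<^sup>2 / 2)"
proof -
  have "(1 + t) ^ m \<le> exp t ^ m"
    using exp_ge_add_one_self[of t] assms by (intro power_mono) auto
  then have "(1 + t) ^ m * exp (- t\<^sup>2 / 2) \<le> exp (m * t) * exp (- t\<^sup>2 / 2)"
    by (intro mult_right_mono) (simp_all add: exp_of_nat_mult)
  also have "\<dots> = exp (m * t - t\<^sup>2 / 2)" by (simp flip: exp_add)
  also have "\<dots> \<le> exp ((real m)\<^sup>2 / 2)"
    using zero_le_power2[of "t - m"] by (simp add: power2_eq_square algebra_simps)
  finally show ?thesis .
qed

text \<open>The Gaussian is centred at \<open>fst p\<close>, so moving a weight in y to a weight in \<open>y - fst p\<close> costs a power of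
\<open>1 + norm p\<close> and nothing worse: Schwartz norms of coherent states grow only polynomially in p.\<close>
lemma partials_coherent_decay:
  assumes "set bs \<subseteq> Basis"
  shows "\<exists>C\<ge>0. \<exists>m. \<forall>p y. (1 + norm y) ^ k * cmod (partials bs (coherent p) y) \<le> C * (1 + norm p) ^ m"
proof -
  obtain P where P: "P \<in> symbols" "\<And>p. partials bs (coherent p) = (\<lambda>y. P p y * coherent p y)"
    using partials_coherent[OF assms] by metis
  obtain C m where C: "C \<ge> 0" "\<And>p y. cmod (P p y) \<le> C * ((1 + norm p) * (1 + norm (y - fst p))) ^ m"
    using symbols_growth[OF P(1)] by metis
  define c where "c = pi powr (- real DIM('a) / 4)"
  have "(1 + norm y) ^ k * cmod (partials bs (coherent p) y)
      \<le> (C * (c * exp ((real (m + k))\<^sup>2 / 2))) * (1 + norm p) ^ (m + k)" for p y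
  proof -
    let ?t = "norm (y - fst p)"
    have "1 + norm y \<le> (1 + norm p) * (1 + ?t)"
    proof -
      have "norm y \<le> ?t + norm p"
        using norm_triangle_ineq[of "y - fst p" "fst p"] norm_fst_le[of "fst p" "snd p"] by simp
      moreover have "0 \<le> norm p * ?t" by simp
      moreover have "(1 + norm p) * (1 + ?t) = 1 + norm p + ?t + norm p * ?t" by algebra
      ultimately show ?thesis by linarith
    qed
    then have "(1 + norm y) ^ k \<le> ((1 + norm p) * (1 + ?t)) ^ k" by (intro power_mono) auto
    then have "(1 + norm y) ^ k * cmod (P p y) \<le> ((1 + norm p) * (1 + ?t)) ^ k * (C * ((1 + norm p) * (1 + ?t)) ^ m)"
      using C(2)[of p y] by (intro mult_mono) auto
    then have "(1 + norm y) ^ k * cmod (P p y) * cmod (coherent p y) \<le>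
        ((1 + norm p) * (1 + ?t)) ^ k * (C * ((1 + norm p) * (1 + ?t)) ^ m) * cmod (coherent p y)"
      by (intro mult_right_mono) auto
    also have "\<dots> = C * (c * ((1 + ?t) ^ (m + k) * exp (- ?t\<^sup>2 / 2))) * (1 + norm p) ^ (m + k)"
      unfolding cmod_coherent c_def by (simp add: power_mult_distrib power_add mult_ac)
    also have "\<dots> \<le> C * (c * exp ((real (m + k))\<^sup>2 / 2)) * (1 + norm p) ^ (m + k)"
      using C(1) by (intro mult_right_mono mult_left_mono poly_times_gaussian_le) (auto simp: c_def)
    finally show ?thesis by (simp add: P norm_mult mult_ac)
  qed
  moreover have "C * (c * exp ((real (m + k))\<^sup>2 / 2)) \<ge> 0" using C by (simp add: c_def)
  ultimately show ?thesis by blast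
qed

lemma norm_power_le: "norm y ^ k * a \<le> (1 + norm y) ^ k * a" if "a \<ge> (0::real)"
  using that by (intro mult_right_mono power_mono) auto

lemma coherent_schwartz: "coherent p \<in> schwartz"
proof (rule schwartzI[OF smooth_coherent])
  fix k and bs :: "'a list" assume "set bs \<subseteq> Basis"
  then obtain C m where "\<And>p y. (1 + norm y) ^ k * cmod (partials bs (coherent p) y) \<le> C * (1 + norm p) ^ m"
    using partials_coherent_decay[of bs k] by metis
  then have "norm y ^ k * cmod (partials bs (coherent p) y) \<le> C * (1 + norm p) ^ m" for y
    using norm_power_le[OF norm_ge_zero] order_trans by blast
  then show "\<exists>C. \<forall>y. norm y ^ k * cmod (partials bs (coherent p) y) \<le> C" by blast
qed

lemma sum_polynomial_growth:
  fixes f :: "'i \<Rightarrow> 'p::real_normed_vector \<Rightarrow> real"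
  assumes "finite I" "\<And>i. i \<in> I \<Longrightarrow> \<exists>C\<ge>0. \<exists>m. \<forall>p. f i p \<le> C * (1 + norm p) ^ m"
  shows "\<exists>C\<ge>0. \<exists>m. \<forall>p. (\<Sum>i\<in>I. f i p) \<le> C * (1 + norm p) ^ m"
  using assms
proof (induction I rule: finite_induct)
  case empty
  show ?case by (rule exI[of _ 0]) auto
next
  case (insert i I)
  obtain C m where C: "C \<ge> 0" "\<And>p. f i p \<le> C * (1 + norm p) ^ m" using insert by (metis insertI1)
  obtain D n where D: "D \<ge> 0" "\<And>p. (\<Sum>i\<in>I. f i p) \<le> D * (1 + norm p) ^ n" using insert by (metis insertI2)
  have "(\<Sum>i\<in>insert i I. f i p) \<le> (C + D) * (1 + norm p) ^ (max m n)" for p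
  proof -
    have "(\<Sum>i\<in>insert i I. f i p) \<le> C * (1 + norm p) ^ m + D * (1 + norm p) ^ n"
      using C(2)[of p] D(2)[of p] insert by simp
    also have "\<dots> \<le> C * (1 + norm p) ^ max m n + D * (1 + norm p) ^ max m n"
      using C(1) D(1) by (intro add_mono mult_left_mono power_increasing) auto
    finally show ?thesis by (simp add: algebra_simps)
  qed
  with C D show ?case by (intro exI[of _ "C + D"]) auto
qed

lemma coherent_schwartz_norm_growth:
  "\<exists>C\<ge>0. \<exists>m. \<forall>p::'a::euclidean_space \<times> 'a. schwartz_norm n (coherent p) \<le> C * (1 + norm p) ^ m"
  unfolding schwartz_norm_def
proof (intro sum_polynomial_growth finite_atMost finite_multiindices)
  fix k and bs :: "'a list" assume "bs \<in> {bs. set bs \<subseteq> Basis \<and> length bs \<le> n}"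
  then have bs: "set bs \<subseteq> Basis" by auto
  obtain C m where C: "C \<ge> 0" "\<And>p y. (1 + norm y) ^ k * cmod (partials bs (coherent p) y) \<le> C * (1 + norm p) ^ m"
    using partials_coherent_decay[OF bs, of k] by metis
  have "norm y ^ k * cmod (partials bs (coherent p) y) \<le> C * (1 + norm p) ^ m" for p :: "'a \<times> 'a" and y
    using norm_power_le[OF norm_ge_zero] C(2) order_trans by blast
  then have "schwartz_seminorm k bs (coherent p) \<le> C * (1 + norm p) ^ m" for p :: "'a \<times> 'a"
    by (rule schwartz_seminorm_le)
  with C(1) show "\<exists>C\<ge>0. \<exists>m. \<forall>p::'a \<times> 'a. schwartz_seminorm k bs (coherent p) \<le> C * (1 + norm p) ^ m" by blast
qed

text \<open>On a large ball the convergence is uniform by compactness. Outside of it one additional power of the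
weight makes both terms small, uniformly for q near p.\<close>
lemma coherent_seminorm_tendsto:
  fixes p :: "'a::euclidean_space \<times> 'a"
  assumes bs: "set bs \<subseteq> Basis"
  shows "((\<lambda>q. schwartz_seminorm k bs (\<lambda>y. coherent q y - coherent p y)) \<longlongrightarrow> 0) (at p)"
proof (rule tendstoI)
  fix e :: real assume e: "e > 0"
  obtain C m where C: "C \<ge> 0"
    "\<And>p y. (1 + norm y) ^ (k + 1) * cmod (partials bs (coherent p) y) \<le> C * (1 + norm p) ^ m"
    using partials_coherent_decay[OF bs, of "k + 1"] by metis
  define D where "D = C * (2 + norm p) ^ m"
  define R where "R = 4 * D / e"
  have D: "D \<ge> 0" using C by (simp add: D_def)
  let ?G = "\<lambda>z. (norm (snd z) ^ k) *\<^sub>R (partials bs (coherent (fst z)) (snd z))"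
  have "continuous_on UNIV ?G"
    using continuous_on_partials_coherent[OF bs] by (intro continuous_intros) (simp add: case_prod_unfold)
  then have "continuous_on (cball p 1 \<times> cball 0 R) ?G" by (rule continuous_on_subset) simp
  then have "uniformly_continuous_on (cball p 1 \<times> cball 0 R) ?G"
    by (rule compact_uniformly_continuous) (intro compact_Times compact_cball)
  from this[unfolded uniformly_continuous_on_def, THEN spec, THEN mp, OF half_gt_zero[OF e]]
  obtain d where d: "d > 0" and dd: "\<forall>z\<in>cball p 1 \<times> cball 0 R. \<forall>z'\<in>cball p 1 \<times> cball 0 R.
      dist z' z < d \<longrightarrow> dist (?G z') (?G z) < e / 2" by (elim exE conjE) (rule that)
  have "schwartz_seminorm k bs (\<lambda>y. coherent q y - coherent p y) < e" if q: "dist q p < min d 1" for q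
  proof -
    have "norm y ^ k * cmod (partials bs (\<lambda>y. coherent q y - coherent p y) y) \<le> e / 2" for y
    proof -
      have eq: "partials bs (\<lambda>y. coherent q y - coherent p y) y = partials bs (coherent q) y - partials bs (coherent p) y"
        using partials_add[OF smooth_coherent smooth_cmult[OF smooth_coherent], of bs q "-1" p]
          partials_cmult[OF smooth_coherent bs, of "-1" p] bs by simp
      show ?thesis
      proof (cases "norm y \<le> R")
        case True
        have "norm (?G (q, y) - ?G (p, y)) < e / 2"
          using dd[THEN bspec[of _ _ "(p, y)"], THEN bspec[of _ _ "(q, y)"]] True q
          by (simp add: dist_norm dist_Pair_Pair norm_minus_commute)
        then show ?thesis
          unfolding eq by (simp add: scaleR_diff_right[symmetric])
      next
        case False
        have tail: "norm y ^ k * cmod (partials bs (coherent z) y) \<le> e / 4" if z: "dist z p \<le> 1" for z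
        proof -
          have nz: "norm z \<le> 1 + norm p" using z norm_triangle_ineq[of "z - p" p] by (simp add: dist_norm)
          have "norm y * (norm y ^ k * cmod (partials bs (coherent z) y))
             \<le> (1 + norm y) ^ (k + 1) * cmod (partials bs (coherent z) y)"
            using norm_power_le[of "cmod (partials bs (coherent z) y)" y "k + 1"] by (simp add: mult_ac)
          also have "\<dots> \<le> C * (1 + norm z) ^ m" by (rule C)
          also have "\<dots> \<le> D" unfolding D_def using C nz by (intro mult_left_mono power_mono) auto
          finally have 1: "norm y * (norm y ^ k * cmod (partials bs (coherent z) y)) \<le> D" .
          have "norm y > 0" using False D e by (auto simp: R_def field_simps intro: le_less_trans)
          then have "norm y ^ k * cmod (partials bs (coherent z) y) \<le> D / norm y" using 1 by (simp add: field_simps)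
          also have "D / norm y \<le> e / 4"
            using False e \<open>norm y > 0\<close> by (auto simp: R_def field_simps)
          finally show ?thesis .
        qed
        have "norm y ^ k * cmod (partials bs (coherent q) y - partials bs (coherent p) y)
          \<le> norm y ^ k * (cmod (partials bs (coherent q) y) + cmod (partials bs (coherent p) y))"
          by (intro mult_left_mono norm_triangle_ineq4) auto
        also have "\<dots> \<le> e / 4 + e / 4" unfolding distrib_left using q by (intro add_mono tail) auto
        finally show ?thesis unfolding eq by simp
      qed
    qed
    then have "schwartz_seminorm k bs (\<lambda>y. coherent q y - coherent p y) \<le> e / 2" by (rule schwartz_seminorm_le)
    with e show ?thesis by simp
  qed
  moreover have "schwartz_seminorm k bs (\<lambda>y. coherent q y - coherent p y) \<ge> 0" for q
    by (intro schwartz_seminorm_nonneg schwartz_diff coherent_schwartz bs)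
  ultimately show "\<forall>\<^sub>F q in at p. dist (schwartz_seminorm k bs (\<lambda>y. coherent q y - coherent p y)) 0 < e"
    unfolding eventually_at using d by (intro exI[of _ "min d 1"]) (auto simp: abs_of_nonneg)
qed

lemma coherent_norm_tendsto:
  "((\<lambda>q. schwartz_norm n (\<lambda>y. coherent q y - coherent p y)) \<longlongrightarrow> 0) (at p)"
  unfolding schwartz_norm_def by (intro tendsto_null_sum coherent_seminorm_tendsto) auto

lemma schwartz_norm_zero: "schwartz_norm n (\<lambda>x::'a::euclidean_space. 0) = 0"
proof (rule antisym)
  show "schwartz_norm n (\<lambda>x::'a. 0) \<le> 0" using schwartz_norm_cmult[OF schwartz_zero, of n 0] by simp
qed (rule schwartz_norm_nonneg[OF schwartz_zero])

lemma continuous_coherent_norm_diff: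
  "continuous_on UNIV (\<lambda>(q, p). schwartz_norm n (\<lambda>y. coherent q y - coherent p y))"
proof (rule continuous_at_imp_continuous_on, safe)
  fix q p :: "'a \<times> 'a"
  let ?N = "\<lambda>q p. schwartz_norm n (\<lambda>y. coherent q y - coherent p y)"
  have tri: "\<bar>?N q' p' - ?N q p\<bar> \<le> ?N q' q + ?N p' p" for q' p' q p
    using schwartz_norm_diff_triangle[of "coherent q'" "coherent q" "coherent p'" n]
      schwartz_norm_diff_triangle[of "coherent q" "coherent p" "coherent p'" n]
      schwartz_norm_diff_triangle[of "coherent q" "coherent q'" "coherent p" n]
      schwartz_norm_diff_triangle[of "coherent q'" "coherent p'" "coherent p" n]
      schwartz_norm_commute[of "coherent q'" "coherent q" n] schwartz_norm_commute[of "coherent p'" "coherent p" n]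
    by (simp add: coherent_schwartz abs_le_iff)
  have cont: "isCont (\<lambda>q. ?N q p) p" for p
    using coherent_norm_tendsto[of n p] unfolding isCont_def by (simp add: schwartz_norm_zero)
  have "isCont (\<lambda>z. ?N (fst z) q) (q, p)"
    by (rule isCont_o2[of "(q, p)" fst "\<lambda>z. ?N z q"]) (use cont[of q] in \<open>auto intro!: continuous_intros\<close>)
  moreover have "isCont (\<lambda>z. ?N (snd z) p) (q, p)"
    by (rule isCont_o2[of "(q, p)" snd "\<lambda>z. ?N z p"]) (use cont[of p] in \<open>auto intro!: continuous_intros\<close>)
  ultimately have "isCont (\<lambda>z. ?N (fst z) q + ?N (snd z) p) (q, p)" by (rule isCont_add)
  moreover have "?N q q = 0" for q by (simp add: schwartz_norm_zero)
  ultimately have "((\<lambda>z. ?N (fst z) q + ?N (snd z) p) \<longlongrightarrow> 0) (at (q, p))"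
    by (simp add: isCont_def schwartz_norm_zero)
  then have "((\<lambda>z. ?N (fst z) (snd z) - ?N q p) \<longlongrightarrow> 0) (at (q, p))"
  proof (rule Lim_null_comparison[rotated], intro always_eventually allI)
    show "norm (?N (fst z) (snd z) - ?N q p) \<le> ?N (fst z) q + ?N (snd z) p" for z
      using tri[of "fst z" "snd z" q p] by simp
  qed
  then show "isCont (\<lambda>(q, p). ?N q p) (q, p)"
    unfolding isCont_def case_prod_unfold by (simp add: LIM_zero_iff)
qed

lemma continuous_tempered_coherent:
  fixes u :: "('a::euclidean_space \<Rightarrow> complex) \<Rightarrow> complex"
  assumes "u \<in> tempered"
  shows "continuous_on UNIV (\<lambda>p. u (coherent p))"
proof (rule continuous_at_imp_continuous_on, intro ballI)
  fix p :: "'a \<times> 'a"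
  obtain n C where C: "C \<ge> 0" "\<And>f. f \<in> schwartz \<Longrightarrow> cmod (u f) \<le> C * schwartz_norm n f"
    using tempered_bound[OF assms] by metis
  have "((\<lambda>q. C * schwartz_norm n (\<lambda>y. coherent q y - coherent p y)) \<longlongrightarrow> 0) (at p)"
    by (rule tendsto_mult_right_zero[OF coherent_norm_tendsto])
  then have "((\<lambda>q. u (coherent q) - u (coherent p)) \<longlongrightarrow> 0) (at p)"
  proof (rule Lim_null_comparison[rotated], intro always_eventually allI)
    fix q
    show "norm (u (coherent q) - u (coherent p)) \<le> C * schwartz_norm n (\<lambda>y. coherent q y - coherent p y)"
      using C(2)[OF schwartz_diff[OF coherent_schwartz coherent_schwartz], of q p]
      by (simp add: tempered_diff[OF assms coherent_schwartz coherent_schwartz])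
  qed
  then show "isCont (\<lambda>p. u (coherent p)) p" by (simp add: isCont_def LIM_zero_iff)
qed

lemma tempered_coherent_growth:
  fixes u :: "('a::euclidean_space \<Rightarrow> complex) \<Rightarrow> complex"
  assumes "u \<in> tempered"
  shows "\<exists>C\<ge>0. \<exists>m. \<forall>p. cmod (u (coherent p)) \<le> C * (1 + norm p) ^ m"
proof -
  obtain n C where C: "C \<ge> 0" "\<And>f. f \<in> schwartz \<Longrightarrow> cmod (u f) \<le> C * schwartz_norm n f"
    using tempered_bound[OF assms] by metis
  obtain D m where D: "D \<ge> 0" "\<And>p::'a \<times> 'a. schwartz_norm n (coherent p) \<le> D * (1 + norm p) ^ m"
    using coherent_schwartz_norm_growth by metis
  have "cmod (u (coherent p)) \<le> C * D * (1 + norm p) ^ m" for p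
    using order_trans[OF C(2)[OF coherent_schwartz, of p] mult_left_mono[OF D(2) C(1)]] by (simp add: mult.assoc)
  with C D show ?thesis by (intro exI[of _ "C * D"]) auto
qed

section \<open>Superpositions of coherent states\<close>

text \<open>Coefficients w for which the integral of w p times \<open>coherent p\<close> converges in the Schwartz space, because the
Schwartz norms of coherent states grow polynomially. The measure is arbitrary because two of them
occur below: Lebesgue measure on phase space, and Lebesgue measure on a fibre with fixed position.\<close>
definition rapid_moments :: "'p::euclidean_space measure \<Rightarrow> ('p \<Rightarrow> complex) \<Rightarrow> bool" where
  "rapid_moments M w \<longleftrightarrow> sets M = sets borel \<and> w \<in> borel_measurable borel \<and>
     (\<forall>m. integrable M (\<lambda>p. (1 + norm p) ^ m * cmod (w p)))"

lemma rapid_moments_integrable: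
  assumes w: "rapid_moments M w" and g: "g \<in> borel_measurable borel"
    and b: "\<And>p. cmod (g p) \<le> C * (1 + norm p) ^ m"
  shows "integrable M (\<lambda>p. w p * g p)"
proof (rule Bochner_Integration.integrable_bound)
  have [measurable_cong]: "sets M = sets borel" using w by (simp add: rapid_moments_def)
  have [measurable]: "w \<in> borel_measurable borel" using w by (simp add: rapid_moments_def)
  note [measurable] = g
  show "integrable M (\<lambda>p. C * ((1 + norm p) ^ m * cmod (w p)))"
    using w by (intro integrable_mult_right) (simp add: rapid_moments_def)
  show "(\<lambda>p. w p * g p) \<in> borel_measurable M" by measurable
  show "AE p in M. norm (w p * g p) \<le> norm (C * ((1 + norm p) ^ m * cmod (w p)))"
  proof (rule AE_I2)
    fix p
    have "norm (w p * g p) \<le> cmod (w p) * (C * (1 + norm p) ^ m)"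
      unfolding norm_mult by (intro mult_left_mono b) auto
    also have "\<dots> \<le> norm (C * ((1 + norm p) ^ m * cmod (w p)))"
      by (simp add: mult_ac abs_mult mult_right_mono)
    finally show "norm (w p * g p) \<le> norm (C * ((1 + norm p) ^ m * cmod (w p)))" .
  qed
qed

lemma coherent_borel_measurable:
  fixes y :: "'a::euclidean_space"
  assumes "set bs \<subseteq> Basis"
  shows "(\<lambda>p. partials bs (coherent p) y) \<in> borel_measurable borel"
proof -
  have "continuous_on UNIV (\<lambda>p::'a \<times> 'a. (p, y))" by (intro continuous_intros)
  from continuous_on_compose2[OF continuous_on_partials_coherent[OF assms] this]
  show ?thesis by (intro borel_measurable_continuous_onI) simp
qed

text \<open>This is used for simple functions \<sigma> that approximate the identity; then the left-hand side is
the error made when a superposition is replaced by a finite sum.\<close>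
lemma partials_superposition_diff:
  fixes M :: "('a::euclidean_space \<times> 'a) measure"
  assumes w: "rapid_moments M w" and \<sigma>: "\<sigma> \<in> borel_measurable borel"
    and \<sigma>_bound: "\<And>p. norm (\<sigma> p) \<le> 2 * norm p"
    and bs: "set bs \<subseteq> Basis"
  shows "partials bs (\<lambda>y. \<integral>p. w p * (coherent (\<sigma> p) y - coherent p y) \<partial>M)
      = (\<lambda>y. \<integral>p. w p * partials bs (\<lambda>y. coherent (\<sigma> p) y - coherent p y) y \<partial>M)"
proof -
  have [measurable_cong]: "sets M = sets borel" using w by (simp add: rapid_moments_def)
  have w'[measurable]: "w \<in> borel_measurable borel" using w by (simp add: rapid_moments_def)
  note [measurable] = \<sigma>
  have sm: "smooth (\<lambda>y. coherent (\<sigma> p) y - coherent p y)" for p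
    by (rule schwartz_smooth[OF schwartz_diff[OF coherent_schwartz coherent_schwartz]])
  have diff: "partials bs (\<lambda>y. coherent q y - coherent p y) = (\<lambda>y. partials bs (coherent q) y - partials bs (coherent p) y)"
    if bs: "set bs \<subseteq> Basis" for bs and p q :: "'a \<times> 'a"
    using partials_add[OF smooth_coherent smooth_cmult[OF smooth_coherent], of bs q "-1" p]
      partials_cmult[OF smooth_coherent bs, of "-1" p] bs by simp
  have eq: "partials bs (\<lambda>y. w p * (coherent (\<sigma> p) y - coherent p y)) =
      (\<lambda>y. w p * (partials bs (coherent (\<sigma> p)) y - partials bs (coherent p) y))" if "set bs \<subseteq> Basis" for bs p
    using partials_cmult[OF sm that, of "w p" p] diff[OF that] by simp
  have meas: "(\<lambda>p. partials bs (\<lambda>y. w p * (coherent (\<sigma> p) y - coherent p y)) y) \<in> borel_measurable M"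
    if bs: "set bs \<subseteq> Basis" for bs y
  proof -
    have [measurable]: "(\<lambda>p. partials bs (coherent p) y) \<in> borel_measurable borel"
      by (rule coherent_borel_measurable[OF bs])
    have [measurable]: "(\<lambda>p. partials bs (coherent (\<sigma> p)) y) \<in> borel_measurable borel"
      by (rule measurable_compose[OF \<sigma>]) simp
    show ?thesis unfolding eq[OF bs] by measurable
  qed
  have bound: "\<exists>K. integrable M K \<and> (\<forall>p y. cmod (partials bs (\<lambda>y. w p * (coherent (\<sigma> p) y - coherent p y)) y) \<le> K p)"
    if bs: "set bs \<subseteq> Basis" for bs
  proof -
    obtain C m where C: "C \<ge> 0" "\<And>p y. (1 + norm y) ^ 0 * cmod (partials bs (coherent p) y) \<le> C * (1 + norm p) ^ m"
      using partials_coherent_decay[OF bs, of 0] by metis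
    define K where "K p = 2 ^ m * 2 * C * ((1 + norm p) ^ m * cmod (w p))" for p
    have "integrable M K" unfolding K_def using w by (intro integrable_mult_right) (simp add: rapid_moments_def)
    moreover have "cmod (partials bs (\<lambda>y. w p * (coherent (\<sigma> p) y - coherent p y)) y) \<le> K p" for p y
    proof -
      have C2: "cmod (partials bs (coherent q) y) \<le> C * (2 * (1 + norm p)) ^ m" if "norm q \<le> 2 * norm p" for q
      proof -
        have "cmod (partials bs (coherent q) y) \<le> C * (1 + norm q) ^ m" using C(2)[of y q] by simp
        also have "\<dots> \<le> C * (2 * (1 + norm p)) ^ m" using that C by (intro mult_left_mono power_mono) auto
        finally show ?thesis .
      qed
      have "cmod (partials bs (coherent (\<sigma> p)) y - partials bs (coherent p) y)
        \<le> C * (2 * (1 + norm p)) ^ m + C * (2 * (1 + norm p)) ^ m"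
        by (rule order_trans[OF norm_triangle_ineq4 add_mono[OF C2 C2]]) (use \<sigma>_bound in auto)
      then have "cmod (w p) * cmod (partials bs (coherent (\<sigma> p)) y - partials bs (coherent p) y)
        \<le> cmod (w p) * (C * (2 * (1 + norm p)) ^ m + C * (2 * (1 + norm p)) ^ m)"
        by (rule mult_left_mono) simp
      also have "\<dots> = K p" unfolding K_def power_mult_distrib by (simp add: mult_ac)
      finally show ?thesis unfolding eq[OF bs] norm_mult .
    qed
    ultimately show ?thesis by blast
  qed
  have smo: "smooth (\<lambda>y. w p * (coherent (\<sigma> p) y - coherent p y))" for p by (rule smooth_cmult[OF sm])
  show ?thesis
    by (subst partials_integral[OF smo meas bound bs]) (simp_all add: partials_cmult[OF sm bs])
qed

lemma superposition_schwartz: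
  fixes M :: "('a::euclidean_space \<times> 'a) measure"
  assumes w: "rapid_moments M w"
  shows "(\<lambda>y. \<integral>p. w p * coherent p y \<partial>M) \<in> schwartz"
proof -
  have [measurable_cong]: "sets M = sets borel" using w by (simp add: rapid_moments_def)
  have w'[measurable]: "w \<in> borel_measurable borel" using w by (simp add: rapid_moments_def)
  have eq: "partials bs (\<lambda>y. w p * coherent p y) = (\<lambda>y. w p * partials bs (coherent p) y)"
    if "set bs \<subseteq> Basis" for bs p
    by (rule partials_cmult[OF smooth_coherent that])
  have meas: "(\<lambda>p. partials bs (\<lambda>y. w p * coherent p y) y) \<in> borel_measurable M"
    if bs: "set bs \<subseteq> Basis" for bs y
  proof -
    have [measurable]: "(\<lambda>p. partials bs (coherent p) y) \<in> borel_measurable borel"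
      by (rule coherent_borel_measurable[OF bs])
    show ?thesis unfolding eq[OF bs] by measurable
  qed
  have bound: "\<exists>K. integrable M K \<and> (\<forall>p y. (1 + norm y) ^ k * cmod (partials bs (\<lambda>y. w p * coherent p y) y) \<le> K p)"
    if bs: "set bs \<subseteq> Basis" for bs k
  proof -
    obtain C m where C: "C \<ge> 0" "\<And>p y. (1 + norm y) ^ k * cmod (partials bs (coherent p) y) \<le> C * (1 + norm p) ^ m"
      using partials_coherent_decay[OF bs, of k] by metis
    have "(1 + norm y) ^ k * cmod (partials bs (\<lambda>y. w p * coherent p y) y) \<le> C * ((1 + norm p) ^ m * cmod (w p))" for p y
      using mult_left_mono[OF C(2)[of y p] norm_ge_zero[of "w p"]] unfolding eq[OF bs] norm_mult by (simp add: mult_ac)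
    moreover have "integrable M (\<lambda>p. C * ((1 + norm p) ^ m * cmod (w p)))"
      using w by (intro integrable_mult_right) (simp add: rapid_moments_def)
    ultimately show ?thesis by (intro exI[of _ "\<lambda>p. C * ((1 + norm p) ^ m * cmod (w p))"]) simp
  qed
  have bound0: "\<exists>K. integrable M K \<and> (\<forall>p y. cmod (partials bs (\<lambda>y. w p * coherent p y) y) \<le> K p)"
    if bs: "set bs \<subseteq> Basis" for bs
    using bound[OF that, of 0] by simp
  have smo: "smooth (\<lambda>y. w p * coherent p y)" for p by (rule smooth_cmult[OF smooth_coherent])
  show ?thesis
  proof (rule schwartzI)
    show "smooth (\<lambda>y. \<integral>p. w p * coherent p y \<partial>M)" by (rule smooth_integral[OF smo meas bound0])
    fix k and bs :: "'a list" assume bs: "set bs \<subseteq> Basis"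
    obtain K where K: "integrable M K"
      "\<And>p y. (1 + norm y) ^ k * cmod (partials bs (\<lambda>y. w p * coherent p y) y) \<le> K p"
      using bound[OF bs, of k] by metis
    have "norm y ^ k * cmod (partials bs (\<lambda>y. \<integral>p. w p * coherent p y \<partial>M) y) \<le> (\<integral>p. K p \<partial>M)" for y
    proof -
      have P: "partials bs (\<lambda>y. \<integral>p. w p * coherent p y \<partial>M)
          = (\<lambda>y. \<integral>p. partials bs (\<lambda>y. w p * coherent p y) y \<partial>M)"
        by (subst partials_integral[OF smo meas bound0 bs]) simp_all
      have "norm y ^ k * cmod (partials bs (\<lambda>y. \<integral>p. w p * coherent p y \<partial>M) y)
        = norm (\<integral>p. of_real (norm y ^ k) * partials bs (\<lambda>y. w p * coherent p y) y \<partial>M)"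
        unfolding P by (simp add: norm_mult norm_power)
      also have "\<dots> \<le> (\<integral>p. K p \<partial>M)"
      proof (rule norm_integral_le[OF K(1)])
        fix p
        show "norm (of_real (norm y ^ k) * partials bs (\<lambda>y. w p * coherent p y) y) \<le> K p"
          using order_trans[OF norm_power_le[OF norm_ge_zero] K(2)[of y p]] by (simp add: norm_mult norm_power)
      qed
      finally show ?thesis .
    qed
    then show "\<exists>C. \<forall>y. norm y ^ k * cmod (partials bs (\<lambda>y. \<integral>p. w p * coherent p y \<partial>M) y) \<le> C" by blast
  qed
qed

text \<open>Replacing p by the values of simple functions that converge to the identity turns the integral into
finite sums, for which linearity of u suffices. The finite sums converge in every Schwartz norm by
dominated convergence, because p \<mapsto> \<open>coherent p\<close> is continuous into the Schwartz space.\<close>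
lemma tempered_superposition:
  fixes M :: "('a::euclidean_space \<times> 'a) measure" and u :: "('a \<Rightarrow> complex) \<Rightarrow> complex"
  assumes u: "u \<in> tempered" and w: "rapid_moments M w"
  shows "u (\<lambda>y. \<integral>p. w p * coherent p y \<partial>M) = (\<integral>p. w p * u (coherent p) \<partial>M)"
proof -
  have setsM[measurable_cong]: "sets M = sets borel" using w by (simp add: rapid_moments_def)
  have spaceM: "space M = UNIV" using sets_eq_imp_space_eq[OF setsM] by simp
  have w'[measurable]: "w \<in> borel_measurable borel" using w by (simp add: rapid_moments_def)
  let ?\<Psi> = "\<lambda>y. \<integral>p. w p * coherent p y \<partial>M"
  have "(\<lambda>p. p) \<in> borel_measurable M" by simp
  from borel_measurable_implies_sequence_metric[OF this, of 0] spaceM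
  obtain F :: "nat \<Rightarrow> 'a \<times> 'a \<Rightarrow> 'a \<times> 'a" where F: "\<And>i. simple_function M (F i)"
    "\<And>p. (\<lambda>i. F i p) \<longlonglongrightarrow> p" "\<And>i p. norm (F i p) \<le> 2 * norm p"
    by auto
  have Fm[measurable]: "F i \<in> borel_measurable borel" for i
    using borel_measurable_simple_function[OF F(1), of i] measurable_cong_sets[OF setsM refl] by blast
  obtain n C where C: "C \<ge> 0" "\<And>f. f \<in> schwartz \<Longrightarrow> cmod (u f) \<le> C * schwartz_norm n f"
    using tempered_bound[OF u] by metis
  have intw: "integrable M w"
    using rapid_moments_integrable[OF w, of "\<lambda>_. 1" 1 0] by simp
  define c where "c i q = (\<integral>p. w p * indicator (F i -` {q}) p \<partial>M)" for i q
  \<comment> \<open>an integral over p of a function of F i p is a finite sum over the values of F i\<close>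
  have simple: "(\<integral>p. w p * H (F i p) \<partial>M) = (\<Sum>q\<in>range (F i). c i q * H q)"
    for i and H :: "'a \<times> 'a \<Rightarrow> complex"
  proof -
    have fin: "finite (range (F i))" using F(1)[of i] spaceM by (simp add: simple_function_def)
    have vs: "F i -` {q} \<in> sets M" for q using simple_functionD(2)[OF F(1)[of i], of "{q}"] spaceM by simp
    have "w p * H (F i p) = (\<Sum>q\<in>range (F i). w p * indicator (F i -` {q}) p * H q)" for p
    proof -
      have "(\<Sum>q\<in>range (F i). w p * indicator (F i -` {q}) p * H q) = (\<Sum>q\<in>{F i p}. w p * indicator (F i -` {q}) p * H q)"
        using fin by (intro sum.mono_neutral_right) (auto simp: indicator_def)
      then show ?thesis by simp
    qed
    then have "(\<integral>p. w p * H (F i p) \<partial>M) = (\<integral>p. (\<Sum>q\<in>range (F i). w p * indicator (F i -` {q}) p * H q) \<partial>M)"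
      by simp
    also have "\<dots> = (\<Sum>q\<in>range (F i). \<integral>p. w p * indicator (F i -` {q}) p * H q \<partial>M)"
    proof (rule Bochner_Integration.integral_sum)
      fix q
      show "integrable M (\<lambda>p. w p * indicator (F i -` {q}) p * H q)"
      proof (rule integrable_mult_left)
        have "(\<lambda>p. w p * indicator (F i -` {q}) p) = (\<lambda>p. indicator (F i -` {q}) p *\<^sub>R w p)"
          by (auto split: split_indicator)
        then show "integrable M (\<lambda>p. w p * indicator (F i -` {q}) p)"
          using integrable_mult_indicator[OF vs intw, of q] by simp
      qed
    qed
    finally show ?thesis by (simp add: c_def)
  qed
  define \<Psi> where "\<Psi> i y = (\<Sum>q\<in>range (F i). c i q * coherent q y)" for i y
  have fin: "finite (range (F i))" for i using F(1)[of i] spaceM by (simp add: simple_function_def)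
  have \<Psi>_schwartz: "\<Psi> i \<in> schwartz" for i
    unfolding \<Psi>_def[abs_def] by (intro schwartz_sum fin schwartz_cmult coherent_schwartz)
  have u\<Psi>: "u (\<Psi> i) = (\<integral>p. w p * u (coherent (F i p)) \<partial>M)" for i
    unfolding simple[where H = "\<lambda>q. u (coherent q)"] \<Psi>_def[abs_def]
    by (subst tempered_sum[OF u fin]) (auto intro!: schwartz_cmult coherent_schwartz sum.cong tempered_cmult[OF u])
  have bdd: "\<exists>C m. \<forall>i p. norm (f (F i p)) \<le> C * (1 + norm p) ^ m"
    if "\<exists>C\<ge>0. \<exists>m. \<forall>p. norm (f p) \<le> C * (1 + norm p) ^ m" for f :: "'a \<times> 'a \<Rightarrow> 'c::real_normed_vector"
  proof -
    obtain C m where C: "C \<ge> 0" "\<And>p. norm (f p) \<le> C * (1 + norm p) ^ m" using \<open>\<exists>C\<ge>0. _\<close> by blast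
    have "norm (f (F i p)) \<le> (C * 2 ^ m) * (1 + norm p) ^ m" for i p
    proof -
      have "norm (f (F i p)) \<le> C * (1 + norm (F i p)) ^ m" by (rule C)
      also have "\<dots> \<le> C * (2 * (1 + norm p)) ^ m" using C F(3)[of i p] by (intro mult_left_mono power_mono) auto
      finally show ?thesis unfolding power_mult_distrib by (simp add: mult_ac)
    qed
    then show ?thesis by blast
  qed
  have ucont: "continuous_on UNIV (\<lambda>p. u (coherent p))" by (rule continuous_tempered_coherent[OF u])
  have um[measurable]: "(\<lambda>p. u (coherent p)) \<in> borel_measurable borel"
    by (rule borel_measurable_continuous_onI[OF ucont])
  have lim1: "(\<lambda>i. u (\<Psi> i)) \<longlonglongrightarrow> (\<integral>p. w p * u (coherent p) \<partial>M)"
  proof -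
    obtain C m where C: "\<And>i p. cmod (u (coherent (F i p))) \<le> C * (1 + norm p) ^ m"
      using bdd[OF tempered_coherent_growth[OF u]] by blast
    show ?thesis unfolding u\<Psi>
    proof (rule integral_dominated_convergence)
      show "(\<lambda>p. w p * u (coherent p)) \<in> borel_measurable M" by measurable
      show "(\<lambda>p. w p * u (coherent (F i p))) \<in> borel_measurable M" for i
        using measurable_compose[OF Fm um, of i] by measurable
      show "integrable M (\<lambda>p. C * ((1 + norm p) ^ m * cmod (w p)))"
        using w by (intro integrable_mult_right) (simp add: rapid_moments_def)
      show "AE p in M. (\<lambda>i. w p * u (coherent (F i p))) \<longlonglongrightarrow> w p * u (coherent p)"
        using continuous_on_tendsto_compose[OF ucont F(2)] by (intro AE_I2 tendsto_intros) auto
      show "AE p in M. norm (w p * u (coherent (F i p))) \<le> C * ((1 + norm p) ^ m * cmod (w p))" for i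
        using mult_left_mono[OF C norm_ge_zero] by (intro AE_I2) (simp add: norm_mult mult_ac)
    qed
  qed
  let ?N = "\<lambda>i p. schwartz_norm n (\<lambda>y. coherent (F i p) y - coherent p y)"
  define I where "I i = (\<integral>p. cmod (w p) * ?N i p \<partial>M)" for i
  define k where "k = real (n + 1) * real (card {bs::'a list. set bs \<subseteq> Basis \<and> length bs \<le> n})"
  obtain D m where D: "D \<ge> 0" "\<And>p::'a \<times> 'a. schwartz_norm n (coherent p) \<le> D * (1 + norm p) ^ m"
    using coherent_schwartz_norm_growth by metis
  have Nbound: "?N i p \<le> 2 * D * 2 ^ m * (1 + norm p) ^ m" for i p
  proof -
    have D2: "schwartz_norm n (coherent q) \<le> D * (2 * (1 + norm p)) ^ m" if "norm q \<le> 2 * norm p" for q :: "'a \<times> 'a"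
    proof -
      have "schwartz_norm n (coherent q) \<le> D * (1 + norm q) ^ m" by (rule D)
      also have "\<dots> \<le> D * (2 * (1 + norm p)) ^ m" using D that by (intro mult_left_mono power_mono) auto
      finally show ?thesis .
    qed
    have "?N i p \<le> schwartz_norm n (coherent (F i p)) + schwartz_norm n (coherent p)"
      by (intro schwartz_norm_minus coherent_schwartz)
    also have "\<dots> \<le> D * (2 * (1 + norm p)) ^ m + D * (2 * (1 + norm p)) ^ m"
      by (intro add_mono D2 F(3)) simp
    finally show ?thesis unfolding power_mult_distrib by (simp add: mult_ac)
  qed
  have Nnn: "0 \<le> ?N i p" for i p by (intro schwartz_norm_nonneg schwartz_diff coherent_schwartz)
  have Nm[measurable]: "?N i \<in> borel_measurable borel" for i
  proof -
    have "(\<lambda>(q, p). schwartz_norm n (\<lambda>y. coherent q y - coherent p y)) \<in> borel_measurable (borel :: (('a \<times> 'a) \<times> ('a \<times> 'a)) measure)"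
      by (rule borel_measurable_continuous_onI[OF continuous_coherent_norm_diff])
    from measurable_compose[OF borel_measurable_Pair[OF Fm measurable_ident_sets[OF refl]] this]
    show ?thesis by simp
  qed
  have wN: "cmod (w p) * ?N i p \<le> (2 * D * 2 ^ m) * ((1 + norm p) ^ m * cmod (w p))" for i p
    using mult_left_mono[OF Nbound[of i p] norm_ge_zero[of "w p"]] by (simp only: mult_ac)
  have intN: "integrable M (\<lambda>p. cmod (w p) * ?N i p)" for i
  proof (rule Bochner_Integration.integrable_bound)
    show "integrable M (\<lambda>p. (2 * D * 2 ^ m) * ((1 + norm p) ^ m * cmod (w p)))"
      using w by (intro integrable_mult_right) (simp add: rapid_moments_def)
    show "AE p in M. norm (cmod (w p) * ?N i p) \<le> norm ((2 * D * 2 ^ m) * ((1 + norm p) ^ m * cmod (w p)))"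
      by (intro AE_I2) (use wN Nnn in \<open>auto intro: order_trans[OF _ abs_ge_self] simp del: split_paired_All\<close>)
  qed measurable
  have "I \<longlonglongrightarrow> (\<integral>p. 0 \<partial>M)"
    unfolding I_def
  proof (rule integral_dominated_convergence)
    show "(\<lambda>p. cmod (w p) * ?N i p) \<in> borel_measurable M" for i by measurable
    show "integrable M (\<lambda>p. (2 * D * 2 ^ m) * ((1 + norm p) ^ m * cmod (w p)))"
      using w by (intro integrable_mult_right) (simp add: rapid_moments_def)
    show "AE p in M. norm (cmod (w p) * ?N i p) \<le> (2 * D * 2 ^ m) * ((1 + norm p) ^ m * cmod (w p))" for i
      by (intro AE_I2) (use wN Nnn in \<open>auto simp del: split_paired_All\<close>)
    show "AE p in M. (\<lambda>i. cmod (w p) * ?N i p) \<longlonglongrightarrow> 0"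
    proof (intro AE_I2)
      fix p
      have "(\<lambda>i. schwartz_norm n (\<lambda>y. coherent (F i p) y - coherent p y)) \<longlonglongrightarrow>
          schwartz_norm n (\<lambda>y. coherent p y - coherent p y)"
        using continuous_on_tendsto_compose[OF continuous_coherent_norm_diff tendsto_Pair[OF F(2)[of p] tendsto_const[of p]], of n]
        by simp
      then show "(\<lambda>i. cmod (w p) * ?N i p) \<longlonglongrightarrow> 0" by (intro tendsto_mult_right_zero) (simp add: schwartz_norm_zero)
    qed
  qed simp
  then have I0: "I \<longlonglongrightarrow> 0" by simp
  have dist: "cmod (u (\<Psi> i) - u ?\<Psi>) \<le> C * (k * I i)" for i
  proof -
    have d: "(\<lambda>y. \<Psi> i y - ?\<Psi> y) = (\<lambda>y. \<integral>p. w p * (coherent (F i p) y - coherent p y) \<partial>M)"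
    proof
      fix y :: 'a
      obtain C m where C: "C \<ge> 0" "\<And>p (y::'a). (1 + norm y) ^ 0 * cmod (partials [] (coherent p) y) \<le> C * (1 + norm p) ^ m"
        using partials_coherent_decay[of "[]" 0] by auto
      then have "cmod (coherent p y) \<le> C * (1 + norm p) ^ m" for p :: "'a \<times> 'a" using C(2)[of y p] by (simp add: partials_Nil)
      with C(1) have g: "\<exists>C\<ge>0. \<exists>m. \<forall>p::'a \<times> 'a. cmod (coherent p y) \<le> C * (1 + norm p) ^ m" by blast
      obtain C' m' where C': "\<And>i p. cmod (coherent (F i p) y) \<le> C' * (1 + norm p) ^ m'" using bdd[OF g] by blast
      obtain C m where C: "\<And>p. cmod (coherent p y) \<le> C * (1 + norm p) ^ m" using g by blast
      have cm: "(\<lambda>p. coherent p y) \<in> borel_measurable borel"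
        using coherent_borel_measurable[of "[]" y] by (simp add: partials_Nil)
      have "?\<Psi> y = (\<integral>p. w p * coherent p y \<partial>M)" by simp
      moreover have "\<Psi> i y = (\<integral>p. w p * coherent (F i p) y \<partial>M)"
        unfolding \<Psi>_def using simple[of "\<lambda>q. coherent q y" i] by simp
      ultimately have "\<Psi> i y - ?\<Psi> y = (\<integral>p. w p * coherent (F i p) y - w p * coherent p y \<partial>M)"
        using Bochner_Integration.integral_diff[OF
            rapid_moments_integrable[OF w measurable_compose[OF Fm cm] C', of i]
            rapid_moments_integrable[OF w cm C]] by simp
      then show "\<Psi> i y - ?\<Psi> y = (\<integral>p. w p * (coherent (F i p) y - coherent p y) \<partial>M)"
        by (simp add: right_diff_distrib)
    qed
    have "cmod (u (\<Psi> i) - u ?\<Psi>) = cmod (u (\<lambda>y. \<Psi> i y - ?\<Psi> y))"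
      using tempered_diff[OF u \<Psi>_schwartz superposition_schwartz[OF w]] by simp
    also have "\<dots> \<le> C * schwartz_norm n (\<lambda>y. \<Psi> i y - ?\<Psi> y)"
      by (rule C(2)[OF schwartz_diff[OF \<Psi>_schwartz superposition_schwartz[OF w]]])
    also have "schwartz_norm n (\<lambda>y. \<Psi> i y - ?\<Psi> y) \<le> k * I i"
      unfolding k_def
    proof (rule schwartz_norm_le)
      fix j y and bs :: "'a list" assume b: "j \<le> n" "set bs \<subseteq> Basis" "length bs \<le> n"
      have "norm y ^ j * cmod (partials bs (\<lambda>y. \<Psi> i y - ?\<Psi> y) y) =
        norm (\<integral>p. of_real (norm y ^ j) * (w p * partials bs (\<lambda>y. coherent (F i p) y - coherent p y) y) \<partial>M)"
        unfolding d partials_superposition_diff[OF w Fm F(3) b(2)] by (simp add: norm_mult norm_power)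
      also have "\<dots> \<le> I i"
        unfolding I_def
      proof (rule norm_integral_le[OF intN])
        fix p
        have "norm y ^ j * cmod (partials bs (\<lambda>y. coherent (F i p) y - coherent p y) y) \<le> ?N i p"
          using b by (intro schwartz_norm_bound schwartz_diff coherent_schwartz)
        from mult_left_mono[OF this norm_ge_zero[of "w p"]]
        show "norm (of_real (norm y ^ j) * (w p * partials bs (\<lambda>y. coherent (F i p) y - coherent p y) y))
          \<le> cmod (w p) * ?N i p"
          by (simp add: norm_mult norm_power mult_ac)
      qed
      finally show "norm y ^ j * cmod (partials bs (\<lambda>y. \<Psi> i y - ?\<Psi> y) y) \<le> I i" .
    qed
    finally show ?thesis using C(1) by (simp add: mult_left_mono)
  qed
  have "(\<lambda>i. C * (k * I i)) \<longlonglongrightarrow> 0" using I0 by (intro tendsto_mult_right_zero)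
  then have "(\<lambda>i. u (\<Psi> i) - u ?\<Psi>) \<longlonglongrightarrow> 0"
    by (rule Lim_null_comparison[rotated]) (use dist in auto)
  then have "(\<lambda>i. u (\<Psi> i)) \<longlonglongrightarrow> u ?\<Psi>" by (simp add: LIM_zero_iff)
  from LIMSEQ_unique[OF this lim1] show ?thesis .
qed

section \<open>Continuous operators on the Schwartz space\<close>

definition schwartz_operator ::
  "(('a::euclidean_space \<Rightarrow> complex) \<Rightarrow> ('a \<Rightarrow> complex)) \<Rightarrow> bool" where
  "schwartz_operator T \<longleftrightarrow> (\<forall>f\<in>schwartz. T f \<in> schwartz) \<and>
     (\<forall>n. \<exists>C\<ge>0. \<exists>m. \<forall>f\<in>schwartz. schwartz_norm n (T f) \<le> C * schwartz_norm m f)"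

lemma schwartz_norm_bound_sum:
  fixes g :: "'i \<Rightarrow> ('a::euclidean_space \<Rightarrow> complex) \<Rightarrow> 'p \<Rightarrow> real"
  assumes "finite I"
    and "\<And>i. i \<in> I \<Longrightarrow> \<exists>C\<ge>0. \<exists>m. \<forall>f\<in>schwartz. \<forall>p. g i f p \<le> C * schwartz_norm m f"
  shows "\<exists>C\<ge>0. \<exists>m. \<forall>f\<in>schwartz. \<forall>p. (\<Sum>i\<in>I. g i f p) \<le> C * schwartz_norm m f"
  using assms
proof (induction I rule: finite_induct)
  case empty
  show ?case by (intro exI[of _ "0::real"]) auto
next
  case (insert i I)
  obtain C m where C: "C \<ge> 0" "\<And>f p. f \<in> schwartz \<Longrightarrow> g i f p \<le> C * schwartz_norm m f"
    using insert by (metis insertI1)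
  obtain D n where D: "D \<ge> 0" "\<And>f p. f \<in> schwartz \<Longrightarrow> (\<Sum>i\<in>I. g i f p) \<le> D * schwartz_norm n f"
    using insert by (metis insertI2)
  have "(\<Sum>i\<in>insert i I. g i f p) \<le> (C + D) * schwartz_norm (max m n) f" if f: "f \<in> schwartz" for f p
  proof -
    have "(\<Sum>i\<in>insert i I. g i f p) \<le> C * schwartz_norm m f + D * schwartz_norm n f"
      using C(2)[OF f] D(2)[OF f] insert by (simp add: add_mono)
    also have "\<dots> \<le> C * schwartz_norm (max m n) f + D * schwartz_norm (max m n) f"
      using C(1) D(1) f by (intro add_mono mult_left_mono schwartz_norm_mono) auto
    finally show ?thesis by (simp add: algebra_simps)
  qed
  with C(1) D(1) show ?case by (intro exI[of _ "C + D"]) auto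
qed

lemma schwartz_operatorI:
  assumes "\<And>f. f \<in> schwartz \<Longrightarrow> smooth (T f)"
    and "\<And>k bs. set bs \<subseteq> Basis \<Longrightarrow>
      \<exists>C\<ge>0. \<exists>m. \<forall>f\<in>schwartz. \<forall>y. norm y ^ k * cmod (partials bs (T f) y) \<le> C * schwartz_norm m f"
  shows "schwartz_operator T"
  unfolding schwartz_operator_def
proof (intro conjI ballI allI)
  show S: "T f \<in> schwartz" if "f \<in> schwartz" for f
    using assms that by (intro schwartzI) blast+
  fix n
  show "\<exists>C\<ge>0. \<exists>m. \<forall>f\<in>schwartz. schwartz_norm n (T f) \<le> C * schwartz_norm m f"
  proof -
    let ?I = "{bs. set bs \<subseteq> (Basis::'a set) \<and> length bs \<le> n}"
    have "\<exists>C\<ge>0. \<exists>m. \<forall>f\<in>schwartz. \<forall>_::unit. schwartz_seminorm k bs (T f) \<le> C * schwartz_norm m f"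
      if "bs \<in> ?I" for k bs
    proof -
      have bs: "set bs \<subseteq> Basis" using that by auto
      obtain C m where C: "C \<ge> 0" "\<And>f y. f \<in> schwartz \<Longrightarrow>
          norm y ^ k * cmod (partials bs (T f) y) \<le> C * schwartz_norm m f"
        using assms(2)[OF bs, of k] by metis
      then show ?thesis
        by (intro exI[of _ C] conjI exI[of _ m] ballI allI schwartz_seminorm_le) auto
    qed
    then have "\<exists>C\<ge>0. \<exists>m. \<forall>f\<in>schwartz. \<forall>_::unit. (\<Sum>bs\<in>?I. schwartz_seminorm k bs (T f)) \<le> C * schwartz_norm m f" for k
      by (intro schwartz_norm_bound_sum[where g = "\<lambda>bs f _. schwartz_seminorm k bs (T f)"] finite_multiindices)
    then have "\<exists>C\<ge>0. \<exists>m. \<forall>f\<in>schwartz. \<forall>_::unit. (\<Sum>k\<le>n. \<Sum>bs\<in>?I. schwartz_seminorm k bs (T f)) \<le> C * schwartz_norm m f"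
      by (intro schwartz_norm_bound_sum[where g = "\<lambda>k f _. \<Sum>bs\<in>?I. schwartz_seminorm k bs (T f)"] finite_atMost)
    then show ?thesis by (simp add: schwartz_norm_def[of n])
  qed
qed

lemma schwartz_operator_closed: "schwartz_operator T \<Longrightarrow> f \<in> schwartz \<Longrightarrow> T f \<in> schwartz"
  by (simp add: schwartz_operator_def)

lemma schwartz_operator_partial:
  assumes b: "b \<in> Basis"
  shows "schwartz_operator (partial b)"
proof (rule schwartz_operatorI)
  show "smooth (partial b f)" if "f \<in> schwartz" for f
    using that b by (intro smooth_partial schwartz_smooth)
  fix k and bs :: "'a list" assume bs: "set bs \<subseteq> Basis"
  have "norm y ^ k * cmod (partials bs (partial b f) y) \<le> 1 * schwartz_norm (k + length bs + 1) f"
    if f: "f \<in> schwartz" for f y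
    using schwartz_norm_bound[OF f, of "bs @ [b]" k "k + length bs + 1" y] b bs
    by (simp add: partials_append partials_Cons partials_Nil)
  then show "\<exists>C\<ge>0. \<exists>m. \<forall>f\<in>schwartz. \<forall>y. norm y ^ k * cmod (partials bs (partial b f) y) \<le> C * schwartz_norm m f"
    by (intro exI[of _ "1::real"]) auto
qed

lemma partial_coordinate_mult:
  assumes "smooth f"
  shows "partial b (\<lambda>y. of_real (y \<bullet> e) * f y) = (\<lambda>y. of_real (b \<bullet> e) * f y + of_real (y \<bullet> e) * partial b f y)"
proof
  fix y
  show "partial b (\<lambda>y. of_real (y \<bullet> e) * f y) y = of_real (b \<bullet> e) * f y + of_real (y \<bullet> e) * partial b f y"
    using partial_mult[OF smooth_differentiable[OF smooth_coordinate] smooth_differentiable[OF assms]]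
    by (simp add: partial_coordinate)
qed

lemma schwartz_operator_coordinate:
  "schwartz_operator (\<lambda>f y. of_real (y \<bullet> e) * f y)"
proof (rule schwartz_operatorI)
  show "smooth (\<lambda>y. of_real (y \<bullet> e) * f y)" if "f \<in> schwartz" for f
    using that by (intro smooth_mult smooth_coordinate schwartz_smooth)
  fix k and bs :: "'a list" assume "set bs \<subseteq> Basis"
  then show "\<exists>C\<ge>0. \<exists>m. \<forall>f\<in>schwartz. \<forall>y.
    norm y ^ k * cmod (partials bs (\<lambda>y. of_real (y \<bullet> e) * f y) y) \<le> C * schwartz_norm m f"
  proof (induction bs rule: rev_induct)
    case Nil
    have "norm y ^ k * cmod (partials [] (\<lambda>y. of_real (y \<bullet> e) * f y) y) \<le> norm e * schwartz_norm (k + 1) f"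
      if f: "f \<in> schwartz" for f and y :: 'a
    proof -
      have "norm y ^ k * cmod (partials [] (\<lambda>y. of_real (y \<bullet> e) * f y) y)
        \<le> norm y ^ k * (norm y * norm e * cmod (f y))"
        unfolding partials_Nil norm_mult
        by (intro mult_left_mono mult_right_mono) (auto simp: Cauchy_Schwarz_ineq2)
      also have "\<dots> = norm e * (norm y ^ (k + 1) * cmod (partials [] f y))" by (simp add: partials_Nil)
      also have "\<dots> \<le> norm e * schwartz_norm (k + 1) f"
        by (intro mult_left_mono schwartz_norm_bound f) auto
      finally show ?thesis .
    qed
    then show ?case by (intro exI[of _ "norm e"] conjI exI[of _ "k + 1"]) auto
  next
    case (snoc b bs)
    then have b: "b \<in> Basis" and bs: "set bs \<subseteq> Basis" by auto
    obtain C m where C: "C \<ge> 0" "\<And>f y. f \<in> schwartz \<Longrightarrow>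
        norm y ^ k * cmod (partials bs (\<lambda>y. of_real (y \<bullet> e) * f y) y) \<le> C * schwartz_norm m f"
      using snoc bs by metis
    obtain D j where D: "D \<ge> 0" "\<And>f. f \<in> schwartz \<Longrightarrow> schwartz_norm m (partial b f) \<le> D * schwartz_norm j f"
      using schwartz_operator_partial[OF b] unfolding schwartz_operator_def by metis
    define l where "l = j + k + length bs"
    have "norm y ^ k * cmod (partials (bs @ [b]) (\<lambda>y. of_real (y \<bullet> e) * f y) y)
        \<le> (\<bar>b \<bullet> e\<bar> + C * D) * schwartz_norm l f" if f: "f \<in> schwartz" for f y
    proof -
      have pf: "partial b f \<in> schwartz" by (rule schwartz_operator_closed[OF schwartz_operator_partial[OF b] f])
      have "partials (bs @ [b]) (\<lambda>y. of_real (y \<bullet> e) * f y) y =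
          of_real (b \<bullet> e) * partials bs f y + partials bs (\<lambda>y. of_real (y \<bullet> e) * partial b f y) y"
        unfolding partials_append partials_Cons partials_Nil partial_coordinate_mult[OF schwartz_smooth[OF f]]
        using f pf bs by (simp add: partials_add partials_cmult smooth_cmult smooth_mult smooth_coordinate schwartz_smooth)
      then have "norm y ^ k * cmod (partials (bs @ [b]) (\<lambda>y. of_real (y \<bullet> e) * f y) y) \<le>
         norm y ^ k * (\<bar>b \<bullet> e\<bar> * cmod (partials bs f y) + cmod (partials bs (\<lambda>y. of_real (y \<bullet> e) * partial b f y) y))"
        by (auto intro!: mult_left_mono norm_triangle_le simp: norm_mult)
      also have "\<dots> \<le> \<bar>b \<bullet> e\<bar> * schwartz_norm l f + C * schwartz_norm m (partial b f)"
        unfolding distrib_left mult.left_commute[of "norm y ^ k"] using f bs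
        by (intro add_mono mult_left_mono C(2) pf schwartz_norm_bound) (auto simp: l_def)
      also have "C * schwartz_norm m (partial b f) \<le> C * (D * schwartz_norm l f)"
        using D C(1) schwartz_norm_mono[OF f, of j l]
        by (intro mult_left_mono order_trans[OF D(2)[OF f]]) (auto simp: l_def)
      finally show ?thesis by (simp add: algebra_simps)
    qed
    with C(1) D(1) show ?case by (intro exI[of _ "\<bar>b \<bullet> e\<bar> + C * D"]) auto
  qed
qed

lemma schwartz_operator_comp:
  assumes S: "schwartz_operator S" and T: "schwartz_operator T"
  shows "schwartz_operator (\<lambda>f. S (T f))"
  unfolding schwartz_operator_def
proof (intro conjI ballI allI)
  show "S (T f) \<in> schwartz" if "f \<in> schwartz" for f
    using that S T by (simp add: schwartz_operator_def)
  fix n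
  obtain C m where C: "C \<ge> 0" "\<And>f. f \<in> schwartz \<Longrightarrow> schwartz_norm n (S f) \<le> C * schwartz_norm m f"
    using S unfolding schwartz_operator_def by metis
  obtain D j where D: "D \<ge> 0" "\<And>f. f \<in> schwartz \<Longrightarrow> schwartz_norm m (T f) \<le> D * schwartz_norm j f"
    using T unfolding schwartz_operator_def by metis
  have "schwartz_norm n (S (T f)) \<le> (C * D) * schwartz_norm j f" if f: "f \<in> schwartz" for f
    using order_trans[OF C(2)[OF schwartz_operator_closed[OF T f]] mult_left_mono[OF D(2)[OF f] C(1)]]
    by (simp add: mult.assoc)
  with C D show "\<exists>C\<ge>0. \<exists>m. \<forall>f\<in>schwartz. schwartz_norm n (S (T f)) \<le> C * schwartz_norm m f"
    by (intro exI[of _ "C * D"]) auto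
qed

lemma schwartz_operator_diff:
  assumes S: "schwartz_operator S" and T: "schwartz_operator T"
  shows "schwartz_operator (\<lambda>f y. S f y - T f y)"
  unfolding schwartz_operator_def
proof (intro conjI ballI allI)
  show "(\<lambda>y. S f y - T f y) \<in> schwartz" if "f \<in> schwartz" for f
    using that S T by (simp add: schwartz_operator_def schwartz_diff)
  fix n
  obtain C m where C: "C \<ge> 0" "\<And>f. f \<in> schwartz \<Longrightarrow> schwartz_norm n (S f) \<le> C * schwartz_norm m f"
    using S unfolding schwartz_operator_def by metis
  obtain D j where D: "D \<ge> 0" "\<And>f. f \<in> schwartz \<Longrightarrow> schwartz_norm n (T f) \<le> D * schwartz_norm j f"
    using T unfolding schwartz_operator_def by metis
  have "schwartz_norm n (\<lambda>y. S f y - T f y) \<le> (C + D) * schwartz_norm (max m j) f" if f: "f \<in> schwartz" for f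
  proof -
    have "schwartz_norm n (\<lambda>y. S f y - T f y) \<le> C * schwartz_norm m f + D * schwartz_norm j f"
      using schwartz_norm_minus[OF schwartz_operator_closed[OF S f] schwartz_operator_closed[OF T f], of n] C(2)[OF f] D(2)[OF f]
      by simp
    also have "\<dots> \<le> C * schwartz_norm (max m j) f + D * schwartz_norm (max m j) f"
      using C(1) D(1) f by (intro add_mono mult_left_mono schwartz_norm_mono) auto
    finally show ?thesis by (simp add: algebra_simps)
  qed
  with C D show "\<exists>C\<ge>0. \<exists>m. \<forall>f\<in>schwartz. schwartz_norm n (\<lambda>y. S f y - T f y) \<le> C * schwartz_norm m f"
    by (intro exI[of _ "C + D"]) auto
qed

lemma schwartz_operator_id: "schwartz_operator (\<lambda>f. f)"
  unfolding schwartz_operator_def by (auto intro!: exI[of _ "1::real"])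

lemma schwartz_operator_funpow: "schwartz_operator T \<Longrightarrow> schwartz_operator (T ^^ n)"
proof (induction n)
  case 0
  then show ?case using schwartz_operator_id by (simp add: id_def)
next
  case (Suc n)
  then show ?case using schwartz_operator_comp[of T "T ^^ n"] by (simp add: o_def)
qed

section \<open>Integrals over Euclidean space\<close>

lemma
  fixes f :: "'a::euclidean_space \<Rightarrow> real \<Rightarrow> 'c::{real_normed_field,banach,second_countable_topology}"
  assumes int: "\<And>b. b \<in> Basis \<Longrightarrow> integrable lborel (f b)"
  shows integrable_lborel_prod: "integrable lborel (\<lambda>x::'a. \<Prod>b\<in>Basis. f b (x \<bullet> b))"
    and integral_lborel_prod: "(\<integral>x. (\<Prod>b\<in>Basis. f b (x \<bullet> b)) \<partial>(lborel :: 'a measure)) = (\<Prod>b\<in>Basis. \<integral>t. f b t \<partial>lborel)"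
proof -
  interpret product_sigma_finite "\<lambda>b::'a. lborel :: real measure" by standard
  have [measurable]: "\<And>b. b \<in> Basis \<Longrightarrow> f b \<in> borel_measurable borel"
    using int[THEN borel_measurable_integrable] by simp
  have m: "(\<lambda>g. \<Sum>b\<in>Basis. g b *\<^sub>R b) \<in> measurable (\<Pi>\<^sub>M b\<in>Basis. lborel) (borel :: 'a measure)"
    by measurable
  have m2: "(\<lambda>x::'a. \<Prod>b\<in>Basis. f b (x \<bullet> b)) \<in> borel_measurable borel"
    by (intro borel_measurable_prod measurable_compose[OF borel_measurable_inner[OF _ measurable_const]])
      (auto intro: \<open>\<And>b. b \<in> Basis \<Longrightarrow> f b \<in> borel_measurable borel\<close>)
  have eq: "(\<Prod>b\<in>Basis. f b ((\<Sum>c\<in>Basis. g c *\<^sub>R c) \<bullet> b)) = (\<Prod>b\<in>Basis. f b (g b))" for g :: "'a \<Rightarrow> real"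
    by (intro prod.cong) auto
  show "integrable lborel (\<lambda>x::'a. \<Prod>b\<in>Basis. f b (x \<bullet> b))"
    by (subst lborel_eq, subst integrable_distr_eq[OF m m2], unfold eq)
      (intro product_integrable_prod int finite_Basis)
  show "(\<integral>x. (\<Prod>b\<in>Basis. f b (x \<bullet> b)) \<partial>(lborel :: 'a measure)) = (\<Prod>b\<in>Basis. \<integral>t. f b t \<partial>lborel)"
    by (subst lborel_eq, subst integral_distr[OF m m2], unfold eq)
      (intro product_integral_prod int finite_Basis)
qed

lemma integrable_inverse_power_norm:
  "integrable lborel (\<lambda>x::'a::euclidean_space. 1 / (1 + norm x) ^ (2 * DIM('a)))"
proof (rule Bochner_Integration.integrable_bound)
  have "integrable lborel (\<lambda>t::real. inverse (1 + t\<^sup>2))"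
    using integrable_inverse_1_plus_square by (simp add: set_integrable_def einterval_eq)
  then show "integrable lborel (\<lambda>x::'a. \<Prod>b\<in>Basis. inverse (1 + (x \<bullet> b)\<^sup>2))"
    by (rule integrable_lborel_prod[of "\<lambda>b t. inverse (1 + t\<^sup>2)"])
  show "(\<lambda>x::'a. 1 / (1 + norm x) ^ (2 * DIM('a))) \<in> borel_measurable lborel" by simp
  show "AE x in (lborel :: 'a measure). norm (1 / (1 + norm x) ^ (2 * DIM('a))) \<le> norm (\<Prod>b\<in>Basis. inverse (1 + (x \<bullet> b)\<^sup>2))"
  proof (rule AE_I2)
    fix x :: 'a
    have le: "1 + (x \<bullet> b)\<^sup>2 \<le> (1 + norm x)\<^sup>2" if "b \<in> Basis" for b
    proof -
      have "(x \<bullet> b)\<^sup>2 \<le> (norm x)\<^sup>2" using Basis_le_norm[OF that, of x] by (simp add: abs_le_square_iff[symmetric])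
      moreover have "(1 + norm x)\<^sup>2 = 1 + 2 * norm x + (norm x)\<^sup>2" by (simp add: power2_sum)
      moreover have "0 \<le> norm x" by simp
      ultimately show ?thesis by linarith
    qed
    have "(\<Prod>b\<in>Basis. 1 + (x \<bullet> b)\<^sup>2) \<le> (\<Prod>b\<in>(Basis::'a set). (1 + norm x)\<^sup>2)"
      using le by (intro prod_mono) auto
    also have "\<dots> = (1 + norm x) ^ (2 * DIM('a))" by (simp add: power_mult)
    finally have *: "(\<Prod>b\<in>Basis. 1 + (x \<bullet> b)\<^sup>2) \<le> (1 + norm x) ^ (2 * DIM('a))" .
    have pos: "0 < (\<Prod>b\<in>Basis. 1 + (x \<bullet> b)\<^sup>2)" by (intro prod_pos) (auto simp: add_pos_nonneg)
    have inv: "(\<Prod>b\<in>Basis. inverse (1 + (x \<bullet> b)\<^sup>2)) = inverse (\<Prod>b\<in>Basis. 1 + (x \<bullet> b)\<^sup>2)"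
      using prod_inversef[of "\<lambda>b. 1 + (x \<bullet> b)\<^sup>2" Basis] by (simp add: o_def)
    have "norm (1 / (1 + norm x) ^ (2 * DIM('a))) \<le> 1 / (\<Prod>b\<in>Basis. 1 + (x \<bullet> b)\<^sup>2)"
      using * pos by (simp add: abs_of_nonneg frac_le)
    also have "\<dots> = norm (\<Prod>b\<in>Basis. inverse (1 + (x \<bullet> b)\<^sup>2))"
      unfolding inv using pos by (simp add: divide_inverse abs_of_pos)
    finally show "norm (1 / (1 + norm x) ^ (2 * DIM('a))) \<le> norm (\<Prod>b\<in>Basis. inverse (1 + (x \<bullet> b)\<^sup>2))" .
  qed
qed

lemma power_sum_le:
  fixes a :: "'i \<Rightarrow> real"
  assumes "finite I" "I \<noteq> {}" "\<And>i. i \<in> I \<Longrightarrow> a i \<ge> 0"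
  shows "(\<Sum>i\<in>I. a i) ^ k \<le> real (card I) ^ k * (\<Sum>i\<in>I. a i ^ k)"
proof -
  have "Max (a ` I) \<in> a ` I" using assms by (intro Max_in) auto
  then obtain j where "j \<in> I" "a j = Max (a ` I)" by force
  then have j: "j \<in> I" "\<And>i. i \<in> I \<Longrightarrow> a i \<le> a j" using assms(1) by auto
  have "(\<Sum>i\<in>I. a i) \<le> real (card I) * a j" using sum_bounded_above[of I a "a j"] j by simp
  then have "(\<Sum>i\<in>I. a i) ^ k \<le> (real (card I) * a j) ^ k" using assms by (intro power_mono sum_nonneg) auto
  also have "\<dots> = real (card I) ^ k * a j ^ k" by (simp add: power_mult_distrib)
  also have "a j ^ k \<le> (\<Sum>i\<in>I. a i ^ k)" using assms j by (intro member_le_sum) auto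
  finally show ?thesis by (simp add: mult_left_mono)
qed

lemma schwartz_decay_norm:
  assumes "f \<in> schwartz" "set bs \<subseteq> Basis"
  shows "(1 + norm y) ^ k * cmod (partials bs f y) \<le> 2 ^ k * (2 * schwartz_norm (k + length bs) f)"
proof -
  have "(1 + norm y) ^ k \<le> 2 ^ k * (1 + norm y ^ k)"
    using power_sum_le[of "{False, True}" "\<lambda>i. if i then norm y else 1" k] by simp
  then have "(1 + norm y) ^ k * cmod (partials bs f y) \<le> 2 ^ k * (1 + norm y ^ k) * cmod (partials bs f y)"
    by (rule mult_right_mono) simp
  also have "\<dots> = 2 ^ k * (norm y ^ 0 * cmod (partials bs f y) + norm y ^ k * cmod (partials bs f y))"
    by (simp add: algebra_simps)
  also have "\<dots> \<le> 2 ^ k * (schwartz_norm (k + length bs) f + schwartz_norm (k + length bs) f)"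
    using assms by (intro mult_left_mono add_mono schwartz_norm_bound) auto
  finally show ?thesis by simp
qed

lemma schwartz_decay:
  assumes "f \<in> schwartz" "set bs \<subseteq> Basis"
  shows "\<exists>C\<ge>0. \<forall>y. (1 + norm y) ^ k * cmod (partials bs f y) \<le> C"
  using schwartz_decay_norm[OF assms] schwartz_norm_nonneg[OF assms(1)]
  by (intro exI[of _ "2 ^ k * (2 * schwartz_norm (k + length bs) f)"]) auto

lemma schwartz_measurable: "f \<in> schwartz \<Longrightarrow> f \<in> borel_measurable borel"
  by (intro borel_measurable_continuous_onI smooth_continuous schwartz_smooth)

lemma integrable_fast_decay:
  fixes f :: "'a::euclidean_space \<Rightarrow> 'b::{banach,second_countable_topology}"
  assumes "f \<in> borel_measurable borel"
    and "\<And>y. (1 + norm y) ^ (2 * DIM('a)) * norm (f y) \<le> C"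
  shows "integrable lborel f"
proof (rule Bochner_Integration.integrable_bound)
  show "integrable lborel (\<lambda>y::'a. C * (1 / (1 + norm y) ^ (2 * DIM('a))))"
    by (intro integrable_mult_right integrable_inverse_power_norm)
  show "AE y in lborel. norm (f y) \<le> norm (C * (1 / (1 + norm y) ^ (2 * DIM('a))))"
  proof (rule AE_I2)
    fix y :: 'a
    have "0 < (1 + norm y) ^ (2 * DIM('a))" by (simp add: add_pos_nonneg)
    then have "norm (f y) \<le> C * (1 / (1 + norm y) ^ (2 * DIM('a)))"
      using assms(2)[of y] by (simp add: field_simps)
    then show "norm (f y) \<le> norm (C * (1 / (1 + norm y) ^ (2 * DIM('a))))"
      by (rule order_trans) (simp only: real_norm_def abs_ge_self)
  qed
qed (use assms in simp)

lemma rapid_moments_lborel: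
  fixes f :: "'a::euclidean_space \<Rightarrow> complex"
  assumes "f \<in> borel_measurable borel" and "\<And>k. \<exists>C. \<forall>y. (1 + norm y) ^ k * cmod (f y) \<le> C"
  shows "rapid_moments lborel f"
  unfolding rapid_moments_def
proof (intro conjI allI assms(1) sets_lborel)
  fix m
  obtain C where C: "\<And>y. (1 + norm y) ^ (2 * DIM('a) + m) * cmod (f y) \<le> C" using assms(2) by blast
  show "integrable lborel (\<lambda>p. (1 + norm p) ^ m * cmod (f p))"
    using C assms(1) by (intro integrable_fast_decay[of _ C]) (auto simp: power_add mult_ac)
qed

lemma schwartz_rapid_moments: "f \<in> schwartz \<Longrightarrow> rapid_moments lborel f"
  using schwartz_decay[of f "[]"]
  by (intro rapid_moments_lborel schwartz_measurable) (auto simp: partials_Nil)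

lemma schwartz_integrable_mult:
  assumes "f \<in> schwartz" "g \<in> borel_measurable borel" "\<And>p. cmod (g p) \<le> C * (1 + norm p) ^ m"
  shows "integrable lborel (\<lambda>p. f p * g p)"
  by (rule rapid_moments_integrable[OF schwartz_rapid_moments[OF assms(1)] assms(2,3)])

text \<open>By translation invariance the integral of g (y + s) does not depend on s. Differentiating it at
s = 0 under the integral sign gives the claim.\<close>
lemma integral_derivative_zero:
  fixes g :: "'a::euclidean_space \<Rightarrow> complex"
  assumes der: "\<And>y. g differentiable at y" and meas: "\<And>b. b \<in> Basis \<Longrightarrow> partial b g \<in> borel_measurable borel"
    and g: "\<And>y. (1 + norm y) ^ (2 * DIM('a)) * cmod (g y) \<le> C"
    and g': "\<And>b y. b \<in> Basis \<Longrightarrow> (1 + norm y) ^ (2 * DIM('a)) * cmod (partial b g y) \<le> C"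
    and b: "b \<in> Basis"
  shows "(\<integral>y. partial b g y \<partial>lborel) = 0"
proof -
  let ?n = "2 * DIM('a)"
  have gm[measurable]: "g \<in> borel_measurable borel"
    using der by (intro borel_measurable_continuous_onI)
      (simp add: differentiable_imp_continuous_within continuous_at_imp_continuous_on)
  have gi: "integrable lborel g" by (rule integrable_fast_decay[OF gm g])
  have shift: "lborel = distr lborel borel (\<lambda>y::'a. s + y)" for s
    by (rule lborel_distr_plus[symmetric])
  have sm: "(\<lambda>y::'a. s + y) \<in> measurable lborel borel" for s by simp
  have const: "(\<integral>y. g (y + s) \<partial>lborel) = (\<integral>y. g y \<partial>lborel)" for s
    by (subst (2) shift[of s], subst integral_distr[OF sm gm]) (simp add: add.commute)
  have gs: "integrable lborel (\<lambda>y. g (y + s))" for s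
    using gi by (subst (asm) shift[of s], subst (asm) integrable_distr_eq[OF sm gm]) (simp add: add.commute)
  define K where "K y = real DIM('a) * (2 ^ ?n * C) * (1 / (1 + norm y) ^ ?n)" for y :: 'a
  have "((\<lambda>s. \<integral>y. g (y + s) \<partial>lborel) has_derivative
      (\<lambda>h. \<integral>y. (\<Sum>b\<in>Basis. (h \<bullet> b) *\<^sub>R partial b g (y + 0)) \<partial>lborel)) (at 0)"
  proof (rule has_derivative_integral_lebesgue[where r = 1 and K = K])
    show "((\<lambda>s. g (y + s)) has_derivative (\<lambda>h. \<Sum>b\<in>Basis. (h \<bullet> b) *\<^sub>R partial b g (y + s))) (at s)" for y s
      using has_derivative_partials[OF der, of "y + s"]
      by (intro has_derivative_compose[of "\<lambda>s. y + s" "\<lambda>h. h" s UNIV g, simplified]) (auto intro!: derivative_eq_intros)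
    show "norm (\<Sum>b\<in>Basis. (h \<bullet> b) *\<^sub>R partial b g (y + s)) \<le> K y * norm h" if s: "dist 0 s < 1" for y s h
    proof -
      have "norm (\<Sum>b\<in>Basis. (h \<bullet> b) *\<^sub>R partial b g (y + s)) \<le> (\<Sum>b\<in>(Basis::'a set). norm h * (2 ^ ?n * C * (1 / (1 + norm y) ^ ?n)))"
      proof (rule sum_norm_le)
        fix b :: 'a assume b: "b \<in> Basis"
        have pos: "0 < (1 + norm y) ^ ?n" by (simp add: add_pos_nonneg)
        have "1 + norm y \<le> 2 * (1 + norm (y + s))"
        proof -
          have "norm s < 1" using s by simp
          then have "norm y \<le> norm (y + s) + 1" using norm_triangle_ineq4[of "y + s" s] by simp
          also have "\<dots> \<le> 2 * norm (y + s) + 1" by simp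
          finally show "1 + norm y \<le> 2 * (1 + norm (y + s))" by simp
        qed
        then have "(1 + norm y) ^ ?n \<le> (2 * (1 + norm (y + s))) ^ ?n" by (intro power_mono) auto
        then have "(1 + norm y) ^ ?n * cmod (partial b g (y + s)) \<le> (2 * (1 + norm (y + s))) ^ ?n * cmod (partial b g (y + s))"
          by (rule mult_right_mono) simp
        also have "\<dots> = 2 ^ ?n * ((1 + norm (y + s)) ^ ?n * cmod (partial b g (y + s)))"
          unfolding power_mult_distrib by (simp only: mult.assoc)
        also have "\<dots> \<le> 2 ^ ?n * C" by (intro mult_left_mono g'[OF b]) simp
        finally have *: "cmod (partial b g (y + s)) \<le> 2 ^ ?n * C * (1 / (1 + norm y) ^ ?n)"
          using pos by (simp add: field_simps)
        show "norm ((h \<bullet> b) *\<^sub>R partial b g (y + s)) \<le> norm h * (2 ^ ?n * C * (1 / (1 + norm y) ^ ?n))"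
          unfolding norm_scaleR using Basis_le_norm[OF b, of h] * by (intro mult_mono) auto
      qed
      then show ?thesis by (simp add: K_def mult_ac)
    qed
    show "integrable lborel K" unfolding K_def by (intro integrable_mult_right integrable_inverse_power_norm)
    show "(\<lambda>y. \<Sum>b\<in>Basis. (h \<bullet> b) *\<^sub>R partial b g (y + 0)) \<in> borel_measurable lborel" for h
      using meas by (intro borel_measurable_sum borel_measurable_scaleR) auto
  qed (use gs in auto)
  moreover have "((\<lambda>s. \<integral>y. g (y + s) \<partial>lborel) has_derivative (\<lambda>h. 0)) (at 0)"
    unfolding const by simp
  ultimately have "(\<lambda>h. \<integral>y. (\<Sum>b\<in>Basis. (h \<bullet> b) *\<^sub>R partial b g (y + 0)) \<partial>lborel) = (\<lambda>h. 0)"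
    by (rule has_derivative_unique)
  from fun_cong[OF this, of b] show ?thesis
    using b by (simp add: inner_Basis if_distrib[of "\<lambda>t. t *\<^sub>R _"] cong: if_cong)
qed

lemma integral_by_parts:
  fixes f e :: "'a::euclidean_space \<Rightarrow> complex"
  assumes f: "f \<in> schwartz" and e: "smooth e"
    and bound: "\<And>y. cmod (e y) \<le> C" "\<And>b y. b \<in> Basis \<Longrightarrow> cmod (partial b e y) \<le> C"
    and b: "b \<in> Basis"
  shows "(\<integral>y. partial b f y * e y \<partial>lborel) = - (\<integral>y. f y * partial b e y \<partial>lborel)"
proof -
  let ?n = "2 * DIM('a)"
  have C: "C \<ge> 0" using bound(1)[of 0] norm_ge_zero order_trans by blast
  have "\<exists>D\<ge>0. \<forall>y. (1 + norm y) ^ ?n * cmod (partials bs f y) \<le> D" if "set bs \<subseteq> Basis" for bs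
    by (rule schwartz_decay[OF f that])
  from this[of "[]"] obtain D0 where D0: "D0 \<ge> 0" "\<And>y. (1 + norm y) ^ ?n * cmod (f y) \<le> D0" by (auto simp: partials_Nil)
  have "\<exists>D. \<forall>b\<in>Basis. D b \<ge> 0 \<and> (\<forall>y. (1 + norm y) ^ ?n * cmod (partial b f y) \<le> D b)"
    using schwartz_decay[OF f, of "[_]" ?n] by (intro bchoice) (auto simp: partials_Cons partials_Nil)
  then obtain D where D: "\<And>b. b \<in> Basis \<Longrightarrow> D b \<ge> 0"
    "\<And>b y. b \<in> Basis \<Longrightarrow> (1 + norm y) ^ ?n * cmod (partial b f y) \<le> D b" by blast
  define E where "E = D0 + (\<Sum>b\<in>Basis. D b)"
  have E: "(1 + norm y) ^ ?n * cmod (f y) \<le> E" for y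
    using D0(2)[of y] sum_nonneg[of Basis D] D(1) by (simp add: E_def)
  have E': "(1 + norm y) ^ ?n * cmod (partial b f y) \<le> E" if "b \<in> Basis" for y b
    using D(2)[OF that, of y] member_le_sum[of b Basis D] D(1) D0(1) that by (simp add: E_def)
  have E0: "E \<ge> 0" using D0 D sum_nonneg[of Basis D] by (simp add: E_def)
  have fd: "f differentiable at y" and ed: "e differentiable at y" for y
    using f e by (auto intro: smooth_differentiable schwartz_smooth)
  have pm: "partial b (\<lambda>y. f y * e y) = (\<lambda>y. partial b f y * e y + f y * partial b e y)" for b
    by (rule ext) (rule partial_mult[OF fd ed])
  have mul: "(1 + norm y) ^ ?n * cmod (g y * h y) \<le> E * C"
    if "(1 + norm y) ^ ?n * cmod (g y) \<le> E" "cmod (h y) \<le> C" for g h and y :: 'a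
    using mult_mono[OF that] E0 by (simp add: norm_mult mult_ac)
  have em: "e \<in> borel_measurable borel" "b \<in> Basis \<Longrightarrow> partial b e \<in> borel_measurable borel" for b
    using e by (auto intro!: borel_measurable_continuous_onI smooth_continuous smooth_partial)
  have fm: "f \<in> borel_measurable borel" "b \<in> Basis \<Longrightarrow> partial b f \<in> borel_measurable borel" for b
    using f by (auto intro!: schwartz_measurable schwartz_operator_closed[OF schwartz_operator_partial])
  have "(\<integral>y. partial b (\<lambda>y. f y * e y) y \<partial>lborel) = 0"
  proof (rule integral_derivative_zero[where C = "E * C + E * C"])
    show "(\<lambda>y. f y * e y) differentiable at y" for y by (intro differentiable_mult fd ed)
    show "partial b (\<lambda>y. f y * e y) \<in> borel_measurable borel" if "b \<in> Basis" for b
      unfolding pm using em fm that by (intro borel_measurable_add borel_measurable_times) auto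
    show "(1 + norm y) ^ ?n * cmod (f y * e y) \<le> E * C + E * C" for y
      using mul[of y f e, OF E bound(1)] mult_nonneg_nonneg[OF E0 C] by linarith
    show "(1 + norm y) ^ ?n * cmod (partial b (\<lambda>y. f y * e y) y) \<le> E * C + E * C" if "b \<in> Basis" for b y
    proof -
      have "(1 + norm y) ^ ?n * cmod (partial b (\<lambda>y. f y * e y) y)
        \<le> (1 + norm y) ^ ?n * (cmod (partial b f y * e y) + cmod (f y * partial b e y))"
        unfolding pm by (intro mult_left_mono norm_triangle_ineq) auto
      also have "\<dots> \<le> E * C + E * C"
        unfolding distrib_left
        using mul[of y "partial b f" e, OF E'[OF that] bound(1)] mul[of y f "partial b e", OF E bound(2)[OF that]]
        by (rule add_mono)
      finally show ?thesis .
    qed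
  qed (rule b)
  moreover have "integrable lborel (\<lambda>y. partial b f y * e y)"
    using mul[of _ "partial b f" e, OF E'[OF b] bound(1)] em fm b
    by (intro integrable_fast_decay[of _ "E * C"] borel_measurable_times) auto
  moreover have "integrable lborel (\<lambda>y. f y * partial b e y)"
    using mul[of _ f "partial b e", OF E bound(2)[OF b]] em fm b
    by (intro integrable_fast_decay[of _ "E * C"] borel_measurable_times) auto
  ultimately show ?thesis unfolding pm by (simp add: eq_neg_iff_add_eq_0)
qed

lemma integral_gaussian_1D:
  "(\<integral>t. of_real (exp (- t\<^sup>2 / 2)) * exp (\<i> * of_real (c * t)) \<partial>lborel) = of_real (sqrt (2 * pi) * exp (- c\<^sup>2 / 2))"
  and integrable_gaussian_1D:
  "integrable lborel (\<lambda>t. of_real (exp (- t\<^sup>2 / 2)) * exp (\<i> * of_real (c * t)))"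
proof -
  have "char std_normal_distribution c = (\<integral>t. of_real (std_normal_density t) * exp (\<i> * of_real (c * t)) \<partial>lborel)"
    unfolding char_def by (subst integral_density) (auto simp: scaleR_conv_of_real)
  then have eq: "(\<integral>t. of_real (std_normal_density t) * exp (\<i> * of_real (c * t)) \<partial>lborel) = of_real (exp (- c\<^sup>2 / 2))"
    by (simp add: char_std_normal_distribution)
  have d: "exp (- t\<^sup>2 / 2) = sqrt (2 * pi) * std_normal_density t" for t
    by (simp add: std_normal_density_def)
  have s: "of_real (exp (- t\<^sup>2 / 2)) * exp (\<i> * of_real (c * t)) =
      of_real (sqrt (2 * pi)) * (of_real (std_normal_density t) * exp (\<i> * of_real (c * t)))" for t
    unfolding d by (simp add: mult.assoc)
  show "(\<integral>t. of_real (exp (- t\<^sup>2 / 2)) * exp (\<i> * of_real (c * t)) \<partial>lborel) = of_real (sqrt (2 * pi) * exp (- c\<^sup>2 / 2))"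
    unfolding s integral_mult_right_zero eq by simp
  show "integrable lborel (\<lambda>t. of_real (exp (- t\<^sup>2 / 2)) * exp (\<i> * of_real (c * t)))"
  proof (rule Bochner_Integration.integrable_bound)
    show "integrable lborel (\<lambda>t::real. sqrt (2 * pi) * std_normal_density t)"
      by (intro integrable_mult_right integrable_normal_density) simp
    show "AE t in lborel. norm (of_real (exp (- t\<^sup>2 / 2)) * exp (\<i> * of_real (c * t))) \<le> norm (sqrt (2 * pi) * std_normal_density t)"
      unfolding d[symmetric] by (intro AE_I2) (simp add: norm_mult)
  qed simp
qed

lemma
  fixes c :: "'a::euclidean_space"
  shows integral_gaussian: "(\<integral>t. of_real (exp (- (norm t)\<^sup>2 / 2)) * exp (\<i> * of_real (c \<bullet> t)) \<partial>lborel)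
     = of_real ((2 * pi) powr (real DIM('a) / 2) * exp (- (norm c)\<^sup>2 / 2))"
    and integrable_gaussian: "integrable lborel (\<lambda>t. of_real (exp (- (norm t)\<^sup>2 / 2)) * exp (\<i> * of_real (c \<bullet> t)))"
proof -
  have eq: "of_real (exp (- (norm t)\<^sup>2 / 2)) * exp (\<i> * of_real (c \<bullet> t)) =
      (\<Prod>b\<in>Basis. complex_of_real (exp (- (t \<bullet> b)\<^sup>2 / 2)) * exp (\<i> * of_real ((c \<bullet> b) * (t \<bullet> b))))" for t
  proof -
    have "exp (- (norm t)\<^sup>2 / 2) = (\<Prod>b\<in>Basis. exp (- (t \<bullet> b)\<^sup>2 / 2))"
      unfolding power2_norm_eq_inner euclidean_inner[of t t]
      by (simp add: exp_sum[symmetric] sum_negf[symmetric] sum_divide_distrib power2_eq_square)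
    moreover have "exp (\<i> * of_real (c \<bullet> t)) = (\<Prod>b\<in>Basis. exp (\<i> * of_real ((c \<bullet> b) * (t \<bullet> b))))"
      unfolding euclidean_inner[of c t] by (simp add: exp_sum[symmetric] sum_distrib_left)
    ultimately show ?thesis by (simp add: prod.distrib)
  qed
  have "(\<integral>t. of_real (exp (- (norm t)\<^sup>2 / 2)) * exp (\<i> * of_real (c \<bullet> t)) \<partial>lborel) =
     (\<Prod>b\<in>(Basis::'a set). of_real (sqrt (2 * pi) * exp (- (c \<bullet> b)\<^sup>2 / 2)))"
    unfolding eq
    by (subst integral_lborel_prod[of "\<lambda>b s. complex_of_real (exp (- s\<^sup>2 / 2)) * exp (\<i> * of_real ((c \<bullet> b) * s))"])
      (simp_all only: integral_gaussian_1D integrable_gaussian_1D)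
  also have "\<dots> = of_real (sqrt (2 * pi) ^ DIM('a) * exp (- (norm c)\<^sup>2 / 2))"
    unfolding power2_norm_eq_inner euclidean_inner[of c c]
    by (simp add: prod.distrib exp_sum[symmetric] sum_negf[symmetric] sum_divide_distrib power2_eq_square flip: of_real_prod)
  also have "sqrt (2 * pi) ^ DIM('a) = (2 * pi) powr (real DIM('a) / 2)"
    by (simp add: powr_half_sqrt[symmetric] powr_powr flip: powr_realpow)
  finally show "(\<integral>t. of_real (exp (- (norm t)\<^sup>2 / 2)) * exp (\<i> * of_real (c \<bullet> t)) \<partial>lborel)
     = of_real ((2 * pi) powr (real DIM('a) / 2) * exp (- (norm c)\<^sup>2 / 2))" .
  show "integrable lborel (\<lambda>t. of_real (exp (- (norm t)\<^sup>2 / 2)) * exp (\<i> * of_real (c \<bullet> t)))"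
    unfolding eq
    by (rule integrable_lborel_prod[of "\<lambda>b s. complex_of_real (exp (- s\<^sup>2 / 2)) * exp (\<i> * of_real ((c \<bullet> b) * s))"])
      (rule integrable_gaussian_1D)
qed

section \<open>The Fourier transform on the Schwartz space\<close>

lemma fourier_lborel:
  fixes f :: "'a::euclidean_space \<Rightarrow> complex"
  assumes "f \<in> borel_measurable borel"
  shows "fourier f \<xi> = of_real ((2 * pi) powr (- real DIM('a) / 2)) *
     (\<integral>x. f x * exp (- \<i> * of_real (x \<bullet> \<xi>)) \<partial>lborel)"
  unfolding fourier_def using assms by (subst integral_completion) auto

lemma
  fixes x :: "'a::euclidean_space"
  shows smooth_plane_wave: "smooth (\<lambda>y. exp (- \<i> * of_real (x \<bullet> y)))"
    and partial_plane_wave: "partial b (\<lambda>y. exp (- \<i> * of_real (x \<bullet> y))) =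
      (\<lambda>y. (- \<i> * of_real (x \<bullet> b)) * exp (- \<i> * of_real (x \<bullet> y)))"
proof -
  have der: "((\<lambda>y. exp (- \<i> * of_real (x \<bullet> y))) has_derivative
    (\<lambda>h. (- \<i> * of_real (x \<bullet> h)) * exp (- \<i> * of_real (x \<bullet> y)))) (at y)" for y
  proof -
    have "((\<lambda>y. - \<i> * complex_of_real (x \<bullet> y)) has_derivative (\<lambda>h. - \<i> * of_real (x \<bullet> h))) (at y)"
      by (auto intro!: derivative_eq_intros)
    from has_derivative_compose[OF this DERIV_exp[unfolded has_field_derivative_def]]
    show ?thesis by (simp add: mult.commute)
  qed
  show P: "partial b (\<lambda>y. exp (- \<i> * of_real (x \<bullet> y))) =
      (\<lambda>y. (- \<i> * of_real (x \<bullet> b)) * exp (- \<i> * of_real (x \<bullet> y)))" for b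
    using partial_eq[OF der] by (rule ext)
  show "smooth (\<lambda>y. exp (- \<i> * of_real (x \<bullet> y)))"
  proof (rule smooth_coinduct[of _ "range (\<lambda>c y. c * exp (- \<i> * of_real (x \<bullet> y)))"])
    show "(\<lambda>y. exp (- \<i> * of_real (x \<bullet> y))) \<in> range (\<lambda>c y. c * exp (- \<i> * of_real (x \<bullet> y)))"
      by (rule range_eqI[of _ _ 1]) simp
    have d: "(\<lambda>y. exp (- \<i> * of_real (x \<bullet> y))) differentiable at y" for y
      using der[of y] unfolding differentiable_def by blast
    show "g differentiable at y" if "g \<in> range (\<lambda>c y. c * exp (- \<i> * of_real (x \<bullet> y)))" for g y
      using that d by (auto intro!: differentiable_mult)
    show "partial b g \<in> range (\<lambda>c y. c * exp (- \<i> * of_real (x \<bullet> y)))"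
      if g': "g \<in> range (\<lambda>c y. c * exp (- \<i> * of_real (x \<bullet> y)))" for g b
    proof -
      obtain c where g: "g = (\<lambda>y. c * exp (- \<i> * of_real (x \<bullet> y)))" using g' by auto
      have "partial b g y = c * (- \<i> * of_real (x \<bullet> b)) * exp (- \<i> * of_real (x \<bullet> y))" for y
        unfolding g partial_cmult[OF d] P by simp
      then have "partial b g = (\<lambda>y. c * (- \<i> * of_real (x \<bullet> b)) * exp (- \<i> * of_real (x \<bullet> y)))" by (rule ext)
      then show ?thesis by blast
    qed
  qed
qed

lemma partials_plane_wave:
  fixes x :: "'a::euclidean_space"
  shows "set bs \<subseteq> Basis \<Longrightarrow> partials bs (\<lambda>y. exp (- \<i> * of_real (x \<bullet> y))) =
      (\<lambda>y. (\<Prod>b\<leftarrow>bs. - \<i> * of_real (x \<bullet> b)) * exp (- \<i> * of_real (x \<bullet> y)))"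
proof (induction bs)
  case (Cons b bs)
  then have IH: "partials bs (\<lambda>y. exp (- \<i> * of_real (x \<bullet> y))) =
      (\<lambda>y. (\<Prod>b\<leftarrow>bs. - \<i> * of_real (x \<bullet> b)) * exp (- \<i> * of_real (x \<bullet> y)))" by simp
  show ?case
    unfolding partials_Cons IH
    by (rule ext, subst partial_cmult[OF smooth_differentiable[OF smooth_plane_wave]])
      (simp only: partial_plane_wave list.map prod_list.Cons mult_ac)
qed (simp add: partials_Nil)

lemma schwartz_mult_multiindex:
  assumes "f \<in> schwartz"
  shows "(\<lambda>x. (\<Prod>b\<leftarrow>bs. - \<i> * of_real (x \<bullet> b)) * f x) \<in> schwartz"
proof (induction bs)
  case (Cons b bs)
  from schwartz_cmult(1)[OF schwartz_operator_closed[OF schwartz_operator_coordinate this], of "- \<i>" b]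
  show ?case by (simp add: mult.assoc)
qed (use assms in simp)

lemma fourier_multiindex:
  fixes f :: "'a::euclidean_space \<Rightarrow> complex"
  assumes f: "f \<in> schwartz"
  shows "smooth (fourier f)"
    and "set bs \<subseteq> Basis \<Longrightarrow> partials bs (fourier f) = fourier (\<lambda>x. (\<Prod>b\<leftarrow>bs. - \<i> * of_real (x \<bullet> b)) * f x)"
proof -
  let ?c = "complex_of_real ((2 * pi) powr (- real DIM('a) / 2))"
  let ?e = "\<lambda>x y. exp (- \<i> * complex_of_real (x \<bullet> y))"
  have fm: "f \<in> borel_measurable borel" by (rule schwartz_measurable[OF f])
  have F: "fourier f = (\<lambda>y. ?c * (\<integral>x. f x * ?e x y \<partial>lborel))"
    using fourier_lborel[OF fm] by (rule ext)
  have eq: "partials bs (\<lambda>y. f x * ?e x y) = (\<lambda>y. (\<Prod>b\<leftarrow>bs. - \<i> * of_real (x \<bullet> b)) * f x * ?e x y)"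
    if "set bs \<subseteq> Basis" for bs x
    using partials_cmult[OF smooth_plane_wave that] partials_plane_wave[OF that] by (simp add: mult_ac)
  have smo: "smooth (\<lambda>y. f x * ?e x y)" for x by (rule smooth_cmult[OF smooth_plane_wave])
  have meas: "(\<lambda>x. partials bs (\<lambda>y. f x * ?e x y) y) \<in> borel_measurable lborel" if "set bs \<subseteq> Basis" for bs y
  proof -
    have "(\<lambda>x. exp (- \<i> * complex_of_real (x \<bullet> y))) \<in> borel_measurable borel"
      by (intro borel_measurable_continuous_onI continuous_intros)
    from borel_measurable_times[OF schwartz_measurable[OF schwartz_mult_multiindex[OF f, of bs]] this]
    show ?thesis unfolding eq[OF that] by simp
  qed
  have bound: "\<exists>K. integrable lborel K \<and> (\<forall>x y. cmod (partials bs (\<lambda>y. f x * ?e x y) y) \<le> K x)"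
    if "set bs \<subseteq> Basis" for bs
  proof -
    have "integrable lborel (\<lambda>x. (\<Prod>b\<leftarrow>bs. - \<i> * of_real (x \<bullet> b)) * f x)"
      using schwartz_integrable_mult[OF schwartz_mult_multiindex[OF f], of "\<lambda>_. 1" 1 0] by simp
    from integrable_norm[OF this] show ?thesis unfolding eq[OF that]
    proof (intro exI conjI allI)
      show "cmod ((\<Prod>b\<leftarrow>bs. - \<i> * of_real (x \<bullet> b)) * f x * exp (- \<i> * of_real (x \<bullet> y)))
        \<le> cmod ((\<Prod>b\<leftarrow>bs. - \<i> * of_real (x \<bullet> b)) * f x)" for x y
        by (simp add: norm_mult)
    qed
  qed
  have sI: "smooth (\<lambda>y. \<integral>x. f x * ?e x y \<partial>lborel)" by (rule smooth_integral[OF smo meas bound])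
  then show "smooth (fourier f)" unfolding F by (rule smooth_cmult)
  show "partials bs (fourier f) = fourier (\<lambda>x. (\<Prod>b\<leftarrow>bs. - \<i> * of_real (x \<bullet> b)) * f x)" if bs: "set bs \<subseteq> Basis"
  proof
    fix y
    have "partials bs (fourier f) y = ?c * partials bs (\<lambda>y. \<integral>x. f x * ?e x y \<partial>lborel) y"
      unfolding F partials_cmult[OF sI bs] ..
    also have "partials bs (\<lambda>y. \<integral>x. f x * ?e x y \<partial>lborel) = (\<lambda>y. \<integral>x. partials bs (\<lambda>y. f x * ?e x y) y \<partial>lborel)"
      by (subst partials_integral[OF smo meas bound bs]) simp_all
    finally show "partials bs (fourier f) y = fourier (\<lambda>x. (\<Prod>b\<leftarrow>bs. - \<i> * of_real (x \<bullet> b)) * f x) y"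
      unfolding eq[OF bs] fourier_lborel[OF schwartz_measurable[OF schwartz_mult_multiindex[OF f]]] .
  qed
qed

lemma fourier_partial:
  fixes f :: "'a::euclidean_space \<Rightarrow> complex"
  assumes f: "f \<in> schwartz" and b: "b \<in> Basis"
  shows "fourier (partial b f) y = \<i> * of_real (y \<bullet> b) * fourier f y"
proof -
  have pf: "partial b f \<in> schwartz" by (rule schwartz_operator_closed[OF schwartz_operator_partial[OF b] f])
  have comm: "exp (- \<i> * complex_of_real (x \<bullet> y)) = exp (- \<i> * complex_of_real (y \<bullet> x))" for x y :: 'a
    by (simp add: inner_commute)
  have bnd: "cmod (exp (- \<i> * complex_of_real (y \<bullet> x))) \<le> 1 + norm y" for x
    by simp
  have bnd': "cmod ((- \<i> * complex_of_real (y \<bullet> b)) * exp (- \<i> * complex_of_real (y \<bullet> x))) \<le> 1 + norm y"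
    if "b \<in> Basis" for x b
    using Basis_le_norm[OF that, of y] by (simp add: norm_mult)
  have "(\<integral>x. partial b f x * exp (- \<i> * complex_of_real (y \<bullet> x)) \<partial>lborel)
    = - (\<integral>x. f x * partial b (\<lambda>x. exp (- \<i> * complex_of_real (y \<bullet> x))) x \<partial>lborel)"
    by (rule integral_by_parts[OF f smooth_plane_wave bnd _ b]) (unfold partial_plane_wave, rule bnd')
  also have "\<dots> = \<i> * of_real (y \<bullet> b) * (\<integral>x. f x * exp (- \<i> * complex_of_real (y \<bullet> x)) \<partial>lborel)"
    unfolding partial_plane_wave
    by (simp flip: integral_mult_right_zero add: mult_ac)
  finally show ?thesis
    unfolding fourier_lborel[OF schwartz_measurable[OF f]] fourier_lborel[OF schwartz_measurable[OF pf]]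
      comm[of _ y]
    by (simp add: mult_ac)
qed

lemma fourier_bound:
  assumes f: "f \<in> schwartz"
  shows "\<exists>C. \<forall>y. cmod (fourier f y) \<le> C"
proof -
  have "integrable lborel f"
    using schwartz_integrable_mult[OF f, of "\<lambda>_. 1" 1 0] by simp
  then have i: "integrable lborel (\<lambda>x. cmod (f x))" by simp
  have "cmod (\<integral>x. f x * exp (- \<i> * of_real (x \<bullet> y)) \<partial>lborel) \<le> (\<integral>x. cmod (f x) \<partial>lborel)" for y
    by (rule norm_integral_le[OF i]) (simp add: norm_mult)
  then show ?thesis
    unfolding fourier_lborel[OF schwartz_measurable[OF f]] norm_mult
    using mult_left_mono[OF _ norm_ge_zero] by blast
qed

lemma norm_power_le_sum:
  fixes y :: "'a::euclidean_space"
  shows "norm y ^ k \<le> real DIM('a) ^ k * (\<Sum>b\<in>Basis. \<bar>y \<bullet> b\<bar> ^ k)"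
  using power_mono[OF norm_le_l1[of y], of k] power_sum_le[of "Basis :: 'a set" "\<lambda>b. \<bar>y \<bullet> b\<bar>" k]
  by simp

text \<open>The Fourier transform turns partial derivatives into multiplication by coordinates and vice versa, so
weighted derivatives of \<open>fourier f\<close> are Fourier transforms of Schwartz functions, which are bounded.\<close>
lemma fourier_schwartz:
  fixes f :: "'a::euclidean_space \<Rightarrow> complex"
  assumes f: "f \<in> schwartz"
  shows "fourier f \<in> schwartz"
proof (rule schwartzI[OF fourier_multiindex(1)[OF f]])
  fix k and bs :: "'a list" assume bs: "set bs \<subseteq> Basis"
  define g where "g x = (\<Prod>b\<leftarrow>bs. - \<i> * of_real (x \<bullet> b)) * f x" for x
  have g: "g \<in> schwartz" unfolding g_def[abs_def] by (rule schwartz_mult_multiindex[OF f])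
  have pw: "(partial b ^^ k) g \<in> schwartz \<and>
      (\<forall>y. cmod (fourier ((partial b ^^ k) g) y) = \<bar>y \<bullet> b\<bar> ^ k * cmod (fourier g y))" if b: "b \<in> Basis" for b k
  proof (induction k)
    case (Suc k)
    then show ?case using schwartz_operator_closed[OF schwartz_operator_partial[OF b]]
      by (simp add: fourier_partial[OF _ b] norm_mult)
  qed (use g in simp)
  have "\<exists>C. \<forall>y. \<bar>y \<bullet> b\<bar> ^ k * cmod (fourier g y) \<le> C" if b: "b \<in> Basis" for b
    using fourier_bound[of "(partial b ^^ k) g"] pw[OF b, of k] by simp
  then obtain C where C: "\<And>b y. b \<in> Basis \<Longrightarrow> \<bar>y \<bullet> b\<bar> ^ k * cmod (fourier g y) \<le> C b" by metis
  have "norm y ^ k * cmod (partials bs (fourier f) y) \<le> real DIM('a) ^ k * (\<Sum>b\<in>Basis. C b)" for y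
  proof -
    have "norm y ^ k * cmod (partials bs (fourier f) y) = norm y ^ k * cmod (fourier g y)"
      unfolding fourier_multiindex(2)[OF f bs] g_def[abs_def] ..
    also have "\<dots> \<le> real DIM('a) ^ k * (\<Sum>b\<in>Basis. \<bar>y \<bullet> b\<bar> ^ k) * cmod (fourier g y)"
      by (intro mult_right_mono norm_power_le_sum) simp
    also have "\<dots> = real DIM('a) ^ k * (\<Sum>b\<in>Basis. \<bar>y \<bullet> b\<bar> ^ k * cmod (fourier g y))"
      by (simp add: sum_distrib_right mult.assoc)
    also have "\<dots> \<le> real DIM('a) ^ k * (\<Sum>b\<in>Basis. C b)"
      by (intro mult_left_mono sum_mono C) auto
    finally show ?thesis .
  qed
  then show "\<exists>C. \<forall>y. norm y ^ k * cmod (partials bs (fourier f) y) \<le> C" by blast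
qed

section \<open>Test functions\<close>

lemma partials_support:
  assumes "smooth f" "set bs \<subseteq> Basis" "y \<notin> closure {x. f x \<noteq> 0}"
  shows "partials bs f y = 0"
  using assms(2,3)
proof (induction bs arbitrary: y)
  case Nil
  then show ?case using closure_subset[of "{x. f x \<noteq> 0}"] by (auto simp: partials_Nil)
next
  case (Cons b bs)
  let ?U = "- closure {x. f x \<noteq> 0}"
  have "open ?U" by auto
  then have "\<forall>\<^sub>F z in nhds y. z \<in> ?U" using Cons.prems by (intro eventually_nhds_in_open) auto
  then have "\<forall>\<^sub>F z in nhds y. z \<noteq> y \<longrightarrow> z \<in> UNIV \<longrightarrow> 0 = partials bs f z"
    by (rule eventually_mono) (use Cons in auto)
  then have ev: "\<forall>\<^sub>F z in at y. 0 = partials bs f z" unfolding eventually_at_filter .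
  have "partials bs f y = 0" using Cons by auto
  then have "(partials bs f has_derivative (\<lambda>h. 0)) (at y)"
    using has_derivative_transform_eventually[OF has_derivative_const ev] by simp
  then show ?case unfolding partials_Cons by (rule partial_eq)
qed

lemma test_functions_schwartz: "f \<in> test_functions \<Longrightarrow> f \<in> schwartz"
proof (rule schwartzI)
  assume f: "f \<in> test_functions"
  then show sm: "smooth f" by (simp add: test_functions_def)
  fix k and bs :: "'a list" assume bs: "set bs \<subseteq> Basis"
  let ?K = "closure {x. f x \<noteq> 0}"
  let ?g = "\<lambda>x. norm x ^ k * cmod (partials bs f x)"
  have K: "compact ?K" using f by (simp add: test_functions_def)
  have "continuous_on ?K ?g"
    using continuous_partials[OF sm bs] by (intro continuous_intros) (auto intro: continuous_on_subset)
  from compact_imp_bounded[OF compact_continuous_image[OF this K]]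
  obtain C where C: "\<And>x. x \<in> ?K \<Longrightarrow> ?g x \<le> C"
    unfolding bounded_iff by (auto simp: abs_of_nonneg)
  have "?g x \<le> max C 0" for x
    using C[of x] partials_support[OF sm bs, of x] by (cases "x \<in> ?K") auto
  then show "\<exists>C. \<forall>x. ?g x \<le> C" by blast
qed

text \<open>For p = 1 this is the standard function exp (-1/t) that is flat at 0. Polynomials in 1/t are
included because they appear in its derivatives.\<close>
definition cutoff :: "real poly \<Rightarrow> real \<Rightarrow> real" where
  "cutoff p t = (if t > 0 then poly p (inverse t) * exp (- inverse t) else 0)"

lemma cutoff_derivative:
  "(cutoff p has_real_derivative cutoff (monom 1 2 * (p - pderiv p)) t) (at t)"
proof -
  consider "t > 0" | "t < 0" | "t = 0" by linarith
  then show ?thesis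
  proof cases
    case 1
    let ?f = "\<lambda>t. poly p (inverse t) * exp (- inverse t)"
    have "(?f has_real_derivative cutoff (monom 1 2 * (p - pderiv p)) t) (at t)"
      using 1 by (auto intro!: derivative_eq_intros poly_DERIV[THEN DERIV_chain2]
          simp: cutoff_def poly_monom algebra_simps power2_eq_square)
    then show ?thesis
    proof (rule has_field_derivative_transform_within_open[where S = "{0<..}"])
      show "?f s = cutoff p s" if "s \<in> {0<..}" for s using that by (simp add: cutoff_def)
    qed (use 1 in auto)
  next
    case 2
    have "((\<lambda>t. 0) has_real_derivative cutoff (monom 1 2 * (p - pderiv p)) t) (at t)"
      using 2 by (simp add: cutoff_def)
    then show ?thesis
    proof (rule has_field_derivative_transform_within_open[where S = "{..<0}"])
      show "0 = cutoff p s" if "s \<in> {..<0}" for s using that by (simp add: cutoff_def)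
    qed (use 2 in auto)
  next
    case 3
    have *: "((\<lambda>s. poly (pCons 0 p) s / exp s) \<longlongrightarrow> 0) at_top"
    proof -
      have "((\<lambda>s. \<Sum>i\<le>degree (pCons 0 p). coeff (pCons 0 p) i * (s ^ i / exp s)) \<longlongrightarrow>
         (\<Sum>i\<le>degree (pCons 0 p). coeff (pCons 0 p) i * 0)) at_top"
        by (intro tendsto_intros tendsto_power_div_exp_0)
      then show ?thesis unfolding poly_altdef by (simp add: sum_divide_distrib)
    qed
    have "((\<lambda>h. poly (pCons 0 p) (inverse h) / exp (inverse h)) \<longlongrightarrow> 0) (at_right 0)"
      by (rule filterlim_compose[OF * filterlim_inverse_at_top_right])
    then have "((\<lambda>h. (cutoff p h - cutoff p 0) / h) \<longlongrightarrow> 0) (at_right 0)"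
      by (rule Lim_transform_eventually)
        (auto simp: eventually_at_right_field cutoff_def divide_inverse exp_minus mult_ac intro!: exI[of _ 1])
    moreover have "((\<lambda>h. (cutoff p h - cutoff p 0) / h) \<longlongrightarrow> 0) (at_left 0)"
      by (rule Lim_transform_eventually[OF tendsto_const])
        (auto simp: eventually_at_left_field cutoff_def intro!: exI[of _ "- 1"])
    ultimately have "((\<lambda>h. (cutoff p h - cutoff p 0) / h) \<longlongrightarrow> 0) (at 0)"
      by (simp add: filterlim_split_at_real)
    with 3 show ?thesis by (simp add: has_field_derivative_iff cutoff_def)
  qed
qed

lemma smooth_cutoff:
  fixes e :: "'a::euclidean_space"
  shows "smooth (\<lambda>x. complex_of_real (cutoff p (x \<bullet> e + a)))"
proof (rule smooth_coinduct[of _ "range (\<lambda>p x. complex_of_real (cutoff p (x \<bullet> e + a)))"])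
  have der: "((\<lambda>x. complex_of_real (cutoff p (x \<bullet> e + a))) has_derivative
    (\<lambda>h. of_real (cutoff (monom 1 2 * (p - pderiv p)) (x \<bullet> e + a) * (h \<bullet> e)))) (at x)" for p and x :: 'a
  proof -
    have "((\<lambda>x. x \<bullet> e + a) has_derivative (\<lambda>h. h \<bullet> e)) (at x)" by (auto intro!: derivative_eq_intros)
    from has_derivative_of_real[OF has_derivative_compose[OF this cutoff_derivative[unfolded has_field_derivative_def]]]
    show ?thesis by (simp add: o_def)
  qed
  show "g differentiable at x" if "g \<in> range (\<lambda>p x. complex_of_real (cutoff p (x \<bullet> e + a)))" for g x
    using that der unfolding differentiable_def by blast
  show "partial b g \<in> range (\<lambda>p x. complex_of_real (cutoff p (x \<bullet> e + a)))"
    if g: "g \<in> range (\<lambda>p x. complex_of_real (cutoff p (x \<bullet> e + a)))" for g b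
  proof -
    obtain p where p: "g = (\<lambda>x. complex_of_real (cutoff p (x \<bullet> e + a)))" using g by auto
    have "partial b g x = complex_of_real (cutoff (smult (b \<bullet> e) (monom 1 2 * (p - pderiv p))) (x \<bullet> e + a))" for x
      using partial_eq[OF der[of p x], of b] unfolding p by (simp add: cutoff_def mult_ac)
    then show ?thesis by (intro image_eqI[of _ _ "smult (b \<bullet> e) (monom 1 2 * (p - pderiv p))"]) auto
  qed
qed auto

definition bump :: "'a::euclidean_space \<Rightarrow> real \<Rightarrow> 'a \<Rightarrow> real" where
  "bump a r x = (\<Prod>b\<in>Basis. cutoff 1 (r - (x - a) \<bullet> b) * cutoff 1 (r + (x - a) \<bullet> b))"

lemma cutoff_1: "cutoff 1 t \<ge> 0" "cutoff 1 t > 0 \<longleftrightarrow> t > 0" "cutoff 1 t = 0 \<longleftrightarrow> t \<le> 0"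
  by (auto simp: cutoff_def)

lemma bump_pos: "bump a r x > 0 \<longleftrightarrow> (\<forall>b\<in>Basis. \<bar>(x - a) \<bullet> b\<bar> < r)"
  and bump_nonneg: "bump a r x \<ge> 0"
proof -
  show nn: "bump a r x \<ge> 0" unfolding bump_def by (intro prod_nonneg) (auto simp: cutoff_1)
  have "bump a r x \<noteq> 0 \<longleftrightarrow> (\<forall>b\<in>Basis. \<bar>(x - a) \<bullet> b\<bar> < r)"
    unfolding bump_def by (auto simp: cutoff_1 abs_less_iff not_le)
  with nn show "bump a r x > 0 \<longleftrightarrow> (\<forall>b\<in>Basis. \<bar>(x - a) \<bullet> b\<bar> < r)" by (simp add: less_le)
qed

lemma smooth_bump: "smooth (\<lambda>x. complex_of_real (bump a r x))"
proof -
  have "smooth (\<lambda>x. \<Prod>b\<in>Basis. complex_of_real (cutoff 1 (x \<bullet> (- b) + (r + a \<bullet> b)))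
     * complex_of_real (cutoff 1 (x \<bullet> b + (r - a \<bullet> b))))"
    by (intro smooth_prod smooth_mult smooth_cutoff finite_Basis)
  also have "(\<lambda>x. \<Prod>b\<in>Basis. complex_of_real (cutoff 1 (x \<bullet> (- b) + (r + a \<bullet> b)))
     * complex_of_real (cutoff 1 (x \<bullet> b + (r - a \<bullet> b)))) = (\<lambda>x. complex_of_real (bump a r x))"
    by (simp add: bump_def inner_diff_left algebra_simps)
  finally show ?thesis .
qed

lemma bump_support: "bump a r x \<noteq> 0 \<Longrightarrow> norm (x - a) \<le> real DIM('a) * r"
  for x :: "'a::euclidean_space"
proof -
  assume "bump a r x \<noteq> 0"
  then have "bump a r x > 0" using bump_nonneg[of a r x] by simp
  then have *: "\<And>b. b \<in> Basis \<Longrightarrow> \<bar>(x - a) \<bullet> b\<bar> < r" by (simp add: bump_pos)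
  have "norm (x - a) \<le> (\<Sum>b\<in>Basis. \<bar>(x - a) \<bullet> b\<bar>)" by (rule norm_le_l1)
  also have "\<dots> \<le> real DIM('a) * r" using * by (intro sum_bounded_above) (auto intro: less_imp_le)
  finally show ?thesis .
qed

lemma bump_test_function: "(\<lambda>x. complex_of_real (bump a r x)) \<in> test_functions"
  for a :: "'a::euclidean_space"
proof -
  have "{x. complex_of_real (bump a r x) \<noteq> 0} \<subseteq> cball a (real DIM('a) * r)"
  proof
    fix x assume "x \<in> {x. complex_of_real (bump a r x) \<noteq> 0}"
    then have "bump a r x \<noteq> 0" by simp
    from bump_support[OF this] show "x \<in> cball a (real DIM('a) * r)" by (simp add: dist_norm norm_minus_commute)
  qed
  then have "bounded {x. complex_of_real (bump a r x) \<noteq> 0}" by (rule bounded_subset[OF bounded_cball])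
  then show ?thesis by (simp add: test_functions_def smooth_bump)
qed

section \<open>The short-time Fourier transform of a tempered distribution\<close>

lemma continuous_L1_loc:
  assumes "continuous_on UNIV g" shows "g \<in> L1_loc"
  unfolding L1_loc_def
proof (intro CollectI allI impI)
  fix K :: "'a set" assume K: "compact K"
  from borel_integrable_compact[OF K continuous_on_subset[OF assms subset_UNIV]]
  have "integrable lborel (\<lambda>x. indicator K x *\<^sub>R g x)" .
  then have "integrable lebesgue (\<lambda>x. indicator K x *\<^sub>R g x)"
    by (subst integrable_completion) (auto dest: borel_measurable_integrable)
  then show "g absolutely_integrable_on K" by (simp add: set_integrable_def)
qed

text \<open>If g and h differ at a, test with a bump function supported where the real part of
cnj (g a - h a) (g x - h x) is positive.\<close>
lemma continuous_representative_unique: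
  fixes g h :: "'a::euclidean_space \<Rightarrow> complex"
  assumes g: "continuous_on UNIV g" "represents u g" and h: "continuous_on UNIV h" "represents u h"
  shows "g = h"
proof (rule ext, rule ccontr)
  fix a assume ne: "g a \<noteq> h a"
  define f where "f x = Re (cnj (g a - h a) * (g x - h x))" for x
  have fc: "continuous_on UNIV f" unfolding f_def using g h by (intro continuous_intros) auto
  have "f a = (cmod (g a - h a))\<^sup>2"
  proof -
    have "cnj (g a - h a) * (g a - h a) = of_real ((cmod (g a - h a))\<^sup>2)"
      by (metis complex_norm_square mult.commute)
    then show ?thesis unfolding f_def by (simp only: Re_complex_of_real)
  qed
  with ne have fa: "f a > 0" by simp
  have "isCont f a" using fc by (simp add: continuous_on_eq_continuous_at)
  then obtain d where d: "d > 0" "\<And>x. dist x a < d \<Longrightarrow> \<bar>f x - f a\<bar> < f a"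
    using fa unfolding continuous_at_eps_delta by (metis dist_real_def)
  \<comment> \<open>the bump function lives on a cube, which is contained in the ball of radius DIM r < d\<close>
  define r where "r = d / (2 * real DIM('a))"
  have r: "r > 0" "real DIM('a) * r < d" using d by (auto simp: r_def)
  have fpos: "f x > 0" if "bump a r x \<noteq> 0" for x
    using d(2)[of x] bump_support[OF that] r by (auto simp: dist_norm)
  let ?\<psi> = "\<lambda>x. complex_of_real (bump a r x)"
  have \<psi>: "?\<psi> \<in> test_functions" by (rule bump_test_function)
  have int: "integrable lborel (\<lambda>x. k x * ?\<psi> x)" if k: "continuous_on UNIV k" for k
  proof -
    let ?K = "cball a (real DIM('a) * r)"
    have "continuous_on ?K (\<lambda>x. k x * ?\<psi> x)"
      using smooth_continuous[OF smooth_bump] k by (intro continuous_intros) (auto intro: continuous_on_subset)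
    from borel_integrable_compact[OF compact_cball this]
    have "integrable lborel (\<lambda>x. indicator ?K x *\<^sub>R (k x * ?\<psi> x))" .
    also have "(\<lambda>x. indicator ?K x *\<^sub>R (k x * ?\<psi> x)) = (\<lambda>x. k x * ?\<psi> x)"
    proof
      show "indicator ?K x *\<^sub>R (k x * ?\<psi> x) = k x * ?\<psi> x" for x
        using bump_support[of a r x] by (cases "bump a r x = 0") (auto simp: dist_norm norm_minus_commute)
    qed
    finally show ?thesis .
  qed
  have eq: "u ?\<psi> = (\<integral>x. k x * ?\<psi> x \<partial>lborel)" if "continuous_on UNIV k" "represents u k" for k
    using that \<psi> int[OF that(1)] unfolding represents_def
    by (subst integral_completion[symmetric]) (auto dest: borel_measurable_integrable)
  have "(\<integral>x. g x * ?\<psi> x \<partial>lborel) = (\<integral>x. h x * ?\<psi> x \<partial>lborel)"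
    using eq[OF g] eq[OF h] by simp
  then have "(\<integral>x. g x * ?\<psi> x - h x * ?\<psi> x \<partial>lborel) = 0"
    using int[OF g(1)] int[OF h(1)] by simp
  then have "(\<integral>x. cnj (g a - h a) * (g x * ?\<psi> x - h x * ?\<psi> x) \<partial>lborel) = 0" by simp
  then have "Re (\<integral>x. cnj (g a - h a) * (g x * ?\<psi> x - h x * ?\<psi> x) \<partial>lborel) = 0"
    by (simp only: zero_complex.sel)
  moreover have i: "integrable lborel (\<lambda>x. cnj (g a - h a) * (g x * ?\<psi> x - h x * ?\<psi> x))"
    using int[OF g(1)] int[OF h(1)] by simp
  moreover have e: "Re (cnj (g a - h a) * (g x * ?\<psi> x - h x * ?\<psi> x)) = f x * bump a r x" for x
    unfolding f_def by (simp add: algebra_simps)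
  ultimately have z: "(\<integral>x. f x * bump a r x \<partial>lborel) = 0" and fi: "integrable lborel (\<lambda>x. f x * bump a r x)"
    using integral_Re[OF i] integrable_Re[OF i] by (simp_all add: e)
  have "f x * bump a r x \<ge> 0" for x
    using fpos[of x] bump_nonneg[of a r x] by (cases "bump a r x = 0") auto
  then have "AE x in lborel. f x * bump a r x = 0"
    using integral_nonneg_eq_0_iff_AE[OF fi] z by auto
  then have "AE x in lborel. x \<in> {x. f x * bump a r x = 0}" by simp
  then have ae: "AE x in lebesgue. x \<in> {x. f x * bump a r x = 0}" by (rule AE_completion)
  have cl: "closed {x. f x * bump a r x = 0}"
  proof -
    have "continuous_on UNIV (\<lambda>x. Re (complex_of_real (bump a r x)))"
      by (rule continuous_on_Re[OF smooth_continuous[OF smooth_bump]])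
    then have "continuous_on UNIV (\<lambda>x. bump a r x)" by simp
    then have "continuous_on UNIV (\<lambda>x. f x * bump a r x)" using fc by (intro continuous_intros)
    then show ?thesis by (intro closed_Collect_eq) auto
  qed
  from mem_closed_if_AE_lebesgue[OF cl ae, of a] have "f a * bump a r a = 0" by simp
  moreover have "bump a r a > 0" using r by (simp add: bump_pos)
  ultimately show False using fa by simp
qed

text \<open>The product of the window at x with \<open>fourier \<psi>\<close> is a superposition of the coherent states (x, \<eta>) with
coefficients \<psi> \<eta>. Hence the distribution in the definition of the short-time Fourier
transform is represented by a continuous function, which is its only continuous representative.\<close>
theorem stft_eq:
  fixes u :: "('a::euclidean_space \<Rightarrow> complex) \<Rightarrow> complex"
  assumes u: "u \<in> tempered"
  shows "stft gauss u p = of_real ((2 * pi) powr (- real DIM('a) / 2)) * u (coherent p)"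
proof -
  obtain x \<xi> where p: "p = (x, \<xi>)" by fastforce
  let ?c = "complex_of_real ((2 * pi) powr (- real DIM('a) / 2))"
  let ?g = "\<lambda>\<eta>. ?c * u (coherent (x, \<eta>))"
  let ?v = "fourier_distr (mult_distr u (\<lambda>y. cnj (gauss (y - x))))"
  have cont: "continuous_on UNIV ?g"
  proof -
    have "continuous_on UNIV (\<lambda>\<eta>::'a. (x, \<eta>))" by (intro continuous_intros)
    from continuous_on_compose2[OF continuous_tempered_coherent[OF u] this]
    show ?thesis by (intro continuous_intros) simp
  qed
  have rep: "?v \<psi> = integral\<^sup>L lebesgue (\<lambda>\<eta>. ?g \<eta> * \<psi> \<eta>)" if "\<psi> \<in> test_functions" for \<psi>
  proof -
    have \<psi>: "\<psi> \<in> schwartz" by (rule test_functions_schwartz[OF that])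
    define M where "M = distr lborel borel (Pair x :: 'a \<Rightarrow> 'a \<times> 'a)"
    have Pm: "Pair x \<in> measurable lborel (borel :: ('a \<times> 'a) measure)"
      by (simp add: borel_measurable_continuous_onI continuous_intros)
    define w where "w p = ?c * \<psi> (snd p)" for p :: "'a \<times> 'a"
    have \<psi>m[measurable]: "\<psi> \<in> borel_measurable borel" by (rule schwartz_measurable[OF \<psi>])
    have sndm: "(snd :: 'a \<times> 'a \<Rightarrow> 'a) \<in> borel_measurable borel"
      by (intro borel_measurable_continuous_onI continuous_intros)
    have wm[measurable]: "w \<in> borel_measurable borel" unfolding w_def
      using measurable_compose[OF sndm \<psi>m] by measurable
    have w: "rapid_moments M w"
      unfolding rapid_moments_def
    proof (intro conjI allI)
      show "sets M = sets borel" by (simp add: M_def)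
      fix m
      have "integrable lborel (\<lambda>\<eta>. (1 + norm (x, \<eta>)) ^ m * cmod (w (x, \<eta>)))"
      proof (rule Bochner_Integration.integrable_bound)
        show "integrable lborel (\<lambda>\<eta>. (cmod ?c * (1 + norm x) ^ m) * ((1 + norm \<eta>) ^ m * cmod (\<psi> \<eta>)))"
          using schwartz_rapid_moments[OF \<psi>] by (intro integrable_mult_right) (simp add: rapid_moments_def)
        show "AE \<eta> in lborel. norm ((1 + norm (x, \<eta>)) ^ m * cmod (w (x, \<eta>)))
          \<le> norm ((cmod ?c * (1 + norm x) ^ m) * ((1 + norm \<eta>) ^ m * cmod (\<psi> \<eta>)))"
        proof (rule AE_I2)
          fix \<eta> :: 'a
          have "1 + norm (x, \<eta>) \<le> (1 + norm x) * (1 + norm \<eta>)"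
          proof -
            have "0 \<le> norm x * norm \<eta>" by simp
            moreover have "(1 + norm x) * (1 + norm \<eta>) = 1 + norm x + norm \<eta> + norm x * norm \<eta>" by algebra
            ultimately show ?thesis using norm_Pair_le[of x \<eta>] by linarith
          qed
          then have "(1 + norm (x, \<eta>)) ^ m \<le> ((1 + norm x) * (1 + norm \<eta>)) ^ m" by (intro power_mono) auto
          then have "(1 + norm (x, \<eta>)) ^ m * cmod (w (x, \<eta>)) \<le> ((1 + norm x) * (1 + norm \<eta>)) ^ m * cmod (w (x, \<eta>))"
            by (rule mult_right_mono) simp
          then show "norm ((1 + norm (x, \<eta>)) ^ m * cmod (w (x, \<eta>)))
            \<le> norm ((cmod ?c * (1 + norm x) ^ m) * ((1 + norm \<eta>) ^ m * cmod (\<psi> \<eta>)))"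
            by (simp add: w_def norm_mult power_mult_distrib mult_ac abs_mult)
        qed
        show "(\<lambda>\<eta>. (1 + norm (x, \<eta>)) ^ m * cmod (w (x, \<eta>))) \<in> borel_measurable lborel"
          by (intro borel_measurable_times borel_measurable_norm borel_measurable_power measurable_compose[OF Pm]
              borel_measurable_add) auto
      qed
      then show "integrable M (\<lambda>p. (1 + norm p) ^ m * cmod (w p))"
        unfolding M_def by (subst integrable_distr_eq[OF Pm]) auto
    qed (rule wm)
    have cm: "(\<lambda>p. coherent p y) \<in> borel_measurable borel" for y :: 'a
      using coherent_borel_measurable[of "[]" y] by (simp add: partials_Nil)
    have "(\<lambda>y. cnj (gauss (y - x)) * fourier \<psi> y) = (\<lambda>y. \<integral>p. w p * coherent p y \<partial>M)"
    proof
      fix y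
      have "(\<integral>p. w p * coherent p y \<partial>M) = (\<integral>\<eta>. w (x, \<eta>) * coherent (x, \<eta>) y \<partial>lborel)"
        unfolding M_def using cm[of y] by (subst integral_distr[OF Pm]) auto
      also have "\<dots> = (\<integral>\<eta>. (gauss (y - x) * ?c) * (\<psi> \<eta> * exp (- \<i> * of_real (\<eta> \<bullet> y))) \<partial>lborel)"
        by (simp add: w_def coherent_def mult_ac inner_commute)
      also have "\<dots> = gauss (y - x) * fourier \<psi> y"
        unfolding fourier_lborel[OF \<psi>m] by (subst integral_mult_right_zero) (simp add: mult_ac)
      finally show "cnj (gauss (y - x)) * fourier \<psi> y = (\<integral>p. w p * coherent p y \<partial>M)"
        by (simp add: gauss_def)
    qed
    then have "?v \<psi> = u (\<lambda>y. \<integral>p. w p * coherent p y \<partial>M)"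
      using \<psi> fourier_schwartz[OF \<psi>] by (simp add: fourier_distr_def mult_distr_def)
    also have "\<dots> = (\<integral>p. w p * u (coherent p) \<partial>M)" by (rule tempered_superposition[OF u w])
    also have "\<dots> = (\<integral>\<eta>. w (x, \<eta>) * u (coherent (x, \<eta>)) \<partial>lborel)"
      unfolding M_def using borel_measurable_continuous_onI[OF continuous_tempered_coherent[OF u]]
      by (subst integral_distr[OF Pm]) auto
    finally have v: "?v \<psi> = (\<integral>\<eta>. w (x, \<eta>) * u (coherent (x, \<eta>)) \<partial>lborel)" .
    have m: "(\<lambda>\<eta>. ?g \<eta> * \<psi> \<eta>) \<in> borel_measurable lborel"
      unfolding measurable_lborel2 by (rule borel_measurable_times[OF borel_measurable_continuous_onI[OF cont] \<psi>m])
    have "w (x, \<eta>) * u (coherent (x, \<eta>)) = ?g \<eta> * \<psi> \<eta>" for \<eta> by (simp add: w_def)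
    then show ?thesis unfolding v integral_completion[OF m] by presburger
  qed
  have "represents ?v ?g" using rep continuous_L1_loc[OF cont] by (simp add: represents_def)
  then have "function_of_distr ?v = ?g"
    unfolding function_of_distr_def
  proof (intro the_equality conjI cont)
    show "g = ?g" if "continuous_on UNIV g \<and> represents ?v g" for g
      by (rule continuous_representative_unique[OF _ _ cont \<open>represents ?v ?g\<close>]) (use that in auto)
  qed
  then show ?thesis by (simp add: stft_def p)
qed

section \<open>The transform of a Schwartz function against coherent states\<close>

definition coherent_transform :: "('a::euclidean_space \<Rightarrow> complex) \<Rightarrow> 'a \<times> 'a \<Rightarrow> complex" where
  "coherent_transform \<psi> p = (\<integral>y. coherent p y * \<psi> y \<partial>lborel)"

lemma partials_coherent_bounded:
  "set bs \<subseteq> Basis \<Longrightarrow> \<exists>C\<ge>0. \<forall>y. cmod (partials bs (coherent p) y) \<le> C"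
proof -
  assume "set bs \<subseteq> Basis"
  then obtain C m where C: "C \<ge> 0" "\<And>p y. (1 + norm y) ^ 0 * cmod (partials bs (coherent p) y) \<le> C * (1 + norm p) ^ m"
    using partials_coherent_decay[of bs 0] by metis
  then show ?thesis by (intro exI[of _ "C * (1 + norm p) ^ m"]) (auto simp del: split_paired_All)
qed

lemma coherent_le:
  fixes y :: "'a::euclidean_space"
  shows "cmod (coherent p y) \<le> pi powr (- real DIM('a) / 4)"
  unfolding cmod_coherent by (simp add: mult_left_le)

lemma coherent_measurable [measurable]: "coherent p \<in> borel_measurable borel"
  by (intro schwartz_measurable coherent_schwartz)

lemma integrable_coherent_mult:
  fixes \<psi> :: "'a::euclidean_space \<Rightarrow> complex"
  assumes "\<psi> \<in> schwartz"
  shows "integrable lborel (\<lambda>y. coherent p y * \<psi> y)"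
  using schwartz_integrable_mult[OF assms coherent_measurable[of p], of "pi powr (- real DIM('a) / 4)" 0] coherent_le[of p]
  by (simp add: mult.commute)

text \<open>On coherent states multiplication by x - i \<xi> acts as \<partial> + y. Integration by parts moves this to
the operator y - \<partial> (the creation operator of the harmonic oscillator) acting on \<psi>.\<close>
lemma coherent_transform_creation:
  fixes \<psi> :: "'a::euclidean_space \<Rightarrow> complex"
  assumes \<psi>: "\<psi> \<in> schwartz" and b: "b \<in> Basis"
  shows "coherent_transform (\<lambda>y. of_real (y \<bullet> b) * \<psi> y - partial b \<psi> y) p =
    Complex (fst p \<bullet> b) (- (snd p \<bullet> b)) * coherent_transform \<psi> p"
proof -
  have \<psi>1: "(\<lambda>y. of_real (y \<bullet> b) * \<psi> y) \<in> schwartz"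
    by (rule schwartz_operator_closed[OF schwartz_operator_coordinate \<psi>])
  have \<psi>2: "partial b \<psi> \<in> schwartz" by (rule schwartz_operator_closed[OF schwartz_operator_partial[OF b] \<psi>])
  have pc: "partial b (coherent p) y = (- of_real ((y - fst p) \<bullet> b) - \<i> * of_real (snd p \<bullet> b)) * coherent p y" for y
    by (rule partial_eq[OF coherent_has_derivative])
  have bnd: "\<exists>D. \<forall>b\<in>Basis. D b \<ge> 0 \<and> (\<forall>y. cmod (partial b (coherent p) y) \<le> D b)"
    using partials_coherent_bounded[of "[_]" p] by (intro bchoice) (auto simp: partials_Cons partials_Nil)
  then obtain D where D: "\<And>b. b \<in> Basis \<Longrightarrow> D b \<ge> 0"
    "\<And>b y. b \<in> Basis \<Longrightarrow> cmod (partial b (coherent p) y) \<le> D b" by blast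
  define E where "E = pi powr (- real DIM('a) / 4) + (\<Sum>b\<in>Basis. D b)"
  have E1: "cmod (coherent p y) \<le> E" for y
    using coherent_le[of p y] sum_nonneg[of Basis D] D(1) by (simp add: E_def)
  have E2: "cmod (partial b (coherent p) y) \<le> E" if "b \<in> Basis" for b y
  proof -
    have "D b \<le> sum D Basis" using D(1) that by (intro member_le_sum) auto
    moreover have "0 \<le> pi powr (- real DIM('a) / 4)" by simp
    ultimately show ?thesis using D(2)[OF that, of y] unfolding E_def by linarith
  qed
  have "(\<integral>y. partial b \<psi> y * coherent p y \<partial>lborel) = - (\<integral>y. \<psi> y * partial b (coherent p) y \<partial>lborel)"
    by (rule integral_by_parts[OF \<psi> smooth_coherent E1 E2 b])
  then have "coherent_transform (partial b \<psi>) p = - (\<integral>y. \<psi> y * partial b (coherent p) y \<partial>lborel)"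
    by (simp add: coherent_transform_def mult.commute)
  also have "(\<lambda>y. \<psi> y * partial b (coherent p) y) =
      (\<lambda>y. Complex (fst p \<bullet> b) (- (snd p \<bullet> b)) * (coherent p y * \<psi> y) - coherent p y * (of_real (y \<bullet> b) * \<psi> y))"
  proof
    have cx: "Complex (fst p \<bullet> b) (- (snd p \<bullet> b)) = of_real (fst p \<bullet> b) - \<i> * of_real (snd p \<bullet> b)"
      by (simp add: complex_eq_iff)
    show "\<psi> y * partial b (coherent p) y =
      Complex (fst p \<bullet> b) (- (snd p \<bullet> b)) * (coherent p y * \<psi> y) - coherent p y * (of_real (y \<bullet> b) * \<psi> y)" for y
      unfolding pc cx by (simp add: algebra_simps inner_diff_left)
  qed
  also have "(\<integral>y. Complex (fst p \<bullet> b) (- (snd p \<bullet> b)) * (coherent p y * \<psi> y) - coherent p y * (of_real (y \<bullet> b) * \<psi> y) \<partial>lborel)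
    = Complex (fst p \<bullet> b) (- (snd p \<bullet> b)) * coherent_transform \<psi> p - coherent_transform (\<lambda>y. of_real (y \<bullet> b) * \<psi> y) p"
    unfolding coherent_transform_def
    by (subst Bochner_Integration.integral_diff[OF integrable_mult_right[OF integrable_coherent_mult[OF \<psi>]] integrable_coherent_mult[OF \<psi>1]])
       simp
  finally have "coherent_transform (\<lambda>y. of_real (y \<bullet> b) * \<psi> y) p - coherent_transform (partial b \<psi>) p
    = Complex (fst p \<bullet> b) (- (snd p \<bullet> b)) * coherent_transform \<psi> p" by simp
  moreover have "coherent_transform (\<lambda>y. of_real (y \<bullet> b) * \<psi> y - partial b \<psi> y) p =
    coherent_transform (\<lambda>y. of_real (y \<bullet> b) * \<psi> y) p - coherent_transform (partial b \<psi>) p"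
    unfolding coherent_transform_def right_diff_distrib
    by (rule Bochner_Integration.integral_diff[OF integrable_coherent_mult[OF \<psi>1] integrable_coherent_mult[OF \<psi>2]])
  ultimately show ?thesis by simp
qed

lemma coherent_transform_bound:
  "\<exists>C\<ge>0. \<exists>m. \<forall>\<psi>\<in>schwartz. \<forall>p::'a::euclidean_space \<times> 'a. cmod (coherent_transform \<psi> p) \<le> C * schwartz_norm m \<psi>"
proof -
  let ?n = "2 * DIM('a)"
  let ?c = "pi powr (- real DIM('a) / 4)"
  define I where "I = (\<integral>y. 1 / (1 + norm y) ^ ?n \<partial>(lborel :: 'a measure))"
  have I: "I \<ge> 0" unfolding I_def by (intro Bochner_Integration.integral_nonneg) auto
  have "cmod (coherent_transform \<psi> p) \<le> (?c * (2 ^ ?n * 2) * I) * schwartz_norm ?n \<psi>"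
    if \<psi>: "\<psi> \<in> schwartz" for \<psi> and p :: "'a \<times> 'a"
  proof -
    have "cmod (coherent_transform \<psi> p) \<le>
      (\<integral>y. (?c * (2 ^ ?n * (2 * schwartz_norm ?n \<psi>))) * (1 / (1 + norm y) ^ ?n) \<partial>(lborel :: 'a measure))"
      unfolding coherent_transform_def
    proof (rule norm_integral_le)
      show "integrable lborel (\<lambda>y::'a. (?c * (2 ^ ?n * (2 * schwartz_norm ?n \<psi>))) * (1 / (1 + norm y) ^ ?n))"
        by (intro integrable_mult_right integrable_inverse_power_norm)
      fix y :: 'a
      have pos: "0 < (1 + norm y) ^ ?n" by (simp add: add_pos_nonneg)
      have "(1 + norm y) ^ ?n * cmod (\<psi> y) \<le> 2 ^ ?n * (2 * schwartz_norm ?n \<psi>)"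
        using schwartz_decay_norm[OF \<psi>, of "[]" y ?n] by (simp add: partials_Nil)
      then have "cmod (\<psi> y) \<le> 2 ^ ?n * (2 * schwartz_norm ?n \<psi>) * (1 / (1 + norm y) ^ ?n)"
        using pos by (simp add: field_simps)
      from mult_mono[OF coherent_le[of p y] this]
      show "cmod (coherent p y * \<psi> y) \<le> (?c * (2 ^ ?n * (2 * schwartz_norm ?n \<psi>))) * (1 / (1 + norm y) ^ ?n)"
        by (simp add: norm_mult mult.assoc)
    qed
    also have "\<dots> = (?c * (2 ^ ?n * 2) * I) * schwartz_norm ?n \<psi>"
      unfolding I_def by (subst integral_mult_right_zero) simp
    finally show ?thesis .
  qed
  with I show ?thesis by (intro exI[of _ "?c * (2 ^ ?n * 2) * I"] conjI exI[of _ ?n] ballI allI) auto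
qed

text \<open>By \<open>coherent_transform_creation\<close> the powers of x - i \<xi> times the transform of \<psi> are transforms of
Schwartz functions, and therefore bounded by a Schwartz norm of \<psi>.\<close>
theorem coherent_transform_decay:
  "\<exists>C\<ge>0. \<exists>m. \<forall>\<psi>\<in>schwartz. \<forall>p::'a::euclidean_space \<times> 'a.
     (1 + norm p) ^ k * cmod (coherent_transform \<psi> p) \<le> C * schwartz_norm m \<psi>"
proof -
  let ?c = "\<lambda>b p. Complex (fst p \<bullet> b) (- (snd p \<bullet> b))"
  let ?D = "real DIM('a)"
  have step: "\<exists>C\<ge>0. \<exists>m. \<forall>\<psi>\<in>schwartz. \<forall>p::'a \<times> 'a.
     cmod (?c b p) ^ k * cmod (coherent_transform \<psi> p) \<le> C * schwartz_norm m \<psi>" if b: "b \<in> Basis" for b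
  proof -
    define L where "L = (\<lambda>(\<psi> :: 'a \<Rightarrow> complex) y. of_real (y \<bullet> b) * \<psi> y - partial b \<psi> y)"
    have L: "schwartz_operator L"
      unfolding L_def by (intro schwartz_operator_diff schwartz_operator_coordinate schwartz_operator_partial b)
    have pow: "coherent_transform ((L ^^ k) \<psi>) p = ?c b p ^ k * coherent_transform \<psi> p"
      if \<psi>: "\<psi> \<in> schwartz" for \<psi> p k
    proof (induction k)
      case (Suc k)
      have "(L ^^ k) \<psi> \<in> schwartz" by (rule schwartz_operator_closed[OF schwartz_operator_funpow[OF L] \<psi>])
      from coherent_transform_creation[OF this b, of p] Suc show ?case by (simp add: L_def)
    qed simp
    obtain C m where C: "C \<ge> 0" "\<And>\<psi> p. \<psi> \<in> schwartz \<Longrightarrow> cmod (coherent_transform \<psi> (p :: 'a \<times> 'a)) \<le> C * schwartz_norm m \<psi>"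
      using coherent_transform_bound[where 'a = 'a] by metis
    obtain D n where D: "D \<ge> 0" "\<And>\<psi>. \<psi> \<in> schwartz \<Longrightarrow> schwartz_norm m ((L ^^ k) \<psi>) \<le> D * schwartz_norm n \<psi>"
      using schwartz_operator_funpow[OF L, of k] unfolding schwartz_operator_def by metis
    have "cmod (?c b p) ^ k * cmod (coherent_transform \<psi> p) \<le> (C * D) * schwartz_norm n \<psi>" if \<psi>: "\<psi> \<in> schwartz" for \<psi> p
    proof -
      have "cmod (?c b p) ^ k * cmod (coherent_transform \<psi> p) = cmod (coherent_transform ((L ^^ k) \<psi>) p)"
        unfolding pow[OF \<psi>] by (simp add: norm_mult norm_power)
      also have "\<dots> \<le> C * schwartz_norm m ((L ^^ k) \<psi>)"
        by (intro C schwartz_operator_closed[OF schwartz_operator_funpow[OF L] \<psi>])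
      also have "\<dots> \<le> C * (D * schwartz_norm n \<psi>)" by (intro mult_left_mono D C \<psi>)
      finally show ?thesis by (simp add: mult.assoc)
    qed
    with C(1) D(1) show ?thesis by (intro exI[of _ "C * D"] conjI exI[of _ n] ballI allI) simp_all
  qed
  have "\<exists>C\<ge>0. \<exists>m. \<forall>\<psi>\<in>schwartz. \<forall>p::'a \<times> 'a.
     (\<Sum>b\<in>Basis. cmod (?c b p) ^ k * cmod (coherent_transform \<psi> p)) \<le> C * schwartz_norm m \<psi>"
    by (intro schwartz_norm_bound_sum[where g = "\<lambda>b \<psi> p. cmod (?c b p) ^ k * cmod (coherent_transform \<psi> p)"] step finite_Basis)
  then obtain C m where C: "C \<ge> 0" and C_sum: "\<forall>\<psi>\<in>schwartz. \<forall>p::'a \<times> 'a.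
     (\<Sum>b\<in>Basis. cmod (?c b p) ^ k * cmod (coherent_transform \<psi> p)) \<le> C * schwartz_norm m \<psi>" by blast
  obtain C' m' where C': "C' \<ge> 0" "\<And>\<psi> p. \<psi> \<in> schwartz \<Longrightarrow> cmod (coherent_transform \<psi> (p :: 'a \<times> 'a)) \<le> C' * schwartz_norm m' \<psi>"
    using coherent_transform_bound[where 'a = 'a] by metis
  define n where "n = max m m'"
  define A where "A = 2 ^ k * (C' + (2 * ?D) ^ k * C)"
  have "(1 + norm p) ^ k * cmod (coherent_transform \<psi> p) \<le> A * schwartz_norm n \<psi>" if \<psi>: "\<psi> \<in> schwartz" for \<psi> and p :: "'a \<times> 'a"
  proof -
    let ?W = "cmod (coherent_transform \<psi> p)"
    have "norm p \<le> norm (fst p) + norm (snd p)" using norm_Pair_le[of "fst p" "snd p"] by simp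
    also have "\<dots> \<le> (\<Sum>b\<in>Basis. \<bar>fst p \<bullet> b\<bar>) + (\<Sum>b\<in>Basis. \<bar>snd p \<bullet> b\<bar>)" by (intro add_mono norm_le_l1)
    also have "\<dots> \<le> (\<Sum>b\<in>Basis. 2 * cmod (?c b p))"
    proof -
      have "\<bar>fst p \<bullet> b\<bar> + \<bar>snd p \<bullet> b\<bar> \<le> 2 * cmod (?c b p)" for b
        using abs_Re_le_cmod[of "?c b p"] abs_Im_le_cmod[of "?c b p"] by simp
      then show ?thesis unfolding sum.distrib[symmetric] by (rule sum_mono)
    qed
    finally have "norm p ^ k \<le> (\<Sum>b\<in>Basis. 2 * cmod (?c b p)) ^ k" by (intro power_mono) auto
    also have "\<dots> \<le> ?D ^ k * (\<Sum>b\<in>Basis. (2 * cmod (?c b p)) ^ k)" by (intro power_sum_le) auto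
    also have "\<dots> = (2 * ?D) ^ k * (\<Sum>b\<in>Basis. cmod (?c b p) ^ k)"
      unfolding power_mult_distrib sum_distrib_left by (simp add: mult_ac)
    finally have np: "norm p ^ k \<le> (2 * ?D) ^ k * (\<Sum>b\<in>Basis. cmod (?c b p) ^ k)" .
    have "(1 + norm p) ^ k \<le> 2 ^ k * (1 + norm p ^ k)"
      using power_sum_le[of "{False, True}" "\<lambda>i. if i then norm p else 1" k] by simp
    then have "(1 + norm p) ^ k * ?W \<le> 2 ^ k * (1 + norm p ^ k) * ?W" by (rule mult_right_mono) simp
    also have "\<dots> \<le> 2 ^ k * (1 + (2 * ?D) ^ k * (\<Sum>b\<in>Basis. cmod (?c b p) ^ k)) * ?W"
      using np by (intro mult_right_mono mult_left_mono add_left_mono) auto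
    also have "\<dots> = 2 ^ k * (?W + (2 * ?D) ^ k * (\<Sum>b\<in>Basis. cmod (?c b p) ^ k * ?W))"
      unfolding sum_distrib_right[symmetric] by (simp add: algebra_simps)
    also have "\<dots> \<le> 2 ^ k * (C' * schwartz_norm m' \<psi> + (2 * ?D) ^ k * (C * schwartz_norm m \<psi>))"
      using C_sum[THEN bspec, OF \<psi>, THEN spec, of p] by (intro mult_left_mono add_mono C' \<psi>) auto
    also have "\<dots> \<le> 2 ^ k * (C' * schwartz_norm n \<psi> + (2 * ?D) ^ k * (C * schwartz_norm n \<psi>))"
      using C C'(1) by (intro mult_left_mono add_mono schwartz_norm_mono \<psi>) (auto simp: n_def)
    finally show ?thesis by (simp add: A_def algebra_simps)
  qed
  moreover have "A \<ge> 0" using C C'(1) by (simp add: A_def)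
  ultimately show ?thesis by blast
qed

lemma integral_lborel_affine:
  fixes f :: "'a::euclidean_space \<Rightarrow> 'b::{banach,second_countable_topology}"
  assumes c: "c \<noteq> 0" and f: "f \<in> borel_measurable borel"
  shows "(\<integral>x. f x \<partial>lborel) = \<bar>c\<bar> ^ DIM('a) *\<^sub>R (\<integral>x. f (t + c *\<^sub>R x) \<partial>lborel)"
proof -
  have m: "(\<lambda>x::'a. t + c *\<^sub>R x) \<in> measurable lborel borel" by measurable
  have "(\<integral>x. f x \<partial>lborel) = (\<integral>x. f x \<partial>density (distr lborel borel (\<lambda>x. t + c *\<^sub>R x)) (\<lambda>_. \<bar>c\<bar> ^ DIM('a)))"
    using lborel_affine[OF c, of t] by (simp add: prod_constant)
  also have "\<dots> = (\<integral>x. \<bar>c\<bar> ^ DIM('a) *\<^sub>R f x \<partial>distr lborel borel (\<lambda>x. t + c *\<^sub>R x))"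
    using f by (subst integral_density) auto
  also have "\<dots> = (\<integral>x. \<bar>c\<bar> ^ DIM('a) *\<^sub>R f (t + c *\<^sub>R x) \<partial>lborel)"
    using f by (subst integral_distr[OF m]) auto
  finally show ?thesis by simp
qed

lemma integrable_lborel_affine:
  fixes f :: "'a::euclidean_space \<Rightarrow> 'b::{banach,second_countable_topology}"
  assumes c: "c \<noteq> 0" and f: "integrable lborel f"
  shows "integrable lborel (\<lambda>x. f (t + c *\<^sub>R x))"
proof -
  have fm: "f \<in> borel_measurable borel" using borel_measurable_integrable[OF f] by simp
  have m: "(\<lambda>x::'a. t + c *\<^sub>R x) \<in> measurable lborel borel" by measurable
  have "integrable (density (distr lborel borel (\<lambda>x. t + c *\<^sub>R x)) (\<lambda>_. \<bar>c\<bar> ^ DIM('a))) f"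
    using f lborel_affine[OF c, of t] by (simp add: prod_constant)
  then have "integrable (distr lborel borel (\<lambda>x. t + c *\<^sub>R x)) (\<lambda>x. \<bar>c\<bar> ^ DIM('a) *\<^sub>R f x)"
    using fm by (subst (asm) integrable_density) auto
  then have "integrable lborel (\<lambda>x. \<bar>c\<bar> ^ DIM('a) *\<^sub>R f (t + c *\<^sub>R x))"
    using fm by (subst (asm) integrable_distr_eq[OF m]) auto
  then have "integrable lborel (\<lambda>x. inverse (\<bar>c\<bar> ^ DIM('a)) *\<^sub>R (\<bar>c\<bar> ^ DIM('a) *\<^sub>R f (t + c *\<^sub>R x)))"
    by (rule integrable_scaleR_right)
  then show ?thesis using c by simp
qed

definition reproducing_kernel :: "'a::euclidean_space \<times> 'a \<Rightarrow> 'a \<times> 'a \<Rightarrow> complex" where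
  "reproducing_kernel p q = of_real (exp (- (norm (p - q))\<^sup>2 / 4)) *
     exp (\<i> * of_real ((fst p + fst q) \<bullet> (snd p - snd q)) / 2)"

text \<open>Completing the square around the midpoint of the two centres leaves a Gaussian integral whose
Fourier variable is the difference of the two frequencies.\<close>
lemma coherent_inner_product:
  fixes p q :: "'a::euclidean_space \<times> 'a"
  shows "(\<integral>y. cnj (coherent p y) * coherent q y \<partial>lborel) = reproducing_kernel p q"
proof -
  obtain x \<xi> where p: "p = (x, \<xi>)" by fastforce
  obtain x' \<xi>' where q: "q = (x', \<xi>')" by fastforce
  let ?d = "real DIM('a)"
  define m where "m = (1/2) *\<^sub>R (x + x')"
  \<comment> \<open>substitute y = m + s t around the midpoint m, which makes the coefficient of |t|^2 equal to 1/2\<close>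
  define s where "s = 1 / sqrt 2"
  have s: "s > 0" "s\<^sup>2 = 1 / 2" by (auto simp: s_def power_divide)
  let ?f = "\<lambda>y. cnj (coherent p y) * coherent q y"
  have fm: "?f \<in> borel_measurable borel"
    by (intro borel_measurable_continuous_onI continuous_intros smooth_continuous smooth_coherent)
  have eq: "?f (m + s *\<^sub>R t) = (of_real (pi powr (- ?d / 2)) * reproducing_kernel p q *
      of_real (exp ((norm (\<xi> - \<xi>'))\<^sup>2 / 4))) * (of_real (exp (- (norm t)\<^sup>2 / 2)) * exp (\<i> * of_real ((s *\<^sub>R (\<xi> - \<xi>')) \<bullet> t)))" for t
  proof -
    let ?y = "m + s *\<^sub>R t"
    have n: "(norm (?y - x))\<^sup>2 + (norm (?y - x'))\<^sup>2 = (norm t)\<^sup>2 + (norm (x - x'))\<^sup>2 / 2"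
    proof -
      have 1: "?y - x = s *\<^sub>R t - (1/2) *\<^sub>R (x - x')" "?y - x' = s *\<^sub>R t + (1/2) *\<^sub>R (x - x')"
        unfolding m_def by (simp_all add: scaleR_add_right scaleR_diff_right scaleR_half_double[symmetric] algebra_simps flip: scaleR_add_left)
      have "(norm (?y - x))\<^sup>2 + (norm (?y - x'))\<^sup>2 = 2 * ((norm (s *\<^sub>R t))\<^sup>2 + (norm ((1/2) *\<^sub>R (x - x')))\<^sup>2)"
        unfolding 1 power2_norm_eq_inner by (simp add: inner_add_left inner_add_right inner_diff_left inner_diff_right inner_commute)
      then show ?thesis using s by (simp add: power_mult_distrib power_divide)
    qed
    have e1: "cnj (coherent p ?y) * coherent q ?y =
       of_real (pi powr (- ?d / 2) * exp (- ((norm (?y - x))\<^sup>2 + (norm (?y - x'))\<^sup>2) / 2)) * exp (\<i> * of_real (?y \<bullet> (\<xi> - \<xi>')))"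
    proof -
      have "pi powr (- ?d / 2) = pi powr (- ?d / 4) * pi powr (- ?d / 4)" by (simp flip: powr_add)
      moreover have "exp (- ((norm (?y - x))\<^sup>2 + (norm (?y - x'))\<^sup>2) / 2) = exp (- (norm (?y - x))\<^sup>2 / 2) * exp (- (norm (?y - x'))\<^sup>2 / 2)"
        by (simp add: add_divide_distrib flip: exp_add)
      moreover have "exp (\<i> * complex_of_real (?y \<bullet> (\<xi> - \<xi>'))) = cnj (exp (- \<i> * of_real (?y \<bullet> \<xi>))) * exp (- \<i> * of_real (?y \<bullet> \<xi>'))"
        unfolding exp_cnj by (simp add: inner_diff_right right_diff_distrib flip: exp_add)
      ultimately show ?thesis by (simp add: coherent_def gauss_def p q mult_ac)
    qed
    have e2: "?y \<bullet> \<eta> = (x + x') \<bullet> \<eta> / 2 + (s *\<^sub>R \<eta>) \<bullet> t" for \<eta>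
      unfolding m_def by (simp add: inner_add_left inner_commute[of \<eta> t])
    have e3: "(norm (p - q))\<^sup>2 = (norm (x - x'))\<^sup>2 + (norm (\<xi> - \<xi>'))\<^sup>2"
      by (simp add: p q norm_Pair)
    have e4: "exp (- ((norm t)\<^sup>2 + (norm (x - x'))\<^sup>2 / 2) / 2) =
       exp (- (norm (p - q))\<^sup>2 / 4) * exp ((norm (\<xi> - \<xi>'))\<^sup>2 / 4) * exp (- (norm t)\<^sup>2 / 2)"
      unfolding e3 exp_add[symmetric] by (simp add: field_simps)
    show ?thesis
      unfolding e1 n e4 unfolding e2 reproducing_kernel_def of_real_add distrib_left exp_add
      by (simp add: p q mult_ac)
  qed
  have "(\<integral>y. ?f y \<partial>lborel) = \<bar>s\<bar> ^ DIM('a) *\<^sub>R (\<integral>t. ?f (m + s *\<^sub>R t) \<partial>lborel)"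
    using s by (intro integral_lborel_affine[OF _ fm]) auto
  also have "(\<integral>t. ?f (m + s *\<^sub>R t) \<partial>lborel) = (of_real (pi powr (- ?d / 2)) * reproducing_kernel p q *
      of_real (exp ((norm (\<xi> - \<xi>'))\<^sup>2 / 4))) * of_real ((2 * pi) powr (?d / 2) * exp (- (norm (s *\<^sub>R (\<xi> - \<xi>')))\<^sup>2 / 2))"
    unfolding eq by (subst integral_mult_right_zero) (simp only: integral_gaussian)
  also have "- (norm (s *\<^sub>R (\<xi> - \<xi>')))\<^sup>2 / 2 = - ((norm (\<xi> - \<xi>'))\<^sup>2 / 4)" using s by (simp add: power_mult_distrib)
  finally have 1: "(\<integral>y. ?f y \<partial>lborel) = of_real (\<bar>s\<bar> ^ DIM('a) * pi powr (- ?d / 2) * (2 * pi) powr (?d / 2) *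
     (exp ((norm (\<xi> - \<xi>'))\<^sup>2 / 4) * exp (- ((norm (\<xi> - \<xi>'))\<^sup>2 / 4)))) * reproducing_kernel p q"
    by (simp add: scaleR_conv_of_real mult_ac)
  have "\<bar>s\<bar> ^ DIM('a) = 2 powr (- ?d / 2)"
  proof -
    have "s = 2 powr (- 1 / 2)" by (simp add: s_def powr_minus_divide powr_half_sqrt)
    then have "\<bar>s\<bar> ^ DIM('a) = (2 powr (- 1 / 2)) powr ?d" using s by (simp add: powr_realpow)
    then show ?thesis by (simp add: powr_powr)
  qed
  then have "\<bar>s\<bar> ^ DIM('a) * pi powr (- ?d / 2) * (2 * pi) powr (?d / 2) = 1"
    by (simp add: powr_mult powr_minus field_simps)
  then show ?thesis unfolding 1 by (simp add: mult.assoc flip: exp_add)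
qed

lemma fubini_dominated:
  fixes F :: "'a::euclidean_space \<Rightarrow> 'b::euclidean_space \<Rightarrow> complex"
  assumes F: "(\<lambda>(x, y). F x y) \<in> borel_measurable borel"
    and g: "integrable lborel g" and h: "integrable lborel h"
    and bound: "\<And>x y. cmod (F x y) \<le> g x * h y"
  shows "(\<integral>x. \<integral>y. F x y \<partial>lborel \<partial>lborel) = (\<integral>y. \<integral>x. F x y \<partial>lborel \<partial>lborel)"
proof -
  have [measurable]: "g \<in> borel_measurable borel" "h \<in> borel_measurable borel"
    using borel_measurable_integrable[OF g] borel_measurable_integrable[OF h] by auto
  have s: "sets (lborel \<Otimes>\<^sub>M lborel) = sets (borel :: ('a \<times> 'b) measure)"
    using sets_pair_measure_cong[OF sets_lborel[where 'a = 'a] sets_lborel[where 'a = 'b]] by (simp only: borel_prod)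
  have F': "(\<lambda>(x, y). F x y) \<in> borel_measurable (lborel \<Otimes>\<^sub>M lborel)"
    using F measurable_cong_sets[OF s refl] by blast
  have "integrable (lborel \<Otimes>\<^sub>M lborel) (\<lambda>(x, y). g x * h y)"
  proof (rule lborel_pair.Fubini_integrable)
    show "(\<lambda>(x, y). g x * h y) \<in> borel_measurable (lborel \<Otimes>\<^sub>M lborel)" by measurable
    have "integrable lborel (\<lambda>x. norm (g x) * (\<integral>y. norm (h y) \<partial>lborel))"
      using g by (intro integrable_mult_left integrable_norm)
    then show "integrable lborel (\<lambda>x. \<integral>y. norm (case (x, y) of (x, y) \<Rightarrow> g x * h y) \<partial>lborel)"
      by (simp add: abs_mult)
    show "AE x in lborel. integrable lborel (\<lambda>y. case (x, y) of (x, y) \<Rightarrow> g x * h y)"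
      using h by (intro AE_I2) simp
  qed
  then have "integrable (lborel \<Otimes>\<^sub>M lborel) (\<lambda>(x, y). F x y)"
    by (rule Bochner_Integration.integrable_bound[OF _ F'])
      (intro AE_I2, use bound in \<open>auto intro: order_trans[OF _ abs_ge_self]\<close>)
  from lborel_pair.Fubini_integral[OF this] show ?thesis by simp
qed

text \<open>For fixed position a the hypothesis says that the Fourier transform of a window at a times h vanishes.
Rescaling around a by \<epsilon> and integrating against a Gaussian in the frequency shows that h has mean 0 for a
Gaussian-type weight of width \<epsilon> around a; as \<epsilon> tends to 0 this mean tends to a nonzero multiple of h a.\<close>
lemma coherent_transform_injective:
  fixes h :: "'a::euclidean_space \<Rightarrow> complex"
  assumes h: "h \<in> schwartz" and zero: "\<And>p. coherent_transform h p = 0"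
  shows "h = (\<lambda>y. 0)"
proof
  fix a
  let ?c = "(2 * pi) powr (real DIM('a) / 2)"
  define g where "g \<epsilon> t = gauss (\<epsilon> *\<^sub>R t) * h (a + \<epsilon> *\<^sub>R t)" for \<epsilon> and t :: 'a
  have hm: "h \<in> borel_measurable borel" by (rule schwartz_measurable[OF h])
  have hc: "continuous_on UNIV h" by (intro smooth_continuous schwartz_smooth h)
  have gc: "continuous_on UNIV (gauss :: 'a \<Rightarrow> complex)" unfolding gauss_def by (intro continuous_intros) auto
  have gbd: "cmod (gauss x) \<le> pi powr (- real DIM('a) / 4)" for x :: 'a
    unfolding gauss_def by (simp add: norm_mult mult_left_le)
  obtain H where H: "\<And>y. cmod (h y) \<le> H" using schwartz_decay[OF h, of "[]" 0] by (auto simp: partials_Nil)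
  have g_cont: "continuous_on UNIV (g \<epsilon>)" for \<epsilon> unfolding g_def
    by (intro continuous_intros continuous_on_compose2[OF gc] continuous_on_compose2[OF hc]) auto
  have gm: "g \<epsilon> \<in> borel_measurable borel" for \<epsilon> by (rule borel_measurable_continuous_onI[OF g_cont])
  have g_bound: "cmod (g \<epsilon> t) \<le> pi powr (- real DIM('a) / 4) * H" for \<epsilon> t
    unfolding g_def norm_mult using H gbd by (intro mult_mono) auto
  have hi: "integrable lborel h" using schwartz_integrable_mult[OF h, of "\<lambda>_. 1" 1 0] by simp
  have g_int: "integrable lborel (g \<epsilon>)" if "\<epsilon> > 0" for \<epsilon>
  proof -
    have i: "integrable lborel (\<lambda>t. h (a + \<epsilon> *\<^sub>R t))" using that by (intro integrable_lborel_affine hi) auto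
    have "integrable lborel (\<lambda>t. pi powr (- real DIM('a) / 4) * cmod (h (a + \<epsilon> *\<^sub>R t)))"
      by (intro integrable_mult_right integrable_norm i)
    then show ?thesis
      by (rule Bochner_Integration.integrable_bound)
        (use gm gbd in \<open>auto simp: g_def norm_mult intro!: AE_I2 mult_right_mono\<close>)
  qed
  have fz: "(\<integral>t. g \<epsilon> t * exp (\<i> * of_real (t \<bullet> s)) \<partial>lborel) = 0" if \<epsilon>: "\<epsilon> > 0" for \<epsilon> s
  proof -
    \<comment> \<open>the frequency that becomes s after rescaling by \<epsilon>\<close>
    define \<eta> where "\<eta> = - (1 / \<epsilon>) *\<^sub>R s"
    have m: "(\<lambda>y. coherent (a, \<eta>) y * h y) \<in> borel_measurable borel"
      by (intro borel_measurable_times hm) auto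
    have "0 = \<bar>\<epsilon>\<bar> ^ DIM('a) *\<^sub>R (\<integral>t. coherent (a, \<eta>) (a + \<epsilon> *\<^sub>R t) * h (a + \<epsilon> *\<^sub>R t) \<partial>lborel)"
      using zero[of "(a, \<eta>)"] integral_lborel_affine[OF _ m, of \<epsilon> a] \<epsilon> by (simp add: coherent_transform_def)
    then have "0 = (\<integral>t. coherent (a, \<eta>) (a + \<epsilon> *\<^sub>R t) * h (a + \<epsilon> *\<^sub>R t) \<partial>lborel)" using \<epsilon> by simp
    also have "\<dots> = (\<integral>t. exp (- \<i> * of_real (a \<bullet> \<eta>)) * (g \<epsilon> t * exp (\<i> * of_real (t \<bullet> s))) \<partial>lborel)"
    proof (intro Bochner_Integration.integral_cong refl)
      fix t
      have "(a + \<epsilon> *\<^sub>R t) \<bullet> \<eta> = a \<bullet> \<eta> - t \<bullet> s" using \<epsilon> by (simp add: \<eta>_def inner_add_left field_simps)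
      then have "exp (- \<i> * of_real ((a + \<epsilon> *\<^sub>R t) \<bullet> \<eta>)) = exp (- \<i> * of_real (a \<bullet> \<eta>)) * exp (\<i> * of_real (t \<bullet> s))"
        by (simp add: right_diff_distrib flip: exp_add)
      then show "coherent (a, \<eta>) (a + \<epsilon> *\<^sub>R t) * h (a + \<epsilon> *\<^sub>R t) =
        exp (- \<i> * of_real (a \<bullet> \<eta>)) * (g \<epsilon> t * exp (\<i> * of_real (t \<bullet> s)))"
        unfolding coherent_def g_def by simp
    qed
    also have "\<dots> = exp (- \<i> * of_real (a \<bullet> \<eta>)) * (\<integral>t. g \<epsilon> t * exp (\<i> * of_real (t \<bullet> s)) \<partial>lborel)"
      by (rule integral_mult_right_zero)
    finally show ?thesis by simp
  qed
  have gz: "(\<integral>t. g \<epsilon> t * of_real (exp (- (norm t)\<^sup>2 / 2)) \<partial>lborel) = 0" if \<epsilon>: "\<epsilon> > 0" for \<epsilon>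
  proof -
    let ?F = "\<lambda>t s::'a. g \<epsilon> t * (of_real (exp (- (norm s)\<^sup>2 / 2)) * exp (\<i> * of_real (t \<bullet> s)))"
    have gs: "integrable lborel (\<lambda>s::'a. exp (- (norm s)\<^sup>2 / 2))"
      using integrable_norm[OF integrable_gaussian[of 0]] by simp
    have "(\<integral>t. \<integral>s. ?F t s \<partial>lborel \<partial>lborel) = (\<integral>s. \<integral>t. ?F t s \<partial>lborel \<partial>lborel)"
    proof (rule fubini_dominated[OF _ integrable_norm[OF g_int[OF \<epsilon>]] gs])
      have "continuous_on UNIV (\<lambda>z. ?F (fst z) (snd z))"
        by (intro continuous_intros continuous_on_compose2[OF g_cont]) auto
      then show "(\<lambda>(t, s). ?F t s) \<in> borel_measurable borel"
        unfolding case_prod_unfold by (rule borel_measurable_continuous_onI)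
    qed (simp add: norm_mult)
    also have "(\<lambda>s. \<integral>t. ?F t s \<partial>lborel) = (\<lambda>s. of_real (exp (- (norm s)\<^sup>2 / 2)) * (\<integral>t. g \<epsilon> t * exp (\<i> * of_real (t \<bullet> s)) \<partial>lborel))"
      by (subst integral_mult_right_zero[symmetric]) (simp add: mult_ac)
    also have "\<dots> = (\<lambda>s. 0)" using fz[OF \<epsilon>] by simp
    finally have z: "(\<integral>t. \<integral>s. ?F t s \<partial>lborel \<partial>lborel) = 0" by simp
    have inner: "(\<integral>s. ?F t s \<partial>lborel) = of_real ?c * (g \<epsilon> t * of_real (exp (- (norm t)\<^sup>2 / 2)))" for t
      by (subst integral_mult_right_zero, subst integral_gaussian) simp
    have "of_real ?c * (\<integral>t. g \<epsilon> t * of_real (exp (- (norm t)\<^sup>2 / 2)) \<partial>lborel) = 0"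
      unfolding integral_mult_right_zero[symmetric] using z unfolding inner .
    then show ?thesis by simp
  qed
  define \<epsilon> where "\<epsilon> n = 1 / real (Suc n)" for n
  have lim: "(\<lambda>n. \<integral>t. g (\<epsilon> n) t * of_real (exp (- (norm t)\<^sup>2 / 2)) \<partial>lborel) \<longlonglongrightarrow>
    (\<integral>t. (gauss (0::'a) * h a) * of_real (exp (- (norm (t::'a))\<^sup>2 / 2)) \<partial>lborel)"
  proof (rule integral_dominated_convergence)
    show "(\<lambda>t. (gauss (0::'a) * h a) * of_real (exp (- (norm (t::'a))\<^sup>2 / 2))) \<in> borel_measurable lborel" by simp
    show "(\<lambda>t. g (\<epsilon> n) t * of_real (exp (- (norm t)\<^sup>2 / 2))) \<in> borel_measurable lborel" for n
      using gm by (intro borel_measurable_times) auto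
    show "integrable lborel (\<lambda>t::'a. pi powr (- real DIM('a) / 4) * H * exp (- (norm t)\<^sup>2 / 2))"
      using integrable_norm[OF integrable_gaussian[of 0]] by (intro integrable_mult_right) simp
    show "AE t in lborel. norm (g (\<epsilon> n) t * of_real (exp (- (norm t)\<^sup>2 / 2)))
        \<le> pi powr (- real DIM('a) / 4) * H * exp (- (norm t)\<^sup>2 / 2)" for n
      using g_bound by (intro AE_I2) (simp add: norm_mult)
    show "AE t in lborel. (\<lambda>n. g (\<epsilon> n) t * of_real (exp (- (norm t)\<^sup>2 / 2))) \<longlonglongrightarrow>
        (gauss (0::'a) * h a) * of_real (exp (- (norm t)\<^sup>2 / 2))"
    proof (rule AE_I2)
      fix t :: 'a
      have e: "\<epsilon> \<longlonglongrightarrow> 0" unfolding \<epsilon>_def[abs_def] by (rule LIMSEQ_Suc[OF lim_1_over_n])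
      have 1: "(\<lambda>n. \<epsilon> n *\<^sub>R t) \<longlonglongrightarrow> 0 *\<^sub>R t" by (intro tendsto_intros e)
      have 2: "(\<lambda>n. a + \<epsilon> n *\<^sub>R t) \<longlonglongrightarrow> a + 0 *\<^sub>R t" by (intro tendsto_intros e)
      have "(\<lambda>n. gauss (\<epsilon> n *\<^sub>R t)) \<longlonglongrightarrow> (gauss (0 *\<^sub>R t) :: complex)"
        by (rule continuous_on_tendsto_compose[OF gc 1]) auto
      moreover have "(\<lambda>n. h (a + \<epsilon> n *\<^sub>R t)) \<longlonglongrightarrow> h (a + 0 *\<^sub>R t)"
        by (rule continuous_on_tendsto_compose[OF hc 2]) auto
      ultimately show "(\<lambda>n. g (\<epsilon> n) t * of_real (exp (- (norm t)\<^sup>2 / 2))) \<longlonglongrightarrow>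
        (gauss (0::'a) * h a) * of_real (exp (- (norm t)\<^sup>2 / 2))"
        unfolding g_def by (intro tendsto_mult tendsto_const) auto
    qed
  qed
  have "\<epsilon> n > 0" for n by (simp add: \<epsilon>_def)
  then have "(\<lambda>n. \<integral>t. g (\<epsilon> n) t * of_real (exp (- (norm t)\<^sup>2 / 2)) \<partial>lborel) = (\<lambda>n. 0)" using gz by simp
  with lim have z1: "(\<integral>t. (gauss (0::'a) * h a) * of_real (exp (- (norm (t::'a))\<^sup>2 / 2)) \<partial>lborel) = 0"
    by (simp add: LIMSEQ_const_iff)
  have z2: "(\<integral>t. (gauss (0::'a) * h a) * of_real (exp (- (norm (t::'a))\<^sup>2 / 2)) \<partial>lborel) = gauss (0::'a) * h a * of_real ?c"
    using integral_gaussian[of "0::'a"] by (subst integral_mult_right_zero) simp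
  have "gauss (0::'a) * h a * of_real ?c = 0" by (rule trans[OF z2[symmetric] z1])
  then show "h a = 0" by (simp add: gauss_def)
qed

section \<open>The mean value property of entire functions\<close>

text \<open>Multiplication by exp (i \<theta>) in the complex coordinates x - i \<xi>.\<close>
definition phase_rotation :: "real \<Rightarrow> 'a::euclidean_space \<times> 'a \<Rightarrow> 'a \<times> 'a" where
  "phase_rotation \<theta> p = (cos \<theta> *\<^sub>R fst p + sin \<theta> *\<^sub>R snd p, cos \<theta> *\<^sub>R snd p - sin \<theta> *\<^sub>R fst p)"

lemma phase_rotation_measurable [measurable]: "phase_rotation \<theta> \<in> borel_measurable borel"
  unfolding phase_rotation_def by (intro borel_measurable_continuous_onI continuous_intros)

lemma norm_phase_rotation:
  fixes p :: "'a::euclidean_space \<times> 'a"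
  shows "norm (phase_rotation \<theta> p) = norm p"
proof -
  have "(norm (phase_rotation \<theta> p))\<^sup>2 = ((cos \<theta>)\<^sup>2 + (sin \<theta>)\<^sup>2) * ((norm (fst p))\<^sup>2 + (norm (snd p))\<^sup>2)"
  proof -
    have "(norm (c *\<^sub>R x + s *\<^sub>R y))\<^sup>2 + (norm (c *\<^sub>R y - s *\<^sub>R x))\<^sup>2 = (c\<^sup>2 + s\<^sup>2) * ((norm x)\<^sup>2 + (norm y)\<^sup>2)"
      for c s and x y :: 'a
      unfolding power2_norm_eq_inner
      by (simp add: inner_add_left inner_add_right inner_diff_left inner_diff_right
          inner_commute[of y x] power2_eq_square algebra_simps)
    then show ?thesis unfolding phase_rotation_def norm_Pair by (simp add: sum_power2_ge_zero)
  qed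
  also have "\<dots> = (norm p)\<^sup>2" by (cases p) (simp add: norm_Pair)
  finally show ?thesis by simp
qed

lemma lborel_shear_fst:
  "distr lborel borel (\<lambda>p::'a::euclidean_space \<times> 'a. (fst p + t *\<^sub>R snd p, snd p)) = lborel"
proof (rule measure_eqI)
  let ?s = "\<lambda>p::'a \<times> 'a. (fst p + t *\<^sub>R snd p, snd p)"
  have sm[measurable]: "?s \<in> borel_measurable borel"
    by (intro borel_measurable_continuous_onI continuous_intros)
  fix A :: "('a \<times> 'a) set" assume "A \<in> sets (distr lborel borel ?s)"
  then have A[measurable]: "A \<in> sets borel" by simp
  have Am: "(\<lambda>p. indicator A p :: ennreal) \<in> borel_measurable (lborel \<Otimes>\<^sub>M lborel)"
    unfolding lborel_prod by simp
  have Asm: "(\<lambda>p. indicator A (?s p) :: ennreal) \<in> borel_measurable (lborel \<Otimes>\<^sub>M lborel)"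
    unfolding lborel_prod using measurable_compose[OF sm, of "indicator A" borel] by simp
  have shift: "distr lborel borel (\<lambda>x::'a. c + x) = lborel" for c by (rule lborel_distr_plus)
  have "emeasure (distr lborel borel ?s) A = (\<integral>\<^sup>+p. indicator A (?s p) \<partial>lborel)"
    by (subst nn_integral_indicator[symmetric], simp, subst nn_integral_distr) (auto simp: borel_measurable_indicator)
  also have "\<dots> = (\<integral>\<^sup>+y. \<integral>\<^sup>+x. indicator A (x + t *\<^sub>R y, y) \<partial>lborel \<partial>lborel)"
    using lborel_pair.nn_integral_snd[OF Asm] by (simp add: lborel_prod)
  also have "\<dots> = (\<integral>\<^sup>+y. \<integral>\<^sup>+x. indicator A (x, y) \<partial>lborel \<partial>lborel)"
  proof (rule nn_integral_cong)
    fix y :: 'a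
    have m: "(\<lambda>x. indicator A (x, y) :: ennreal) \<in> borel_measurable borel"
      by (rule measurable_compose[of "\<lambda>x. (x, y)" borel borel])
        (auto intro!: borel_measurable_continuous_onI continuous_intros)
    have "(\<integral>\<^sup>+x. indicator A (x, y) \<partial>lborel) = (\<integral>\<^sup>+x. indicator A (x, y) \<partial>distr lborel borel (\<lambda>x::'a. t *\<^sub>R y + x))"
      unfolding shift ..
    also have "\<dots> = (\<integral>\<^sup>+x. indicator A (t *\<^sub>R y + x, y) \<partial>lborel)"
      using m by (subst nn_integral_distr) auto
    finally show "(\<integral>\<^sup>+x. indicator A (x + t *\<^sub>R y, y) \<partial>lborel) = (\<integral>\<^sup>+x. indicator A (x, y) \<partial>lborel)"
      by (simp add: add.commute)
  qed
  also have "\<dots> = (\<integral>\<^sup>+p. indicator A p \<partial>lborel)"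
    using lborel_pair.nn_integral_snd[OF Am] by (simp add: lborel_prod)
  finally show "emeasure (distr lborel borel ?s) A = emeasure lborel A" by simp
qed simp

lemma lborel_shear_snd:
  "distr lborel borel (\<lambda>p::'a::euclidean_space \<times> 'a. (fst p, snd p + t *\<^sub>R fst p)) = lborel"
proof (rule measure_eqI)
  let ?s = "\<lambda>p::'a \<times> 'a. (fst p, snd p + t *\<^sub>R fst p)"
  have sm[measurable]: "?s \<in> borel_measurable borel"
    by (intro borel_measurable_continuous_onI continuous_intros)
  fix A :: "('a \<times> 'a) set" assume "A \<in> sets (distr lborel borel ?s)"
  then have A[measurable]: "A \<in> sets borel" by simp
  have Am: "(\<lambda>p. indicator A p :: ennreal) \<in> borel_measurable (lborel \<Otimes>\<^sub>M lborel)"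
    unfolding lborel_prod by simp
  have Asm: "(\<lambda>p. indicator A (?s p) :: ennreal) \<in> borel_measurable (lborel \<Otimes>\<^sub>M lborel)"
    unfolding lborel_prod using measurable_compose[OF sm, of "indicator A" borel] by simp
  have shift: "distr lborel borel (\<lambda>x::'a. c + x) = lborel" for c by (rule lborel_distr_plus)
  have "emeasure (distr lborel borel ?s) A = (\<integral>\<^sup>+p. indicator A (?s p) \<partial>lborel)"
    by (subst nn_integral_indicator[symmetric], simp, subst nn_integral_distr) (auto simp: borel_measurable_indicator)
  also have "\<dots> = (\<integral>\<^sup>+x. \<integral>\<^sup>+y. indicator A (x, y + t *\<^sub>R x) \<partial>lborel \<partial>lborel)"
    using lborel.nn_integral_fst[OF Asm] by (simp add: lborel_prod)
  also have "\<dots> = (\<integral>\<^sup>+x. \<integral>\<^sup>+y. indicator A (x, y) \<partial>lborel \<partial>lborel)"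
  proof (rule nn_integral_cong)
    fix x :: 'a
    have m: "(\<lambda>y. indicator A (x, y) :: ennreal) \<in> borel_measurable borel"
      by (rule measurable_compose[of "\<lambda>y. (x, y)" borel borel])
        (auto intro!: borel_measurable_continuous_onI continuous_intros)
    have "(\<integral>\<^sup>+y. indicator A (x, y) \<partial>lborel) = (\<integral>\<^sup>+y. indicator A (x, y) \<partial>distr lborel borel (\<lambda>y::'a. t *\<^sub>R x + y))"
      unfolding shift ..
    also have "\<dots> = (\<integral>\<^sup>+y. indicator A (x, t *\<^sub>R x + y) \<partial>lborel)"
      using m by (subst nn_integral_distr) auto
    finally show "(\<integral>\<^sup>+y. indicator A (x, y + t *\<^sub>R x) \<partial>lborel) = (\<integral>\<^sup>+y. indicator A (x, y) \<partial>lborel)"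
      by (simp add: add.commute)
  qed
  also have "\<dots> = (\<integral>\<^sup>+p. indicator A p \<partial>lborel)"
    using lborel.nn_integral_fst[OF Am] by (simp add: lborel_prod)
  finally show "emeasure (distr lborel borel ?s) A = emeasure lborel A" by simp
qed simp

lemma phase_rotation_add: "phase_rotation \<alpha> (phase_rotation \<beta> p) = phase_rotation (\<alpha> + \<beta>) p"
  unfolding phase_rotation_def
  by (simp add: cos_add sin_add scaleR_add_right scaleR_diff_right scaleR_add_left scaleR_diff_left algebra_simps)

text \<open>If cos (\<theta>/2) is nonzero, a rotation is a product of three shears, each of which preserves Lebesgue
measure by Fubini and translation invariance. The remaining angles are twice an angle of this kind.\<close>
lemma lborel_phase_rotation:
  "distr lborel borel (phase_rotation \<theta> :: 'a::euclidean_space \<times> 'a \<Rightarrow> 'a \<times> 'a) = lborel"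
proof -
  have small: "distr lborel borel (phase_rotation \<theta> :: 'a \<times> 'a \<Rightarrow> 'a \<times> 'a) = lborel"
    if c: "cos (\<theta> / 2) \<noteq> 0" for \<theta>
  proof -
    let ?S = "\<lambda>t (p::'a \<times> 'a). (fst p + t *\<^sub>R snd p, snd p)"
    let ?T = "\<lambda>t (p::'a \<times> 'a). (fst p, snd p + t *\<^sub>R fst p)"
    have Sm: "?S t \<in> borel_measurable borel" and Tm: "?T t \<in> borel_measurable borel" for t
      by (intro borel_measurable_continuous_onI continuous_intros)+
    define a where "a = tan (\<theta> / 2)"
    have 1: "1 - a * sin \<theta> = cos \<theta>" "a * (1 + cos \<theta>) = sin \<theta>"
    proof -
      have s: "sin \<theta> = 2 * sin (\<theta> / 2) * cos (\<theta> / 2)" using sin_double[of "\<theta> / 2"] by simp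
      have co: "cos \<theta> = 1 - 2 * (sin (\<theta> / 2))\<^sup>2" "cos \<theta> = 2 * (cos (\<theta> / 2))\<^sup>2 - 1"
        using cos_double_sin[of "\<theta> / 2"] cos_double_cos[of "\<theta> / 2"] by simp_all
      show "1 - a * sin \<theta> = cos \<theta>" unfolding co(1) s a_def tan_def using c by (simp add: power2_eq_square)
      show "a * (1 + cos \<theta>) = sin \<theta>" unfolding co(2) s a_def tan_def using c by (simp add: power2_eq_square)
    qed
    have eq: "phase_rotation \<theta> p = ?S a (?T (- sin \<theta>) (?S a p))" for p :: "'a \<times> 'a"
    proof -
      obtain x \<xi> where p: "p = (x, \<xi>)" by fastforce
      have e2: "\<xi> + (- sin \<theta>) *\<^sub>R (x + a *\<^sub>R \<xi>) = cos \<theta> *\<^sub>R \<xi> - sin \<theta> *\<^sub>R x"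
        unfolding 1(1)[symmetric] by (simp add: algebra_simps)
      have e1: "x + a *\<^sub>R \<xi> + a *\<^sub>R (cos \<theta> *\<^sub>R \<xi> - sin \<theta> *\<^sub>R x) = cos \<theta> *\<^sub>R x + sin \<theta> *\<^sub>R \<xi>"
      proof -
        have "x + a *\<^sub>R \<xi> + a *\<^sub>R (cos \<theta> *\<^sub>R \<xi> - sin \<theta> *\<^sub>R x) = (1 - a * sin \<theta>) *\<^sub>R x + (a * (1 + cos \<theta>)) *\<^sub>R \<xi>"
          by (simp add: algebra_simps)
        then show ?thesis unfolding 1 .
      qed
      show ?thesis using e1 e2 by (simp add: phase_rotation_def p)
    qed
    have "distr lborel borel (phase_rotation \<theta> :: 'a \<times> 'a \<Rightarrow> 'a \<times> 'a)
      = distr (distr (distr lborel borel (?S a)) borel (?T (- sin \<theta>))) borel (?S a)"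
    proof -
      have Sl: "?S a \<in> measurable lborel borel" using Sm by simp
      have "distr (distr (distr lborel borel (?S a)) borel (?T (- sin \<theta>))) borel (?S a)
        = distr lborel borel (?S a \<circ> (?T (- sin \<theta>) \<circ> ?S a))"
        unfolding distr_distr[OF Tm Sl] by (rule distr_distr[OF Sm measurable_comp[OF Sl Tm]])
      also have "?S a \<circ> (?T (- sin \<theta>) \<circ> ?S a) = phase_rotation \<theta>" using eq by (auto simp: o_def fun_eq_iff)
      finally show ?thesis by simp
    qed
    then show ?thesis by (simp only: lborel_shear_fst lborel_shear_snd)
  qed
  show ?thesis
  proof (cases "cos (\<theta> / 2) = 0")
    case True
    have "cos (\<theta> / 2) = 2 * (cos (\<theta> / 2 / 2))\<^sup>2 - 1" using cos_double_cos[of "\<theta> / 2 / 2"] by simp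
    with True have c: "cos (\<theta> / 2 / 2) \<noteq> 0" by auto
    have "distr lborel borel (phase_rotation \<theta> :: 'a \<times> 'a \<Rightarrow> 'a \<times> 'a)
      = distr (distr lborel borel (phase_rotation (\<theta> / 2))) borel (phase_rotation (\<theta> / 2))"
      by (subst distr_distr) (simp_all add: o_def phase_rotation_add)
    then show ?thesis by (simp only: small[OF c])
  qed (rule small)
qed

text \<open>The point at which \<open>bargmann_S\<close> evaluates its argument. The factor 1 / sqrt 2 halves the squared norm.\<close>
definition to_complex :: "(real ^ 'd) \<times> (real ^ 'd) \<Rightarrow> complex ^ 'd" where
  "to_complex p = (\<chi> j. Complex (fst p $ j / sqrt 2) (- snd p $ j / sqrt 2))"

lemma bargmann_S_eq: "bargmann_S F p = F (to_complex p)"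
  by (simp add: bargmann_S_def to_complex_def case_prod_unfold)

lemma to_complex_add: "to_complex (p + q) = to_complex p + to_complex q"
  by (simp add: to_complex_def vec_eq_iff complex_eq_iff add_divide_distrib diff_divide_distrib)

lemma linear_to_complex: "linear to_complex"
  by (rule linearI) (simp_all add: to_complex_def vec_eq_iff complex_eq_iff add_divide_distrib diff_divide_distrib)

lemma continuous_to_complex: "continuous_on S to_complex"
  by (rule linear_continuous_on) (simp add: linear_conv_bounded_linear[symmetric] linear_to_complex)

lemma to_complex_0 [simp]: "to_complex 0 = 0"
  using linear_to_complex by (rule linear_0)

lemma surj_to_complex: "\<exists>p. to_complex p = z"
  by (rule exI[of _ "(\<chi> j. sqrt 2 * Re (z $ j), \<chi> j. - (sqrt 2 * Im (z $ j)))"])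
    (simp add: to_complex_def vec_eq_iff complex_eq_iff)

lemma norm_to_complex: "(norm (to_complex p))\<^sup>2 = (norm p)\<^sup>2 / 2"
proof -
  have n: "(norm v)\<^sup>2 = (\<Sum>j\<in>UNIV. (norm (v $ j))\<^sup>2)" for v :: "'b::real_normed_vector ^ 'd"
    by (simp add: norm_vec_def L2_set_def sum_nonneg)
  have "(norm (to_complex p))\<^sup>2 = (\<Sum>j\<in>UNIV. ((fst p $ j)\<^sup>2 + (snd p $ j)\<^sup>2) / 2)"
    unfolding n by (simp add: to_complex_def cmod_power2 power_divide add_divide_distrib)
  also have "\<dots> = ((norm (fst p))\<^sup>2 + (norm (snd p))\<^sup>2) / 2"
    unfolding n by (simp add: sum.distrib sum_divide_distrib[symmetric])
  also have "(norm (fst p))\<^sup>2 + (norm (snd p))\<^sup>2 = (norm p)\<^sup>2" by (cases p) (simp add: norm_Pair)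
  finally show ?thesis .
qed

lemma to_complex_phase_rotation: "to_complex (phase_rotation \<theta> p) = exp (\<i> * of_real \<theta>) *s to_complex p"
  by (simp add: to_complex_def phase_rotation_def vec_eq_iff complex_eq_iff cis_conv_exp[symmetric]
      field_simps)

lemma entire_continuous:
  assumes "F \<in> entire" shows "continuous_on S F"
proof (rule continuous_at_imp_continuous_on, intro ballI)
  fix z
  obtain D where "(F has_derivative D) (at z)" using assms unfolding entire_def by blast
  then show "isCont F z" by (rule has_derivative_continuous)
qed

lemma entire_line_holomorphic:
  assumes "F \<in> entire" shows "(\<lambda>u. F (u *s z)) holomorphic_on S"
proof (rule holomorphic_on_subset[OF _ subset_UNIV], rule holomorphic_onI)
  fix u
  obtain D where D: "(F has_derivative D) (at (u *s z))" "\<And>c h. D (c *s h) = c * D h"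
    using assms unfolding entire_def by blast
  have "bounded_linear (\<lambda>u::complex. u *s z)"
    by (rule linear_conv_bounded_linear[THEN iffD1], rule linearI)
      (simp_all add: vec_eq_iff distrib_right)
  then have "((\<lambda>u. u *s z) has_derivative (\<lambda>h. h *s z)) (at u)" by (rule bounded_linear_imp_has_derivative)
  from has_derivative_compose[OF this D(1)] D(2)
  have "((\<lambda>u. F (u *s z)) has_derivative (\<lambda>h. h * D z)) (at u)" by simp
  then have "((\<lambda>u. F (u *s z)) has_field_derivative D z) (at u)"
    unfolding has_field_derivative_def mult.commute[of _ "D z"] .
  then show "(\<lambda>u. F (u *s z)) field_differentiable at u within UNIV"
    unfolding field_differentiable_def by auto
qed

lemma entire_circle_mean:
  assumes F: "F \<in> entire"
  shows "(\<integral>t. indicator {0..1} t *\<^sub>R F (exp (\<i> * of_real (2 * pi * t)) *s z) \<partial>lborel) = F 0"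
proof -
  let ?f = "\<lambda>u. F (u *s z)"
  let ?h = "\<lambda>t::real. F (exp (\<i> * of_real (2 * pi * t)) *s z)"
  have "((\<lambda>u. ?f u / (u - 0)) has_contour_integral (2 * of_real pi * \<i> * ?f 0)) (circlepath 0 1)"
    by (rule Cauchy_integral_circlepath)
      (auto intro!: holomorphic_on_imp_continuous_on entire_line_holomorphic[OF F])
  then have "((\<lambda>t. ?f (circlepath 0 1 t) / (circlepath 0 1 t - 0) * vector_derivative (circlepath 0 1) (at t within {0..1}))
    has_integral (2 * of_real pi * \<i> * F 0)) {0..1}"
    unfolding has_contour_integral_def by simp
  then have "((\<lambda>t. (2 * of_real pi * \<i>) * ?h t) has_integral (2 * of_real pi * \<i> * F 0)) {0..1}"
  proof (rule has_integral_eq[rotated])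
    fix t :: real assume t: "t \<in> {0..1}"
    have c: "circlepath 0 1 t = exp (\<i> * of_real (2 * pi * t))"
      by (simp add: circlepath mult_ac)
    show "?f (circlepath 0 1 t) / (circlepath 0 1 t - 0) * vector_derivative (circlepath 0 1) (at t within {0..1})
      = (2 * of_real pi * \<i>) * ?h t"
      using t unfolding c by (subst vector_derivative_circlepath01) (auto simp: mult_ac)
  qed
  then have "((\<lambda>t. inverse (2 * of_real pi * \<i>) * ((2 * of_real pi * \<i>) * ?h t)) has_integral
     inverse (2 * of_real pi * \<i>) * (2 * of_real pi * \<i> * F 0)) {0..1}"
    by (rule has_integral_mult_right)
  moreover have "inverse k * (k * x) = x" if "k \<noteq> 0" for k x :: complex using that by simp
  from this[of "2 * of_real pi * \<i>"] have "inverse (2 * of_real pi * \<i>) * (2 * of_real pi * \<i> * x) = x" for x :: complex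
    by simp
  ultimately have hi: "(?h has_integral F 0) {0..1}" by (simp only:)
  have hc: "continuous_on {0..1} ?h"
  proof -
    have l: "continuous_on UNIV (\<lambda>u. F (u *s z))"
      by (rule holomorphic_on_imp_continuous_on[OF entire_line_holomorphic[OF F]])
    show ?thesis by (rule continuous_on_compose2[OF l]) (auto intro!: continuous_intros)
  qed
  then have "integrable lborel (\<lambda>t. indicator {0..1} t *\<^sub>R ?h t)"
    by (intro borel_integrable_compact) auto
  then have "set_integrable lborel {0..1} ?h" by (simp add: set_integrable_def)
  from has_integral_set_lebesgue[of "{0..1}" ?h] set_borel_integral_eq_integral(2)[OF this]
  have "(\<integral>t. indicator {0..1} t *\<^sub>R ?h t \<partial>lborel) = integral {0..1} ?h" by (simp add: set_lebesgue_integral_def)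
  also have "\<dots> = F 0" using hi by (rule integral_unique)
  finally show ?thesis .
qed

text \<open>Averaging over all phase rotations does not change the left-hand side, since Lebesgue measure and the
radial weight are invariant. The average of F over the circle through z is F 0 by Cauchy's
formula on the complex line spanned by z.\<close>
theorem entire_mean_value:
  fixes F :: "complex ^ 'd \<Rightarrow> complex" and \<rho> :: "real \<Rightarrow> real"
  assumes F: "F \<in> entire" and \<rho>[measurable]: "\<rho> \<in> borel_measurable borel"
    and int: "integrable lborel (\<lambda>p. F (to_complex p) * of_real (\<rho> (norm p)))"
  shows "(\<integral>p. F (to_complex p) * of_real (\<rho> (norm p)) \<partial>lborel) = F 0 * of_real (\<integral>p. \<rho> (norm (p :: (real ^ 'd) \<times> (real ^ 'd))) \<partial>lborel)"
proof -
  let ?Q = "\<lambda>p. F (to_complex p) * of_real (\<rho> (norm p))"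
  let ?R = "\<lambda>t::real. phase_rotation (2 * pi * t) :: (real ^ 'd) \<times> (real ^ 'd) \<Rightarrow> _"
  let ?J = "\<lambda>(t::real, p). indicator {0..1} t *\<^sub>R ?Q (?R t p)"
  have Qm: "?Q \<in> borel_measurable borel" using borel_measurable_integrable[OF int] by simp
  have rot_int: "(\<integral>p. g (?R t p) \<partial>lborel) = (\<integral>p. g p \<partial>lborel)" if "g \<in> borel_measurable borel"
    for g :: "(real ^ 'd) \<times> (real ^ 'd) \<Rightarrow> 'z::{banach,second_countable_topology}" and t
  proof -
    have "(\<integral>p. g p \<partial>distr lborel borel (?R t)) = (\<integral>p. g (?R t p) \<partial>lborel)"
      using that by (intro integral_distr) auto
    then show ?thesis unfolding lborel_phase_rotation by simp
  qed
  have rot_integrable: "integrable lborel (\<lambda>p. ?Q (?R t p))" for t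
  proof -
    have "integrable (distr lborel borel (?R t)) ?Q" unfolding lborel_phase_rotation by (rule int)
    then show ?thesis using Qm by (subst (asm) integrable_distr_eq) auto
  qed
  have rc: "continuous_on UNIV (\<lambda>z. ?R (fst z) (snd z))"
    unfolding phase_rotation_def by (intro continuous_intros)
  have Rm: "(\<lambda>z. ?R (fst z) (snd z)) \<in> borel_measurable borel"
    by (rule borel_measurable_continuous_onI[OF rc])
  have fstm: "(fst :: real \<times> (real ^ 'd) \<times> (real ^ 'd) \<Rightarrow> real) \<in> borel_measurable borel"
    by (intro borel_measurable_continuous_onI continuous_intros)
  have Jm: "?J \<in> borel_measurable (lborel \<Otimes>\<^sub>M lborel)"
    unfolding lborel_prod measurable_lborel2 case_prod_unfold
    by (intro borel_measurable_scaleR measurable_compose[OF fstm] measurable_compose[OF Rm Qm]) simp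
  have Ji: "integrable (lborel \<Otimes>\<^sub>M lborel) ?J"
  proof (rule lborel_pair.Fubini_integrable[OF Jm])
    have "(\<integral>p. norm (?J (t, p)) \<partial>lborel) = indicator {0..1} t * (\<integral>p. norm (?Q p) \<partial>lborel)" for t
    proof -
      have "(\<integral>p. norm (?J (t, p)) \<partial>lborel) = (\<integral>p. indicator {0..1} t * norm (?Q (?R t p)) \<partial>lborel)"
        by (simp add: abs_of_nonneg)
      also have "\<dots> = indicator {0..1} t * (\<integral>p. norm (?Q (?R t p)) \<partial>lborel)" by (rule integral_mult_right_zero)
      also have "(\<integral>p. norm (?Q (?R t p)) \<partial>lborel) = (\<integral>p. norm (?Q p) \<partial>lborel)"
        by (rule rot_int) (rule measurable_compose[OF Qm borel_measurable_norm])
      finally show ?thesis .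
    qed
    then have "(\<lambda>t. \<integral>p. norm (?J (t, p)) \<partial>lborel) = (\<lambda>t. indicator {0..1} t * (\<integral>p. norm (?Q p) \<partial>lborel))"
      by (rule ext)
    then show "integrable lborel (\<lambda>t. \<integral>p. norm (?J (t, p)) \<partial>lborel)"
      by (simp only:) (intro integrable_mult_left, simp)
    show "AE t in lborel. integrable lborel (\<lambda>p. ?J (t, p))"
      using rot_integrable by (intro AE_I2) simp
  qed
  have "(\<integral>p. \<integral>t. ?J (t, p) \<partial>lborel \<partial>lborel) = (\<integral>t. \<integral>p. ?J (t, p) \<partial>lborel \<partial>lborel)"
    using lborel_pair.Fubini_integral[of "\<lambda>t p. ?J (t, p)"] Ji by simp
  also have "\<dots> = (\<integral>t. indicator {0..1} t *\<^sub>R (\<integral>p. ?Q p \<partial>lborel) \<partial>(lborel :: real measure))"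
    using rot_int[OF Qm] by simp
  also have "\<dots> = (\<integral>p. ?Q p \<partial>lborel)" by simp
  finally have 1: "(\<integral>p. ?Q p \<partial>lborel) = (\<integral>p. \<integral>t. ?J (t, p) \<partial>lborel \<partial>lborel)" by simp
  have "(\<integral>t. ?J (t, p) \<partial>lborel) = F 0 * of_real (\<rho> (norm p))" for p
  proof -
    have "(\<integral>t. ?J (t, p) \<partial>lborel) = (\<integral>t. (indicator {0..1} t *\<^sub>R F (exp (\<i> * of_real (2 * pi * t)) *s to_complex p)) * of_real (\<rho> (norm p)) \<partial>lborel)"
      by (simp add: norm_phase_rotation to_complex_phase_rotation)
    also have "\<dots> = F 0 * of_real (\<rho> (norm p))"
      by (subst integral_mult_left_zero) (simp only: entire_circle_mean[OF F])
    finally show ?thesis .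
  qed
  then have "(\<integral>p. ?Q p \<partial>lborel) = (\<integral>p. F 0 * of_real (\<rho> (norm (p :: (real ^ 'd) \<times> (real ^ 'd)))) \<partial>lborel)" unfolding 1 by simp
  also have "\<dots> = F 0 * of_real (\<integral>p. \<rho> (norm (p :: (real ^ 'd) \<times> (real ^ 'd))) \<partial>lborel)" by simp
  finally show ?thesis .
qed

section \<open>The Bargmann kernel and coherent states\<close>

text \<open>The ratio of the Bargmann kernel at \<open>to_complex p\<close> and the coherent state at p.\<close>
definition twist :: "'a::euclidean_space \<times> 'a \<Rightarrow> complex" where
  "twist p = exp (of_real ((norm p)\<^sup>2 / 4) + \<i> * of_real (fst p \<bullet> snd p / 2))"

lemma twist_nonzero [simp]: "twist p \<noteq> 0" by (simp add: twist_def)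

lemma norm_twist: "cmod (twist p) = exp ((norm p)\<^sup>2 / 4)" by (simp add: twist_def)

lemma norm_prod_sq: "(norm p)\<^sup>2 = fst p \<bullet> fst p + snd p \<bullet> snd p"
  by (cases p) (simp add: norm_Pair power2_norm_eq_inner)

lemma inner_real_vec: "(x::real ^ 'd) \<bullet> y = (\<Sum>j\<in>UNIV. x $ j * y $ j)"
  by (simp add: inner_vec_def)

lemma cdot_to_complex:
  "cdot (to_complex p) (to_complex p) =
    Complex ((fst p \<bullet> fst p - snd p \<bullet> snd p) / 2) (- (fst p \<bullet> snd p))"
  unfolding cdot_def to_complex_def inner_real_vec
  by (simp add: complex_eq_iff sum_subtractf[symmetric] sum_negf[symmetric] sum_divide_distrib
      diff_divide_distrib mult.commute)

lemma cdot_to_complex_real: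
  "cdot (to_complex p) (\<chi> j. of_real (y $ j)) = Complex (fst p \<bullet> y / sqrt 2) (- (snd p \<bullet> y) / sqrt 2)"
  unfolding cdot_def to_complex_def inner_real_vec
  by (simp add: complex_eq_iff sum_divide_distrib sum_negf[symmetric])

definition vec_cnj :: "complex ^ 'd \<Rightarrow> complex ^ 'd" where
  "vec_cnj z = (\<chi> j. cnj (z $ j))"

text \<open>The real part is half the inner product of phase space, the imaginary part half its symplectic form.\<close>
lemma cdot_to_complex_cnj:
  "cdot (to_complex p) (vec_cnj (to_complex q)) =
     Complex ((fst p \<bullet> fst q + snd p \<bullet> snd q) / 2) ((fst p \<bullet> snd q - snd p \<bullet> fst q) / 2)"
  unfolding cdot_def to_complex_def vec_cnj_def inner_real_vec
  by (simp add: complex_eq_iff sum_subtractf[symmetric] sum_divide_distrib sum.distrib[symmetric]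
      add_divide_distrib diff_divide_distrib)

lemma bargmann_kernel_eq: "bargmann_kernel (to_complex p) y = twist p * coherent p y"
proof -
  have s: "complex_of_real (sqrt 2) * Complex (a / sqrt 2) (b / sqrt 2) = Complex a b" for a b
    by (simp add: complex_eq_iff)
  have e: "- (1 / 2) * (cdot (to_complex p) (to_complex p) + of_real ((norm y)\<^sup>2)) +
          of_real (sqrt 2) * cdot (to_complex p) (\<chi> j. of_real (y $ j)) =
        (of_real ((norm p)\<^sup>2 / 4) + \<i> * of_real (fst p \<bullet> snd p / 2)) +
        (of_real (- (norm (y - fst p))\<^sup>2 / 2) + - \<i> * of_real (y \<bullet> snd p))"
  proof -
    have n: "(norm (y - fst p))\<^sup>2 = (norm y)\<^sup>2 - 2 * (fst p \<bullet> y) + fst p \<bullet> fst p"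
      by (simp add: power2_norm_eq_inner inner_diff_left inner_diff_right inner_commute)
    show ?thesis
      unfolding cdot_to_complex cdot_to_complex_real s norm_prod_sq n inner_commute[of y "snd p"]
      by (simp add: complex_eq_iff field_simps)
  qed
  show ?thesis
    unfolding bargmann_kernel_def e exp_add twist_def coherent_def gauss_def
    by (simp add: exp_of_real[symmetric])
qed

lemma bargmann_eq:
  assumes "u \<in> tempered"
  shows "bargmann u (to_complex p) = twist p * u (coherent p)"
proof -
  have "bargmann_kernel (to_complex p) = (\<lambda>y. twist p * coherent p y)"
    using bargmann_kernel_eq by (rule ext)
  then show ?thesis unfolding bargmann_def by (simp add: tempered_cmult[OF assms coherent_schwartz])
qed

section \<open>The reproducing formula\<close>

lemma poly_times_gaussian_bounded:
  fixes c :: real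
  assumes "c > 0"
  shows "\<exists>C. \<forall>t\<ge>0. (1 + t) ^ m * exp (- (c * t\<^sup>2)) \<le> C"
proof (intro exI allI impI)
  fix t :: real assume t: "t \<ge> 0"
  have "(1 + t) ^ m \<le> exp t ^ m" using exp_ge_add_one_self[of t] t by (intro power_mono) auto
  then have "(1 + t) ^ m * exp (- (c * t\<^sup>2)) \<le> exp t ^ m * exp (- (c * t\<^sup>2))" by (rule mult_right_mono) simp
  also have "\<dots> = exp (m * t - c * t\<^sup>2)" by (simp add: exp_of_nat_mult[symmetric] flip: exp_add)
  also have "\<dots> \<le> exp ((real m)\<^sup>2 / (4 * c))"
  proof -
    have "0 \<le> c * (t - m / (2 * c))\<^sup>2" using assms by simp
    also have "c * (t - m / (2 * c))\<^sup>2 = c * t\<^sup>2 - m * t + (real m)\<^sup>2 / (4 * c)"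
      using assms by (simp add: power2_diff field_simps power2_eq_square)
    finally show ?thesis by simp
  qed
  finally show "(1 + t) ^ m * exp (- (c * t\<^sup>2)) \<le> exp ((real m)\<^sup>2 / (4 * c))" .
qed

lemma integrable_poly_gaussian:
  fixes f :: "'a::euclidean_space \<Rightarrow> complex"
  assumes f: "f \<in> borel_measurable borel" and c: "c > 0"
    and b: "\<And>p. cmod (f p) \<le> C * (1 + norm p) ^ m * exp (- (c * (norm p)\<^sup>2))"
  shows "integrable lborel f"
proof -
  obtain D where D: "\<And>t. t \<ge> 0 \<Longrightarrow> (1 + t) ^ (2 * DIM('a) + m) * exp (- (c * t\<^sup>2)) \<le> D"
    using poly_times_gaussian_bounded[OF c] by blast
  have C: "C \<ge> 0"
  proof -
    have "0 \<le> C * (1 + norm (0::'a)) ^ m * exp (- (c * (norm (0::'a))\<^sup>2))"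
      using b[of 0] norm_ge_zero order_trans by blast
    then show ?thesis by simp
  qed
  show ?thesis
  proof (rule integrable_fast_decay[OF f])
    fix p
    have "(1 + norm p) ^ (2 * DIM('a)) * cmod (f p) \<le> (1 + norm p) ^ (2 * DIM('a)) * (C * (1 + norm p) ^ m * exp (- (c * (norm p)\<^sup>2)))"
      by (intro mult_left_mono b) auto
    also have "\<dots> = C * ((1 + norm p) ^ (2 * DIM('a) + m) * exp (- (c * (norm p)\<^sup>2)))" by (simp add: power_add mult_ac)
    also have "\<dots> \<le> C * D" using C by (intro mult_left_mono D) auto
    finally show "(1 + norm p) ^ (2 * DIM('a)) * cmod (f p) \<le> C * D" .
  qed
qed

lemma one_plus_norm_add: "1 + norm (p + q) \<le> (1 + norm p) * (1 + norm q)"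
proof -
  have "0 \<le> norm p * norm q" by simp
  moreover have "(1 + norm p) * (1 + norm q) = 1 + norm p + norm q + norm p * norm q" by algebra
  ultimately show ?thesis using norm_triangle_ineq[of p q] by linarith
qed

lemma one_plus_norm_add_power: "(1 + norm (p + q)) ^ m \<le> (1 + norm p) ^ m * (1 + norm q) ^ m"
  unfolding power_mult_distrib[symmetric] by (rule power_mono[OF one_plus_norm_add]) simp

lemma continuous_reproducing_kernel: "continuous_on UNIV (\<lambda>p. reproducing_kernel p q)"
  unfolding reproducing_kernel_def by (intro continuous_intros) auto

lemma norm_reproducing_kernel: "cmod (reproducing_kernel p q) = exp (- (norm (p - q))\<^sup>2 / 4)"
proof -
  have "Re (\<i> * complex_of_real t / 2) = 0" for t by simp
  then show ?thesis by (simp add: reproducing_kernel_def norm_mult)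
qed

lemma rapid_moments_reproducing_kernel:
  fixes q :: "'a::euclidean_space \<times> 'a"
  assumes G: "G \<in> borel_measurable borel" and b: "\<And>p. cmod (G p) \<le> C * (1 + norm p) ^ m"
  shows "rapid_moments lborel (\<lambda>p. G p * reproducing_kernel p q)"
proof (rule rapid_moments_lborel)
  show "(\<lambda>p. G p * reproducing_kernel p q) \<in> borel_measurable borel"
    by (intro borel_measurable_times G borel_measurable_continuous_onI continuous_reproducing_kernel)
  fix k
  have C: "C \<ge> 0"
    using order_trans[OF norm_ge_zero b[of 0]] by simp
  have "(0 :: real) < 1 / 4" by simp
  then obtain D where D: "\<And>t::real. t \<ge> 0 \<Longrightarrow> (1 + t) ^ (k + m) * exp (- (1 / 4 * t\<^sup>2)) \<le> D"
    using poly_times_gaussian_bounded by blast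
  have "(1 + norm p) ^ k * cmod (G p * reproducing_kernel p q) \<le> C * (1 + norm q) ^ (k + m) * D" for p
  proof -
    have "(1 + norm p) ^ k * cmod (G p * reproducing_kernel p q)
      \<le> (1 + norm p) ^ k * ((C * (1 + norm p) ^ m) * exp (- (norm (p - q))\<^sup>2 / 4))"
      unfolding norm_mult norm_reproducing_kernel by (intro mult_left_mono mult_right_mono b) auto
    also have "\<dots> = C * ((1 + norm (q + (p - q))) ^ (k + m) * exp (- (1 / 4 * (norm (p - q))\<^sup>2)))"
      by (simp add: power_add mult_ac)
    also have "\<dots> \<le> C * ((1 + norm q) ^ (k + m) * (1 + norm (p - q)) ^ (k + m) * exp (- (1 / 4 * (norm (p - q))\<^sup>2)))"
      by (intro mult_left_mono[OF _ C] mult_right_mono one_plus_norm_add_power) auto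
    also have "\<dots> = C * (1 + norm q) ^ (k + m) * ((1 + norm (p - q)) ^ (k + m) * exp (- (1 / 4 * (norm (p - q))\<^sup>2)))"
      by (simp only: mult.assoc)
    also have "\<dots> \<le> C * (1 + norm q) ^ (k + m) * D"
      using C by (intro mult_left_mono D) auto
    finally show ?thesis .
  qed
  then show "\<exists>C. \<forall>p. (1 + norm p) ^ k * cmod (G p * reproducing_kernel p q) \<le> C" by blast
qed

lemma cdot_add_left: "cdot (a + b) c = cdot a c + cdot b c"
  and cdot_add_right: "cdot c (a + b) = cdot c a + cdot c b"
  and cdot_smult_left: "cdot (k *s a) c = k * cdot a c"
  and cdot_smult_right: "cdot c (k *s a) = k * cdot c a"
  and cdot_commute: "cdot a c = cdot c a"
  by (simp_all add: cdot_def sum.distrib[symmetric] algebra_simps sum_distrib_left)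

lemma bounded_linear_cdot_left: "bounded_linear (\<lambda>z. cdot z c)"
  by (rule linear_conv_bounded_linear[THEN iffD1], rule linearI)
    (simp_all add: cdot_add_left, simp add: cdot_def scaleR_sum_right)

lemma norm_cdot_le: "cmod (cdot z w) \<le> norm z * norm w"
proof -
  have "cmod (cdot z w) \<le> (\<Sum>j\<in>UNIV. cmod (z $ j * w $ j))" unfolding cdot_def by (rule norm_sum)
  also have "\<dots> = (\<Sum>j\<in>UNIV. \<bar>cmod (z $ j)\<bar> * \<bar>cmod (w $ j)\<bar>)" by (simp add: norm_mult)
  also have "\<dots> \<le> norm z * norm w" unfolding norm_vec_def by (rule L2_set_mult_ineq)
  finally show ?thesis .
qed

lemma entire_translate_exp:
  assumes F: "F \<in> entire"
  shows "(\<lambda>w. F (z + w) * exp (- cdot w c)) \<in> entire"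
  unfolding entire_def
proof (intro CollectI allI)
  fix w
  obtain D where D: "(F has_derivative D) (at (z + w))" "\<And>k h. D (k *s h) = k * D h"
    using F unfolding entire_def by blast
  have 1: "((\<lambda>w. F (z + w)) has_derivative D) (at w)"
  proof -
    have "((\<lambda>w. z + w) has_derivative (\<lambda>h. h)) (at w)" by (auto intro!: derivative_eq_intros)
    from has_derivative_compose[OF this D(1)] show ?thesis .
  qed
  have "((\<lambda>w. - cdot w c) has_derivative (\<lambda>h. - cdot h c)) (at w)"
    by (intro has_derivative_minus bounded_linear_imp_has_derivative bounded_linear_cdot_left)
  from has_derivative_compose[OF this DERIV_exp[unfolded has_field_derivative_def]]
  have 2: "((\<lambda>w. exp (- cdot w c)) has_derivative (\<lambda>h. exp (- cdot w c) * - cdot h c)) (at w)" .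
  show "\<exists>D. ((\<lambda>w. F (z + w) * exp (- cdot w c)) has_derivative D) (at w) \<and> (\<forall>k h. D (k *s h) = k * D h)"
    by (rule exI, rule conjI, rule has_derivative_mult[OF 1 2]) (simp add: D(2) cdot_smult_left algebra_simps)
qed

context
  fixes F :: "complex ^ 'd \<Rightarrow> complex" and G :: "(real ^ 'd) \<times> (real ^ 'd) \<Rightarrow> complex"
  assumes F: "F \<in> entire" and FG: "\<And>p. F (to_complex p) = twist p * G p"
begin

lemma entire_quotient: "G p = F (to_complex p) * inverse (twist p)"
  using FG by simp

lemma entire_quotient_continuous: "continuous_on UNIV G"
proof -
  have "continuous_on UNIV (\<lambda>p. F (to_complex p) * inverse (twist p))"
    unfolding twist_def
    by (intro continuous_intros continuous_on_compose2[OF entire_continuous[OF F, of UNIV]] continuous_to_complex) auto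
  then show ?thesis using entire_quotient by simp
qed

text \<open>Multiplication by the reproducing kernel at q turns G into an entire function of the displacement r times a
centred Gaussian. The exponential of the linear function is the one that makes the phases
and the mixed terms of |q + r|^2 cancel.\<close>
lemma recentre:
  "G (q + r) * reproducing_kernel (q + r) q = inverse (twist q) *
     (F (to_complex q + to_complex r) * exp (- cdot (to_complex r) (vec_cnj (to_complex q))) * of_real (exp (- (norm r)\<^sup>2 / 2)))"
proof -
  obtain x \<xi> a \<alpha> where q: "q = (x, \<xi>)" and r: "r = (a, \<alpha>)" by (metis surj_pair)
  let ?A = "of_real ((norm (q + r))\<^sup>2 / 4) + \<i> * of_real (fst (q + r) \<bullet> snd (q + r) / 2)"
  let ?B = "of_real (- (norm (q + r - q))\<^sup>2 / 4) + \<i> * complex_of_real ((fst (q + r) + fst q) \<bullet> (snd (q + r) - snd q)) / 2"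
  let ?C = "of_real ((norm q)\<^sup>2 / 4) + \<i> * complex_of_real (fst q \<bullet> snd q / 2)"
  let ?D = "- cdot (to_complex r) (vec_cnj (to_complex q))"
  have e: "- ?A + ?B = - ?C + (?D + of_real (- (norm r)\<^sup>2 / 2))"
  proof -
    have i1: "(norm (q + r))\<^sup>2 = (norm q)\<^sup>2 + (norm r)\<^sup>2 + 2 * (a \<bullet> x + \<alpha> \<bullet> \<xi>)"
      unfolding norm_prod_sq q r by (simp add: inner_add_left inner_add_right inner_commute)
    have i2: "fst (q + r) \<bullet> snd (q + r) = x \<bullet> \<xi> + x \<bullet> \<alpha> + a \<bullet> \<xi> + a \<bullet> \<alpha>"
      unfolding q r by (simp add: inner_add_left inner_add_right)
    have i3: "(fst (q + r) + fst q) \<bullet> (snd (q + r) - snd q) = 2 * (x \<bullet> \<alpha>) + a \<bullet> \<alpha>"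
    proof -
      have "fst (q + r) + fst q = a + 2 *\<^sub>R x" "snd (q + r) - snd q = \<alpha>" by (simp_all add: q r scaleR_2)
      then show ?thesis by (simp add: inner_add_left)
    qed
    have i4: "q + r - q = r" by simp
    show ?thesis
      unfolding i1 i2 i3 i4 cdot_to_complex_cnj
      by (simp add: complex_eq_iff q r inner_commute[of \<alpha> x] field_simps)
  qed
  have "G (q + r) * reproducing_kernel (q + r) q = F (to_complex (q + r)) * exp (- ?A + ?B)"
  proof -
    have a: "inverse (twist (q + r)) = exp (- ?A)" unfolding twist_def by (rule exp_minus[symmetric])
    have b: "reproducing_kernel (q + r) q = exp ?B" by (simp only: reproducing_kernel_def exp_add exp_of_real)
    show ?thesis unfolding entire_quotient a b by (simp only: mult.assoc exp_add)
  qed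
  also have "\<dots> = F (to_complex (q + r)) * (exp (- ?C) * (exp ?D * exp (of_real (- (norm r)\<^sup>2 / 2))))"
    unfolding e exp_add ..
  finally show ?thesis
    unfolding to_complex_add twist_def exp_minus[symmetric] exp_of_real[symmetric] by (simp only: mult_ac)
qed

text \<open>After the translation of \<open>recentre\<close> this is the mean value property for the weight exp (-|r|^2 / 2).\<close>
theorem reproducing_formula:
  assumes bound: "\<And>p. cmod (G p) \<le> C * (1 + norm p) ^ m"
  shows "(\<integral>p. G p * reproducing_kernel p q \<partial>lborel) = of_real ((2 * pi) ^ CARD('d)) * G q"
proof -
  let ?H = "\<lambda>w. F (to_complex q + w) * exp (- cdot w (vec_cnj (to_complex q)))"
  have Gm: "G \<in> borel_measurable borel" by (rule borel_measurable_continuous_onI[OF entire_quotient_continuous])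
  let ?f = "\<lambda>p. G p * reproducing_kernel p q"
  have fm: "?f \<in> borel_measurable borel"
    by (intro borel_measurable_times Gm borel_measurable_continuous_onI continuous_reproducing_kernel)
  have rec: "?f (q + r) = inverse (twist q) * (?H (to_complex r) * of_real (exp (- (norm r)\<^sup>2 / 2)))" for r
    by (rule recentre)
  have "rapid_moments lborel ?f" by (rule rapid_moments_reproducing_kernel[OF Gm bound])
  from rapid_moments_integrable[OF this, of "\<lambda>_. 1" 1 0] have "integrable lborel ?f" by simp
  then have "integrable lborel (\<lambda>r. ?f (q + 1 *\<^sub>R r))" by (intro integrable_lborel_affine) auto
  then have "integrable lborel (\<lambda>r. twist q * ?f (q + r))" by (intro integrable_mult_right) simp
  moreover have "twist q * ?f (q + r) = ?H (to_complex r) * of_real (exp (- (norm r)\<^sup>2 / 2))" for r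
    unfolding rec by simp
  ultimately have int: "integrable lborel (\<lambda>r. ?H (to_complex r) * of_real (exp (- (norm r)\<^sup>2 / 2)))" by simp
  have "(\<integral>p. ?f p \<partial>lborel) = (\<integral>r. ?f (q + r) \<partial>lborel)"
    using integral_lborel_affine[OF _ fm, of 1 q] by simp
  also have "\<dots> = inverse (twist q) * (\<integral>r. ?H (to_complex r) * of_real (exp (- (norm r)\<^sup>2 / 2)) \<partial>lborel)"
    unfolding rec by (rule integral_mult_right_zero)
  also have "(\<integral>r. ?H (to_complex r) * of_real (exp (- (norm r)\<^sup>2 / 2)) \<partial>lborel) =
      ?H 0 * of_real (\<integral>r. exp (- (norm (r::(real ^ 'd) \<times> (real ^ 'd)))\<^sup>2 / 2) \<partial>lborel)"
    by (rule entire_mean_value[where \<rho> = "\<lambda>t. exp (- t\<^sup>2 / 2)", OF entire_translate_exp[OF F] _ int]) simp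
  also have "?H 0 = twist q * G q" by (simp add: FG cdot_def)
  also have "(\<integral>r. exp (- (norm (r::(real ^ 'd) \<times> (real ^ 'd)))\<^sup>2 / 2) \<partial>lborel) = (2 * pi) ^ CARD('d)"
  proof -
    have "complex_of_real (\<integral>r. exp (- (norm (r::(real ^ 'd) \<times> (real ^ 'd)))\<^sup>2 / 2) \<partial>lborel)
      = (\<integral>r. complex_of_real (exp (- (norm (r::(real ^ 'd) \<times> (real ^ 'd)))\<^sup>2 / 2)) * exp (\<i> * of_real (0 \<bullet> r)) \<partial>lborel)"
      by (simp flip: integral_complex_of_real)
    also have "\<dots> = of_real ((2 * pi) powr (real DIM((real ^ 'd) \<times> (real ^ 'd)) / 2) * exp (- (norm (0::(real ^ 'd) \<times> (real ^ 'd)))\<^sup>2 / 2))"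
      by (rule integral_gaussian)
    also have "\<dots> = of_real ((2 * pi) ^ CARD('d))" by (simp add: powr_realpow)
    finally show ?thesis by (simp only: of_real_eq_iff)
  qed
  finally show ?thesis by simp
qed

text \<open>The mean value property on the unit ball, again for the entire function of \<open>recentre\<close>; on this ball the
Gaussians involved are bounded by exp (1/4).\<close>
theorem entire_local_bound:
  shows "cmod (G q) * measure lborel (cball 0 1 :: ((real ^ 'd) \<times> (real ^ 'd)) set)
     \<le> exp (1 / 4) * (\<integral>r. indicator (cball 0 1) r * cmod (G (q + r)) \<partial>lborel)"
proof -
  let ?B = "cball 0 1 :: ((real ^ 'd) \<times> (real ^ 'd)) set"
  let ?\<rho> = "indicator {..1} :: real \<Rightarrow> real"
  let ?H = "\<lambda>w. F (to_complex q + w) * exp (- cdot w (vec_cnj (to_complex q)))"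
  have \<rho>: "?\<rho> (norm r) = indicator ?B r" for r :: "(real ^ 'd) \<times> (real ^ 'd)" by (simp add: indicator_def)
  have Hent: "?H \<in> entire" by (rule entire_translate_exp[OF F])
  have "continuous_on UNIV (\<lambda>r. ?H (to_complex r))"
    by (rule continuous_on_compose2[OF entire_continuous[OF Hent, of UNIV] continuous_to_complex]) auto
  then have "integrable lborel (\<lambda>r. indicator ?B r *\<^sub>R ?H (to_complex r))"
    by (intro borel_integrable_compact) (auto intro: continuous_on_subset)
  then have "integrable lborel (\<lambda>r. ?H (to_complex r) * of_real (?\<rho> (norm r)))"
    unfolding \<rho> by (simp add: scaleR_conv_of_real mult.commute)
  from entire_mean_value[OF Hent _ this]
  have "(\<integral>r. ?H (to_complex r) * of_real (?\<rho> (norm r)) \<partial>lborel) = ?H 0 * of_real (\<integral>r. ?\<rho> (norm r) \<partial>(lborel :: ((real ^ 'd) \<times> (real ^ 'd)) measure))"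
    by simp
  also have "(\<integral>r. ?\<rho> (norm r) \<partial>(lborel :: ((real ^ 'd) \<times> (real ^ 'd)) measure)) = measure lborel ?B" unfolding \<rho> by simp
  also have "?H 0 = twist q * G q" by (simp add: FG cdot_def)
  finally have "cmod (twist q) * (cmod (G q) * measure lborel ?B) = cmod (\<integral>r. ?H (to_complex r) * of_real (?\<rho> (norm r)) \<partial>lborel)"
    by (simp add: norm_mult)
  also have "\<dots> \<le> (\<integral>r. cmod (twist q) * (exp (1 / 4) * (indicator ?B r * cmod (G (q + r)))) \<partial>lborel)"
  proof (rule norm_integral_le)
    have "continuous_on UNIV (\<lambda>r. cmod (G (q + r)))"
      by (intro continuous_intros continuous_on_compose2[OF entire_quotient_continuous]) auto
    then have "integrable lborel (\<lambda>r. indicator ?B r *\<^sub>R cmod (G (q + r)))"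
      by (intro borel_integrable_compact) (auto intro: continuous_on_subset)
    then show "integrable lborel (\<lambda>r. cmod (twist q) * (exp (1 / 4) * (indicator ?B r * cmod (G (q + r)))))"
      by (intro integrable_mult_right) simp
    fix r :: "(real ^ 'd) \<times> (real ^ 'd)"
    show "norm (?H (to_complex r) * of_real (?\<rho> (norm r))) \<le> cmod (twist q) * (exp (1 / 4) * (indicator ?B r * cmod (G (q + r))))"
    proof (cases "r \<in> ?B")
      case True
      have "cmod (G (q + r)) * exp (- (norm r)\<^sup>2 / 4) = cmod (G (q + r) * reproducing_kernel (q + r) q)"
        by (simp add: norm_mult norm_reproducing_kernel)
      also have "\<dots> = inverse (cmod (twist q)) * (cmod (?H (to_complex r)) * exp (- (norm r)\<^sup>2 / 2))"
        unfolding recentre by (simp add: norm_mult norm_inverse)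
      finally have "cmod (?H (to_complex r)) * exp (- (norm r)\<^sup>2 / 2) = cmod (twist q) * (cmod (G (q + r)) * exp (- (norm r)\<^sup>2 / 4))"
        by (simp add: field_simps)
      then have "cmod (?H (to_complex r)) * exp (- (norm r)\<^sup>2 / 2) * exp ((norm r)\<^sup>2 / 2)
        = cmod (twist q) * (cmod (G (q + r)) * (exp (- (norm r)\<^sup>2 / 4) * exp ((norm r)\<^sup>2 / 2)))" by simp
      then have "cmod (?H (to_complex r)) = cmod (twist q) * (cmod (G (q + r)) * exp ((norm r)\<^sup>2 / 4))"
        by (simp add: mult.assoc flip: exp_add)
      also have "\<dots> \<le> cmod (twist q) * (cmod (G (q + r)) * exp (1 / 4))"
        using True by (intro mult_left_mono) (auto simp: power_le_one)
      finally show ?thesis using True by (simp add: \<rho> mult_ac norm_mult)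
    qed (simp add: \<rho>)
  qed
  also have "\<dots> = cmod (twist q) * (exp (1 / 4) * (\<integral>r. indicator ?B r * cmod (G (q + r)) \<partial>lborel))"
    by simp
  finally show ?thesis by simp
qed

end

lemma bargmann_kernel_entire:
  fixes y :: "real ^ 'd"
  shows "(\<lambda>z. bargmann_kernel z y) \<in> entire"
  unfolding entire_def
proof (intro CollectI allI)
  fix z :: "complex ^ 'd"
  let ?y = "\<chi> j. complex_of_real (y $ j)"
  let ?E = "\<lambda>z. - (1 / 2) * (cdot z z + of_real ((norm y)\<^sup>2)) + of_real (sqrt 2) * cdot z ?y"
  let ?c = "complex_of_real (pi powr (- real CARD('d) / 4))"
  have "bounded_bilinear (cdot :: complex ^ 'd \<Rightarrow> _)"
  proof
    show "\<exists>K. \<forall>a b::complex ^ 'd. norm (cdot a b) \<le> norm a * norm b * K"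
      by (intro exI[of _ 1] allI) (simp add: norm_cdot_le)
  qed (simp_all add: cdot_add_left cdot_add_right, simp_all add: cdot_def scaleR_sum_right)
  from bounded_bilinear.FDERIV[OF this has_derivative_ident has_derivative_ident]
  have 1: "((\<lambda>z. cdot z z) has_derivative (\<lambda>h. cdot z h + cdot h z)) (at z)" .
  have 2: "((\<lambda>z. cdot z ?y) has_derivative (\<lambda>h. cdot h ?y)) (at z)"
    by (rule bounded_linear_imp_has_derivative[OF bounded_linear_cdot_left])
  have E: "(?E has_derivative (\<lambda>h. - (1 / 2) * (cdot z h + cdot h z) + of_real (sqrt 2) * cdot h ?y)) (at z)"
    by (rule has_derivative_eq_rhs, rule has_derivative_add[OF has_derivative_mult_right[OF has_derivative_add_const[OF 1]] has_derivative_mult_right[OF 2]]) simp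
  have "((\<lambda>z. ?c * exp (?E z)) has_derivative (\<lambda>h. ?c * (exp (?E z) * (- (1 / 2) * (cdot z h + cdot h z) + of_real (sqrt 2) * cdot h ?y)))) (at z)"
    by (rule has_derivative_mult_right[OF has_derivative_compose[OF E DERIV_exp[unfolded has_field_derivative_def]]])
  then have der: "((\<lambda>z. bargmann_kernel z y) has_derivative (\<lambda>h. ?c * (exp (?E z) * (- (1 / 2) * (cdot z h + cdot h z) + of_real (sqrt 2) * cdot h ?y)))) (at z)"
    unfolding bargmann_kernel_def .
  show "\<exists>D. ((\<lambda>z. bargmann_kernel z y) has_derivative D) (at z) \<and> (\<forall>c h. D (c *s h) = c * D h)"
    by (rule exI, rule conjI, rule der) (simp add: cdot_smult_left cdot_smult_right algebra_simps)
qed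

lemma coherent_reproducing:
  fixes q :: "(real ^ 'd) \<times> (real ^ 'd)"
  shows "(\<integral>p. reproducing_kernel p q * coherent p y \<partial>lborel) = of_real ((2 * pi) ^ CARD('d)) * coherent q y"
proof -
  have "cmod (coherent p y) \<le> pi powr (- real DIM(real ^ 'd) / 4) * (1 + norm p) ^ 0" for p
    using coherent_le[of p y] by simp
  from reproducing_formula[OF bargmann_kernel_entire bargmann_kernel_eq this]
  show ?thesis by (simp add: mult.commute)
qed

lemma rapid_moments_kernel: "rapid_moments lborel (\<lambda>p. reproducing_kernel p q)"
  using rapid_moments_reproducing_kernel[of "\<lambda>_. 1" 1 0 q] by simp

text \<open>The reproducing formula is an identity between coherent states, to which u is applied. It therefore precedes the
analyticity of \<open>bargmann u\<close>, and that is derived from it.\<close>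
lemma tempered_reproducing:
  fixes u :: "((real ^ 'd) \<Rightarrow> complex) \<Rightarrow> complex"
  assumes u: "u \<in> tempered"
  shows "(\<integral>p. reproducing_kernel p q * u (coherent p) \<partial>lborel) = of_real ((2 * pi) ^ CARD('d)) * u (coherent q)"
  using tempered_superposition[OF u rapid_moments_kernel, of q]
  unfolding coherent_reproducing tempered_cmult[OF u coherent_schwartz] by simp

section \<open>The Bargmann transform of a tempered distribution is entire\<close>

text \<open>As a function of q the left-hand side is holomorphic in \<open>to_complex q\<close>: the first factor on the right depends
on it through a linear function, and the second one does not depend on q.\<close>
lemma twist_kernel:
  "twist q * reproducing_kernel p q = exp (cdot (to_complex q) (vec_cnj (to_complex p))) * inverse (cnj (twist p))"
proof -
  obtain x \<xi> x' \<xi>' where p: "p = (x, \<xi>)" and q: "q = (x', \<xi>')" by (metis surj_pair)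
  let ?A = "of_real ((norm q)\<^sup>2 / 4) + \<i> * complex_of_real (fst q \<bullet> snd q / 2)"
  let ?B = "of_real (- (norm (p - q))\<^sup>2 / 4) + \<i> * complex_of_real ((fst p + fst q) \<bullet> (snd p - snd q)) / 2"
  let ?C = "cnj (of_real ((norm p)\<^sup>2 / 4) + \<i> * complex_of_real (fst p \<bullet> snd p / 2))"
  have e: "?A + ?B = cdot (to_complex q) (vec_cnj (to_complex p)) + - ?C"
  proof -
    have i1: "(norm (p - q))\<^sup>2 = (norm p)\<^sup>2 + (norm q)\<^sup>2 - 2 * (x' \<bullet> x + \<xi>' \<bullet> \<xi>)"
      unfolding norm_prod_sq p q by (simp add: inner_diff_left inner_diff_right inner_commute)
    have i3: "(fst p + fst q) \<bullet> (snd p - snd q) = x \<bullet> \<xi> - x \<bullet> \<xi>' + x' \<bullet> \<xi> - x' \<bullet> \<xi>'"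
      unfolding p q by (simp add: inner_add_left inner_diff_right)
    show ?thesis
      unfolding i1 i3 cdot_to_complex_cnj
      by (simp add: complex_eq_iff p q inner_commute[of \<xi>' x] field_simps)
  qed
  have "twist q * reproducing_kernel p q = exp (?A + ?B)"
    unfolding twist_def reproducing_kernel_def exp_of_real[symmetric] exp_add by simp
  also have "\<dots> = exp (cdot (to_complex q) (vec_cnj (to_complex p))) * exp (- ?C)" unfolding e exp_add ..
  finally show ?thesis unfolding twist_def exp_cnj exp_minus .
qed

lemma norm_vec_cnj: "norm (vec_cnj z) = norm z"
  by (simp add: norm_vec_def vec_cnj_def)

lemma gaussian_dominates_exponential:
  "exp (R * t) * exp (- t\<^sup>2 / 4) \<le> exp (2 * R\<^sup>2) * exp (- (1 / 8 * t\<^sup>2))" for R t :: real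
proof -
  have "0 \<le> (t - 4 * R)\<^sup>2 / 8" by simp
  also have "(t - 4 * R)\<^sup>2 / 8 = 2 * R\<^sup>2 - 1 / 8 * t\<^sup>2 - (R * t - t\<^sup>2 / 4)"
    by (simp add: power2_diff field_simps power2_eq_square)
  finally show ?thesis by (simp flip: exp_add)
qed

text \<open>By \<open>tempered_reproducing\<close> and \<open>twist_kernel\<close> the Bargmann transform is an integral of exponentials of linear
functions. The factor 1 / cnj (twist p) contributes a Gaussian in p, so one may differentiate
under the integral sign.\<close>
theorem bargmann_entire:
  fixes u :: "((real ^ 'd) \<Rightarrow> complex) \<Rightarrow> complex"
  assumes u: "u \<in> tempered"
  shows "bargmann u \<in> entire"
proof -
  let ?k = "complex_of_real ((2 * pi) ^ CARD('d))"
  let ?c = "\<lambda>p. vec_cnj (to_complex p) :: complex ^ 'd"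
  define m where "m p = inverse (cnj (twist p)) * u (coherent p)" for p
  obtain C n where C: "C \<ge> 0" "\<And>p. cmod (u (coherent p)) \<le> C * (1 + norm p) ^ n"
    using tempered_coherent_growth[OF u] by blast
  have uc: "continuous_on UNIV (\<lambda>p. u (coherent p))" by (rule continuous_tempered_coherent[OF u])
  have mc: "continuous_on UNIV m" unfolding m_def twist_def by (intro continuous_intros uc) auto
  have cc: "continuous_on UNIV (\<lambda>p. cdot z (?c p))" for z
    unfolding cdot_def vec_cnj_def to_complex_def Complex_eq by (intro continuous_intros | simp)+
  have m_bound: "cmod (m p) \<le> C * (1 + norm p) ^ n * exp (- (norm p)\<^sup>2 / 4)" for p
  proof -
    have "cmod (m p) = cmod (u (coherent p)) * exp (- (norm p)\<^sup>2 / 4)"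
      unfolding m_def norm_mult norm_inverse complex_mod_cnj norm_twist by (simp add: exp_minus)
    then show ?thesis using C(2)[of p] by (simp add: mult_right_mono)
  qed
  have nz: "norm (?c p) \<le> norm p" for p
  proof -
    have "(norm (?c p))\<^sup>2 \<le> (norm p)\<^sup>2" unfolding norm_vec_cnj norm_to_complex by simp
    then show ?thesis by (rule power2_le_imp_le) simp
  qed
  have e_bound: "cmod (exp (cdot z (?c p))) \<le> exp (R * norm p)" if "norm z \<le> R" for z p R
  proof -
    have "cmod (exp (cdot z (?c p))) \<le> exp (cmod (cdot z (?c p)))" by (rule norm_exp)
    also have "cmod (cdot z (?c p)) \<le> norm z * norm (?c p)" by (rule norm_cdot_le)
    also have "\<dots> \<le> R * norm p" using nz that by (intro mult_mono) (auto intro: order_trans[OF norm_ge_zero])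
    finally show ?thesis by simp
  qed
  have prod_bound: "cmod (m p) * cmod (exp (cdot z (?c p))) \<le> (C * exp (2 * R\<^sup>2)) * (1 + norm p) ^ n * exp (- (1 / 8 * (norm p)\<^sup>2))"
    if "norm z \<le> R" for z p R
  proof -
    have "cmod (m p) * cmod (exp (cdot z (?c p))) \<le> (C * (1 + norm p) ^ n * exp (- (norm p)\<^sup>2 / 4)) * exp (R * norm p)"
      using C by (intro mult_mono m_bound e_bound that) auto
    also have "\<dots> = (C * (1 + norm p) ^ n) * (exp (R * norm p) * exp (- (norm p)\<^sup>2 / 4))" by (simp only: mult_ac)
    also have "\<dots> \<le> (C * (1 + norm p) ^ n) * (exp (2 * R\<^sup>2) * exp (- (1 / 8 * (norm p)\<^sup>2)))"
      using C by (intro mult_left_mono gaussian_dominates_exponential) auto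
    finally show ?thesis by (simp only: mult_ac)
  qed
  have "bargmann u z = inverse ?k * (\<integral>p. m p * exp (cdot z (?c p)) \<partial>lborel)" for z
  proof -
    obtain q where q: "z = to_complex q" using surj_to_complex by metis
    have "bargmann u z = twist q * (inverse ?k * (\<integral>p. reproducing_kernel p q * u (coherent p) \<partial>lborel))"
    proof -
      have "inverse k * (k * x) = x" if "k \<noteq> 0" for k x :: complex using that by simp
      from this[of ?k] have "inverse ?k * (?k * x) = x" for x by simp
      then show ?thesis unfolding q bargmann_eq[OF u] tempered_reproducing[OF u] by (simp only:)
    qed
    also have "\<dots> = inverse ?k * (\<integral>p. twist q * (reproducing_kernel p q * u (coherent p)) \<partial>lborel)"
      unfolding integral_mult_right_zero by (simp only: mult_ac)
    also have "(\<lambda>p. twist q * (reproducing_kernel p q * u (coherent p))) = (\<lambda>p. m p * exp (cdot z (?c p)))"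
      unfolding mult.assoc[symmetric] twist_kernel by (rule ext) (simp add: m_def q mult_ac)
    finally show ?thesis .
  qed
  then have eq: "bargmann u = (\<lambda>z. inverse ?k * (\<integral>p. m p * exp (cdot z (?c p)) \<partial>lborel))" by (rule ext)
  show ?thesis unfolding entire_def
  proof (intro CollectI allI)
    fix z :: "complex ^ 'd"
    let ?R = "norm z + 1"
    let ?D = "\<lambda>p y h. m p * (exp (cdot y (?c p)) * cdot h (?c p))"
    have "((\<lambda>z. \<integral>p. m p * exp (cdot z (?c p)) \<partial>lborel) has_derivative (\<lambda>h. \<integral>p. ?D p z h \<partial>lborel)) (at z)"
    proof (rule has_derivative_integral_lebesgue[where r = 1 and
          K = "\<lambda>p. (C * exp (2 * ?R\<^sup>2)) * (1 + norm p) ^ (n + 1) * exp (- (1 / 8 * (norm p)\<^sup>2))"])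
      show "integrable lborel (\<lambda>p. m p * exp (cdot y (?c p)))" for y
      proof (rule integrable_poly_gaussian)
        show "(\<lambda>p. m p * exp (cdot y (?c p))) \<in> borel_measurable borel"
          by (intro borel_measurable_continuous_onI continuous_intros mc cc)
        show "cmod (m p * exp (cdot y (?c p))) \<le> (C * exp (2 * (norm y)\<^sup>2)) * (1 + norm p) ^ n * exp (- (1 / 8 * (norm p)\<^sup>2))" for p
          unfolding norm_mult by (rule prod_bound) simp
      qed simp
      show "((\<lambda>z. m p * exp (cdot z (?c p))) has_derivative ?D p y) (at y)" for p y
        by (rule has_derivative_mult_right[OF has_derivative_compose[OF
              bounded_linear_imp_has_derivative[OF bounded_linear_cdot_left] DERIV_exp[unfolded has_field_derivative_def]]])
      show "norm (?D p y h) \<le> (C * exp (2 * ?R\<^sup>2)) * (1 + norm p) ^ (n + 1) * exp (- (1 / 8 * (norm p)\<^sup>2)) * norm h"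
        if "dist z y < 1" for p y h
      proof -
        have "norm y \<le> ?R" using that norm_triangle_ineq2[of y z] by (simp add: dist_norm norm_minus_commute)
        have B: "0 \<le> (C * exp (2 * ?R\<^sup>2)) * (1 + norm p) ^ n * exp (- (1 / 8 * (norm p)\<^sup>2))" using C(1) by simp
        from mult_mono[OF prod_bound[OF \<open>norm y \<le> ?R\<close>, of p] norm_cdot_le[of h "?c p"] B norm_ge_zero]
        have "norm (?D p y h) \<le> ((C * exp (2 * ?R\<^sup>2)) * (1 + norm p) ^ n * exp (- (1 / 8 * (norm p)\<^sup>2))) * (norm h * norm (?c p))"
          by (simp only: norm_mult mult.assoc)
        also have "\<dots> \<le> ((C * exp (2 * ?R\<^sup>2)) * (1 + norm p) ^ n * exp (- (1 / 8 * (norm p)\<^sup>2))) * (norm h * (1 + norm p))"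
          using C order_trans[OF nz[of p], of "1 + norm p"] by (intro mult_left_mono) auto
        finally show ?thesis by (simp only: mult_ac power_add power_one_right)
      qed
      show "integrable lborel (\<lambda>p::(real ^ 'd) \<times> (real ^ 'd). (C * exp (2 * ?R\<^sup>2)) * (1 + norm p) ^ (n + 1) * exp (- (1 / 8 * (norm p)\<^sup>2)))"
      proof -
        have "integrable lborel (\<lambda>p::(real ^ 'd) \<times> (real ^ 'd). complex_of_real ((C * exp (2 * ?R\<^sup>2)) * (1 + norm p) ^ (n + 1) * exp (- (1 / 8 * (norm p)\<^sup>2))))"
        proof (rule integrable_poly_gaussian)
          show "(\<lambda>p::(real ^ 'd) \<times> (real ^ 'd). complex_of_real ((C * exp (2 * ?R\<^sup>2)) * (1 + norm p) ^ (n + 1) * exp (- (1 / 8 * (norm p)\<^sup>2)))) \<in> borel_measurable borel"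
            by (intro borel_measurable_continuous_onI continuous_intros)
          show "cmod (complex_of_real ((C * exp (2 * ?R\<^sup>2)) * (1 + norm p) ^ (n + 1) * exp (- (1 / 8 * (norm p)\<^sup>2))))
            \<le> (C * exp (2 * ?R\<^sup>2)) * (1 + norm p) ^ (n + 1) * exp (- (1 / 8 * (norm p)\<^sup>2))" for p :: "(real ^ 'd) \<times> (real ^ 'd)"
            unfolding norm_of_real using C by (simp add: abs_mult)
        qed simp
        from integrable_Re[OF this] show ?thesis by simp
      qed
      show "(\<lambda>p. ?D p z h) \<in> borel_measurable lborel" for h
        unfolding measurable_lborel2 by (intro borel_measurable_continuous_onI continuous_intros mc cc)
    qed simp
    from has_derivative_mult_right[OF this, of "inverse ?k"]
    have "(bargmann u has_derivative (\<lambda>h. inverse ?k * (\<integral>p. ?D p z h \<partial>lborel))) (at z)" unfolding eq .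
    moreover have "inverse ?k * (\<integral>p. ?D p z (c *s h) \<partial>lborel) = c * (inverse ?k * (\<integral>p. ?D p z h \<partial>lborel))" for c h
    proof -
      have "(\<lambda>p. ?D p z (c *s h)) = (\<lambda>p. c * ?D p z h)" by (simp add: cdot_smult_left mult_ac)
      then show ?thesis by (simp only: integral_mult_right_zero mult_ac)
    qed
    ultimately show "\<exists>D. (bargmann u has_derivative D) (at z) \<and> (\<forall>c h. D (c *s h) = c * D h)" by blast
  qed
qed

section \<open>Inversion and injectivity\<close>

text \<open>On coherent states complex conjugation is the reflection of the frequency.\<close>
definition flip :: "'a::euclidean_space \<times> 'a \<Rightarrow> 'a \<times> 'a" where
  "flip p = (fst p, - snd p)"

lemma flip_flip [simp]: "flip (flip p) = p" and norm_flip [simp]: "norm (flip p) = norm p"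
  by (simp_all add: flip_def norm_Pair prod_eq_iff, cases p, simp add: norm_Pair)

lemma continuous_flip: "continuous_on S flip"
  unfolding flip_def by (intro continuous_intros)

lemma flip_measurable: "flip \<in> borel_measurable borel"
  by (intro borel_measurable_continuous_onI continuous_flip)

lemma lborel_flip: "distr lborel borel flip = (lborel :: ('a::euclidean_space \<times> 'a) measure)"
proof -
  define c :: "'a \<times> 'a \<Rightarrow> real" where "c j = (if snd j = 0 then 1 else - 1)" for j
  have eq: "0 + (\<Sum>j\<in>Basis. (c j * (p \<bullet> j)) *\<^sub>R j) = flip p" for p :: "'a \<times> 'a"
  proof (rule euclidean_eqI)
    fix b :: "'a \<times> 'a" assume b: "b \<in> Basis"
    then have "flip p \<bullet> b = c b * (p \<bullet> b)" by (auto simp: Basis_prod_def flip_def c_def inner_prod_def)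
    with b show "(0 + (\<Sum>j\<in>Basis. (c j * (p \<bullet> j)) *\<^sub>R j)) \<bullet> b = flip p \<bullet> b" by simp
  qed
  have "(\<Prod>j\<in>(Basis :: ('a \<times> 'a) set). \<bar>c j\<bar>) = 1" by (intro prod.neutral) (auto simp: c_def)
  then have "lborel = density (distr lborel borel (flip :: 'a \<times> 'a \<Rightarrow> _)) (\<lambda>_. ennreal 1)"
    using lborel_affine_euclidean[of c 0] unfolding eq by (simp add: c_def eta_contract_eq)
  then show ?thesis by (simp add: density_1)
qed

lemma integral_flip:
  fixes g :: "'a::euclidean_space \<times> 'a \<Rightarrow> complex"
  assumes "g \<in> borel_measurable borel"
  shows "(\<integral>p. g (flip p) \<partial>lborel) = (\<integral>p. g p \<partial>lborel)"
proof -
  have "(\<integral>p. g p \<partial>distr lborel borel flip) = (\<integral>p. g (flip p) \<partial>lborel)"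
    using assms flip_measurable by (intro integral_distr) auto
  then show ?thesis by (simp add: lborel_flip)
qed

lemma coherent_flip: "coherent (flip p) y = cnj (coherent p y)"
  by (simp add: coherent_def flip_def gauss_def exp_cnj)

text \<open>The tempered distribution given by a Schwartz function, restricted so that it is extensional.\<close>
definition pairing :: "('a::euclidean_space \<Rightarrow> complex) \<Rightarrow> ('a \<Rightarrow> complex) \<Rightarrow> complex" where
  "pairing \<psi> = restrict (\<lambda>\<phi>. \<integral>y. \<phi> y * \<psi> y \<partial>lborel) schwartz"

lemma schwartz_bounded: "\<phi> \<in> schwartz \<Longrightarrow> cmod (\<phi> y) \<le> schwartz_norm 0 \<phi>"
  using schwartz_norm_bound[of \<phi> "[]" 0 0 y] by (simp add: partials_Nil)

lemma pairing_tempered: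
  assumes \<psi>: "\<psi> \<in> schwartz"
  shows "pairing \<psi> \<in> tempered"
proof (rule temperedI[where C = "\<integral>y. cmod (\<psi> y) \<partial>lborel" and n = 0])
  have int: "integrable lborel (\<lambda>y. \<phi> y * \<psi> y)" if \<phi>: "\<phi> \<in> schwartz" for \<phi>
    using schwartz_integrable_mult[OF \<psi> schwartz_measurable[OF \<phi>], of "schwartz_norm 0 \<phi>" 0] schwartz_bounded[OF \<phi>]
    by (simp add: mult.commute)
  have i: "integrable lborel (\<lambda>y. cmod (\<psi> y))"
    using schwartz_integrable_mult[OF \<psi>, of "\<lambda>_. 1" 1 0] by simp
  show "pairing \<psi> \<in> extensional schwartz" by (simp add: pairing_def)
  show "pairing \<psi> (\<lambda>x. f x + g x) = pairing \<psi> f + pairing \<psi> g" if "f \<in> schwartz" "g \<in> schwartz" for f g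
    using that int by (simp add: pairing_def schwartz_add distrib_right)
  show "pairing \<psi> (\<lambda>x. c * f x) = c * pairing \<psi> f" if "f \<in> schwartz" for f c
    using that by (simp add: pairing_def schwartz_cmult mult.assoc)
  show "cmod (pairing \<psi> f) \<le> (\<integral>y. cmod (\<psi> y) \<partial>lborel) * schwartz_norm 0 f" if f: "f \<in> schwartz" for f
  proof -
    have "cmod (\<integral>y. f y * \<psi> y \<partial>lborel) \<le> (\<integral>y. schwartz_norm 0 f * cmod (\<psi> y) \<partial>lborel)"
      by (rule norm_integral_le) (use i schwartz_bounded[OF f] in \<open>auto simp: norm_mult intro: mult_right_mono\<close>)
    with f show ?thesis by (simp add: pairing_def mult.commute)
  qed
qed

lemma pairing_coherent: "pairing \<psi> (coherent p) = coherent_transform \<psi> p"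
  by (simp add: pairing_def coherent_schwartz coherent_transform_def)

lemma continuous_coherent_transform:
  assumes "\<psi> \<in> schwartz" shows "continuous_on UNIV (coherent_transform \<psi>)"
  using continuous_tempered_coherent[OF pairing_tempered[OF assms]] by (simp add: pairing_coherent eta_contract_eq)

lemma coherent_transform_coherent: "coherent_transform (coherent q) (flip p) = reproducing_kernel p q"
  unfolding coherent_transform_def coherent_flip by (rule coherent_inner_product)

lemma coherent_transform_flip_measurable:
  "\<psi> \<in> schwartz \<Longrightarrow> (\<lambda>p. coherent_transform \<psi> (flip p)) \<in> borel_measurable borel"
  by (intro borel_measurable_continuous_onI continuous_on_compose2[OF continuous_coherent_transform continuous_flip]) auto

lemma coherent_transform_rapid_moments:
  assumes \<psi>: "\<psi> \<in> schwartz"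
  shows "rapid_moments lborel (\<lambda>p. c * coherent_transform \<psi> (flip p))"
proof (rule rapid_moments_lborel)
  show "(\<lambda>p. c * coherent_transform \<psi> (flip p)) \<in> borel_measurable borel"
    by (intro borel_measurable_times coherent_transform_flip_measurable \<psi>) simp
  fix k
  obtain C m where C: "\<forall>\<psi>\<in>schwartz. \<forall>p::'a \<times> 'a. (1 + norm p) ^ k * cmod (coherent_transform \<psi> p) \<le> C * schwartz_norm m \<psi>"
    using coherent_transform_decay[of k, where 'a = 'a] by blast
  have "(1 + norm p) ^ k * cmod (c * coherent_transform \<psi> (flip p)) \<le> cmod c * (C * schwartz_norm m \<psi>)" for p
  proof -
    have "(1 + norm (flip p)) ^ k * cmod (coherent_transform \<psi> (flip p)) \<le> C * schwartz_norm m \<psi>" using C \<psi> by blast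
    from mult_left_mono[OF this norm_ge_zero[of c]] show ?thesis by (simp add: norm_mult mult_ac)
  qed
  then show "\<exists>D. \<forall>p. (1 + norm p) ^ k * cmod (c * coherent_transform \<psi> (flip p)) \<le> D" by blast
qed

lemma coherent_transform_diff:
  assumes "f \<in> schwartz" "g \<in> schwartz"
  shows "coherent_transform (\<lambda>y. f y - g y) q = coherent_transform f q - coherent_transform g q"
  unfolding coherent_transform_def right_diff_distrib
  by (rule Bochner_Integration.integral_diff[OF integrable_coherent_mult[OF assms(1)] integrable_coherent_mult[OF assms(2)]])

lemma inverse_mult_cancel: "k \<noteq> 0 \<Longrightarrow> inverse k * (k * x) = x" for k x :: complex
  by simp

text \<open>Both sides have the same transform in coherent states: the transform of the right-hand side at q is the
integral of the transform of \<psi> against the reproducing kernel, because pairing with \<open>coherent q\<close> is a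
tempered distribution that can be interchanged with the superposition. Then injectivity applies.\<close>
theorem coherent_inversion:
  fixes \<psi> :: "real ^ 'd \<Rightarrow> complex"
  assumes \<psi>: "\<psi> \<in> schwartz"
  shows "\<psi> = (\<lambda>y. \<integral>p. (inverse (of_real ((2 * pi) ^ CARD('d))) * coherent_transform \<psi> (flip p)) * coherent p y \<partial>lborel)"
proof -
  let ?k = "complex_of_real ((2 * pi) ^ CARD('d))"
  let ?w = "\<lambda>p. inverse ?k * coherent_transform \<psi> (flip p)"
  let ?\<Psi> = "\<lambda>y. \<integral>p. ?w p * coherent p y \<partial>lborel"
  have w: "rapid_moments lborel ?w" by (rule coherent_transform_rapid_moments[OF \<psi>])
  have \<Psi>: "?\<Psi> \<in> schwartz" by (rule superposition_schwartz[OF w])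
  have k: "inverse ?k * (?k * x) = x" for x by (rule inverse_mult_cancel) simp
  have eq: "coherent_transform ?\<Psi> q = coherent_transform \<psi> q" for q
  proof -
    have cq: "pairing (coherent q) \<in> tempered" by (rule pairing_tempered[OF coherent_schwartz])
    let ?g = "\<lambda>p. coherent_transform \<psi> p * reproducing_kernel p q"
    have gm: "?g \<in> borel_measurable borel"
      by (intro borel_measurable_continuous_onI continuous_intros continuous_coherent_transform[OF \<psi>] continuous_reproducing_kernel)
    have "coherent_transform ?\<Psi> q = pairing (coherent q) ?\<Psi>"
      using \<Psi> by (simp add: pairing_def coherent_transform_def mult.commute)
    also have "\<dots> = (\<integral>p. ?w p * pairing (coherent q) (coherent p) \<partial>lborel)"
      by (rule tempered_superposition[OF cq w])
    also have "\<dots> = (\<integral>p. inverse ?k * ?g (flip p) \<partial>lborel)"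
    proof -
      have "pairing (coherent q) (coherent p) = reproducing_kernel (flip p) q" for p
        using coherent_transform_coherent[of q "flip p"] by (simp add: pairing_coherent)
      then show ?thesis by (simp only: mult.assoc)
    qed
    also have "\<dots> = inverse ?k * (\<integral>p. ?g p \<partial>lborel)"
      unfolding integral_mult_right_zero integral_flip[OF gm] ..
    also have "(\<integral>p. ?g p \<partial>lborel) = ?k * coherent_transform \<psi> q"
      using tempered_reproducing[OF pairing_tempered[OF \<psi>], of q] unfolding pairing_coherent by (simp only: mult.commute)
    finally show ?thesis unfolding k .
  qed
  have "(\<lambda>y. ?\<Psi> y - \<psi> y) = (\<lambda>y. 0)"
  proof (rule coherent_transform_injective[OF schwartz_diff[OF \<Psi> \<psi>]])
    fix q
    have "coherent_transform (\<lambda>y. ?\<Psi> y - \<psi> y) q = coherent_transform ?\<Psi> q - coherent_transform \<psi> q"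
      by (rule coherent_transform_diff[OF \<Psi> \<psi>])
    then show "coherent_transform (\<lambda>y. ?\<Psi> y - \<psi> y) q = 0" unfolding eq by simp
  qed
  then show ?thesis by (auto simp: fun_eq_iff)
qed

lemma tempered_eqI:
  fixes u v :: "(real ^ 'd \<Rightarrow> complex) \<Rightarrow> complex"
  assumes u: "u \<in> tempered" and v: "v \<in> tempered" and eq: "\<And>p. u (coherent p) = v (coherent p)"
  shows "u = v"
proof (rule extensionalityI)
  show "u \<in> extensional schwartz" "v \<in> extensional schwartz" using u v by (auto simp: tempered_def)
  fix \<psi> :: "real ^ 'd \<Rightarrow> complex" assume \<psi>: "\<psi> \<in> schwartz"
  let ?w = "\<lambda>p. inverse (of_real ((2 * pi) ^ CARD('d))) * coherent_transform \<psi> (flip p)"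
  have w: "rapid_moments lborel ?w" by (rule coherent_transform_rapid_moments[OF \<psi>])
  have "u (\<lambda>y. \<integral>p. ?w p * coherent p y \<partial>lborel) = v (\<lambda>y. \<integral>p. ?w p * coherent p y \<partial>lborel)"
    unfolding tempered_superposition[OF u w] tempered_superposition[OF v w] eq ..
  then show "u \<psi> = v \<psi>" using coherent_inversion[OF \<psi>] by (simp only:)
qed

theorem bargmann_injective:
  fixes u v :: "(real ^ 'd \<Rightarrow> complex) \<Rightarrow> complex"
  assumes u: "u \<in> tempered" and v: "v \<in> tempered" and eq: "bargmann u = bargmann v"
  shows "u = v"
proof (rule tempered_eqI[OF u v])
  show "u (coherent p) = v (coherent p)" for p
    using fun_cong[OF eq, of "to_complex p"] by (simp add: bargmann_eq[OF u] bargmann_eq[OF v])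
qed

section \<open>Surjectivity for entire functions of moderate growth\<close>

text \<open>The distribution is the formal adjoint of \<open>coherent_inversion\<close> applied to G. Rapid decay of the transform of a
Schwartz function makes it tempered, and at \<open>coherent q\<close> it is G q by the reproducing formula.\<close>
theorem bargmann_surjective:
  fixes F :: "complex ^ 'd \<Rightarrow> complex"
  assumes F: "F \<in> entire" and FG: "\<And>p. F (to_complex p) = twist p * G p"
    and bound: "\<And>p. cmod (G p) \<le> C * (1 + norm p) ^ m"
  shows "\<exists>u\<in>tempered. bargmann u = F"
proof -
  let ?k = "complex_of_real ((2 * pi) ^ CARD('d))"
  let ?n = "2 * DIM((real ^ 'd) \<times> (real ^ 'd))"
  define u :: "(real ^ 'd \<Rightarrow> complex) \<Rightarrow> complex" where
    "u = restrict (\<lambda>\<psi>. inverse ?k * (\<integral>p. G p * coherent_transform \<psi> (flip p) \<partial>lborel)) schwartz"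
  have Gm: "G \<in> borel_measurable borel"
    by (rule borel_measurable_continuous_onI[OF entire_quotient_continuous[OF F FG]])
  have C: "C \<ge> 0" using order_trans[OF norm_ge_zero bound[of 0]] by simp
  have int: "integrable lborel (\<lambda>p. G p * coherent_transform \<psi> (flip p))" if \<psi>: "\<psi> \<in> schwartz" for \<psi>
    using rapid_moments_integrable[OF coherent_transform_rapid_moments[OF \<psi>, of 1] Gm bound] by (simp add: mult.commute)
  obtain D j where D: "D \<ge> 0" "\<And>\<psi> p. \<psi> \<in> schwartz \<Longrightarrow>
     (1 + norm p) ^ (m + ?n) * cmod (coherent_transform \<psi> (p :: (real ^ 'd) \<times> (real ^ 'd))) \<le> D * schwartz_norm j \<psi>"
    using coherent_transform_decay[of "m + ?n", where 'a = "real ^ 'd"] by blast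
  define I where "I = (\<integral>p. 1 / (1 + norm p) ^ ?n \<partial>(lborel :: ((real ^ 'd) \<times> (real ^ 'd)) measure))"
  have trans_add: "coherent_transform (\<lambda>x. f x + g x) p = coherent_transform f p + coherent_transform g p"
    if "f \<in> schwartz" "g \<in> schwartz" for f g :: "real ^ 'd \<Rightarrow> complex" and p
    unfolding coherent_transform_def distrib_left
    by (rule Bochner_Integration.integral_add[OF integrable_coherent_mult[OF that(1)] integrable_coherent_mult[OF that(2)]])
  have trans_cmult: "coherent_transform (\<lambda>x. c * f x) p = c * coherent_transform f p" for c f and p :: "(real ^ 'd) \<times> (real ^ 'd)"
    unfolding coherent_transform_def mult.left_commute[of _ c] by (rule integral_mult_right_zero)
  have u: "u \<in> tempered"
  proof (rule temperedI)
    show "u \<in> extensional schwartz" by (simp add: u_def)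
    show "u (\<lambda>x. f x + g x) = u f + u g" if f: "f \<in> schwartz" and g: "g \<in> schwartz" for f g
    proof -
      have "(\<integral>p. G p * coherent_transform f (flip p) + G p * coherent_transform g (flip p) \<partial>lborel)
         = (\<integral>p. G p * coherent_transform f (flip p) \<partial>lborel) + (\<integral>p. G p * coherent_transform g (flip p) \<partial>lborel)"
        by (rule Bochner_Integration.integral_add[OF int[OF f] int[OF g]])
      with f g show ?thesis by (simp add: u_def schwartz_add trans_add[OF f g] distrib_left)
    qed
    show "u (\<lambda>x. c * f x) = c * u f" if f: "f \<in> schwartz" for f c
    proof -
      have "(\<integral>p. G p * (c * coherent_transform f (flip p)) \<partial>lborel) = c * (\<integral>p. G p * coherent_transform f (flip p) \<partial>lborel)"
        unfolding mult.left_commute[of _ c] by (rule integral_mult_right_zero)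
      with f show ?thesis by (simp add: u_def schwartz_cmult trans_cmult)
    qed
    show "cmod (u f) \<le> (cmod (inverse ?k) * (C * D * I)) * schwartz_norm j f" if f: "f \<in> schwartz" for f
    proof -
      have "cmod (\<integral>p. G p * coherent_transform f (flip p) \<partial>lborel)
        \<le> (\<integral>p. (C * (D * schwartz_norm j f)) * (1 / (1 + norm p) ^ ?n) \<partial>(lborel :: ((real ^ 'd) \<times> (real ^ 'd)) measure))"
      proof (rule norm_integral_le)
        show "integrable lborel (\<lambda>p::(real ^ 'd) \<times> (real ^ 'd). (C * (D * schwartz_norm j f)) * (1 / (1 + norm p) ^ ?n))"
          by (intro integrable_mult_right integrable_inverse_power_norm)
        fix p :: "(real ^ 'd) \<times> (real ^ 'd)"
        have pos: "0 < (1 + norm p) ^ ?n" by (simp add: add_pos_nonneg)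
        have "cmod (G p * coherent_transform f (flip p)) * (1 + norm p) ^ ?n
          \<le> C * (1 + norm p) ^ m * cmod (coherent_transform f (flip p)) * (1 + norm p) ^ ?n"
          unfolding norm_mult by (intro mult_right_mono bound) auto
        also have "\<dots> = C * ((1 + norm (flip p)) ^ (m + ?n) * cmod (coherent_transform f (flip p)))"
          by (simp only: power_add mult_ac norm_flip)
        also have "\<dots> \<le> C * (D * schwartz_norm j f)" by (intro mult_left_mono D f C)
        finally show "cmod (G p * coherent_transform f (flip p)) \<le> (C * (D * schwartz_norm j f)) * (1 / (1 + norm p) ^ ?n)"
          using pos by (simp add: field_simps)
      qed
      also have "\<dots> = (C * (D * schwartz_norm j f)) * I" unfolding I_def by (rule integral_mult_right_zero)
      finally have "cmod (u f) \<le> cmod (inverse ?k) * ((C * (D * schwartz_norm j f)) * I)"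
        using f by (simp only: u_def restrict_apply' norm_mult) (intro mult_left_mono norm_ge_zero)
      then show ?thesis by (simp only: mult_ac)
    qed
  qed
  have uc: "u (coherent q) = G q" for q
  proof -
    have "u (coherent q) = inverse ?k * (\<integral>p. G p * reproducing_kernel p q \<partial>lborel)"
      unfolding u_def restrict_apply'[OF coherent_schwartz] coherent_transform_coherent ..
    also have "\<dots> = inverse ?k * (?k * G q)" unfolding reproducing_formula[OF F FG bound] ..
    also have "\<dots> = G q" by (rule inverse_mult_cancel) simp
    finally show ?thesis .
  qed
  have "bargmann u z = F z" for z
  proof -
    obtain q where "z = to_complex q" using surj_to_complex by metis
    then show ?thesis by (simp add: bargmann_eq[OF u] uc FG)
  qed
  with u show ?thesis by blast
qed

section \<open>Weights and translation invariant function spaces\<close>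

lemma real_polynomial_growth:
  "real_polynomial_function w \<Longrightarrow> \<exists>C\<ge>0. \<exists>m. \<forall>x. \<bar>w x\<bar> \<le> C * (1 + norm x) ^ m"
proof (induction rule: real_polynomial_function.induct)
  case (linear h)
  obtain K where K: "\<And>x. norm (h x) \<le> norm x * K" "K > 0" using bounded_linear.pos_bounded[OF linear] by blast
  have "\<bar>h x\<bar> \<le> K * (1 + norm x) ^ 1" for x
  proof -
    have "norm x * K \<le> (1 + norm x) * K" using K(2) by simp
    then show ?thesis using K(1)[of x] by (simp add: mult.commute)
  qed
  with K(2) show ?case by (intro exI[of _ K] conjI exI[of _ 1] allI) auto
next
  case (const c)
  show ?case by (intro exI[of _ "\<bar>c\<bar>"] conjI exI[of _ 0]) auto
next
  case (add f g)
  then obtain C m D n where C: "C \<ge> 0" "\<And>x. \<bar>f x\<bar> \<le> C * (1 + norm x) ^ m" and D: "D \<ge> 0" "\<And>x. \<bar>g x\<bar> \<le> D * (1 + norm x) ^ n"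
    by metis
  have "\<bar>f x + g x\<bar> \<le> (C + D) * (1 + norm x) ^ max m n" for x
  proof -
    have "\<bar>f x + g x\<bar> \<le> C * (1 + norm x) ^ m + D * (1 + norm x) ^ n" using C(2)[of x] D(2)[of x] by linarith
    also have "\<dots> \<le> C * (1 + norm x) ^ max m n + D * (1 + norm x) ^ max m n"
      using C(1) D(1) by (intro add_mono mult_left_mono power_increasing) auto
    finally show ?thesis by (simp add: algebra_simps)
  qed
  with C(1) D(1) show ?case by (intro exI[of _ "C + D"]) auto
next
  case (mult f g)
  then obtain C m D n where C: "C \<ge> 0" "\<And>x. \<bar>f x\<bar> \<le> C * (1 + norm x) ^ m" and D: "D \<ge> 0" "\<And>x. \<bar>g x\<bar> \<le> D * (1 + norm x) ^ n"
    by metis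
  have "\<bar>f x * g x\<bar> \<le> (C * D) * (1 + norm x) ^ (m + n)" for x
    using mult_mono[OF C(2)[of x] D(2)[of x]] C(1) D(1) by (simp add: abs_mult power_add mult_ac)
  with C(1) D(1) show ?case by (intro exI[of _ "C * D"]) auto
qed

text \<open>Moderateness with the pairs (0, x) and (x, -x) compares \<omega> x with \<omega> 0 from above and from below.\<close>
lemma poly_moderate_growth:
  assumes "\<omega> \<in> poly_moderate"
  shows "\<exists>C\<ge>0. \<exists>m. \<forall>x. \<omega> x \<le> C * (1 + norm x) ^ m"
    and "\<exists>C\<ge>0. \<exists>m. \<forall>x. inverse (\<omega> x) \<le> C * (1 + norm x) ^ m"
proof -
  obtain w C where w: "real_polynomial_function w" and pos: "\<And>x. \<omega> x > 0" "\<And>x. w x > 0"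
    and C: "C > 0" "\<And>x y. \<omega> (x + y) \<le> C * \<omega> x * w y"
    using assms unfolding poly_moderate_def moderate_def weight_def by blast
  obtain D m where D: "D \<ge> 0" "\<And>x. \<bar>w x\<bar> \<le> D * (1 + norm x) ^ m" using real_polynomial_growth[OF w] by blast
  have "\<omega> x \<le> (C * \<omega> 0 * D) * (1 + norm x) ^ m" for x
  proof -
    have "\<omega> x \<le> C * \<omega> 0 * w x" using C(2)[of 0 x] by simp
    also have "\<dots> \<le> C * \<omega> 0 * (D * (1 + norm x) ^ m)"
      using C(1) pos(1)[of 0] order_trans[OF abs_ge_self D(2)[of x]] by (intro mult_left_mono) auto
    finally show ?thesis by (simp add: mult.assoc)
  qed
  moreover have "0 \<le> C * \<omega> 0 * D" using C(1) D(1) pos(1)[of 0] by simp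
  ultimately show "\<exists>C\<ge>0. \<exists>m. \<forall>x. \<omega> x \<le> C * (1 + norm x) ^ m" by blast
  have "inverse (\<omega> x) \<le> (C * D / \<omega> 0) * (1 + norm x) ^ m" for x
  proof -
    have "\<omega> 0 \<le> C * \<omega> x * w (- x)" using C(2)[of x "- x"] by simp
    also have "\<dots> \<le> C * \<omega> x * (D * (1 + norm x) ^ m)"
      using C(1) pos(1)[of x] order_trans[OF abs_ge_self D(2)[of "- x"]] by (intro mult_left_mono) auto
    finally show ?thesis using pos(1)[of 0] pos(1)[of x] by (simp add: field_simps)
  qed
  moreover have "0 \<le> C * D / \<omega> 0" using C(1) D(1) pos(1)[of 0] by simp
  ultimately show "\<exists>C\<ge>0. \<exists>m. \<forall>x. inverse (\<omega> x) \<le> C * (1 + norm x) ^ m" by blast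
qed

lemma solid_withD:
  assumes S: "solid_with C B N" and f: "f \<in> L1_loc" and g: "g \<in> L1_loc" "g \<in> B"
    and le: "AE x in lebesgue. cmod (f x) \<le> cmod (g x)"
  shows "f \<in> B \<and> N f \<le> C * N g"
  by (rule S[unfolded solid_with_def, THEN bspec, OF f, THEN bspec, OF g(1), THEN mp, OF conjI[OF g(2) le]])

lemma L1_loc_dominated:
  fixes f :: "'a::euclidean_space \<Rightarrow> complex"
  assumes f: "f \<in> L1_loc" and g: "g \<in> borel_measurable lebesgue" and le: "\<And>x. cmod (g x) \<le> cmod (f x)"
  shows "g \<in> L1_loc"
  unfolding L1_loc_def set_integrable_def
proof (intro CollectI allI impI)
  fix K :: "'a set" assume K: "compact K"
  then have "integrable lebesgue (\<lambda>x. indicator K x *\<^sub>R f x)" using f by (simp add: L1_loc_def set_integrable_def)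
  moreover have "K \<in> sets lebesgue" using borel_compact[OF K] by (simp add: sets_completionI_sets)
  ultimately show "integrable lebesgue (\<lambda>x. indicator K x *\<^sub>R g x)"
    by (rule Bochner_Integration.integrable_bound[OF _ borel_measurable_scaleR[OF borel_measurable_indicator g]])
      (use le in \<open>simp_all add: mult_left_mono\<close>)
qed

context
  fixes v :: "'a::euclidean_space \<Rightarrow> real" and B N
  assumes BF: "translation_invariant_BF v B N"
begin

lemma
  shows BF_measurable: "f \<in> B \<Longrightarrow> f \<in> borel_measurable lebesgue"
    and BF_add: "f \<in> B \<Longrightarrow> g \<in> B \<Longrightarrow> (\<lambda>x. f x + g x) \<in> B"
    and BF_cmult: "f \<in> B \<Longrightarrow> (\<lambda>x. c * f x) \<in> B"
    and BF_zero: "(\<lambda>x. 0) \<in> B"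
    and BF_triangle: "f \<in> B \<Longrightarrow> g \<in> B \<Longrightarrow> N (\<lambda>x. f x + g x) \<le> N f + N g"
    and BF_norm_cmult: "f \<in> B \<Longrightarrow> N (\<lambda>x. c * f x) = cmod c * N f"
proof -
  have "banach_function_space B N" using BF unfolding translation_invariant_BF_def by (elim conjE)
  note b = this[unfolded banach_function_space_def]
  have sub: "B \<subseteq> borel_measurable lebesgue" by (rule b[THEN conjunct1])
  have fs: "function_subspace B" by (rule b[THEN conjunct2, THEN conjunct1])
  have sn: "seminorm_on B N" by (rule b[THEN conjunct2, THEN conjunct2, THEN conjunct1])
  show "f \<in> B \<Longrightarrow> f \<in> borel_measurable lebesgue" using sub by blast
  show "f \<in> B \<Longrightarrow> g \<in> B \<Longrightarrow> (\<lambda>x. f x + g x) \<in> B" "f \<in> B \<Longrightarrow> (\<lambda>x. c * f x) \<in> B" "(\<lambda>x. 0) \<in> B"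
    using fs by (simp_all add: function_subspace_def)
  show "f \<in> B \<Longrightarrow> g \<in> B \<Longrightarrow> N (\<lambda>x. f x + g x) \<le> N f + N g" "f \<in> B \<Longrightarrow> N (\<lambda>x. c * f x) = cmod c * N f"
    using sn by (simp_all add: seminorm_on_def)
qed

lemma BF_L1_loc: "f \<in> B \<Longrightarrow> f \<in> L1_loc"
  using BF unfolding translation_invariant_BF_def represents_def by blast

lemma BF_diff: "f \<in> B \<Longrightarrow> g \<in> B \<Longrightarrow> (\<lambda>x. f x - g x) \<in> B"
  using BF_add[of f "\<lambda>x. (- 1) * g x"] BF_cmult[of g "- 1"] by simp

lemma BF_norm_nonneg: assumes f: "f \<in> B" shows "0 \<le> N f"
proof -
  have "N (\<lambda>x. 0) = 0" using BF_norm_cmult[OF f, of 0] by simp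
  moreover have "N (\<lambda>x. f x + (- 1) * f x) \<le> N f + N (\<lambda>x. (- 1) * f x)" by (rule BF_triangle[OF f BF_cmult[OF f]])
  moreover have "N (\<lambda>x. (- 1) * f x) = N f" using BF_norm_cmult[OF f, of "- 1"] by simp
  ultimately show ?thesis by simp
qed

lemma BF_open_ball:
  assumes "openin (seminorm_topology B {N}) U" "f \<in> U"
  shows "\<exists>r>0. \<forall>g\<in>B. N (\<lambda>x. g x - f x) < r \<longrightarrow> g \<in> U"
proof -
  have "generate_topology_on {{g \<in> B. p (\<lambda>x. g x - f x) < r} |p f r. p \<in> {N} \<and> f \<in> B \<and> 0 < r} U"
    using assms(1) unfolding seminorm_topology_def openin_topology_generated_by_iff .
  then show ?thesis using assms(2)
  proof (induction arbitrary: f)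
    case (Int a b)
    obtain r where "r > 0" "\<forall>g\<in>B. N (\<lambda>x. g x - f x) < r \<longrightarrow> g \<in> a" using Int.IH(1)[of f] Int.prems by auto
    moreover obtain s where "s > 0" "\<forall>g\<in>B. N (\<lambda>x. g x - f x) < s \<longrightarrow> g \<in> b" using Int.IH(2)[of f] Int.prems by auto
    ultimately show ?case by (intro exI[of _ "min r s"]) auto
  next
    case (UN K)
    then show ?case by (meson UnionE UnionI)
  next
    case (Basis s)
    then obtain h r where s: "s = {g \<in> B. N (\<lambda>x. g x - h x) < r}" and h: "h \<in> B" by auto
    have f: "f \<in> B" "N (\<lambda>x. f x - h x) < r" using Basis s by auto
    show ?case
    proof (intro exI[of _ "r - N (\<lambda>x. f x - h x)"] conjI ballI impI)
      fix g assume g: "g \<in> B" "N (\<lambda>x. g x - f x) < r - N (\<lambda>x. f x - h x)"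
      have "N (\<lambda>x. g x - h x) \<le> N (\<lambda>x. g x - f x) + N (\<lambda>x. f x - h x)"
        using BF_triangle[OF BF_diff[OF g(1) f(1)] BF_diff[OF f(1) h]] by simp
      with g show "g \<in> s" by (simp add: s)
    qed (use f in simp)
  qed simp
qed

text \<open>The embedding into the tempered distributions is continuous for the weak topology, so pairing with \<theta> is bounded
on a ball of B; scaling gives the estimate.\<close>
lemma BF_pairing_bound:
  assumes \<theta>: "\<theta> \<in> test_functions"
  shows "\<exists>C\<ge>0. \<forall>f\<in>B. cmod (integral\<^sup>L lebesgue (\<lambda>x. f x * \<theta> x)) \<le> C * N f"
proof -
  obtain \<iota> where cont: "continuous_map (seminorm_topology B {N}) tempered_topology \<iota>" and rep: "\<And>f. f \<in> B \<Longrightarrow> represents (\<iota> f) f"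
    using BF unfolding translation_invariant_BF_def by blast
  have \<iota>: "\<iota> f \<theta> = integral\<^sup>L lebesgue (\<lambda>x. f x * \<theta> x)" if "f \<in> B" for f
    using rep[OF that] \<theta> by (simp add: represents_def)
  let ?V = "{u \<in> tempered. cmod ((\<lambda>x. u x - \<iota> (\<lambda>x. 0) x) \<theta>) < 1}"
  have top: "(\<lambda>x. 0) \<in> topspace (seminorm_topology B {N})"
  proof -
    have "N (\<lambda>x. 0 - 0) < 1" using BF_norm_cmult[OF BF_zero, of 0] by simp
    then have "(\<lambda>x. 0) \<in> {g \<in> B. N (\<lambda>x. g x - 0) < 1}" using BF_zero by simp
    moreover have "{g \<in> B. N (\<lambda>x. g x - 0) < 1} \<in> {{g \<in> B. p (\<lambda>x. g x - f x) < r} |p f r. p \<in> {N} \<and> f \<in> B \<and> 0 < r}"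
      by (rule CollectI, rule exI[of _ N], rule exI[of _ "\<lambda>x. 0"], rule exI[of _ 1]) (simp add: BF_zero)
    ultimately show ?thesis
      unfolding seminorm_topology_def topology_generated_by_topspace by (rule UnionI[rotated])
  qed
  have "\<iota> (\<lambda>x. 0) \<in> topspace tempered_topology" using continuous_map_image_subset_topspace[OF cont] top by blast
  then have \<iota>0: "\<iota> (\<lambda>x. 0) \<in> tempered"
    unfolding tempered_topology_def seminorm_topology_def topology_generated_by_topspace by auto
  have "openin tempered_topology ?V"
    unfolding tempered_topology_def seminorm_topology_def openin_topology_generated_by_iff
  proof (rule generate_topology_on.Basis)
    show "?V \<in> {{g \<in> tempered. p (\<lambda>x. g x - f x) < r} |p f r.
         p \<in> {\<lambda>u. cmod (u \<phi>) |\<phi>. \<phi> \<in> schwartz} \<and> f \<in> tempered \<and> 0 < r}"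
      using test_functions_schwartz[OF \<theta>] \<iota>0 by (intro CollectI exI[of _ "\<lambda>u. cmod (u \<theta>)"] exI[of _ "\<iota> (\<lambda>x. 0)"] exI[of _ 1]) auto
  qed
  from openin_continuous_map_preimage[OF cont this]
  have 1: "openin (seminorm_topology B {N}) {f \<in> topspace (seminorm_topology B {N}). \<iota> f \<in> ?V}" .
  have 2: "(\<lambda>x. 0) \<in> {f \<in> topspace (seminorm_topology B {N}). \<iota> f \<in> ?V}" using top \<iota>0 by simp
  from BF_open_ball[OF 1 2] obtain r where r: "r > 0"
    and *: "\<And>g. g \<in> B \<Longrightarrow> N (\<lambda>x. g x - 0) < r \<Longrightarrow> \<iota> g \<in> ?V" by auto
  have small: "cmod (integral\<^sup>L lebesgue (\<lambda>x. g x * \<theta> x)) < 1" if "g \<in> B" "N g < r" for g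
    using *[of g] that \<iota>[OF that(1)] \<iota>[OF BF_zero] by simp
  show ?thesis
  proof (intro exI[of _ "1 / r"] conjI ballI)
    fix f assume f: "f \<in> B"
    show "cmod (integral\<^sup>L lebesgue (\<lambda>x. f x * \<theta> x)) \<le> 1 / r * N f"
    proof (rule field_le_epsilon)
      fix e :: real assume e: "e > 0"
      define s where "s = N f + e * r"
      have s: "s > 0" "N f < s" using BF_norm_nonneg[OF f] e r by (auto simp: s_def add_nonneg_pos)
      define c where "c = r / s"
      have c: "c > 0" "c * s = r" using r s by (simp_all add: c_def)
      have "N (\<lambda>x. of_real c * f x) = c * N f" using BF_norm_cmult[OF f, of "of_real c"] c by simp
      also have "\<dots> < c * s" using s c by (intro mult_strict_left_mono) auto
      also have "\<dots> = r" by (rule c)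
      finally have "cmod (integral\<^sup>L lebesgue (\<lambda>x. (of_real c * f x) * \<theta> x)) < 1" by (intro small BF_cmult f)
      then have "c * cmod (integral\<^sup>L lebesgue (\<lambda>x. f x * \<theta> x)) < 1"
        unfolding mult.assoc integral_mult_right_zero norm_mult norm_of_real using c(1) by simp
      then have "cmod (integral\<^sup>L lebesgue (\<lambda>x. f x * \<theta> x)) < s / r" using r s by (simp add: c_def field_simps)
      also have "s / r = 1 / r * N f + e" using r by (simp add: s_def field_simps)
      finally show "cmod (integral\<^sup>L lebesgue (\<lambda>x. f x * \<theta> x)) \<le> 1 / r * N f + e" by simp
    qed
  qed (use r in simp)
qed

lemma
  assumes f: "f \<in> B" and s: "continuous_on UNIV s" "\<And>x. cmod (s x) = 1"
  shows BF_unimodular_mult: "(\<lambda>x. s x * f x) \<in> B"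
    and BF_unimodular_norm: "solid_with C B N \<Longrightarrow> N (\<lambda>x. s x * f x) \<le> C * N f"
proof -
  have sm: "s \<in> borel_measurable lebesgue"
    using borel_measurable_continuous_onI[OF s(1)] by (simp add: measurable_completion)
  have L: "(\<lambda>x. s x * f x) \<in> L1_loc"
    by (rule L1_loc_dominated[OF BF_L1_loc[OF f]])
      (use BF_measurable[OF f] sm s(2) in \<open>auto simp: norm_mult intro!: borel_measurable_times\<close>)
  have AE: "AE x in lebesgue. cmod (s x * f x) \<le> cmod (f x)" using s(2) by (simp add: norm_mult)
  have *: "(\<lambda>x. s x * f x) \<in> B \<and> N (\<lambda>x. s x * f x) \<le> C * N f" if "solid_with C B N" for C
    by (rule solid_withD[OF that L BF_L1_loc[OF f] f AE])
  obtain C' where "solid_with C' B N" using BF unfolding translation_invariant_BF_def by blast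
  from *[OF this] show "(\<lambda>x. s x * f x) \<in> B" ..
  show "N (\<lambda>x. s x * f x) \<le> C * N f" if "solid_with C B N" using *[OF that] ..
qed

text \<open>Solidity allows f to be replaced by its absolute value, whose pairing with a bump function that is positive
on the unit ball dominates the integral over this ball.\<close>
lemma BF_local_integral_bound:
  "\<exists>C\<ge>0. \<forall>f\<in>B. integrable lebesgue (\<lambda>x. indicator (cball 0 1) x * cmod (f x)) \<and>
     integral\<^sup>L lebesgue (\<lambda>x. indicator (cball 0 1) x * cmod (f x)) \<le> C * N f"
proof -
  let ?b = "bump 0 2 :: 'a \<Rightarrow> real"
  let ?\<theta> = "\<lambda>x::'a. complex_of_real (?b x)"
  let ?K = "cball (0::'a) (real DIM('a) * 2)"
  obtain C where C: "C \<ge> 0" "\<And>f. f \<in> B \<Longrightarrow> cmod (integral\<^sup>L lebesgue (\<lambda>x. f x * ?\<theta> x)) \<le> C * N f"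
    using BF_pairing_bound[OF bump_test_function[of 0 2]] by blast
  obtain D where D: "solid_with D B N" using BF unfolding translation_invariant_BF_def by blast
  have bc: "continuous_on S ?b" for S
  proof -
    have "continuous_on UNIV (\<lambda>x. Re (?\<theta> x))" by (rule continuous_on_Re[OF smooth_continuous[OF smooth_bump]])
    then show ?thesis by (simp add: eta_contract_eq) (rule continuous_on_subset, auto)
  qed
  have "compact (cball (0::'a) 1)" "cball (0::'a) 1 \<noteq> {}" by auto
  from continuous_attains_inf[OF this bc] obtain a where a: "a \<in> cball 0 1" "\<And>x. x \<in> cball 0 1 \<Longrightarrow> ?b a \<le> ?b x" by blast
  define m where "m = ?b a"
  have m: "m > 0"
    unfolding m_def bump_pos
  proof
    fix b :: 'a assume "b \<in> Basis"
    from Basis_le_norm[OF this, of a] a(1) show "\<bar>(a - 0) \<bullet> b\<bar> < 2" by simp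
  qed
  have "compact ?K" "?K \<noteq> {}" by auto
  from continuous_attains_sup[OF this bc] obtain M where M: "\<And>x. x \<in> ?K \<Longrightarrow> ?b x \<le> M" by blast
  have "M \<ge> 0" using M[of 0] bump_nonneg[of 0 2 "0::'a"] by auto
  have bM: "?b x \<le> M * indicator ?K x" for x
  proof (cases "?b x = 0")
    case False
    from bump_support[OF this] have "x \<in> ?K" by simp
    with M show ?thesis by simp
  qed (use \<open>M \<ge> 0\<close> in simp)
  have bm: "?b \<in> borel_measurable lebesgue"
    using borel_measurable_continuous_onI[OF bc] by (simp add: measurable_completion)
  have "integrable lebesgue (\<lambda>x. indicator (cball 0 1) x * cmod (f x)) \<and>
     integral\<^sup>L lebesgue (\<lambda>x. indicator (cball 0 1) x * cmod (f x)) \<le> (C * \<bar>D\<bar> / m) * N f" if f: "f \<in> B" for f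
  proof -
    let ?h = "\<lambda>x. complex_of_real (cmod (f x))"
    have fm: "f \<in> borel_measurable lebesgue" by (rule BF_measurable[OF f])
    have hm: "?h \<in> borel_measurable lebesgue" using fm by measurable
    have L: "?h \<in> L1_loc" by (rule L1_loc_dominated[OF BF_L1_loc[OF f] hm]) simp
    have "?h \<in> B \<and> N ?h \<le> D * N f"
      by (rule solid_withD[OF D L BF_L1_loc[OF f] f]) simp
    then have h: "?h \<in> B" "N ?h \<le> D * N f" by simp_all
    have i: "integrable lebesgue (\<lambda>x. indicator K x * cmod (f x))" if "compact K" for K
    proof -
      have "integrable lebesgue (\<lambda>x. indicator K x *\<^sub>R f x)" using BF_L1_loc[OF f] that by (simp add: L1_loc_def set_integrable_def)
      from integrable_norm[OF this] show ?thesis by simp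
    qed
    have ib: "integrable lebesgue (\<lambda>x. cmod (f x) * ?b x)"
    proof (rule Bochner_Integration.integrable_bound)
      show "integrable lebesgue (\<lambda>x. M * (indicator ?K x * cmod (f x)))" by (intro integrable_mult_right i) simp
      show "(\<lambda>x. cmod (f x) * ?b x) \<in> borel_measurable lebesgue" using fm bm by measurable
      show "AE x in lebesgue. norm (cmod (f x) * ?b x) \<le> norm (M * (indicator ?K x * cmod (f x)))"
      proof (rule AE_I2)
        fix x
        have "norm (cmod (f x) * ?b x) = cmod (f x) * ?b x" using bump_nonneg[of 0 2 x] by simp
        also have "\<dots> \<le> cmod (f x) * (M * indicator ?K x)" by (intro mult_left_mono bM) simp
        also have "\<dots> \<le> norm (M * (indicator ?K x * cmod (f x)))" by (simp add: mult_ac)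
        finally show "norm (cmod (f x) * ?b x) \<le> norm (M * (indicator ?K x * cmod (f x)))" .
      qed
    qed
    have "m * integral\<^sup>L lebesgue (\<lambda>x. indicator (cball 0 1) x * cmod (f x))
      = integral\<^sup>L lebesgue (\<lambda>x. m * (indicator (cball 0 1) x * cmod (f x)))" by simp
    also have "\<dots> \<le> integral\<^sup>L lebesgue (\<lambda>x. cmod (f x) * ?b x)"
    proof (rule integral_mono[OF integrable_mult_right[OF i] ib])
      fix x
      show "m * (indicator (cball 0 1) x * cmod (f x)) \<le> cmod (f x) * ?b x"
      proof (cases "x \<in> cball 0 1")
        case True
        then show ?thesis using mult_left_mono[OF a(2)[OF True] norm_ge_zero[of "f x"]] by (simp add: m_def mult.commute)
      qed (simp add: bump_nonneg)
    qed simp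
    also have "\<dots> \<le> cmod (complex_of_real (integral\<^sup>L lebesgue (\<lambda>x. cmod (f x) * ?b x)))" by simp
    also have "complex_of_real (integral\<^sup>L lebesgue (\<lambda>x. cmod (f x) * ?b x)) = integral\<^sup>L lebesgue (\<lambda>x. ?h x * ?\<theta> x)"
      by (simp flip: integral_complex_of_real)
    also have "cmod (integral\<^sup>L lebesgue (\<lambda>x. ?h x * ?\<theta> x)) \<le> C * N ?h" by (rule C(2)[OF h(1)])
    also have "\<dots> \<le> C * (\<bar>D\<bar> * N f)"
    proof (rule mult_left_mono[OF _ C(1)])
      have "D * N f \<le> \<bar>D\<bar> * N f" using BF_norm_nonneg[OF f] by (intro mult_right_mono) auto
      with h(2) show "N ?h \<le> \<bar>D\<bar> * N f" by linarith
    qed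
    finally show ?thesis using i[of "cball 0 1"] m by (simp add: field_simps)
  qed
  moreover have "0 \<le> C * \<bar>D\<bar> / m" using C(1) m by simp
  ultimately show ?thesis by blast
qed

end

lemma norm_weighted_entire:
  assumes FG: "\<And>p. F (to_complex p) = twist p * G p" and "\<omega> p > 0"
  shows "cmod (weighted_entire \<omega> F p) = cmod (G p) * \<omega> p"
proof -
  have "weighted_entire \<omega> F p = twist p * G p * of_real (exp (- (norm p)\<^sup>2 / 4)) * of_real (\<omega> p)"
    unfolding weighted_entire_def bargmann_S_eq FG by (simp add: norm_to_complex)
  then have "cmod (weighted_entire \<omega> F p) = (exp ((norm p)\<^sup>2 / 4) * exp (- (norm p)\<^sup>2 / 4)) * cmod (G p) * \<omega> p"
    using assms(2) by (simp add: norm_mult norm_twist)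
  then show ?thesis by (simp flip: exp_add)
qed

text \<open>Bound G q by the integral of |G| over the unit ball around q. There |G| is the weighted function divided by
\<omega>, and 1 / \<omega> grows polynomially. Translating the ball to the origin replaces the weighted function by a
translate, whose norm in B is at most v (-q) times the norm of the function, up to a constant.\<close>
theorem weighted_entire_growth:
  fixes F :: "complex ^ 'd \<Rightarrow> complex"
  assumes BF: "translation_invariant_BF v B N" and \<omega>: "\<omega> \<in> poly_moderate"
    and F: "F \<in> entire" and FG: "\<And>p. F (to_complex p) = twist p * G p" and f: "weighted_entire \<omega> F \<in> B"
  shows "\<exists>C m. \<forall>p. cmod (G p) \<le> C * (1 + norm p) ^ m"
proof -
  let ?f = "weighted_entire \<omega> F"
  let ?B = "cball 0 1 :: ((real ^ 'd) \<times> (real ^ 'd)) set"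
  have \<omega>pos: "\<omega> p > 0" for p using \<omega> unfolding poly_moderate_def moderate_def weight_def by blast
  have v: "v \<in> poly_moderate" using BF by (simp add: translation_invariant_BF_def)
  have vpos: "v p > 0" for p using v unfolding poly_moderate_def moderate_def weight_def by blast
  obtain C1 where C1: "\<And>x f. f \<in> B \<Longrightarrow> (\<lambda>y. f (y - x)) \<in> B" "\<And>x f. f \<in> B \<Longrightarrow> N (\<lambda>y. f (y - x)) \<le> C1 * v x * N f"
    using BF unfolding translation_invariant_BF_def by blast
  obtain C2 where C2: "C2 \<ge> 0" "\<And>f. f \<in> B \<Longrightarrow> integrable lebesgue (\<lambda>x. indicator ?B x * cmod (f x))"
     "\<And>f. f \<in> B \<Longrightarrow> integral\<^sup>L lebesgue (\<lambda>x. indicator ?B x * cmod (f x)) \<le> C2 * N f"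
    using BF_local_integral_bound[OF BF] by blast
  obtain D k where D: "D \<ge> 0" "\<And>p. inverse (\<omega> p) \<le> D * (1 + norm p) ^ k" using poly_moderate_growth(2)[OF \<omega>] by blast
  obtain E j where E: "E \<ge> 0" "\<And>p. v p \<le> E * (1 + norm p) ^ j" using poly_moderate_growth(1)[OF v] by blast
  define V where "V = measure lborel ?B"
  have V: "V > 0" unfolding V_def by (rule content_cball_pos) simp
  have Nf: "N ?f \<ge> 0" by (rule BF_norm_nonneg[OF BF f])
  have "cmod (G q) \<le> (exp (1 / 4) * D * 2 ^ k * C2 * \<bar>C1\<bar> * E * N ?f / V) * (1 + norm q) ^ (k + j)" for q
  proof -
    let ?g = "\<lambda>y. ?f (y - (- q))"
    define A where "A = D * (2 ^ k * (1 + norm q) ^ k)"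
    have A: "A \<ge> 0" using D(1) by (simp add: A_def)
    have g: "?g \<in> B" by (rule C1(1)[OF f])
    have pt: "indicator ?B r * cmod (G (q + r)) \<le> A * (indicator ?B r * cmod (?g r))" for r
    proof (cases "r \<in> ?B")
      case True
      have "cmod (G (q + r)) = cmod (?f (q + r)) * inverse (\<omega> (q + r))"
        unfolding norm_weighted_entire[OF FG \<omega>pos] using \<omega>pos[of "q + r"] by simp
      also have "\<dots> \<le> cmod (?f (q + r)) * A"
      proof (rule mult_left_mono)
        have "inverse (\<omega> (q + r)) \<le> D * (1 + norm (q + r)) ^ k" by (rule D)
        also have "\<dots> \<le> D * ((1 + norm q) ^ k * (1 + norm r) ^ k)"
          by (intro mult_left_mono one_plus_norm_add_power D)
        also have "\<dots> \<le> D * ((1 + norm q) ^ k * 2 ^ k)"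
          using True D(1) by (intro mult_left_mono power_mono) auto
        finally show "inverse (\<omega> (q + r)) \<le> A" by (simp add: A_def mult.commute)
      qed simp
      finally show ?thesis using True by (simp add: add.commute mult.commute)
    qed simp
    have gc: "continuous_on UNIV (\<lambda>r. cmod (G (q + r)))"
      by (intro continuous_intros continuous_on_compose2[OF entire_quotient_continuous[OF F FG]]) auto
    have li: "integrable lborel (\<lambda>r. indicator ?B r * cmod (G (q + r)))"
      using borel_integrable_compact[OF compact_cball continuous_on_subset[OF gc subset_UNIV], of 0 1] by simp
    have lm: "(\<lambda>r. indicator ?B r * cmod (G (q + r))) \<in> borel_measurable lborel" by (rule borel_measurable_integrable[OF li])
    have "cmod (G q) * V \<le> exp (1 / 4) * (\<integral>r. indicator ?B r * cmod (G (q + r)) \<partial>lborel)"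
      unfolding V_def by (rule entire_local_bound[OF F FG])
    also have "(\<integral>r. indicator ?B r * cmod (G (q + r)) \<partial>lborel) = integral\<^sup>L lebesgue (\<lambda>r. indicator ?B r * cmod (G (q + r)))"
      by (rule integral_completion[OF lm, symmetric])
    also have "\<dots> \<le> integral\<^sup>L lebesgue (\<lambda>r. A * (indicator ?B r * cmod (?g r)))"
      using li unfolding integrable_completion[OF lm, symmetric]
      by (rule integral_mono[OF _ integrable_mult_right[OF C2(2)[OF g]]]) (rule pt)
    also have "\<dots> = A * integral\<^sup>L lebesgue (\<lambda>r. indicator ?B r * cmod (?g r))" by (rule integral_mult_right_zero)
    also have "\<dots> \<le> A * (C2 * N ?g)" by (rule mult_left_mono[OF C2(3)[OF g] A])
    also have "\<dots> \<le> A * (C2 * (\<bar>C1\<bar> * (E * (1 + norm q) ^ j) * N ?f))"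
    proof (intro mult_left_mono A C2(1))
      have "N ?g \<le> C1 * v (- q) * N ?f" by (rule C1(2)[OF f])
      also have "\<dots> \<le> \<bar>C1\<bar> * v (- q) * N ?f" using Nf vpos[of "- q"] by (intro mult_right_mono) auto
      also have "\<dots> \<le> \<bar>C1\<bar> * (E * (1 + norm q) ^ j) * N ?f" using Nf E(2)[of "- q"] by (intro mult_right_mono mult_left_mono) auto
      finally show "N ?g \<le> \<bar>C1\<bar> * (E * (1 + norm q) ^ j) * N ?f" .
    qed
    finally have "cmod (G q) * V \<le> exp (1 / 4) * (A * (C2 * (\<bar>C1\<bar> * (E * (1 + norm q) ^ j) * N ?f)))" by simp
    then have "cmod (G q) \<le> exp (1 / 4) * (A * (C2 * (\<bar>C1\<bar> * (E * (1 + norm q) ^ j) * N ?f))) / V"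
      using V by (simp add: pos_le_divide_eq)
    also have "\<dots> = (exp (1 / 4) * D * 2 ^ k * C2 * \<bar>C1\<bar> * E * N ?f / V) * (1 + norm q) ^ (k + j)"
      by (simp add: A_def power_add)
    finally show ?thesis .
  qed
  then show ?thesis by blast
qed

section \<open>The Bargmann transform on modulation spaces\<close>

text \<open>The unimodular part of \<open>twist\<close>.\<close>
definition phase :: "'a::euclidean_space \<times> 'a \<Rightarrow> complex" where
  "phase p = exp (\<i> * of_real (fst p \<bullet> snd p / 2))"

lemma phase_unimodular:
  shows "continuous_on UNIV phase" "continuous_on UNIV (\<lambda>p. cnj (phase p))"
    and "cmod (phase p) = 1" "cmod (cnj (phase p)) = 1" "cnj (phase p) * phase p = 1" "phase p * cnj (phase p) = 1"
proof -
  show c: "continuous_on UNIV phase" unfolding phase_def by (intro continuous_intros) auto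
  then show "continuous_on UNIV (\<lambda>p. cnj (phase p))" by (intro continuous_intros)
  show n: "cmod (phase p) = 1" unfolding phase_def norm_exp_i_times ..
  then show "cmod (cnj (phase p)) = 1" by simp
  have "phase p * cnj (phase p) = of_real ((cmod (phase p))\<^sup>2)" by (rule complex_norm_square[symmetric])
  then show "phase p * cnj (phase p) = 1" using n by simp
  then show "cnj (phase p) * phase p = 1" by (simp add: mult.commute)
qed

text \<open>Both sides are multiples of u (coherent p). The modulus of \<open>twist p\<close> is cancelled by the Gaussian weight
of the space of entire functions, its phase by \<open>cnj (phase p)\<close>.\<close>
lemma stft_weighted_entire:
  fixes u :: "(real ^ 'd \<Rightarrow> complex) \<Rightarrow> complex"
  assumes u: "u \<in> tempered"
  shows "stft gauss u p * of_real (\<omega> p) =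
     cnj (phase p) * (of_real ((2 * pi) powr (- real CARD('d) / 2)) * weighted_entire \<omega> (bargmann u) p)"
proof -
  have "weighted_entire \<omega> (bargmann u) p = twist p * u (coherent p) * of_real (exp (- (norm p)\<^sup>2 / 4)) * of_real (\<omega> p)"
    unfolding weighted_entire_def bargmann_S_eq bargmann_eq[OF u] by (simp add: norm_to_complex)
  also have "twist p = of_real (exp ((norm p)\<^sup>2 / 4)) * phase p"
    unfolding twist_def phase_def exp_add exp_of_real ..
  finally have "weighted_entire \<omega> (bargmann u) p =
      of_real (exp ((norm p)\<^sup>2 / 4) * exp (- (norm p)\<^sup>2 / 4)) * (phase p * (u (coherent p) * of_real (\<omega> p)))"
    by (simp add: mult_ac)
  also have "exp ((norm p)\<^sup>2 / 4) * exp (- (norm p)\<^sup>2 / 4) = 1" by (simp flip: exp_add)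
  finally have w: "weighted_entire \<omega> (bargmann u) p = phase p * (u (coherent p) * of_real (\<omega> p))" by simp
  have "cnj (phase p) * (k * (phase p * x)) = (cnj (phase p) * phase p) * (k * x)" for k x by (simp only: mult_ac)
  then show ?thesis unfolding w stft_eq[OF u] by (simp add: phase_unimodular(5))
qed

theorem theorem3p1:
  fixes B :: "((real ^ 'd) \<times> (real ^ 'd) \<Rightarrow> complex) set"
    and N :: "((real ^ 'd) \<times> (real ^ 'd) \<Rightarrow> complex) \<Rightarrow> real"
    and v \<omega> :: "(real ^ 'd) \<times> (real ^ 'd) \<Rightarrow> real"
  assumes "translation_invariant_BF v B N"
    and "\<omega> \<in> poly_moderate"
  shows "A0_space \<omega> B = A_space \<omega> B \<and>
    bij_betw bargmann (modulation_space \<omega> B) (A_space \<omega> B) \<and>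
    (\<forall>f\<in>modulation_space \<omega> B. A0_norm \<omega> B N (bargmann f) = modulation_norm \<omega> N f) \<and>
    (solid_with 1 B N \<longrightarrow>
      (\<forall>f\<in>modulation_space \<omega> B. A_norm_normalized \<omega> N (bargmann f) = modulation_norm \<omega> N f)) \<and>
    (\<forall>C. solid_with C B N \<longrightarrow>
      (\<forall>f\<in>modulation_space \<omega> B.
        A_norm_normalized \<omega> N (bargmann f) \<le> C * modulation_norm \<omega> N f \<and>
        modulation_norm \<omega> N f \<le> C * A_norm_normalized \<omega> N (bargmann f)))"
proof -
  note BF = assms(1)
  let ?c = "(2 * pi) powr (- real CARD('d) / 2)"
  let ?M = "\<lambda>u p. stft gauss u p * complex_of_real (\<omega> p)"
  let ?W = "\<lambda>u p. complex_of_real ?c * weighted_entire \<omega> (bargmann u) p"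
  have c: "?c > 0" by simp
  have c0: "complex_of_real ?c \<noteq> 0" by simp
  have M: "?M u = (\<lambda>p. cnj (phase p) * ?W u p)" if "u \<in> tempered" for u
    using stft_weighted_entire[OF that] by (rule ext)
  have W: "?W u = (\<lambda>p. phase p * ?M u p)" if "u \<in> tempered" for u
  proof
    fix p :: "(real ^ 'd) \<times> (real ^ 'd)"
    have "phase p * (cnj (phase p) * x) = x" for x
      by (simp only: mult.assoc[symmetric] phase_unimodular(6) mult_1_left)
    then show "?W u p = phase p * ?M u p" unfolding stft_weighted_entire[OF that] by (simp only:)
  qed
  have W_iff: "?W u \<in> B \<longleftrightarrow> weighted_entire \<omega> (bargmann u) \<in> B" for u
  proof
    assume "?W u \<in> B"
    from BF_cmult[OF BF this, of "inverse (of_real ?c)"] show "weighted_entire \<omega> (bargmann u) \<in> B"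
      unfolding inverse_mult_cancel[OF c0] .
  qed (rule BF_cmult[OF BF])
  have M_iff: "?M u \<in> B \<longleftrightarrow> weighted_entire \<omega> (bargmann u) \<in> B" if u: "u \<in> tempered" for u
  proof
    assume "?M u \<in> B"
    from BF_unimodular_mult[OF BF this phase_unimodular(1,3)] show "weighted_entire \<omega> (bargmann u) \<in> B"
      unfolding W[OF u, symmetric] W_iff .
  next
    assume "weighted_entire \<omega> (bargmann u) \<in> B"
    then have "?W u \<in> B" unfolding W_iff .
    from BF_unimodular_mult[OF BF this phase_unimodular(2,4)] show "?M u \<in> B" unfolding M[OF u, symmetric] .
  qed
  have inj: "inj_on bargmann (modulation_space \<omega> B)"
    by (rule inj_onI, rule bargmann_injective) (auto simp: modulation_space_def)
  have image: "bargmann ` modulation_space \<omega> B = A_space \<omega> B"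
  proof (intro equalityI subsetI)
    fix F assume "F \<in> bargmann ` modulation_space \<omega> B"
    then obtain u where u: "u \<in> tempered" "?M u \<in> B" "F = bargmann u" by (auto simp: modulation_space_def)
    then show "F \<in> A_space \<omega> B" using bargmann_entire[OF u(1)] M_iff[OF u(1)] by (simp add: A_space_def)
  next
    fix F assume "F \<in> A_space \<omega> B"
    then have F: "F \<in> entire" "weighted_entire \<omega> F \<in> B" by (auto simp: A_space_def)
    define G where "G p = inverse (twist p) * F (to_complex p)" for p
    have FG: "F (to_complex p) = twist p * G p" for p by (simp add: G_def)
    obtain C m where "\<And>p. cmod (G p) \<le> C * (1 + norm p) ^ m"
      using weighted_entire_growth[OF BF assms(2) F(1) FG F(2)] by blast
    from bargmann_surjective[OF F(1) FG this] obtain u where u: "u \<in> tempered" "bargmann u = F" by blast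
    then have "u \<in> modulation_space \<omega> B" using M_iff[OF u(1)] F(2) by (simp add: modulation_space_def)
    with u(2) show "F \<in> bargmann ` modulation_space \<omega> B" by blast
  qed
  have A0: "A0_norm \<omega> B N (bargmann f) = modulation_norm \<omega> N f" if f: "f \<in> modulation_space \<omega> B" for f
  proof -
    have "(THE g. g \<in> modulation_space \<omega> B \<and> bargmann g = bargmann f) = f"
      using f inj by (intro the_equality) (auto dest: inj_onD)
    then show ?thesis by (simp add: A0_norm_def)
  qed
  have norms: "A_norm_normalized \<omega> N (bargmann f) \<le> C * modulation_norm \<omega> N f \<and>
        modulation_norm \<omega> N f \<le> C * A_norm_normalized \<omega> N (bargmann f)"
    if C: "solid_with C B N" and f: "f \<in> modulation_space \<omega> B" for C f
  proof -
    have u: "f \<in> tempered" and Mf: "?M f \<in> B" using f by (auto simp: modulation_space_def)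
    have Wf: "weighted_entire \<omega> (bargmann f) \<in> B" "?W f \<in> B" using Mf M_iff[OF u] W_iff by auto
    have A: "A_norm_normalized \<omega> N (bargmann f) = N (?W f)"
      unfolding A_norm_normalized_def A_norm_def BF_norm_cmult[OF BF Wf(1)] using c by simp
    have "N (\<lambda>p. phase p * ?M f p) \<le> C * N (?M f)"
      by (rule BF_unimodular_norm[OF BF Mf phase_unimodular(1,3) C])
    moreover have "N (\<lambda>p. cnj (phase p) * ?W f p) \<le> C * N (?W f)"
      by (rule BF_unimodular_norm[OF BF Wf(2) phase_unimodular(2,4) C])
    ultimately show ?thesis
      unfolding A modulation_norm_def W[OF u, symmetric] M[OF u, symmetric] by blast
  qed
  show ?thesis
    using image inj A0 norms by (auto simp: A0_space_def bij_betw_def intro: antisym dest: norms)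
qed

end
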